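(* Let $W$ be a $\Sigma_{g,1}$ bundle over $T^2$ and let $W'$ be a $\Sigma_{g',1}$ bundle over $T^2$, each with monodromy fixing the boundary of the fiber pointwise (so that $\partial W$ and $\partial W'$ are $3$-tori). Suppose $f: \partial W' \to \partial W$ is a diffeomorphism, and set $X= W \cup_f W'$. Then $X$ fibers over $S^1$.
   Context: All manifolds, maps and bundles are smooth. $\Sigma_{g,1}$ is the compact, oriented surface of genus $g$ with one boundary component. A $\Sigma_{g,1}$ bundle over $T^2$ is a compact $4$-manifold with a smooth fiber bundle map onto $T^2$ with fiber $\Sigma_{g,1}$; its monodromy fixes the boundary pointwise means the structure group is the group of diffeomorphisms of $\Sigma_{g,1}$ that restrict to the identity on $\partial\Sigma_{g,1}$, so the boundary is identified with $\partial\Sigma_{g,1}\times T^2 \cong T^3$. A closed manifold "fibers over $S^1$" if it is the total space of a smooth fiber bundle over $S^1$. *)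

theory Defs
  imports "HOL-Analysis.Analysis"
begin

section \<open>Smooth maps between subsets of Euclidean spaces\<close>

text \<open>\<open>C_on k S f\<close>: for open \<open>S\<close>, the function \<open>f\<close> is of class \<open>C\<^sup>k\<close> on \<open>S\<close>.\<close>

primrec C_on :: "nat \<Rightarrow> 'a::euclidean_space set \<Rightarrow> ('a \<Rightarrow> 'b::euclidean_space) \<Rightarrow> bool" where
  "C_on 0 S f \<longleftrightarrow> continuous_on S f"
| "C_on (Suc k) S f \<longleftrightarrow>
     f differentiable_on S \<and> (\<forall>v. C_on k S (\<lambda>x. frechet_derivative f (at x) v))"

text \<open>On an arbitrary set, such as a relatively open subset of a closed half-space or of a
  hyperplane, smoothness means that near each point there is a smooth extension to an open
  subset of the ambient space.\<close>

definition smooth_on :: "'a::euclidean_space set \<Rightarrow> ('a \<Rightarrow> 'b::euclidean_space) \<Rightarrow> bool" where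
  "smooth_on S f \<longleftrightarrow>
     (\<forall>x\<in>S. \<exists>U h. open U \<and> x \<in> U \<and> (\<forall>k. C_on k U h) \<and> (\<forall>y\<in>U \<inter> S. h y = f y))"


section \<open>Smooth manifolds with boundary\<close>

text \<open>A manifold is given by a topology and an atlas, which need not be maximal. A chart is a pair
  of its domain and a coordinate function, whose values outside the domain are irrelevant.
  The dimension is that of the model space \<open>'e\<close>.\<close>

record ('a, 'e) manifold =
  topo :: "'a topology"
  charts :: "('a set \<times> ('a \<Rightarrow> 'e)) set"

abbreviation carr :: "('a, 'e) manifold \<Rightarrow> 'a set" where
  "carr M \<equiv> topspace (topo M)"

text \<open>Every coordinate half-space is admitted as a local model, not just one of them, so that the
  products of charts are charts.\<close>

definition model_open :: "'e::euclidean_space set \<Rightarrow> bool" where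
  "model_open S \<longleftrightarrow> open S \<or> (\<exists>b\<in>Basis. openin (top_of_set {x. 0 \<le> x \<bullet> b}) S)"

definition smooth_manifold :: "('a, 'e::euclidean_space) manifold \<Rightarrow> bool" where
  "smooth_manifold M \<longleftrightarrow>
     Hausdorff_space (topo M) \<and> second_countable (topo M) \<and>
     (\<Union>(U, \<phi>)\<in>charts M. U) = carr M \<and>
     (\<forall>(U, \<phi>)\<in>charts M. openin (topo M) U \<and> model_open (\<phi> ` U) \<and>
        homeomorphic_map (subtopology (topo M) U) (top_of_set (\<phi> ` U)) \<phi>) \<and>
     (\<forall>(U, \<phi>)\<in>charts M. \<forall>(V, \<psi>)\<in>charts M.
        smooth_on (\<phi> ` (U \<inter> V)) (\<psi> \<circ> inv_into U \<phi>))"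

definition mboundary :: "('a, 'e::euclidean_space) manifold \<Rightarrow> 'a set" where
  "mboundary M = {p. \<exists>(U, \<phi>)\<in>charts M. p \<in> U \<and> \<phi> p \<notin> interior (\<phi> ` U)}"

definition closed_manifold :: "('a, 'e::euclidean_space) manifold \<Rightarrow> bool" where
  "closed_manifold M \<longleftrightarrow> smooth_manifold M \<and> compact_space (topo M) \<and> mboundary M = {}"

text \<open>Smooth maps and diffeomorphisms between subsets of manifolds. For \<open>S = mboundary M\<close> this is
  smoothness with respect to the smooth structure of the boundary, since the charts of \<open>M\<close>
  restrict to the charts of \<open>mboundary M\<close> with values in a hyperplane.\<close>

definition smooth_map ::
  "('a, 'e::euclidean_space) manifold \<Rightarrow> 'a set \<Rightarrow> ('b, 'd::euclidean_space) manifold \<Rightarrow> 'b set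
     \<Rightarrow> ('a \<Rightarrow> 'b) \<Rightarrow> bool" where
  "smooth_map M S N T f \<longleftrightarrow>
     continuous_map (subtopology (topo M) S) (subtopology (topo N) T) f \<and>
     (\<forall>(U, \<phi>)\<in>charts M. \<forall>(V, \<psi>)\<in>charts N.
        smooth_on (\<phi> ` {p \<in> U \<inter> S. f p \<in> V}) (\<psi> \<circ> f \<circ> inv_into U \<phi>))"

definition diffeo ::
  "('a, 'e::euclidean_space) manifold \<Rightarrow> 'a set \<Rightarrow> ('b, 'd::euclidean_space) manifold \<Rightarrow> 'b set
     \<Rightarrow> ('a \<Rightarrow> 'b) \<Rightarrow> bool" where
  "diffeo M S N T f \<longleftrightarrow>
     bij_betw f S T \<and> smooth_map M S N T f \<and> smooth_map N T M S (inv_into S f)"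

text \<open>The product of manifolds at most one of which has a boundary (otherwise it has corners).\<close>

definition prod_manifold ::
  "('a, 'e) manifold \<Rightarrow> ('b, 'd) manifold \<Rightarrow> ('a \<times> 'b, 'e \<times> 'd) manifold" where
  "prod_manifold M N =
     \<lparr>topo = prod_topology (topo M) (topo N),
      charts = {(U \<times> V, map_prod \<phi> \<psi>) |U \<phi> V \<psi>. (U, \<phi>) \<in> charts M \<and> (V, \<psi>) \<in> charts N}\<rparr>"

text \<open>The circle, with the local inverses of \<open>t \<mapsto> cis t\<close> as charts.\<close>

definition circle :: "(complex, real) manifold" where
  "circle =
     \<lparr>topo = top_of_set (sphere 0 1),
      charts = {(cis ` {a<..<a + 2 * pi}, inv_into {a<..<a + 2 * pi} cis) |a. True}\<rparr>"

definition torus :: "(complex \<times> complex, real \<times> real) manifold" where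
  "torus = prod_manifold circle circle"


section \<open>Compact oriented surfaces with one boundary component\<close>

text \<open>An oriented surface is one whose atlas is oriented, that is, the coordinate changes
  have positive Jacobian determinant.\<close>

definition oriented_surface :: "('a, real^2) manifold \<Rightarrow> bool" where
  "oriented_surface M \<longleftrightarrow>
     smooth_manifold M \<and>
     (\<forall>(U, \<phi>)\<in>charts M. \<forall>(V, \<psi>)\<in>charts M. \<forall>x\<in>\<phi> ` (U \<inter> V).
        \<exists>D. ((\<psi> \<circ> inv_into U \<phi>) has_derivative D) (at x within \<phi> ` (U \<inter> V)) \<and>
            0 < det (matrix D))"

text \<open>The genus is the largest number of disjoint simple closed curves along which the surface can
  be cut without becoming disconnected. The curves lie in the interior: a boundary circle
  itself never separates.\<close>

definition nonseparating_curves :: "('a, real^2) manifold \<Rightarrow> 'a set set \<Rightarrow> bool" where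
  "nonseparating_curves M C \<longleftrightarrow>
     finite C \<and> disjoint C \<and>
     (\<forall>c\<in>C. c \<subseteq> carr M - mboundary M \<and> subtopology (topo M) c homeomorphic_space topo circle) \<and>
     connectedin (topo M) (carr M - \<Union>C)"

definition has_genus :: "('a, real^2) manifold \<Rightarrow> nat \<Rightarrow> bool" where
  "has_genus M g \<longleftrightarrow>
     (\<exists>C. nonseparating_curves M C \<and> card C = g) \<and>
     (\<forall>C. nonseparating_curves M C \<longrightarrow> card C \<le> g)"

definition is_Sigma_1 :: "nat \<Rightarrow> ('a, real^2) manifold \<Rightarrow> bool" where
  "is_Sigma_1 g M \<longleftrightarrow>
     oriented_surface M \<and> compact_space (topo M) \<and> connected_space (topo M) \<and>
     mboundary M \<noteq> {} \<and> connectedin (topo M) (mboundary M) \<and> has_genus M g"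


section \<open>Smooth fiber bundles\<close>

definition Diff :: "('f, 'd::euclidean_space) manifold \<Rightarrow> ('f \<Rightarrow> 'f) set" where
  "Diff F = {h. diffeo F (carr F) F (carr F) h}"

definition Diff_rel_boundary :: "('f, 'd::euclidean_space) manifold \<Rightarrow> ('f \<Rightarrow> 'f) set" where
  "Diff_rel_boundary F = {h \<in> Diff F. \<forall>y\<in>mboundary F. h y = y}"

definition local_trivialization ::
  "('e, 'm::euclidean_space) manifold \<Rightarrow> ('b, 'n::euclidean_space) manifold \<Rightarrow>
   ('f, 'd::euclidean_space) manifold \<Rightarrow> ('e \<Rightarrow> 'b) \<Rightarrow> 'b set \<Rightarrow> ('e \<Rightarrow> 'b \<times> 'f) \<Rightarrow> bool" where
  "local_trivialization E B F \<pi> U \<Phi> \<longleftrightarrow>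
     openin (topo B) U \<and>
     diffeo E {e \<in> carr E. \<pi> e \<in> U} (prod_manifold B F) (U \<times> carr F) \<Phi> \<and>
     (\<forall>e\<in>carr E. \<pi> e \<in> U \<longrightarrow> fst (\<Phi> e) = \<pi> e)"

text \<open>Smooth bundles with fiber \<open>F\<close> and structure group \<open>G \<subseteq> Diff F\<close>, over a base without
  boundary. The transition functions depend smoothly on the base point, because the local
  trivializations are diffeomorphisms.\<close>

definition fiber_bundle ::
  "('e, 'm::euclidean_space) manifold \<Rightarrow> ('b, 'n::euclidean_space) manifold \<Rightarrow>
   ('f, 'd::euclidean_space) manifold \<Rightarrow> ('f \<Rightarrow> 'f) set \<Rightarrow> ('e \<Rightarrow> 'b) \<Rightarrow> bool" where
  "fiber_bundle E B F G \<pi> \<longleftrightarrow>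
     smooth_manifold E \<and> smooth_manifold B \<and> mboundary B = {} \<and> smooth_manifold F \<and>
     smooth_map E (carr E) B (carr B) \<pi> \<and>
     (\<exists>\<T>. (\<forall>(U, \<Phi>)\<in>\<T>. local_trivialization E B F \<pi> U \<Phi>) \<and>
          (\<Union>(U, \<Phi>)\<in>\<T>. U) = carr B \<and>
          (\<forall>(U, \<Phi>)\<in>\<T>. \<forall>(V, \<Psi>)\<in>\<T>. \<forall>x\<in>U \<inter> V. \<exists>h\<in>G.
             \<forall>e\<in>carr E. \<pi> e = x \<longrightarrow> snd (\<Phi> e) = h (snd (\<Psi> e))))"

definition Sigma_1_bundle_over_torus ::
  "nat \<Rightarrow> ('w, real^4) manifold \<Rightarrow> ('f, real^2) manifold \<Rightarrow> ('w \<Rightarrow> complex \<times> complex) \<Rightarrow> bool" where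
  "Sigma_1_bundle_over_torus g W F \<pi> \<longleftrightarrow>
     is_Sigma_1 g F \<and> compact_space (topo W) \<and> fiber_bundle W torus F (Diff_rel_boundary F) \<pi>"

text \<open>The fiber may be taken on the type of points of \<open>M\<close>, because it is diffeomorphic to the
  preimage of a point.\<close>

definition fibers_over_circle :: "('a, real^4) manifold \<Rightarrow> bool" where
  "fibers_over_circle M \<longleftrightarrow>
     closed_manifold M \<and>
     (\<exists>(F :: ('a, real^3) manifold) \<pi>. fiber_bundle M circle F (Diff F) \<pi>)"


section \<open>Gluing along the boundary\<close>

text \<open>\<open>X = W \<union>\<^sub>f W'\<close> for a diffeomorphism \<open>f : \<partial>W' \<rightarrow> \<partial>W\<close>, with inclusions \<open>i\<close> and \<open>i'\<close> of the two
  pieces: the points of \<open>X\<close> are those of the disjoint union of \<open>W\<close> and \<open>W'\<close> with \<open>p \<in> \<partial>W'\<close>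
  identified with \<open>f p\<close>, the topology is the quotient topology, and the smooth structure is one
  for which \<open>i\<close> and \<open>i'\<close> are diffeomorphisms onto their images. Such a structure exists by
  means of collars, and is unique up to diffeomorphism.\<close>

definition is_gluing ::
  "('x, 'e::euclidean_space) manifold \<Rightarrow> ('w, 'e) manifold \<Rightarrow> ('v, 'e) manifold \<Rightarrow>
   ('v \<Rightarrow> 'w) \<Rightarrow> ('w \<Rightarrow> 'x) \<Rightarrow> ('v \<Rightarrow> 'x) \<Rightarrow> bool" where
  "is_gluing X W W' f i i' \<longleftrightarrow>
     smooth_manifold X \<and>
     diffeo W (carr W) X (i ` carr W) i \<and> diffeo W' (carr W') X (i' ` carr W') i' \<and>
     carr X = i ` carr W \<union> i' ` carr W' \<and>
     i ` carr W \<inter> i' ` carr W' = i ` mboundary W \<and>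
     (\<forall>p\<in>mboundary W'. i' p = i (f p)) \<and>
     (\<forall>Q. openin (topo X) Q \<longleftrightarrow>
        Q \<subseteq> carr X \<and>
        openin (topo W) {p \<in> carr W. i p \<in> Q} \<and> openin (topo W') {p \<in> carr W'. i' p \<in> Q})"

end

theory Submission imports Defs "HOL-Analysis.Analysis" begin

text \<open>A map \<open>X \<rightarrow> S\<^sup>1\<close> without critical points on a closed manifold is a bundle projection, so
  it suffices to construct such a map. On each piece the characters \<open>z\<^sub>1\<^sup>m z\<^sub>2\<^sup>n\<close> of the torus, pulled back by the
  bundle projection, have no critical points, neither on the piece nor on its boundary. Because \<open>\<partial>F'\<close> is
  a closed one-manifold, some nontrivial character of the first torus, transported by \<open>f\<close>, becomes null-homotopic
  on \<open>\<partial>F'\<close>. On \<open>\<partial>W' = T\<^sup>2 \<times> \<partial>F'\<close> it is then homotopic to a character of the second torus, which is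
  nontrivial since a nontrivial character is not null-homotopic on \<open>\<partial>W = T\<^sup>2 \<times> \<partial>F\<close>. The two maps are
  interpolated along the homotopy in a collar of the hypersurface, and a large monotone multiple of its
  defining function is added to the argument, which keeps the derivative nonzero.\<close>

section \<open>Calculus of smooth maps\<close>

text \<open>Degrees decide which character of the first torus is used: along the closed curve
  \<open>mboundary F'\<close> each of its two coordinate functions has one, and two integers always
  satisfy a nontrivial integral linear relation. Interpolation alone may create critical points,
  because the lift of the homotopy is uncontrolled. A steep function of the defining function
  \<open>s\<close> outweighs it, but such a function must flatten out again at both ends of the
  collar. There a second reason takes over: a nontrivial character varies already along the
  hypersurface, hence along nearby level sets of \<open>s\<close>, where functions of
  \<open>s\<close> are constant. So both characters have to be nontrivial, and their regularity on
  the boundary is used, not only that in the interior. The constants are chosen in this order: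
  bounds for the derivatives near the hypersurface, then the width of the collar, then the height of
  the added function. No metric and no flow is used: local triviality comes from the inverse
  function theorem and compactness, regularity is tested on curves, and the closed curve is handled
  through a finite cover by arcs instead of a classification.\<close>

declare C_on.simps(2) [simp del]

text \<open>\<open>frechet_derivative\<close> at a point depends on a whole neighbourhood of it;
  agreement on \<open>S\<close> carries over to the derivatives because \<open>S\<close> is
  open.\<close>

lemma C_on_cong:
 assumes "open S" "!!x. x \<in> S ==> f x = g x" "C_on k S f"
 shows "C_on k S g"
 using assms(2,3)
proof (induction k arbitrary: f g)
 case 0
 then show ?case by (metis C_on.simps(1) continuous_on_cong)
next
 case (Suc k)
 have D: "(g has_derivative frechet_derivative f (at x)) (at x)" if "x \<in> S" for x
 proof -
  have "f differentiable (at x)"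
   using Suc.prems(2) that assms(1) by (auto simp: C_on.simps differentiable_on_eq_differentiable_at)
  then have "(f has_derivative frechet_derivative f (at x)) (at x)"
   by (simp add: frechet_derivative_works)
  then show ?thesis
   using has_derivative_transform_within_open[OF _ assms(1) that] Suc.prems(1) by blast
 qed
 have "g differentiable_on S"
  using D assms(1) by (auto simp: differentiable_on_eq_differentiable_at differentiable_def)
 moreover have "C_on k S (%x. frechet_derivative g (at x) v)" for v
 proof (rule Suc.IH)
  show "C_on k S (%x. frechet_derivative f (at x) v)" using Suc.prems(2) by (simp add: C_on.simps)
  show "frechet_derivative f (at x) v = frechet_derivative g (at x) v" if "x \<in> S" for x
   using frechet_derivative_at[OF D[OF that]] by simp
 qed
 ultimately show ?case by (simp add: C_on.simps)
qed

text \<open>\<open>frechet_derivative\<close> is a choice operator; this frees the definition from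
  it. Any family of derivatives may be used instead, and most closure properties below are proved by
  writing down such a family and applying the induction hypothesis to it.\<close>

lemma C_on_Suc_iff:
 assumes "open S"
 shows "C_on (Suc k) S f \<longleftrightarrow>
  (EX f'. (ALL x:S. (f has_derivative f' x) (at x)) & (ALL v. C_on k S (%x. f' x v)))"
proof
 assume "C_on (Suc k) S f"
 then show "EX f'. (ALL x:S. (f has_derivative f' x) (at x)) & (ALL v. C_on k S (%x. f' x v))"
  using assms
  by (intro exI[of _ "%x. frechet_derivative f (at x)"])
   (auto simp: C_on.simps differentiable_on_eq_differentiable_at frechet_derivative_works)
next
 assume "EX f'. (ALL x:S. (f has_derivative f' x) (at x)) & (ALL v. C_on k S (%x. f' x v))"
 then obtain f' where f': "!!x. x \<in> S ==> (f has_derivative f' x) (at x)"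
   "!!v. C_on k S (%x. f' x v)" by blast
 have "C_on k S (%x. frechet_derivative f (at x) v)" for v
  by (rule C_on_cong[OF assms _ f'(2)[of v]]) (use frechet_derivative_at[OF f'(1)] in auto)
 then show "C_on (Suc k) S f"
  using f'(1) assms by (auto simp: C_on.simps differentiable_on_eq_differentiable_at differentiable_def)
qed

lemma C_on_SucI:
 assumes "open S" "!!x. x \<in> S ==> (f has_derivative f' x) (at x)" "!!v. C_on k S (%x. f' x v)"
 shows "C_on (Suc k) S f"
 using assms C_on_Suc_iff by blast

lemma C_on_SucE:
 assumes "open S" "C_on (Suc k) S f"
 obtains f' where "!!x. x \<in> S ==> (f has_derivative f' x) (at x)" "!!v. C_on k S (%x. f' x v)"
 using assms C_on_Suc_iff by metis

lemma C_on_SucD: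
 assumes "open S" "C_on (Suc k) S f"
 shows "C_on k S f"
 using assms(2)
proof (induction k arbitrary: f)
 case 0
 then show ?case by (auto simp: C_on.simps differentiable_imp_continuous_on)
next
 case (Suc k)
 obtain f' where f': "!!x. x \<in> S ==> (f has_derivative f' x) (at x)"
   "!!v. C_on (Suc k) S (%x. f' x v)"
  using C_on_SucE[OF assms(1) Suc.prems] by blast
 show ?case by (rule C_on_SucI[OF assms(1) f'(1) Suc.IH[OF f'(2)]])
qed

lemma C_on_subset: "C_on k S f ==> T <= S ==> C_on k T f"
 by (induction k arbitrary: f) (auto simp: C_on.simps intro: continuous_on_subset differentiable_on_subset)

text \<open>Used to return from the local extensions in \<open>smooth_on\<close> to a single
  function on an open set.\<close>

lemma C_on_local:
 assumes "open S" "!!x. x \<in> S ==> EX U. open U & x \<in> U & C_on k (U Int S) f"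
 shows "C_on k S f"
 using assms(2)
proof (induction k arbitrary: f)
 case 0
 have "continuous (at x) f" if x: "x \<in> S" for x
 proof -
  obtain U where "open U" "x \<in> U" "continuous_on (U Int S) f" using 0[OF x] by auto
  then show ?thesis using assms(1) x by (simp add: continuous_on_eq_continuous_at open_Int)
 qed
 then show ?case by (simp add: continuous_at_imp_continuous_on)
next
 case (Suc k)
 have d: "f differentiable (at x)" if x: "x \<in> S" for x
 proof -
  obtain U where "open U" "x \<in> U" "f differentiable_on (U Int S)"
   using Suc.prems[OF x] by (auto simp: C_on.simps)
  then show ?thesis using assms(1) x by (simp add: differentiable_on_eq_differentiable_at open_Int)
 qed
 have "C_on k S (%x. frechet_derivative f (at x) v)" for v
  by (rule Suc.IH) (use Suc.prems in \<open>fastforce simp: C_on.simps\<close>)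
 then show ?case using d assms(1) by (simp add: C_on.simps differentiable_on_eq_differentiable_at)
qed

lemma C_on_const: "open S ==> C_on k S (%x. c)"
proof (induction k arbitrary: c)
 case (Suc k)
 show ?case by (rule C_on_SucI[where f'="%x v. 0"]) (use Suc in auto)
qed simp

lemma C_on_add: "open S ==> C_on k S f ==> C_on k S g ==> C_on k S (%x. f x + g x)"
proof (induction k arbitrary: f g)
 case (Suc k)
 obtain f' where f': "!!x. x \<in> S ==> (f has_derivative f' x) (at x)" "!!v. C_on k S (%x. f' x v)"
  using C_on_SucE[OF Suc.prems(1,2)] by blast
 obtain g' where g': "!!x. x \<in> S ==> (g has_derivative g' x) (at x)" "!!v. C_on k S (%x. g' x v)"
  using C_on_SucE[OF Suc.prems(1,3)] by blast
 show ?case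
  by (rule C_on_SucI[where f'="%x v. f' x v + g' x v"])
   (use Suc f' g' in \<open>auto intro!: has_derivative_add\<close>)
qed (auto intro: continuous_intros)

lemma C_on_linear_compose:
 assumes "bounded_linear L" "open S"
 shows "C_on k S f ==> C_on k S (%x. L (f x))"
proof (induction k arbitrary: f)
 case 0
 then show ?case using assms(1) by (simp add: bounded_linear.continuous_on)
next
 case (Suc k)
 obtain f' where f': "!!x. x \<in> S ==> (f has_derivative f' x) (at x)" "!!v. C_on k S (%x. f' x v)"
  using C_on_SucE[OF assms(2) Suc.prems(1)] by blast
 show ?case
  by (rule C_on_SucI[where f'="%x v. L (f' x v)"])
   (use Suc f' assms in \<open>auto intro: bounded_linear.has_derivative\<close>)
qed

lemma C_on_linear:
 assumes "bounded_linear L" "open S" shows "C_on k S L"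
proof (cases k)
 case 0
 then show ?thesis using assms(1) by (simp add: linear_continuous_on)
next
 case (Suc k')
 show ?thesis unfolding Suc
  by (rule C_on_SucI[OF assms(2), where f'="%x. L"])
   (use assms in \<open>auto intro: bounded_linear_imp_has_derivative C_on_const\<close>)
qed

lemma C_on_ident: "open S ==> C_on k S (%x. x)"
 using C_on_linear[OF bounded_linear_ident] .

lemma C_on_sum:
 assumes "open S" "!!i. i \<in> I ==> C_on k S (f i)"
 shows "C_on k S (%x. \<Sum>i\<in>I. f i x)"
 using assms by (induction I rule: infinite_finite_induct) (auto intro: C_on_const C_on_add)

lemma C_on_bilinear:
 assumes "bounded_bilinear prd" "open S"
 shows "C_on k S f ==> C_on k S g ==> C_on k S (%x. prd (f x) (g x))"
proof (induction k arbitrary: f g)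
 case 0
 then show ?case using assms(1) by (simp add: bounded_bilinear.continuous_on)
next
 case (Suc k)
 obtain f' where f': "!!x. x \<in> S ==> (f has_derivative f' x) (at x)" "!!v. C_on k S (%x. f' x v)"
  using C_on_SucE[OF assms(2) Suc.prems(1)] by blast
 obtain g' where g': "!!x. x \<in> S ==> (g has_derivative g' x) (at x)" "!!v. C_on k S (%x. g' x v)"
  using C_on_SucE[OF assms(2) Suc.prems(2)] by blast
 show ?case
  by (rule C_on_SucI[where f'="%x v. prd (f x) (g' x v) + prd (f' x v) (g x)"])
   (use Suc.IH f' g' assms C_on_SucD[OF assms(2) Suc.prems(1)] C_on_SucD[OF assms(2) Suc.prems(2)]
    in \<open>auto intro!: bounded_bilinear.FDERIV C_on_add\<close>)
qed

lemma C_on_compose: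
 assumes "open S" "open T"
 shows "C_on k T g ==> C_on k S f ==> f ` S <= T ==> C_on k S (%x. g (f x))"
proof (induction k arbitrary: f g)
 case 0
 then show ?case by (auto intro: continuous_on_compose2)
next
 case (Suc k)
 obtain f' where f': "!!x. x \<in> S ==> (f has_derivative f' x) (at x)" "!!v. C_on k S (%x. f' x v)"
  using C_on_SucE[OF assms(1) Suc.prems(2)] by blast
 obtain g' where g': "!!x. x \<in> T ==> (g has_derivative g' x) (at x)" "!!v. C_on k T (%x. g' x v)"
  using C_on_SucE[OF assms(2) Suc.prems(1)] by blast
 show ?case
 \<comment> \<open>The chain rule gives \<open>g' (f x) (f' x v)\<close>, where the point and the
   direction both move with \<open>x\<close>. Expanding the direction in the basis leaves
   \<open>g' (f x) b\<close> with fixed \<open>b\<close>, to which the induction hypothesis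
   applies.\<close>
 proof (rule C_on_SucI[where f'="%x v. \<Sum>b\<in>Basis. (f' x v \<bullet> b) *\<^sub>R g' (f x) b"])
  fix x assume x: "x \<in> S"
  then have *: "(g has_derivative g' (f x)) (at (f x))" using g'(1) Suc.prems by auto
  then interpret L: bounded_linear "g' (f x)" by (rule has_derivative_bounded_linear)
  have der: "((%x. g (f x)) has_derivative (%v. g' (f x) (f' x v))) (at x)"
   using diff_chain_at[OF f'(1)[OF x] *] by (simp add: o_def)
  have eq: "g' (f x) v = (\<Sum>b\<in>Basis. (v \<bullet> b) *\<^sub>R g' (f x) b)" for v
  proof -
   have "g' (f x) v = g' (f x) (\<Sum>b\<in>Basis. (v \<bullet> b) *\<^sub>R b)" by (simp add: euclidean_representation)
   then show ?thesis by (simp add: L.sum L.scaleR)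
  qed
  show "((%x. g (f x)) has_derivative (%v. \<Sum>b\<in>Basis. (f' x v \<bullet> b) *\<^sub>R g' (f x) b)) (at x)"
   by (rule has_derivative_eq_rhs[OF der ext]) (rule eq)
 next
  fix v
  have "C_on k S f" by (rule C_on_SucD[OF assms(1) Suc.prems(2)])
  then have "C_on k S (%x. g' (f x) b)" for b
   using Suc.IH[OF g'(2)[of b]] Suc.prems(3) by blast
  then show "C_on k S (%x. \<Sum>b\<in>Basis. (f' x v \<bullet> b) *\<^sub>R g' (f x) b)"
   using assms f'(2)
   by (intro C_on_sum C_on_bilinear[OF bounded_bilinear_scaleR]
     C_on_linear_compose[OF bounded_linear_inner_left]) auto
 qed (use assms in auto)
qed

definition Cinf :: "'a::euclidean_space set => ('a => 'b::euclidean_space) => bool" where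
 "Cinf S f \<longleftrightarrow> (ALL k. C_on k S f)"

lemma Cinf_const: "open S ==> Cinf S (%x. c)"
 by (simp add: Cinf_def C_on_const)

lemma Cinf_compose:
 "Cinf T g ==> Cinf S f ==> open S ==> open T ==> f ` S <= T ==> Cinf S (%x. g (f x))"
 unfolding Cinf_def using C_on_compose by blast

lemma Cinf_linear: "bounded_linear L ==> open S ==> Cinf S L"
 by (simp add: Cinf_def C_on_linear)

lemma Cinf_linear_compose: "bounded_linear L ==> open S ==> Cinf S f ==> Cinf S (%x. L (f x))"
 by (simp add: Cinf_def C_on_linear_compose)

lemma Cinf_subset: "Cinf S f ==> T <= S ==> Cinf T f"
 unfolding Cinf_def using C_on_subset by blast

lemma Cinf_continuous: "Cinf S f ==> continuous_on S f"
 unfolding Cinf_def by (metis C_on.simps(1))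

lemma Cinf_derivative:
 assumes "Cinf S f" "open S"
 obtains f' where "!!x. x \<in> S ==> (f has_derivative f' x) (at x)" "!!v. Cinf S (%x. f' x v)"
proof
 show "(f has_derivative frechet_derivative f (at x)) (at x)" if "x \<in> S" for x
 proof -
  have "C_on (Suc 0) S f" using assms by (simp add: Cinf_def)
  then show ?thesis
   using assms(2) that
   by (simp add: C_on.simps differentiable_on_eq_differentiable_at frechet_derivative_works)
 qed
 show "Cinf S (%x. frechet_derivative f (at x) v)" for v
  unfolding Cinf_def
 proof
  fix k
  have "C_on (Suc k) S f" using assms by (simp add: Cinf_def)
  then show "C_on k S (%x. frechet_derivative f (at x) v)" by (simp add: C_on.simps)
 qed
qed

lemma C_on_mult:
 fixes f g :: "'a::euclidean_space => 'b::{euclidean_space,real_normed_algebra}"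
 shows "open S ==> C_on k S f ==> C_on k S g ==> C_on k S (%x. f x * g x)"
 by (rule C_on_bilinear[OF bounded_bilinear_mult])

lemma C_on_prod:
 fixes f :: "'i => 'a::euclidean_space => real"
 assumes "open S" "!!i. i \<in> I ==> C_on k S (f i)"
 shows "C_on k S (%x. \<Prod>i\<in>I. f i x)"
 using assms by (induction I rule: infinite_finite_induct) (auto intro: C_on_const C_on_mult)

text \<open>For functions of a real variable, smoothness can be read off from differential equations.\<close>

lemma C_on_SucI_real:
 fixes f :: "real => 'a::euclidean_space"
 assumes "open S" "!!x. x \<in> S ==> (f has_vector_derivative f' x) (at x)" "C_on k S f'"
 shows "C_on (Suc k) S f"
proof (rule C_on_SucI[OF assms(1), where f'="%x v. v *\<^sub>R f' x"])
 show "(f has_derivative (%v. v *\<^sub>R f' x)) (at x)" if "x \<in> S" for x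
  using assms(2)[OF that] by (simp add: has_vector_derivative_def)
 show "C_on k S (%x. v *\<^sub>R f' x)" for v
  by (rule C_on_linear_compose[OF bounded_linear_scaleR_right assms(1,3)])
qed

lemma C_on_inverse_real: "C_on k (- {0::real}) inverse"
proof (induction k)
 case 0
 then show ?case by (auto intro: continuous_intros)
next
 case (Suc k)
 have o: "open (- {0::real})" by auto
 show ?case
 proof (rule C_on_SucI_real[OF o, where f'="%x. - 1 *\<^sub>R (inverse x * inverse x)"])
  show "(inverse has_vector_derivative - 1 *\<^sub>R (inverse x * inverse x)) (at x)" if "x \<in> - {0}" for x :: real
   using DERIV_inverse[of x UNIV] that
   by (simp add: has_real_derivative_iff_has_vector_derivative power2_eq_square flip: numeral_2_eq_2)
  show "C_on k (- {0::real}) (%x. - 1 *\<^sub>R (inverse x * inverse x))"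
   by (rule C_on_linear_compose[OF bounded_linear_scaleR_right o]) (rule C_on_mult[OF o Suc Suc])
 qed
qed

lemma C_on_inverse:
 fixes f :: "'a::euclidean_space => real"
 assumes "open S" "C_on k S f" "!!x. x \<in> S ==> f x ~= 0"
 shows "C_on k S (%x. inverse (f x))"
 by (rule C_on_compose[OF assms(1) _ C_on_inverse_real]) (use assms in auto)

lemma C_on_arctan: "C_on k UNIV arctan"
proof (cases k)
 case (Suc k')
 have "C_on (Suc k') UNIV arctan"
 proof (rule C_on_SucI_real[where f'="%x. inverse (1 + x * x)"])
  show "(arctan has_vector_derivative inverse (1 + x * x)) (at x)" for x
   using DERIV_arctan[of x] by (simp add: has_real_derivative_iff_has_vector_derivative power2_eq_square)
  show "C_on k' UNIV (%x::real. inverse (1 + x * x))"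
   by (intro C_on_inverse C_on_add C_on_const C_on_mult C_on_ident)
    (auto simp: add_nonneg_eq_0_iff)
 qed auto
 then show ?thesis using Suc by simp
qed (auto intro: continuous_intros)

lemma C_on_cis: "C_on k UNIV cis"
proof (induction k)
 case (Suc k)
 show ?case
 proof (rule C_on_SucI_real[where f'="%x. \<i> * cis x"])
  show "(cis has_vector_derivative \<i> * cis x) (at x)" for x
  proof -
   have "((%t. cis t) has_derivative (%h. h *\<^sub>R (\<i> * cis x))) (at x)"
    by (rule derivative_eq_intros refl | simp add: scaleR_conv_of_real)+
   then show ?thesis by (simp add: has_vector_derivative_def)
  qed
  show "C_on k UNIV (%x. \<i> * cis x)"
   by (intro C_on_mult C_on_const Suc) auto
 qed auto
qed (auto intro!: continuous_intros)

section \<open>The inverse function theorem\<close>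

lemma C_on_vec:
 fixes f :: "'n::finite => 'a::euclidean_space => real"
 assumes "open S" "!!i. C_on k S (f i)"
 shows "C_on k S (%x. \<chi> i. f i x)"
proof -
 have "(%x. \<chi> i. f i x) = (%x. \<Sum>i\<in>UNIV. f i x *\<^sub>R axis i 1)"
  by (auto simp: vec_eq_iff fun_eq_iff axis_def if_distrib cong: if_cong)
 then show ?thesis
  by (simp only:) (intro C_on_sum C_on_bilinear[OF bounded_bilinear_scaleR] C_on_const assms)
qed

lemma C_on_nth:
 fixes f :: "'a::euclidean_space => real^'n"
 assumes "open S" "C_on k S f"
 shows "C_on k S (%x. f x $ i)"
 by (rule C_on_linear_compose[OF bounded_linear_vec_nth assms])

lemma C_on_det:
 fixes M :: "'a::euclidean_space => real^'n^'n"
 assumes "open S" "!!i j. C_on k S (%x. M x $ i $ j)"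
 shows "C_on k S (%x. det (M x))"
 unfolding det_def by (intro C_on_sum C_on_mult C_on_prod C_on_const assms)

text \<open>Bootstrapping: the derivative of \<open>g\<close> at \<open>y\<close> is the inverse of
  \<open>f' (g y)\<close>. By Cramer's rule its entries are quotients of determinants in the entries
  of \<open>f' (g y)\<close>, which are of class C^k as soon as \<open>g\<close> is. Hence
  \<open>g\<close> is of class C^(k+1).\<close>

lemma C_on_local_inverse_vec:
 fixes f :: "real^'n => real^'n"
 assumes "open U" "open V" "homeomorphism U V f g" "Cinf U f"
  and der: "!!x. x \<in> U ==> (f has_derivative f' x) (at x)"
  and "!!v. Cinf U (%x. f' x v)"
  and derg: "!!y. y \<in> V ==> (g has_derivative inv (f' (g y))) (at y)"
  and bij: "!!y. y \<in> V ==> bij (f' (g y))"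
 shows "C_on k V g"
proof (induction k)
 case 0
 then show ?case using assms(3) by (simp add: homeomorphism_def)
next
 case (Suc k)
 define M where "M y = matrix (f' (g y))" for y
 have gV: "g ` V <= U" using assms(3) by (auto simp: homeomorphism_def)
 have M: "C_on k V (%y. M y $ i $ j)" for i j
 proof -
  have "C_on k V (%y. f' (g y) (axis j 1))"
   by (rule C_on_compose[OF assms(2,1) _ Suc gV, of "%x. f' x (axis j 1)"])
    (use assms(6) in \<open>auto simp: Cinf_def\<close>)
  then show ?thesis
   using C_on_nth[OF assms(2), of k "%y. f' (g y) (axis j 1)" i] by (simp add: M_def matrix_def)
 qed
 have lin: "linear (f' (g y))" if "y \<in> V" for y
  using der[of "g y"] gV that by (auto intro: has_derivative_linear)
 have mv: "M y *v w = f' (g y) w" if "y \<in> V" for y w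
  using lin[OF that] by (simp add: M_def matrix_works)
 have det: "det (M y) ~= 0" if "y \<in> V" for y
  using lin[OF that] bij[OF that] det_nz_iff_inj[of "f' (g y)"]
  by (auto simp: M_def bij_def linear_def)
 show ?case
 proof (rule C_on_SucI[OF assms(2) derg])
  fix v
  have eq: "inv (f' (g y)) v = (\<chi> k. det (\<chi> i j. if j = k then v $ i else M y $ i $ j) * inverse (det (M y)))"
   if "y \<in> V" for y
  proof -
   have "M y *v inv (f' (g y)) v = v"
    using mv[OF that] bij[OF that] by (simp add: bij_def surj_f_inv_f)
   then show ?thesis using cramer[OF det[OF that]] by (simp add: divide_inverse)
  qed
  have "C_on k V (%y. \<chi> k. det (\<chi> i j. if j = k then v $ i else M y $ i $ j) * inverse (det (M y)))"
  proof (intro C_on_vec C_on_mult C_on_inverse C_on_det assms(2) M)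
   show "C_on k V (%y. (\<chi> i j. if j = l then v $ i else M y $ i $ j) $ i $ j)" for i j l
    using M C_on_const[OF assms(2)] by (cases "j = l") auto
  qed (use det in auto)
  then show "C_on k V (%y. inv (f' (g y)) v)"
   by (rule C_on_cong[OF assms(2), rotated]) (simp add: eq)
 qed
qed

lemma smooth_inverse_function_vec:
 fixes f :: "real^'n => real^'n"
 assumes U: "open U" "Cinf U f" "x0 \<in> U" "(f has_derivative f0) (at x0)" "inj f0"
 obtains O' V g where "open O'" "x0 \<in> O'" "O' <= U" "open V" "homeomorphism O' V f g" "Cinf V g"
proof -
 obtain f' where f': "!!x. x \<in> U ==> (f has_derivative f' x) (at x)" "!!v. Cinf U (%x. f' x v)"
  using Cinf_derivative[OF U(2,1)] by blast
 \<comment> \<open>The derivative as a map into the normed space of bounded linear maps. Its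
   continuity may be checked on each vector separately, since the dimension is finite.\<close>
 define F where "F x = Blinfun (f' x)" for x
 have F: "blinfun_apply (F x) = f' x" if "x \<in> U" for x
  unfolding F_def using f'(1)[OF that] by (simp add: bounded_linear_Blinfun_apply has_derivative_bounded_linear)
 have cont: "continuous_on U F"
 proof (rule continuous_on_blinfun_componentwise)
  show "continuous_on U (%x. blinfun_apply (F x) i)" for i
   using Cinf_continuous[OF f'(2)[of i]] F by (metis (no_types, lifting) continuous_on_cong)
 qed
 have eq0: "f' x0 = f0" using has_derivative_unique[OF f'(1)[OF U(3)] U(4)] .
 have "linear f0" using U(4) has_derivative_linear by blast
 then obtain h where h: "linear h" "h \<circ> f0 = id"
  using linear_injective_left_inverse U(5) by blast
 have "bounded_linear h" using h(1) by (simp add: linear_linear)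
 then have "blinfun_apply (Blinfun h o\<^sub>L F x0) v = blinfun_apply id_blinfun v" for v
  using F[OF U(3)] eq0 pointfree_idE[OF h(2), of v] by (simp add: bounded_linear_Blinfun_apply)
 then have left_inv: "Blinfun h o\<^sub>L F x0 = id_blinfun" by (rule blinfun_eqI)
 have derF: "(f has_derivative blinfun_apply (F x)) (at x)" if "x \<in> U" for x
  using f'(1)[OF that] F[OF that] by simp
 obtain O' V g g' where og: "open O'" "O' <= U" "x0 \<in> O'" "open V" "f x0 \<in> V" "homeomorphism O' V f g"
  "!!y. y \<in> V ==> (g has_derivative (g' y)) (at y)"
  "!!y. y \<in> V ==> g' y = inv (blinfun_apply (F (g y)))"
  "!!y. y \<in> V ==> bij (blinfun_apply (F (g y)))"
  by (rule inverse_function_theorem[OF U(1) derF cont U(3) left_inv, rotated]) (rule that)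
 have gU: "g y \<in> U" if "y \<in> V" for y using og that by (auto simp: homeomorphism_def)
 have "C_on k V g" for k
 proof (rule C_on_local_inverse_vec[OF og(1) og(4) og(6), where f'=f'])
  show "Cinf O' f" "!!v. Cinf O' (%x. f' x v)" using Cinf_subset U(2) f'(2) og(2) by blast+
 qed (use f' og F gU in \<open>auto simp: subset_iff\<close>)
 then show ?thesis using that og by (simp add: Cinf_def)
qed

text \<open>Determinants need coordinates indexed by a finite type, so both spaces are transported
  to \<open>real^'n\<close> by linear isomorphisms; \<open>'n\<close> only records the common
  dimension. Below it is 4, and the target is \<open>real^4\<close> or
  \<open>real \<times> (real^3)\<close>.\<close>

theorem smooth_inverse_function:
 fixes f :: "'a::euclidean_space => 'b::euclidean_space"
 assumes dim: "DIM('a) = CARD('n::finite)" "DIM('b) = CARD('n)"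
  and U: "open U" "Cinf U f" "x0 \<in> U" "(f has_derivative f0) (at x0)" "inj f0"
 obtains O' V g where "open O'" "x0 \<in> O'" "O' <= U" "open V" "homeomorphism O' V f g" "Cinf V g"
proof -
 obtain p :: "'a => real^'n" and p' where p: "linear p" "linear p'" "p' \<circ> p = id" "p \<circ> p' = id"
 proof -
  have "DIM('a) = DIM(real^'n)" using dim(1) by simp
  then show ?thesis
   by (rule isomorphisms_UNIV_UNIV) (rule that, auto simp: fun_eq_iff)
 qed
 obtain q :: "'b => real^'n" and q' where q: "linear q" "linear q'" "q' \<circ> q = id" "q \<circ> q' = id"
 proof -
  have "DIM('b) = DIM(real^'n)" using dim(2) by simp
  then show ?thesis
   by (rule isomorphisms_UNIV_UNIV) (rule that, auto simp: fun_eq_iff)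
 qed
 note bl = p(1)[THEN linear_linear[THEN iffD2]] p(2)[THEN linear_linear[THEN iffD2]]
  q(1)[THEN linear_linear[THEN iffD2]] q(2)[THEN linear_linear[THEN iffD2]]
 have pp: "p' (p x) = x" "p (p' y) = y" "q' (q z) = z" "q (q' w) = w" for x y z w
  using p q by (simp_all add: pointfree_idE)
 have cont: "continuous_on S p" "continuous_on S' p'" "continuous_on T q" "continuous_on T' q'" for S S' T T'
  using bl by (simp_all add: linear_continuous_on)
 let ?U = "p' -` U" and ?F = "%x. q (f (p' x))"
 have oU: "open ?U" using U(1) cont(2)[of UNIV] by (simp add: continuous_on_open_vimage)
 have 1: "Cinf ?U ?F"
  by (rule Cinf_linear_compose[OF bl(3) oU], rule Cinf_compose[OF U(2) Cinf_linear[OF bl(2) oU] oU U(1)]) auto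
 have 2: "(?F has_derivative (%v. q (f0 (p' v)))) (at (p x0))"
 proof -
  have "((%x. f (p' x)) has_derivative (%v. f0 (p' v))) (at (p x0))"
   using diff_chain_at[OF bounded_linear_imp_has_derivative[OF bl(2)], of f f0 "p x0"] U(4)
   by (simp add: pp o_def)
  then show ?thesis by (rule bounded_linear.has_derivative[OF bl(3)])
 qed
 have 3: "inj (%v. q (f0 (p' v)))"
 proof (rule injI)
  fix v w assume "q (f0 (p' v)) = q (f0 (p' w))"
  then have "f0 (p' v) = f0 (p' w)" using pp by metis
  then have "p' v = p' w" using U(5) by (simp add: inj_eq)
  then show "v = w" using pp by metis
 qed
 obtain A B g where A: "open A" "p x0 \<in> A" "A <= ?U" "open B" "homeomorphism A B ?F g" "Cinf B g"
  by (rule smooth_inverse_function_vec[OF oU 1 _ 2 3]) (use U(3) pp in auto)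
 show ?thesis
 proof
  show "open (p -` A)" "open (q -` B)"
   using A cont(1)[of UNIV] cont(3)[of UNIV] by (simp_all add: continuous_on_open_vimage)
  show "x0 \<in> p -` A" "p -` A <= U" using A(2,3) pp by auto
  show "homeomorphism (p -` A) (q -` B) f (%y. p' (g (q y)))"
  proof (rule homeomorphismI)
   have FA: "?F x \<in> B & g (?F x) = x" if "x \<in> A" for x
    using A(5) that by (auto simp: homeomorphism_def)
   have gB: "g y \<in> A & ?F (g y) = y" if "y \<in> B" for y
    using A(5) that by (auto simp: homeomorphism_def)
   show "continuous_on (p -` A) f"
    using U(2) Cinf_continuous \<open>p -` A <= U\<close> continuous_on_subset by blast
   show "continuous_on (q -` B) (%y. p' (g (q y)))"
    by (rule continuous_on_compose2[OF cont(2)[of UNIV]],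
      rule continuous_on_compose2[OF Cinf_continuous[OF A(6)] cont(3)]) auto
   show "f ` (p -` A) <= q -` B" using FA pp by (metis image_subsetI vimageE vimageI2)
   show "(%y. p' (g (q y))) ` (q -` B) <= p -` A" using gB pp by auto
   show "p' (g (q (f x))) = x" if "x \<in> p -` A" for x
    using FA[of "p x"] that pp by auto
   show "f (p' (g (q y))) = y" if "y \<in> q -` B" for y
   proof -
    have "q (f (p' (g (q y)))) = q y" using gB[of "q y"] that by auto
    then show ?thesis using pp by metis
   qed
  qed
  show "Cinf (q -` B) (%y. p' (g (q y)))"
   by (rule Cinf_linear_compose[OF bl(2) \<open>open (q -` B)\<close>],
     rule Cinf_compose[OF A(6) Cinf_linear[OF bl(3)] _ A(4)]) (use \<open>open (q -` B)\<close> in auto)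
 qed
qed

section \<open>Smooth functions on arbitrary subsets\<close>

lemma smooth_onI:
 "(!!x. x \<in> S ==> EX U h. open U & x \<in> U & Cinf U h & (ALL y:U Int S. h y = f y)) ==> smooth_on S f"
 by (simp add: smooth_on_def Cinf_def)

lemma smooth_onE:
 assumes "smooth_on S f" "x \<in> S"
 obtains U h where "open U" "x \<in> U" "Cinf U h" "!!y. y \<in> U Int S ==> h y = f y"
proof -
 have "EX U h. open U & x \<in> U & Cinf U h & (ALL y:U Int S. h y = f y)"
  using assms by (simp add: smooth_on_def Cinf_def)
 then show ?thesis using that by auto
qed

lemma smooth_on_open:
 assumes "open S" shows "smooth_on S f \<longleftrightarrow> Cinf S f"
proof
 assume *: "smooth_on S f"
 have "C_on k S f" for k
 proof (rule C_on_local[OF assms])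
  fix x assume "x \<in> S"
  then obtain U h where U: "open U" "x \<in> U" "Cinf U h" "!!y. y \<in> U Int S ==> h y = f y"
   using smooth_onE[OF *] by metis
  have "C_on k (U Int S) f"
   by (rule C_on_cong[where f=h])
    (use U assms C_on_subset[of k U h "U Int S"] in \<open>auto simp: Cinf_def open_Int\<close>)
  then show "EX U. open U & x \<in> U & C_on k (U Int S) f" using U by blast
 qed
 then show "Cinf S f" by (simp add: Cinf_def)
next
 assume "Cinf S f"
 then show "smooth_on S f" using assms by (auto intro!: smooth_onI)
qed

lemma smooth_on_subset:
 assumes "smooth_on S f" "T <= S" shows "smooth_on T f"
proof (rule smooth_onI)
 fix x assume "x \<in> T"
 then obtain U h where "open U" "x \<in> U" "Cinf U h" "!!y. y \<in> U Int S ==> h y = f y"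
  using smooth_onE[OF assms(1), of x] assms(2) by auto
 then show "EX U h. open U & x \<in> U & Cinf U h & (ALL y:U Int T. h y = f y)"
  using assms(2) by (intro exI[of _ U] exI[of _ h]) auto
qed

lemma smooth_on_cong:
 assumes "smooth_on S f" "!!x. x \<in> S ==> f x = g x" shows "smooth_on S g"
proof (rule smooth_onI)
 fix x assume "x \<in> S"
 then obtain U h where "open U" "x \<in> U" "Cinf U h" "!!y. y \<in> U Int S ==> h y = f y"
  using smooth_onE[OF assms(1), of x] by auto
 then show "EX U h. open U & x \<in> U & Cinf U h & (ALL y:U Int S. h y = g y)"
  using assms(2) by (intro exI[of _ U] exI[of _ h]) auto
qed

lemma smooth_on_local:
 assumes "!!x. x \<in> S ==> EX U. open U & x \<in> U & smooth_on (U Int S) f"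
 shows "smooth_on S f"
proof (rule smooth_onI)
 fix x assume x: "x \<in> S"
 then obtain U where U: "open U" "x \<in> U" "smooth_on (U Int S) f" using assms by blast
 then obtain V h where V: "open V" "x \<in> V" "Cinf V h" "!!y. y \<in> V Int (U Int S) ==> h y = f y"
  using x smooth_onE[OF U(3), of x] by blast
 have "Cinf (U Int V) h" by (rule Cinf_subset[OF V(3)]) auto
 then show "EX U h. open U & x \<in> U & Cinf U h & (ALL y:U Int S. h y = f y)"
  using U V by (intro exI[of _ "U Int V"] exI[of _ h]) auto
qed

lemma smooth_on_continuous:
 assumes "smooth_on S f" shows "continuous_on S f"
 unfolding continuous_on_eq_continuous_within
proof
 fix x assume x: "x \<in> S"
 then obtain U h where U: "open U" "x \<in> U" "Cinf U h" "!!y. y \<in> U Int S ==> h y = f y"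
  using smooth_onE[OF assms] by metis
 have "continuous (at x within S) h"
  using Cinf_continuous[OF U(3)] U(1,2) by (simp add: continuous_at_imp_continuous_within continuous_on_eq_continuous_at)
 moreover have "eventually (%y. y \<in> U Int S) (at x within S)"
  using U(1,2) by (auto simp: eventually_at_filter eventually_nhds)
 then have "eventually (%y. h y = f y) (at x within S)"
  by (rule eventually_mono) (use U(4) in auto)
 moreover have "h x = f x" using U(2,4) x by blast
 ultimately show "continuous (at x within S) f"
  unfolding continuous_within using Lim_transform_eventually by fastforce
qed

lemma smooth_on_compose:
 assumes g: "smooth_on T g" and f: "smooth_on S f" and "f ` S <= T"
 shows "smooth_on S (%x. g (f x))"
proof (rule smooth_onI)
 fix x assume x: "x \<in> S"
 obtain U h where U: "open U" "x \<in> U" "Cinf U h" "!!y. y \<in> U Int S ==> h y = f y"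
  using smooth_onE[OF f x] by metis
 obtain V k where V: "open V" "f x \<in> V" "Cinf V k" "!!y. y \<in> V Int T ==> k y = g y"
  using smooth_onE[OF g, of "f x"] x assms(3) by blast
 let ?W = "U Int h -` V"
 have o: "open ?W" using Cinf_continuous[OF U(3)] U(1) V(1) by (simp add: continuous_on_open_vimage Int_commute)
 have "Cinf ?W (%y. k (h y))"
  by (rule Cinf_compose[OF V(3) Cinf_subset[OF U(3)] o V(1)]) auto
 moreover have "x \<in> ?W" using U V x by auto
 moreover have "k (h y) = g (f y)" if "y \<in> ?W Int S" for y
  using that U(4)[of y] V(4)[of "h y"] assms(3) by auto
 ultimately show "EX U ha. open U & x \<in> U & Cinf U ha & (ALL y:U Int S. ha y = g (f y))"
  using o by (intro exI[of _ ?W] exI[of _ "%y. k (h y)"]) blast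
qed

lemma smooth_on_linear: "bounded_linear L ==> smooth_on S L"
 by (rule smooth_on_subset[of UNIV]) (simp_all add: smooth_on_open Cinf_linear)

lemma smooth_on_const: "smooth_on S (%x. c)"
 by (rule smooth_on_subset[of UNIV]) (simp_all add: smooth_on_open Cinf_const)

lemma smooth_on_ident: "smooth_on S (%x. x)"
 by (rule smooth_on_linear) (rule bounded_linear_ident)

lemma smooth_on_linear_compose:
 "bounded_linear L ==> smooth_on S f ==> smooth_on S (%x. L (f x))"
 using smooth_on_compose[OF smooth_on_linear[of L UNIV], of S f] by simp

lemma smooth_on_binop:
 fixes f :: "'a::euclidean_space => 'b::euclidean_space" and g :: "'a => 'c::euclidean_space"
  and op :: "'b => 'c => 'd::euclidean_space"
 assumes op: "!!(U::'a set) k h h'. open U ==> C_on k U h ==> C_on k U h' ==> C_on k U (%x. op (h x) (h' x))"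
  and f: "smooth_on S f" and g: "smooth_on S g"
 shows "smooth_on S (%x. op (f x) (g x))"
proof (rule smooth_onI)
 fix x assume x: "x \<in> S"
 obtain U h where U: "open U" "x \<in> U" "Cinf U h" "!!y. y \<in> U Int S ==> h y = f y"
  using smooth_onE[OF f x] by metis
 obtain V k where V: "open V" "x \<in> V" "Cinf V k" "!!y. y \<in> V Int S ==> k y = g y"
  using smooth_onE[OF g x] by metis
 have "Cinf (U Int V) h" "Cinf (U Int V) k" by (auto intro: Cinf_subset U(3) V(3))
 then have "Cinf (U Int V) (%x. op (h x) (k x))"
  using op[of "U Int V"] U(1) V(1) by (simp add: Cinf_def open_Int)
 then show "EX U ha. open U & x \<in> U & Cinf U ha & (ALL y:U Int S. ha y = op (f y) (g y))"
  using U V by (intro exI[of _ "U Int V"] exI[of _ "%x. op (h x) (k x)"]) auto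
qed

lemma smooth_on_bilinear:
 "bounded_bilinear prd ==> smooth_on S f ==> smooth_on S g ==> smooth_on S (%x. prd (f x) (g x))"
 by (rule smooth_on_binop[where op=prd]) (rule C_on_bilinear)

lemma smooth_on_add:
 "smooth_on S f ==> smooth_on S g ==> smooth_on S (%x. f x + g x)"
 by (rule smooth_on_binop[where op="(+)"]) (rule C_on_add)

lemma smooth_on_mult:
 fixes f g :: "'a::euclidean_space => 'b::{euclidean_space,real_normed_algebra}"
 shows "smooth_on S f ==> smooth_on S g ==> smooth_on S (%x. f x * g x)"
 by (rule smooth_on_bilinear[OF bounded_bilinear_mult])

lemma smooth_on_uminus: "smooth_on S f ==> smooth_on S (%x. - f x)"
 by (rule smooth_on_linear_compose[OF bounded_linear_minus[OF bounded_linear_ident]])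

lemma smooth_on_diff:
 "smooth_on S f ==> smooth_on S g ==> smooth_on S (%x. f x - g x)"
 using smooth_on_add[OF _ smooth_on_uminus[of S g], of f] by simp

lemma smooth_on_sum:
 "(!!i. i \<in> I ==> smooth_on S (f i)) ==> smooth_on S (%x. \<Sum>i\<in>I. f i x)"
 by (induction I rule: infinite_finite_induct) (auto intro: smooth_on_const smooth_on_add)

lemma smooth_on_Pair:
 assumes "smooth_on S f" "smooth_on S g"
 shows "smooth_on S (%x. (f x, g x))"
proof -
 have 1: "bounded_linear (%x::'b. (x, 0::'c))" "bounded_linear (%y::'c. (0::'b, y))"
  by (auto intro!: bounded_linear_Pair bounded_linear_ident bounded_linear_zero)
 show ?thesis
  using smooth_on_add[OF smooth_on_linear_compose[OF 1(1) assms(1)] smooth_on_linear_compose[OF 1(2) assms(2)]]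
  by simp
qed

lemma smooth_on_fst: "smooth_on S f ==> smooth_on S (%x. fst (f x))"
 by (rule smooth_on_linear_compose[OF bounded_linear_fst])

lemma smooth_on_snd: "smooth_on S f ==> smooth_on S (%x. snd (f x))"
 by (rule smooth_on_linear_compose[OF bounded_linear_snd])

lemma smooth_on_Cinf_compose:
 "Cinf T g ==> open T ==> smooth_on S f ==> f ` S <= T ==> smooth_on S (%x. g (f x))"
 using smooth_on_compose smooth_on_open by blast

lemma smooth_on_cis: "smooth_on S f ==> smooth_on S (%x. cis (f x))"
 by (rule smooth_on_Cinf_compose[of UNIV cis]) (auto simp: Cinf_def C_on_cis)

lemma smooth_on_arctan: "smooth_on S f ==> smooth_on S (%x. arctan (f x))"
 by (rule smooth_on_Cinf_compose[of UNIV arctan]) (auto simp: Cinf_def C_on_arctan)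

lemma smooth_on_inverse:
 fixes f :: "'a::euclidean_space => real"
 shows "smooth_on S f ==> (!!x. x \<in> S ==> f x ~= 0) ==> smooth_on S (%x. inverse (f x))"
 by (rule smooth_on_Cinf_compose[of "- {0}" inverse]) (auto simp: Cinf_def C_on_inverse_real)

lemma smooth_on_divide:
 fixes f g :: "'a::euclidean_space => real"
 shows "smooth_on S f ==> smooth_on S g ==> (!!x. x \<in> S ==> g x ~= 0) ==> smooth_on S (%x. f x / g x)"
 unfolding divide_inverse by (intro smooth_on_mult smooth_on_inverse)

lemma smooth_on_Re: "smooth_on S f ==> smooth_on S (%x. Re (f x))"
 by (rule smooth_on_linear_compose[OF bounded_linear_Re])

lemma smooth_on_Im: "smooth_on S f ==> smooth_on S (%x. Im (f x))"
 by (rule smooth_on_linear_compose[OF bounded_linear_Im])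

text \<open>The branch of the argument on the right half-plane, with values between
  \<open>- pi / 2\<close> and \<open>pi / 2\<close>. It is applied to \<open>w * cnj z\<close> for
  nearby unit numbers \<open>w\<close> and \<open>z\<close>, and so measures a small angle from
  \<open>z\<close> to \<open>w\<close>.\<close>

definition arg0 :: "complex => real" where "arg0 z = arctan (Im z / Re z)"

lemma smooth_on_arg0: "smooth_on S f ==> (!!x. x \<in> S ==> Re (f x) > 0) ==> smooth_on S (%x. arg0 (f x))"
 unfolding arg0_def
 by (intro smooth_on_arctan smooth_on_divide smooth_on_Re smooth_on_Im) (assumption | metis order_less_irrefl)+

lemma cis_arg0:
 assumes "Re z > 0" shows "of_real (cmod z) * cis (arg0 z) = z"
proof -
 have s: "sqrt (1 + (Im z / Re z)\<^sup>2) = cmod z / Re z"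
 proof -
  have "1 + (Im z / Re z)\<^sup>2 = (cmod z / Re z)\<^sup>2"
   using assms by (simp add: cmod_power2 power_divide field_simps)
  then show ?thesis using assms by (simp only: real_sqrt_abs) auto
 qed
 have "cmod z > 0" using assms by auto
 then show ?thesis
  using assms by (intro complex_eqI) (simp_all add: arg0_def cos_arctan sin_arctan s)
qed

lemma arg0_cis: "- (pi / 2) < t ==> t < pi / 2 ==> arg0 (cis t) = t"
 using arctan_tan[of t] by (simp add: arg0_def tan_def)

lemma abs_arg0_less: "\<bar>arg0 z\<bar> < pi / 2"
 unfolding arg0_def using arctan[of "Im z / Re z"] by (simp add: abs_if)

section \<open>Smooth maps between manifolds\<close>

lemma chartD:
 assumes "smooth_manifold M" "(U, \<phi>) \<in> charts M"
 shows chart_open: "openin (topo M) U" and chart_model: "model_open (\<phi> ` U)"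
  and chart_homeo: "homeomorphic_map (subtopology (topo M) U) (top_of_set (\<phi> ` U)) \<phi>"
  and chart_inj: "inj_on \<phi> U" and chart_subset: "U <= carr M"
proof -
 show 1: "openin (topo M) U" and "model_open (\<phi> ` U)"
  and 2: "homeomorphic_map (subtopology (topo M) U) (top_of_set (\<phi> ` U)) \<phi>"
  using assms unfolding smooth_manifold_def by fast+
 show 3: "U <= carr M" using openin_subset[OF 1] .
 show "inj_on \<phi> U" using homeomorphic_imp_injective_map[OF 2] 3 by (simp add: inf_absorb2)
qed

lemma chart_transition:
 "smooth_manifold M ==> (U, \<phi>) \<in> charts M ==> (V, \<psi>) \<in> charts M ==>
  smooth_on (\<phi> ` (U Int V)) (\<psi> \<circ> inv_into U \<phi>)"
 unfolding smooth_manifold_def by fast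

lemma chart_at:
 assumes "smooth_manifold M" "p \<in> carr M"
 obtains U \<phi> where "(U, \<phi>) \<in> charts M" "p \<in> U"
proof -
 have "p \<in> (\<Union>(U, \<phi>)\<in>charts M. U)" using assms unfolding smooth_manifold_def by simp
 then show ?thesis using that by auto
qed

lemma chart_continuous:
 assumes "smooth_manifold M" "(U, \<phi>) \<in> charts M"
 shows "continuous_map (subtopology (topo M) U) euclidean \<phi>"
 using homeomorphic_imp_continuous_map[OF chart_homeo[OF assms]] continuous_map_in_subtopology by blast

lemma chart_image_open:
 assumes "smooth_manifold M" "(U, \<phi>) \<in> charts M" "openin (topo M) G"
 obtains T where "open T" "\<phi> ` (U Int G) = \<phi> ` U Int T"
proof -
 have "openin (subtopology (topo M) U) (U Int G)"
  using assms(3) by (rule openin_subtopology_Int2)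
 then have "openin (top_of_set (\<phi> ` U)) (\<phi> ` (U Int G))"
  using homeomorphic_imp_open_map[OF chart_homeo[OF assms(1,2)]] by (simp add: open_map_def)
 then show ?thesis using that by (auto simp: openin_open)
qed

lemma chart_inv_continuous:
 assumes "smooth_manifold M" "(U, \<phi>) \<in> charts M"
 shows "continuous_map (top_of_set (\<phi> ` U)) (subtopology (topo M) U) (inv_into U \<phi>)"
proof -
 have U: "topspace (subtopology (topo M) U) = U"
  using chart_subset[OF assms] by (simp add: inf_absorb2)
 obtain g where "homeomorphic_maps (subtopology (topo M) U) (top_of_set (\<phi> ` U)) \<phi> g"
  using chart_homeo[OF assms] homeomorphic_map_maps by blast
 then have g: "continuous_map (top_of_set (\<phi> ` U)) (subtopology (topo M) U) g" "!!x. x \<in> U ==> g (\<phi> x) = x"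
  using U by (auto simp: homeomorphic_maps_def)
 show ?thesis
  by (rule continuous_map_eq[OF g(1)]) (use g(2) chart_inj[OF assms] in auto)
qed

section \<open>Smooth maps: locality and composition\<close>

lemma smooth_mapI:
 assumes "continuous_map (subtopology (topo M) S) (subtopology (topo N) T) f"
  and "!!U \<phi> V \<psi>. (U, \<phi>) \<in> charts M ==> (V, \<psi>) \<in> charts N ==>
    smooth_on (\<phi> ` {p \<in> U Int S. f p \<in> V}) (\<psi> \<circ> f \<circ> inv_into U \<phi>)"
 shows "smooth_map M S N T f"
 using assms unfolding smooth_map_def by auto

lemma smooth_mapD:
 assumes "smooth_map M S N T f"
 shows smooth_map_continuous: "continuous_map (subtopology (topo M) S) (subtopology (topo N) T) f"
  and smooth_map_charts: "(U, \<phi>) \<in> charts M ==> (V, \<psi>) \<in> charts N ==>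
    smooth_on (\<phi> ` {p \<in> U Int S. f p \<in> V}) (\<psi> \<circ> f \<circ> inv_into U \<phi>)"
 using assms unfolding smooth_map_def by auto

lemma smooth_map_in:
 assumes "smooth_map M S N T f" "p \<in> S" "p \<in> carr M"
 shows "f p \<in> T" "f p \<in> carr N"
 using continuous_map_funspace[OF smooth_map_continuous[OF assms(1)]] assms(2,3) by auto

lemma smooth_map_preimage:
 assumes "smooth_map M S N T f" "openin (topo N) V"
 obtains G where "openin (topo M) G" "{p \<in> carr M Int S. f p \<in> V} = S Int G"
proof -
 have "openin (subtopology (topo N) T) (T Int V)" using assms(2) by (rule openin_subtopology_Int2)
 then have "openin (subtopology (topo M) S) {p \<in> carr M Int S. f p \<in> T Int V}"
  using openin_continuous_map_preimage[OF smooth_map_continuous[OF assms(1)], of "T Int V"]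
  by (simp del: Int_iff)
 moreover have "{p \<in> carr M Int S. f p \<in> T Int V} = {p \<in> carr M Int S. f p \<in> V}"
  using smooth_map_in[OF assms(1)] by auto
 ultimately show ?thesis using that by (auto simp: openin_subtopology Int_commute)
qed

lemma smooth_map_cong:
 assumes M: "smooth_manifold M" and f: "smooth_map M S N T f" and eq: "!!p. p \<in> S ==> f p = g p"
 shows "smooth_map M S N T g"
proof (rule smooth_mapI)
 show "continuous_map (subtopology (topo M) S) (subtopology (topo N) T) g"
  by (rule continuous_map_eq[OF smooth_map_continuous[OF f]]) (use eq in auto)
 fix U \<phi> V \<psi> assume c: "(U, \<phi>) \<in> charts M" "(V, \<psi>) \<in> charts N"
 have "{p \<in> U Int S. f p \<in> V} = {p \<in> U Int S. g p \<in> V}" using eq by auto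
 with smooth_map_charts[OF f c] have *: "smooth_on (\<phi> ` {p \<in> U Int S. g p \<in> V}) (\<psi> \<circ> f \<circ> inv_into U \<phi>)" by simp
 show "smooth_on (\<phi> ` {p \<in> U Int S. g p \<in> V}) (\<psi> \<circ> g \<circ> inv_into U \<phi>)"
  by (rule smooth_on_cong[OF *]) (use chart_inj[OF M c(1)] eq in auto)
qed

lemma smooth_map_subset:
 assumes f: "smooth_map M S N T f" and "S' <= S" "!!p. p \<in> S' ==> p \<in> carr M ==> f p \<in> T'"
 shows "smooth_map M S' N T' f"
proof (rule smooth_mapI)
 have "continuous_map (subtopology (topo M) S) (topo N) f"
  using smooth_map_continuous[OF f] by (simp add: continuous_map_in_subtopology)
 then have "continuous_map (subtopology (topo M) S') (topo N) f"
  by (rule continuous_map_from_subtopology_mono) (rule assms(2))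
 moreover have "f \<in> topspace (subtopology (topo M) S') \<rightarrow> T'"
  using assms(3) by auto
 ultimately show "continuous_map (subtopology (topo M) S') (subtopology (topo N) T') f"
  by (simp only: continuous_map_in_subtopology simp_thms)
 fix U \<phi> V \<psi> assume c: "(U, \<phi>) \<in> charts M" "(V, \<psi>) \<in> charts N"
 show "smooth_on (\<phi> ` {p \<in> U Int S'. f p \<in> V}) (\<psi> \<circ> f \<circ> inv_into U \<phi>)"
  by (rule smooth_on_subset[OF smooth_map_charts[OF f c] image_mono]) (use assms(2) in blast)
qed

lemma continuous_map_locally:
 assumes "S <= topspace X"
  and loc: "!!p. p \<in> S ==> EX G. openin X G & p \<in> G & continuous_map (subtopology X (G Int S)) Y f"
 shows "continuous_map (subtopology X S) Y f"
 unfolding continuous_map_def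
proof (intro conjI allI impI)
 show "f \<in> topspace (subtopology X S) \<rightarrow> topspace Y"
 proof
  fix p assume "p \<in> topspace (subtopology X S)"
  then have p: "p \<in> S" "p \<in> topspace X" by auto
  then obtain G where "p \<in> G" "continuous_map (subtopology X (G Int S)) Y f" using loc by auto
  then show "f p \<in> topspace Y" using p continuous_map_funspace by fastforce
 qed
 fix V assume V: "openin Y V"
 show "openin (subtopology X S) {x \<in> topspace (subtopology X S). f x \<in> V}"
  unfolding openin_subopen[of _ "{x \<in> topspace (subtopology X S). f x \<in> V}"]
 proof
  fix p assume p: "p \<in> {x \<in> topspace (subtopology X S). f x \<in> V}"
  then obtain G where G: "openin X G" "p \<in> G" "continuous_map (subtopology X (G Int S)) Y f"
   using loc by auto
  obtain H where H: "openin X H" "{x \<in> topspace (subtopology X (G Int S)). f x \<in> V} = H Int (G Int S)"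
   using openin_continuous_map_preimage[OF G(3) V] unfolding openin_subtopology by auto
  have "openin (subtopology X S) (S Int (G Int H))"
   by (rule openin_subtopology_Int2[OF openin_Int[OF G(1) H(1)]])
  moreover have "p \<in> S Int (G Int H)" "S Int (G Int H) <= {x \<in> topspace (subtopology X S). f x \<in> V}"
   using p G H by auto
  ultimately show "EX T. openin (subtopology X S) T & p \<in> T &
    T <= {x \<in> topspace (subtopology X S). f x \<in> V}" by blast
 qed
qed

lemma smooth_map_local:
 assumes M: "smooth_manifold M" and "S <= carr M"
  and loc: "!!p. p \<in> S ==> EX G. openin (topo M) G & p \<in> G & smooth_map M (G Int S) N T f"
 shows "smooth_map M S N T f"
proof (rule smooth_mapI)
 have fT: "f p \<in> T & f p \<in> carr N" if "p \<in> S" for p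
 proof -
  obtain G where "p \<in> G" "smooth_map M (G Int S) N T f" using loc[OF \<open>p \<in> S\<close>] by auto
  then show ?thesis using smooth_map_in[of M "G Int S" N T f p] that assms(2) by auto
 qed
 show "continuous_map (subtopology (topo M) S) (subtopology (topo N) T) f"
  unfolding continuous_map_in_subtopology
 proof
  show "continuous_map (subtopology (topo M) S) (topo N) f"
  proof (rule continuous_map_locally[OF assms(2)])
   fix p assume "p \<in> S"
   then obtain G where G: "openin (topo M) G" "p \<in> G" "smooth_map M (G Int S) N T f"
    using loc by auto
   have "continuous_map (subtopology (topo M) (G Int S)) (topo N) f"
    using smooth_map_continuous[OF G(3)] by (simp add: continuous_map_in_subtopology)
   then show "EX G. openin (topo M) G & p \<in> G & continuous_map (subtopology (topo M) (G Int S)) (topo N) f"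
    using G by auto
  qed
  show "f \<in> topspace (subtopology (topo M) S) \<rightarrow> T" using fT by auto
 qed
 fix U \<phi> V \<psi> assume c: "(U, \<phi>) \<in> charts M" "(V, \<psi>) \<in> charts N"
 show "smooth_on (\<phi> ` {p \<in> U Int S. f p \<in> V}) (\<psi> \<circ> f \<circ> inv_into U \<phi>)"
 proof (rule smooth_on_local)
  fix x assume "x \<in> \<phi> ` {p \<in> U Int S. f p \<in> V}"
  then obtain p where p: "x = \<phi> p" "p \<in> U" "p \<in> S" "f p \<in> V" by auto
  obtain G where G: "openin (topo M) G" "p \<in> G" "smooth_map M (G Int S) N T f"
   using loc[OF p(3)] by auto
  obtain O' where O': "open O'" "\<phi> ` (U Int G) = \<phi> ` U Int O'" using chart_image_open[OF M c(1) G(1)] .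
  have "O' Int \<phi> ` {p \<in> U Int S. f p \<in> V} <= \<phi> ` {p \<in> U Int (G Int S). f p \<in> V}"
  proof
   fix y assume y: "y \<in> O' Int \<phi> ` {p \<in> U Int S. f p \<in> V}"
   then obtain q where q: "y = \<phi> q" "q \<in> U" "q \<in> S" "f q \<in> V" by auto
   then have "\<phi> q \<in> \<phi> ` (U Int G)" using O' y by auto
   then have "q \<in> G" using chart_inj[OF M c(1)] q(2) by (auto dest: inj_onD)
   then show "y \<in> \<phi> ` {p \<in> U Int (G Int S). f p \<in> V}" using q by auto
  qed
  then have "smooth_on (O' Int \<phi> ` {p \<in> U Int S. f p \<in> V}) (\<psi> \<circ> f \<circ> inv_into U \<phi>)"
   using smooth_on_subset smooth_map_charts[OF G(3) c] by blast
  moreover have "x \<in> O'" using O'(2) p G(2) by blast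
  ultimately show "EX O'. open O' & x \<in> O' & smooth_on (O' Int \<phi> ` {p \<in> U Int S. f p \<in> V}) (\<psi> \<circ> f \<circ> inv_into U \<phi>)"
   using O'(1) by blast
 qed
qed

text \<open>One chart of \<open>N\<close> need not contain the intermediate image, so the claim is
  local: near each point a chart \<open>V\<close> around \<open>f p\<close> is inserted, and the
  expression in coordinates factors through it.\<close>

lemma smooth_map_compose:
 assumes M: "smooth_manifold M" and N: "smooth_manifold N"
  and f: "smooth_map M S N T f" and g: "smooth_map N T P R g"
 shows "smooth_map M S P R (%p. g (f p))"
proof (rule smooth_mapI)
 show "continuous_map (subtopology (topo M) S) (subtopology (topo P) R) (%p. g (f p))"
  using continuous_map_compose[OF smooth_map_continuous[OF f] smooth_map_continuous[OF g]] by (simp add: o_def)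
 fix U \<phi> Z \<zeta> assume c: "(U, \<phi>) \<in> charts M" "(Z, \<zeta>) \<in> charts P"
 let ?D = "\<phi> ` {p \<in> U Int S. g (f p) \<in> Z}"
 show "smooth_on ?D (\<zeta> \<circ> (%p. g (f p)) \<circ> inv_into U \<phi>)"
 proof (rule smooth_on_local)
  fix x assume "x \<in> ?D"
  then obtain p where p: "x = \<phi> p" "p \<in> U" "p \<in> S" "g (f p) \<in> Z" by auto
  have "p \<in> carr M" using p(2) chart_subset[OF M c(1)] by auto
  then obtain V \<psi> where V: "(V, \<psi>) \<in> charts N" "f p \<in> V"
   using chart_at[OF N] smooth_map_in[OF f p(3)] by metis
  obtain G where G: "openin (topo M) G" "{p \<in> carr M Int S. f p \<in> V} = S Int G"
   using smooth_map_preimage[OF f chart_open[OF N V(1)]] .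
  obtain O' where O': "open O'" "\<phi> ` (U Int G) = \<phi> ` U Int O'" using chart_image_open[OF M c(1) G(1)] .
  have dom: "EX q. y = \<phi> q & q \<in> U & q \<in> S & f q \<in> V & f q \<in> T & g (f q) \<in> Z" if y: "y \<in> O' Int ?D" for y
  proof -
   obtain q where q: "y = \<phi> q" "q \<in> U" "q \<in> S" "g (f q) \<in> Z" using y by auto
   then have "\<phi> q \<in> \<phi> ` (U Int G)" using O' y by auto
   then have "q \<in> G" using chart_inj[OF M c(1)] q(2) by (auto dest: inj_onD)
   then have "f q \<in> V" using G(2) q(3) by blast
   then show ?thesis using q smooth_map_in(1)[OF f q(3)] chart_subset[OF M c(1)] by auto
  qed
  let ?F = "\<psi> \<circ> f \<circ> inv_into U \<phi>" and ?G = "\<zeta> \<circ> g \<circ> inv_into V \<psi>"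
  have inv: "inv_into U \<phi> (\<phi> q) = q" if "q \<in> U" for q using chart_inj[OF M c(1)] that by simp
  have "smooth_on (O' Int ?D) (%x. ?G (?F x))"
  proof (rule smooth_on_compose[OF smooth_map_charts[OF g V(1) c(2)]])
   show "smooth_on (O' Int ?D) ?F"
    by (rule smooth_on_subset[OF smooth_map_charts[OF f c(1) V(1)]]) (use dom in fastforce)
   show "?F ` (O' Int ?D) <= \<psi> ` {p \<in> V Int T. g p \<in> Z}"
   proof
    fix z assume "z \<in> ?F ` (O' Int ?D)"
    then obtain y where "y \<in> O' Int ?D" "z = ?F y" by blast
    then obtain q where "q \<in> U" "f q \<in> V" "f q \<in> T" "g (f q) \<in> Z" "z = \<psi> (f q)" using dom[of y] inv by auto
    then show "z \<in> \<psi> ` {p \<in> V Int T. g p \<in> Z}" by blast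
   qed
  qed
  moreover have "?G (?F y) = (\<zeta> \<circ> (%p. g (f p)) \<circ> inv_into U \<phi>) y" if "y \<in> O' Int ?D" for y
   using dom[OF that] inv chart_inj[OF N V(1)] by auto
  ultimately have "smooth_on (O' Int ?D) (\<zeta> \<circ> (%p. g (f p)) \<circ> inv_into U \<phi>)"
   by (rule smooth_on_cong)
  moreover have "x \<in> O'"
  proof -
   have "p \<in> G" using G(2) p V \<open>p \<in> carr M\<close> by blast
   then show ?thesis using O'(2) p by blast
  qed
  ultimately show "EX O'. open O' & x \<in> O' & smooth_on (O' Int ?D) (\<zeta> \<circ> (%p. g (f p)) \<circ> inv_into U \<phi>)"
   using O'(1) by blast
 qed
qed

lemma smooth_map_ident:
 assumes "smooth_manifold M" "S <= T" shows "smooth_map M S M T (%x. x)"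
proof (rule smooth_mapI)
 show "continuous_map (subtopology (topo M) S) (subtopology (topo M) T) (%x. x)"
  using assms(2) by (auto simp: continuous_map_in_subtopology intro: continuous_map_from_subtopology)
 fix U \<phi> V \<psi> assume c: "(U, \<phi>) \<in> charts M" "(V, \<psi>) \<in> charts M"
 have "smooth_on (\<phi> ` {p \<in> U Int S. p \<in> V}) (\<psi> \<circ> inv_into U \<phi>)"
  by (rule smooth_on_subset[OF chart_transition[OF assms(1) c]]) auto
 then show "smooth_on (\<phi> ` {p \<in> U Int S. p \<in> V}) (\<psi> \<circ> (%x. x) \<circ> inv_into U \<phi>)" by (simp add: o_def)
qed

lemma smooth_manifoldI:
 assumes "Hausdorff_space (topo M)" "second_countable (topo M)"
  and cover: "!!p. p \<in> carr M ==> EX U \<phi>. (U, \<phi>) \<in> charts M & p \<in> U"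
  and ch: "!!U \<phi>. (U, \<phi>) \<in> charts M ==> openin (topo M) U"
   "!!U \<phi>. (U, \<phi>) \<in> charts M ==> model_open (\<phi> ` U)"
   "!!U \<phi>. (U, \<phi>) \<in> charts M ==> inj_on \<phi> U"
   "!!U \<phi>. (U, \<phi>) \<in> charts M ==> continuous_map (subtopology (topo M) U) euclidean \<phi>"
   "!!U \<phi>. (U, \<phi>) \<in> charts M ==> continuous_map (top_of_set (\<phi> ` U)) (topo M) (inv_into U \<phi>)"
  and tr: "!!U \<phi> V \<psi>. (U, \<phi>) \<in> charts M ==> (V, \<psi>) \<in> charts M ==>
    smooth_on (\<phi> ` (U Int V)) (\<psi> \<circ> inv_into U \<phi>)"
 shows "smooth_manifold M"
proof -
 have "homeomorphic_map (subtopology (topo M) U) (top_of_set (\<phi> ` U)) \<phi>" if c: "(U, \<phi>) \<in> charts M" for U \<phi>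
 proof (rule homeomorphic_maps_imp_map)
  have U: "U <= carr M" using openin_subset[OF ch(1)[OF c]] .
  have "continuous_map (subtopology (topo M) U) (top_of_set (\<phi> ` U)) \<phi>"
   using ch(4)[OF c] by (auto simp: continuous_map_in_subtopology)
  moreover have "continuous_map (top_of_set (\<phi> ` U)) (subtopology (topo M) U) (inv_into U \<phi>)"
   using ch(5)[OF c] by (auto simp: continuous_map_in_subtopology inv_into_into)
  ultimately show "homeomorphic_maps (subtopology (topo M) U) (top_of_set (\<phi> ` U)) \<phi> (inv_into U \<phi>)"
   using U ch(3)[OF c] by (auto simp: homeomorphic_maps_def f_inv_into_f)
 qed
 moreover have "(\<Union>(U, \<phi>)\<in>charts M. U) = carr M"
  using cover openin_subset[OF ch(1)] by fast
 ultimately show ?thesis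
  unfolding smooth_manifold_def using assms(1,2) ch(1,2) tr by auto
qed

lemma chart_ex: "smooth_manifold M ==> p \<in> carr M ==> EX U \<phi>. (U, \<phi>) \<in> charts M & p \<in> U"
 by (erule (1) chart_at) auto

lemma chart_inv_continuous_carr:
 assumes "smooth_manifold M" "(U, \<phi>) \<in> charts M"
 shows "continuous_map (top_of_set (\<phi> ` U)) (topo M) (inv_into U \<phi>)"
 using chart_inv_continuous[OF assms] by (simp add: continuous_map_in_subtopology)

subsection \<open>Euclidean spaces as manifolds\<close>

text \<open>With a Euclidean space as a manifold with a single chart, curves, charts and their
  inverses become instances of \<open>smooth_map\<close> and \<open>diffeo\<close>, and all
  compositions go through one lemma.\<close>

definition eu :: "('e, 'e::euclidean_space) manifold" where
 "eu = \<lparr>topo = euclidean, charts = {(UNIV, %x. x)}\<rparr>"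

lemma topo_eu [simp]: "topo eu = euclidean" and charts_eu [simp]: "charts eu = {(UNIV, %x. x)}"
 by (simp_all add: eu_def)

lemma inv_into_UNIV_ident [simp]: "inv_into UNIV (%x. x) = (%x. x)"
 by (rule ext) (metis UNIV_I inj_on_id2 inv_into_f_f)

lemma second_countable_euclidean: "second_countable (euclidean :: 'a::second_countable_topology topology)"
proof -
 obtain B :: "'a set set" where B: "countable B" "!!C. C \<in> B ==> open C" "!!S. open S ==> EX U. U <= B & S = \<Union>U"
  by (rule univ_second_countable) (rule that)
 have "EX V:B. x \<in> V & V <= S" if "open S" "x \<in> S" for S and x :: 'a
  using B(3)[OF that(1)] that(2) by auto
 then show ?thesis
  unfolding second_countable_def using B(1,2) by (intro exI[of _ B]) auto
qed

lemma smooth_manifold_eu: "smooth_manifold (eu :: ('e, 'e::euclidean_space) manifold)"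
 by (rule smooth_manifoldI)
  (auto simp: second_countable_euclidean Hausdorff_space_euclidean model_open_def o_def smooth_on_ident)

lemma smooth_map_eu: "smooth_map eu S eu T f \<longleftrightarrow> smooth_on S f & f ` S <= T"
proof
 assume f: "smooth_map eu S eu T f"
 have "smooth_on S f" using smooth_map_charts[OF f, of UNIV "%x. x" UNIV "%x. x"] by (simp add: o_def)
 then show "smooth_on S f & f ` S <= T" using smooth_map_in(1)[OF f] by auto
next
 assume "smooth_on S f & f ` S <= T"
 then show "smooth_map eu S eu T f"
  using smooth_on_continuous[of S f]
  by (auto intro!: smooth_mapI intro: smooth_on_subset simp: o_def continuous_map_in_subtopology image_subset_iff)
qed

text \<open>Agrees with smoothness as a map into \<open>eu\<close> by
  \<open>smooth_map_to_eu\<close>, but mentions no charts of the target and derives continuity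
  instead of demanding it. Algebra of functions is done with this notion.\<close>

definition sfun :: "('a, 'e::euclidean_space) manifold => 'a set => ('a => 'b::euclidean_space) => bool" where
 "sfun M S f \<longleftrightarrow> (ALL (U, \<phi>):charts M. smooth_on (\<phi> ` (U Int S)) (%x. f (inv_into U \<phi> x)))"

lemma sfunD: "sfun M S f ==> (U, \<phi>) \<in> charts M ==> smooth_on (\<phi> ` (U Int S)) (%x. f (inv_into U \<phi> x))"
 unfolding sfun_def by auto

lemma sfunI: "(!!U \<phi>. (U, \<phi>) \<in> charts M ==> smooth_on (\<phi> ` (U Int S)) (%x. f (inv_into U \<phi> x))) ==> sfun M S f"
 unfolding sfun_def by auto

lemma sfun_continuous:
 assumes M: "smooth_manifold M" and "S <= carr M" and f: "sfun M S f"
 shows "continuous_map (subtopology (topo M) S) euclidean f"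
proof (rule continuous_map_locally[OF assms(2)])
 fix p assume p: "p \<in> S"
 then obtain U \<phi> where c: "(U, \<phi>) \<in> charts M" "p \<in> U" using chart_at[OF M] assms(2) by blast
 have "continuous_map (subtopology (topo M) (U Int S)) (top_of_set (\<phi> ` (U Int S))) \<phi>"
  using continuous_map_from_subtopology_mono[OF chart_continuous[OF M c(1)], of "U Int S"]
  by (auto simp: continuous_map_in_subtopology)
 then have "continuous_map (subtopology (topo M) (U Int S)) euclidean ((%x. f (inv_into U \<phi> x)) \<circ> \<phi>)"
  using smooth_on_continuous[OF sfunD[OF f c(1)]]
  by (intro continuous_map_compose[where X'="top_of_set (\<phi> ` (U Int S))"]) auto
 then have "continuous_map (subtopology (topo M) (U Int S)) euclidean f"
  by (rule continuous_map_eq) (use chart_inj[OF M c(1)] in auto)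
 then show "EX G. openin (topo M) G & p \<in> G & continuous_map (subtopology (topo M) (G Int S)) euclidean f"
  using chart_open[OF M c(1)] c(2) by blast
qed

lemma smooth_map_to_eu:
 assumes M: "smooth_manifold M" and "S <= carr M"
 shows "smooth_map M S eu T f \<longleftrightarrow> sfun M S f & f ` S <= T"
proof
 assume f: "smooth_map M S eu T f"
 have "sfun M S f"
  by (rule sfunI) (use smooth_map_charts[OF f, of _ _ UNIV "%x. x"] in \<open>simp add: o_def Int_def\<close>)
 then show "sfun M S f & f ` S <= T" using smooth_map_in(1)[OF f] assms(2) by auto
next
 assume f: "sfun M S f & f ` S <= T"
 show "smooth_map M S eu T f"
 proof (rule smooth_mapI)
  show "continuous_map (subtopology (topo M) S) (subtopology (topo eu) T) f"
   using sfun_continuous[OF assms] f by (auto simp: continuous_map_in_subtopology)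
  fix U \<phi> V \<psi> assume "(U, \<phi>) \<in> charts M" "(V::'c set, \<psi>) \<in> charts eu"
  then show "smooth_on (\<phi> ` {p \<in> U Int S. f p \<in> V}) (\<psi> \<circ> f \<circ> inv_into U \<phi>)"
   using sfunD[of M S f U \<phi>] f by (simp add: o_def Int_def)
 qed
qed

lemma sfun_eu: "sfun eu S f \<longleftrightarrow> smooth_on S f"
 by (simp add: sfun_def)

lemma sfun_compose_smooth_on:
 assumes "smooth_manifold M" "sfun M S f" "smooth_on T g" "f ` S <= T"
 shows "sfun M S (%p. g (f p))"
proof (rule sfunI)
 fix U \<phi> assume c: "(U, \<phi>) \<in> charts M"
 show "smooth_on (\<phi> ` (U Int S)) (%x. g (f (inv_into U \<phi> x)))"
  by (rule smooth_on_compose[OF assms(3) sfunD[OF assms(2) c]])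
   (use assms(4) chart_inj[OF assms(1) c] in auto)
qed

lemma sfun_compose:
 assumes "smooth_manifold M" "smooth_manifold N" "S <= carr M" "smooth_map M S N T f" "sfun N T' g"
  "f ` S <= T'" "T' <= carr N"
 shows "sfun M S (%p. g (f p))"
proof -
 have "smooth_map M S N T' f" by (rule smooth_map_subset[OF assms(4)]) (use assms(6) in auto)
 moreover have "smooth_map N T' eu UNIV g" using smooth_map_to_eu[OF assms(2,7)] assms(5) by auto
 ultimately have "smooth_map M S eu UNIV (%p. g (f p))" by (rule smooth_map_compose[OF assms(1,2)])
 then show ?thesis using smooth_map_to_eu[OF assms(1,3)] by auto
qed

lemma sfun_subset: "sfun M S f ==> T <= S ==> sfun M T f"
 by (rule sfunI, drule (1) sfunD, erule smooth_on_subset) auto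

lemma sfun_cong:
 assumes "smooth_manifold M" "sfun M S f" "!!p. p \<in> S ==> f p = g p" shows "sfun M S g"
proof (rule sfunI)
 fix U \<phi> assume c: "(U, \<phi>) \<in> charts M"
 show "smooth_on (\<phi> ` (U Int S)) (%x. g (inv_into U \<phi> x))"
  by (rule smooth_on_cong[OF sfunD[OF assms(2) c]]) (use assms(3) chart_inj[OF assms(1) c] in auto)
qed

lemma sfun_local:
 assumes M: "smooth_manifold M" and S: "S <= carr M"
  and "!!p. p \<in> S ==> EX G. openin (topo M) G & p \<in> G & sfun M (G Int S) f"
 shows "sfun M S f"
proof -
 have "smooth_map M S eu UNIV f"
 proof (rule smooth_map_local[OF M S])
  fix p assume "p \<in> S"
  then obtain G where G: "openin (topo M) G" "p \<in> G" "sfun M (G Int S) f" using assms(3) by blast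
  have "smooth_map M (G Int S) eu UNIV f" using smooth_map_to_eu[OF M, of "G Int S"] S G by auto
  then show "EX G. openin (topo M) G & p \<in> G & smooth_map M (G Int S) eu UNIV f" using G by blast
 qed
 then show ?thesis using smooth_map_to_eu[OF M S] by auto
qed

lemma sfun_const: "sfun M S (%x. c)"
 by (simp add: sfun_def smooth_on_const split: prod.splits)

lemma sfun_add: "sfun M S f ==> sfun M S g ==> sfun M S (%x. f x + g x)"
 by (rule sfunI, drule (1) sfunD, drule (1) sfunD, rule smooth_on_add)

lemma sfun_bilinear:
 "bounded_bilinear prd ==> sfun M S f ==> sfun M S g ==> sfun M S (%x. prd (f x) (g x))"
 by (rule sfunI, drule (1) sfunD, drule (1) sfunD, rule smooth_on_bilinear)

lemma sfun_mult:
 fixes f g :: "'a => 'b::{euclidean_space,real_normed_algebra}"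
 shows "sfun M S f ==> sfun M S g ==> sfun M S (%x. f x * g x)"
 by (rule sfun_bilinear[OF bounded_bilinear_mult])

lemma sfun_linear: "bounded_linear L ==> sfun M S f ==> sfun M S (%x. L (f x))"
 by (rule sfunI, drule (1) sfunD, rule smooth_on_linear_compose)

lemma sfun_sum: "(!!i. i \<in> I ==> sfun M S (f i)) ==> sfun M S (%x. \<Sum>i\<in>I. f i x)"
 by (rule sfunI, rule smooth_on_sum) (auto dest: sfunD)

lemma sfun_Pair: "sfun M S f ==> sfun M S g ==> sfun M S (%x. (f x, g x))"
 by (rule sfunI, drule (1) sfunD, drule (1) sfunD, rule smooth_on_Pair)

lemma sfun_cis: "sfun M S f ==> sfun M S (%x. cis (f x))"
 by (rule sfunI, drule (1) sfunD, rule smooth_on_cis)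

lemma sfun_inverse:
 fixes f :: "'a => real"
 assumes "smooth_manifold M" "sfun M S f" "!!x. x \<in> S ==> f x ~= 0"
 shows "sfun M S (%x. inverse (f x))"
 by (rule sfun_compose_smooth_on[OF assms(1,2), of "- {0}"])
  (use assms(3) in \<open>auto intro!: smooth_on_inverse smooth_on_ident\<close>)

lemma sfun_arg0:
 assumes "smooth_manifold M" "sfun M S f" "!!x. x \<in> S ==> Re (f x) > 0"
 shows "sfun M S (%x. arg0 (f x))"
 by (rule sfun_compose_smooth_on[OF assms(1,2), of "{z. Re z > 0}"])
  (use assms(3) in \<open>auto intro!: smooth_on_arg0 smooth_on_ident\<close>)

lemma chart_smooth:
 assumes M: "smooth_manifold M" and c: "(U, \<phi>) \<in> charts M"
 shows "smooth_map M U eu (\<phi> ` U) \<phi>"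
proof -
 have "sfun M U \<phi>"
 proof (rule sfunI)
  fix V \<psi> assume d: "(V, \<psi>) \<in> charts M"
  show "smooth_on (\<psi> ` (V Int U)) (%x. \<phi> (inv_into V \<psi> x))"
   using chart_transition[OF M d c] by (simp add: o_def)
 qed
 then show ?thesis using smooth_map_to_eu[OF M chart_subset[OF M c]] by auto
qed

lemma chart_inv_smooth:
 assumes M: "smooth_manifold M" and c: "(U, \<phi>) \<in> charts M"
 shows "smooth_map eu (\<phi> ` U) M U (inv_into U \<phi>)"
proof (rule smooth_mapI)
 show "continuous_map (subtopology (topo eu) (\<phi> ` U)) (subtopology (topo M) U) (inv_into U \<phi>)"
  using chart_inv_continuous[OF M c] by simp
 fix V \<psi> Z \<zeta> assume d: "(V::'b set, \<psi>) \<in> charts eu" "(Z, \<zeta>) \<in> charts M"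
 have "smooth_on (\<phi> ` (U Int Z)) (\<zeta> \<circ> inv_into U \<phi>)" by (rule chart_transition[OF M c d(2)])
 moreover have "{p \<in> V Int \<phi> ` U. inv_into U \<phi> p \<in> Z} = \<phi> ` (U Int Z)"
  using d(1) chart_inj[OF M c] by auto
 ultimately show "smooth_on (\<psi> ` {p \<in> V Int \<phi> ` U. inv_into U \<phi> p \<in> Z}) (\<zeta> \<circ> inv_into U \<phi> \<circ> inv_into V \<psi>)"
  using d(1) by (simp add: o_def)
qed

subsection \<open>Diffeomorphisms\<close>

lemma diffeoI:
 assumes N: "smooth_manifold N" and f: "smooth_map M S N T f" and g: "smooth_map N T M S g"
  and "S <= carr M" "T <= carr N"
  and "!!x. x \<in> S ==> g (f x) = x" "!!y. y \<in> T ==> f (g y) = y"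
 shows "diffeo M S N T f"
proof -
 have fS: "f x \<in> T" if "x \<in> S" for x using smooth_map_in[OF f that] assms(4) that by auto
 have gT: "g y \<in> S" if "y \<in> T" for y using smooth_map_in[OF g that] assms(5) that by auto
 have bij: "bij_betw f S T" by (rule bij_betw_byWitness[of _ g]) (use assms fS gT in auto)
 moreover have "smooth_map N T M S (inv_into S f)"
 proof (rule smooth_map_cong[OF N g])
  fix y assume "y \<in> T"
  then show "g y = inv_into S f y"
   using gT bij assms(7) by (metis bij_betw_imp_inj_on inv_into_f_f)
 qed
 ultimately show ?thesis using f by (simp add: diffeo_def)
qed

lemma diffeoD:
 assumes "diffeo M S N T f"
 shows diffeo_bij: "bij_betw f S T" and diffeo_smooth: "smooth_map M S N T f"
  and diffeo_inv_smooth: "smooth_map N T M S (inv_into S f)"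
  and diffeo_in: "x \<in> S ==> f x \<in> T" and diffeo_inv_in: "y \<in> T ==> inv_into S f y \<in> S"
  and diffeo_inv_left: "x \<in> S ==> inv_into S f (f x) = x"
  and diffeo_inv_right: "y \<in> T ==> f (inv_into S f y) = y"
 using assms unfolding diffeo_def
 by (auto simp: bij_betw_def f_inv_into_f inv_into_into)

lemma diffeo_compose:
 assumes "smooth_manifold M" "smooth_manifold N" "smooth_manifold P"
  and f: "diffeo M S N T f" and g: "diffeo N T P R g" and "S <= carr M" "R <= carr P"
 shows "diffeo M S P R (%x. g (f x))"
 by (rule diffeoI[OF assms(3) smooth_map_compose[OF assms(1,2) diffeo_smooth[OF f] diffeo_smooth[OF g]]
    smooth_map_compose[OF assms(3,2) diffeo_inv_smooth[OF g] diffeo_inv_smooth[OF f]] assms(6,7)])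
  (use diffeoD[OF f] diffeoD[OF g] in auto)

lemma diffeo_inverse:
 assumes "smooth_manifold M" "diffeo M S N T f" "S <= carr M" "T <= carr N"
 shows "diffeo N T M S (inv_into S f)"
 by (rule diffeoI[OF assms(1) diffeo_inv_smooth[OF assms(2)] diffeo_smooth[OF assms(2)] assms(4,3)])
  (use diffeoD[OF assms(2)] in auto)

subsection \<open>Products\<close>

lemma topo_prod_manifold [simp]: "topo (prod_manifold M N) = prod_topology (topo M) (topo N)"
 by (simp add: prod_manifold_def)

lemma charts_prod_manifold:
 "c \<in> charts (prod_manifold M N) \<longleftrightarrow>
  (EX U \<phi> V \<psi>. c = (U \<times> V, map_prod \<phi> \<psi>) & (U, \<phi>) \<in> charts M & (V, \<psi>) \<in> charts N)"
 by (auto simp: prod_manifold_def)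

lemma charts_prodE:
 assumes "(W, \<kappa>) \<in> charts (prod_manifold M N)"
 obtains U \<phi> V \<psi> where "W = U \<times> V" "\<kappa> = map_prod \<phi> \<psi>" "(U, \<phi>) \<in> charts M" "(V, \<psi>) \<in> charts N"
 using assms by (auto simp: charts_prod_manifold)

lemma inv_into_map_prod:
 assumes "inj_on \<phi> U" "inj_on \<psi> V" "x \<in> \<phi> ` U" "y \<in> \<psi> ` V"
 shows "inv_into (U \<times> V) (map_prod \<phi> \<psi>) (x, y) = (inv_into U \<phi> x, inv_into V \<psi> y)"
proof -
 have "inj_on (map_prod \<phi> \<psi>) (U \<times> V)" using assms(1,2) by (rule map_prod_inj_on)
 moreover have "(x, y) = map_prod \<phi> \<psi> (inv_into U \<phi> x, inv_into V \<psi> y)" "(inv_into U \<phi> x, inv_into V \<psi> y) \<in> U \<times> V"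
  using assms(3,4) by (auto simp: f_inv_into_f inv_into_into)
 ultimately show ?thesis by (metis inv_into_f_f)
qed

lemma chart_image_interior:
 assumes "mboundary M = {}" "(U, \<phi>) \<in> charts M" shows "open (\<phi> ` U)"
proof -
 have "\<phi> ` U <= interior (\<phi> ` U)" using assms by (auto simp: mboundary_def)
 then show ?thesis using interior_subset[of "\<phi> ` U"] interior_eq[of "\<phi> ` U"] by auto
qed

lemma second_countable_prod_topology:
 assumes "second_countable X" "second_countable Y"
 shows "second_countable (prod_topology X Y)"
proof -
 obtain A where A: "countable A" "!!V. V \<in> A ==> openin X V" "!!U x. openin X U & x \<in> U --> (\<exists>V \<in> A. x \<in> V & V <= U)"
  using assms(1) by (auto simp: second_countable_def)
 obtain B where B: "countable B" "!!V. V \<in> B ==> openin Y V" "!!U x. openin Y U & x \<in> U --> (\<exists>V \<in> B. x \<in> V & V <= U)"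
  using assms(2) by (auto simp: second_countable_def)
 let ?C = "(%(a, b). a \<times> b) ` (A \<times> B)"
 have c: "countable ?C" using A(1) B(1) by simp
 have o: "ALL V:?C. openin (prod_topology X Y) V"
  using A(2) B(2) by (auto simp: openin_prod_Times_iff)
 have *: "EX V:?C. p \<in> V & V <= U" if U: "openin (prod_topology X Y) U" and p: "p \<in> U" for U p
 proof -
  obtain G H where "openin X G" "openin Y H" "fst p \<in> G" "snd p \<in> H" "G \<times> H <= U"
  proof -
   have "(fst p, snd p) \<in> U" using p by simp
   moreover have "ALL x y. (x, y) \<in> U --> (EX G H. openin X G & openin Y H & x \<in> G & y \<in> H & G \<times> H <= U)"
    using U by (simp add: openin_prod_topology_alt)
   ultimately have "EX G H. openin X G & openin Y H & fst p \<in> G & snd p \<in> H & G \<times> H <= U"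
    by (simp only:)
   then show ?thesis using that by auto
  qed
  moreover then obtain a b where "a \<in> A" "b \<in> B" "fst p \<in> a" "a <= G" "snd p \<in> b" "b <= H"
   using A(3)[of G "fst p"] B(3)[of H "snd p"] by auto
  ultimately show ?thesis by (intro bexI[of _ "a \<times> b"]) (auto simp: mem_Times_iff)
 qed
 show ?thesis unfolding second_countable_def by (intro exI[of _ ?C] conjI allI impI c o) (elim conjE, rule *)
qed

lemma model_open_Times:
 assumes "open S" "model_open T" shows "model_open (S \<times> T)"
 using assms(2) unfolding model_open_def
proof
 assume "open T" then show "open (S \<times> T) \<or> (EX b:Basis. openin (top_of_set {x. 0 \<le> x \<bullet> b}) (S \<times> T))"
  using assms(1) by (simp add: open_Times)
next
 assume "EX b:Basis. openin (top_of_set {x. 0 \<le> x \<bullet> b}) T"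
 then obtain b T' where b: "b \<in> Basis" "open T'" "T = {x. 0 \<le> x \<bullet> b} Int T'" by (auto simp: openin_open)
 have "S \<times> T = {x. 0 \<le> x \<bullet> (0, b)} Int (S \<times> T')" using b(3) by (auto simp: inner_Pair)
 moreover have "(0, b) \<in> Basis" using b(1) by (simp add: Basis_prod_def)
 ultimately show "open (S \<times> T) \<or> (EX b:Basis. openin (top_of_set {x. 0 \<le> x \<bullet> b}) (S \<times> T))"
  using assms(1) b(2) by (auto simp: openin_open intro!: bexI[of _ "(0, b)"] open_Times)
qed

lemma smooth_manifold_prod:
 assumes M: "smooth_manifold M" and N: "smooth_manifold N" and bd: "mboundary M = {}"
 shows "smooth_manifold (prod_manifold M N)"
proof (rule smooth_manifoldI)
 show "Hausdorff_space (topo (prod_manifold M N))" "second_countable (topo (prod_manifold M N))"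
  using M N by (auto simp: smooth_manifold_def Hausdorff_space_prod_topology second_countable_prod_topology)
 show "EX W \<kappa>. (W, \<kappa>) \<in> charts (prod_manifold M N) & p \<in> W" if p: "p \<in> carr (prod_manifold M N)" for p
 proof -
  obtain U \<phi> where "(U, \<phi>) \<in> charts M" "fst p \<in> U" using chart_ex[OF M, of "fst p"] p by auto
  moreover obtain V \<psi> where "(V, \<psi>) \<in> charts N" "snd p \<in> V" using chart_ex[OF N, of "snd p"] p by auto
  ultimately show ?thesis
   by (intro exI[of _ "U \<times> V"] exI[of _ "map_prod \<phi> \<psi>"]) (auto simp: charts_prod_manifold mem_Times_iff)
 qed
 fix W \<kappa> assume "(W, \<kappa>) \<in> charts (prod_manifold M N)"
 then obtain U \<phi> V \<psi> where c: "W = U \<times> V" "\<kappa> = map_prod \<phi> \<psi>" "(U, \<phi>) \<in> charts M" "(V, \<psi>) \<in> charts N"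
  by (rule charts_prodE)
 note inj = chart_inj[OF M c(3)] chart_inj[OF N c(4)]
 show "openin (topo (prod_manifold M N)) W"
  using chart_open[OF M c(3)] chart_open[OF N c(4)] by (simp add: c openin_prod_Times_iff)
 have im: "\<kappa> ` W = \<phi> ` U \<times> \<psi> ` V" by (simp add: c map_prod_image)
 show "model_open (\<kappa> ` W)"
  unfolding im by (rule model_open_Times[OF chart_image_interior[OF bd c(3)] chart_model[OF N c(4)]])
 show "inj_on \<kappa> W" unfolding c by (rule map_prod_inj_on[OF inj])
 have "continuous_map (prod_topology (subtopology (topo M) U) (subtopology (topo N) V))
   (prod_topology euclidean euclidean) (%(x, y). (\<phi> x, \<psi> y))"
  unfolding continuous_map_prod_top
  using chart_continuous[OF M c(3)] chart_continuous[OF N c(4)] by simp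
 then show "continuous_map (subtopology (topo (prod_manifold M N)) W) euclidean \<kappa>"
  by (simp add: c subtopology_Times map_prod_def)
 have "continuous_map (prod_topology (top_of_set (\<phi> ` U)) (top_of_set (\<psi> ` V)))
   (prod_topology (topo M) (topo N)) (%(x, y). (inv_into U \<phi> x, inv_into V \<psi> y))"
  unfolding continuous_map_prod_top
  using chart_inv_continuous_carr[OF M c(3)] chart_inv_continuous_carr[OF N c(4)] by simp
 then have "continuous_map (top_of_set (\<kappa> ` W)) (topo (prod_manifold M N)) (%(x, y). (inv_into U \<phi> x, inv_into V \<psi> y))"
  by (simp add: im subtopology_Times flip: euclidean_product_topology)
 then show "continuous_map (top_of_set (\<kappa> ` W)) (topo (prod_manifold M N)) (inv_into W \<kappa>)"
 proof (rule continuous_map_eq)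
  fix z assume "z \<in> topspace (top_of_set (\<kappa> ` W))"
  then have z: "fst z \<in> \<phi> ` U" "snd z \<in> \<psi> ` V" unfolding im by auto
  show "(case z of (x, y) => (inv_into U \<phi> x, inv_into V \<psi> y)) = inv_into W \<kappa> z"
   using inv_into_map_prod[OF inj z] by (simp add: c split_beta)
 qed
 fix W' \<kappa>' assume "(W', \<kappa>') \<in> charts (prod_manifold M N)"
 then obtain U' \<phi>' V' \<psi>' where d: "W' = U' \<times> V'" "\<kappa>' = map_prod \<phi>' \<psi>'" "(U', \<phi>') \<in> charts M" "(V', \<psi>') \<in> charts N"
  by (rule charts_prodE)
 have im2: "\<kappa> ` (W Int W') = \<phi> ` (U Int U') \<times> \<psi> ` (V Int V')" by (simp add: c d Times_Int_Times map_prod_image)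
 let ?S = "\<phi> ` (U Int U') \<times> \<psi> ` (V Int V')"
 have "smooth_on ?S (%z. ((\<phi>' \<circ> inv_into U \<phi>) (fst z), (\<psi>' \<circ> inv_into V \<psi>) (snd z)))"
  by (intro smooth_on_Pair smooth_on_compose[OF chart_transition[OF M c(3) d(3)] smooth_on_fst[OF smooth_on_ident]]
    smooth_on_compose[OF chart_transition[OF N c(4) d(4)] smooth_on_snd[OF smooth_on_ident]]) auto
 then show "smooth_on (\<kappa> ` (W Int W')) (\<kappa>' \<circ> inv_into W \<kappa>)"
  unfolding im2
 proof (rule smooth_on_cong)
  fix z assume "z \<in> ?S"
  then have z: "fst z \<in> \<phi> ` U" "snd z \<in> \<psi> ` V" by auto
  show "((\<phi>' \<circ> inv_into U \<phi>) (fst z), (\<psi>' \<circ> inv_into V \<psi>) (snd z)) = (\<kappa>' \<circ> inv_into W \<kappa>) z"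
   using inv_into_map_prod[OF inj z] by (simp add: c d)
 qed
qed

lemma mboundaryI: "(U, \<phi>) \<in> charts M ==> p \<in> U ==> \<phi> p \<notin> interior (\<phi> ` U) ==> p \<in> mboundary M"
 unfolding mboundary_def by auto

lemma mboundary_prod:
 assumes M: "smooth_manifold M" and bd: "mboundary M = {}"
 shows "mboundary (prod_manifold M N) = carr M \<times> mboundary N"
proof (intro set_eqI iffI)
 fix p assume "p \<in> mboundary (prod_manifold M N)"
 then obtain W \<kappa> where W: "(W, \<kappa>) \<in> charts (prod_manifold M N)" "p \<in> W" "\<kappa> p \<notin> interior (\<kappa> ` W)"
  by (auto simp: mboundary_def)
 obtain U \<phi> V \<psi> where c: "W = U \<times> V" "\<kappa> = map_prod \<phi> \<psi>" "(U, \<phi>) \<in> charts M" "(V, \<psi>) \<in> charts N"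
  by (rule charts_prodE[OF W(1)])
 have "interior (\<phi> ` U) = \<phi> ` U" using chart_image_interior[OF bd c(3)] by (simp add: interior_eq)
 then have "\<psi> (snd p) \<notin> interior (\<psi> ` V)" using W c by (auto simp: map_prod_image interior_Times)
 then show "p \<in> carr M \<times> mboundary N"
  using c W(2) chart_subset[OF M c(3)] by (auto simp: mboundary_def)
next
 fix p assume p: "p \<in> carr M \<times> mboundary N"
 then obtain V \<psi> where V: "(V, \<psi>) \<in> charts N" "snd p \<in> V" "\<psi> (snd p) \<notin> interior (\<psi> ` V)"
  by (auto simp: mboundary_def)
 obtain U \<phi> where U: "(U, \<phi>) \<in> charts M" "fst p \<in> U"
  using chart_ex[OF M, of "fst p"] p by auto
 have mp: "map_prod \<phi> \<psi> p = (\<phi> (fst p), \<psi> (snd p))" by (cases p) simp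
 have "(U \<times> V, map_prod \<phi> \<psi>) \<in> charts (prod_manifold M N)"
  unfolding charts_prod_manifold using U(1) V(1) by blast
 moreover have "p \<in> U \<times> V" using U(2) V(2) by (simp add: mem_Times_iff)
 moreover have "map_prod \<phi> \<psi> p \<notin> interior (map_prod \<phi> \<psi> ` (U \<times> V))"
  unfolding mp map_prod_image interior_Times using V(3) by simp
 ultimately show "p \<in> mboundary (prod_manifold M N)" by (rule mboundaryI)
qed

lemma smooth_map_Pair:
 assumes M: "smooth_manifold M" and f: "smooth_map M S N1 T1 f" and g: "smooth_map M S N2 T2 g"
 shows "smooth_map M S (prod_manifold N1 N2) (T1 \<times> T2) (%p. (f p, g p))"
proof (rule smooth_mapI)
 show "continuous_map (subtopology (topo M) S) (subtopology (topo (prod_manifold N1 N2)) (T1 \<times> T2)) (%p. (f p, g p))"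
  using smooth_map_continuous[OF f] smooth_map_continuous[OF g]
  by (simp add: subtopology_Times continuous_map_pairedI)
 fix U \<phi> W \<kappa> assume c: "(U, \<phi>) \<in> charts M" and "(W, \<kappa>) \<in> charts (prod_manifold N1 N2)"
 then obtain V1 \<psi>1 V2 \<psi>2 where d: "W = V1 \<times> V2" "\<kappa> = map_prod \<psi>1 \<psi>2" "(V1, \<psi>1) \<in> charts N1" "(V2, \<psi>2) \<in> charts N2"
  by (auto elim: charts_prodE)
 let ?D = "\<phi> ` {p \<in> U Int S. (f p, g p) \<in> W}"
 have "smooth_on ?D (%x. ((\<psi>1 \<circ> f \<circ> inv_into U \<phi>) x, (\<psi>2 \<circ> g \<circ> inv_into U \<phi>) x))"
  by (intro smooth_on_Pair smooth_on_subset[OF smooth_map_charts[OF f c d(3)] image_mono]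
    smooth_on_subset[OF smooth_map_charts[OF g c d(4)] image_mono]) (auto simp: d)
 then show "smooth_on ?D (\<kappa> \<circ> (%p. (f p, g p)) \<circ> inv_into U \<phi>)"
  by (simp add: d o_def)
qed

lemma smooth_map_fst:
 assumes M: "smooth_manifold M" and N: "smooth_manifold N" and bd: "mboundary M = {}"
 shows "smooth_map (prod_manifold M N) (S \<times> T) M S fst"
proof (rule smooth_mapI)
 show "continuous_map (subtopology (topo (prod_manifold M N)) (S \<times> T)) (subtopology (topo M) S) fst"
  by (auto simp: continuous_map_in_subtopology continuous_map_fst continuous_map_from_subtopology)
 fix W \<kappa> U' \<phi>' assume "(W, \<kappa>) \<in> charts (prod_manifold M N)" and d: "(U', \<phi>') \<in> charts M"
 then obtain U \<phi> V \<psi> where c: "W = U \<times> V" "\<kappa> = map_prod \<phi> \<psi>" "(U, \<phi>) \<in> charts M" "(V, \<psi>) \<in> charts N"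
  by (auto elim: charts_prodE)
 let ?D = "\<kappa> ` {p \<in> W Int S \<times> T. fst p \<in> U'}"
 have D: "?D <= \<phi> ` (U Int U') \<times> \<psi> ` V" by (auto simp: c)
 have "smooth_on ?D (%z. (\<phi>' \<circ> inv_into U \<phi>) (fst z))"
  by (rule smooth_on_compose[OF chart_transition[OF M c(3) d] smooth_on_fst[OF smooth_on_ident]]) (use D in auto)
 then show "smooth_on ?D (\<phi>' \<circ> fst \<circ> inv_into W \<kappa>)"
 proof (rule smooth_on_cong)
  fix z assume "z \<in> ?D"
  then have z: "fst z \<in> \<phi> ` U" "snd z \<in> \<psi> ` V" using D by auto
  show "(\<phi>' \<circ> inv_into U \<phi>) (fst z) = (\<phi>' \<circ> fst \<circ> inv_into W \<kappa>) z"
   using inv_into_map_prod[OF chart_inj[OF M c(3)] chart_inj[OF N c(4)] z] by (simp add: c)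
 qed
qed

lemma smooth_map_snd:
 assumes M: "smooth_manifold M" and N: "smooth_manifold N" and bd: "mboundary M = {}"
 shows "smooth_map (prod_manifold M N) (S \<times> T) N T snd"
proof (rule smooth_mapI)
 show "continuous_map (subtopology (topo (prod_manifold M N)) (S \<times> T)) (subtopology (topo N) T) snd"
  by (auto simp: continuous_map_in_subtopology continuous_map_snd continuous_map_from_subtopology)
 fix W \<kappa> V' \<psi>' assume "(W, \<kappa>) \<in> charts (prod_manifold M N)" and d: "(V', \<psi>') \<in> charts N"
 then obtain U \<phi> V \<psi> where c: "W = U \<times> V" "\<kappa> = map_prod \<phi> \<psi>" "(U, \<phi>) \<in> charts M" "(V, \<psi>) \<in> charts N"
  by (auto elim: charts_prodE)
 let ?D = "\<kappa> ` {p \<in> W Int S \<times> T. snd p \<in> V'}"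
 have D: "?D <= \<phi> ` U \<times> \<psi> ` (V Int V')" by (auto simp: c)
 have "smooth_on ?D (%z. (\<psi>' \<circ> inv_into V \<psi>) (snd z))"
  by (rule smooth_on_compose[OF chart_transition[OF N c(4) d] smooth_on_snd[OF smooth_on_ident]]) (use D in auto)
 then show "smooth_on ?D (\<psi>' \<circ> snd \<circ> inv_into W \<kappa>)"
 proof (rule smooth_on_cong)
  fix z assume "z \<in> ?D"
  then have z: "fst z \<in> \<phi> ` U" "snd z \<in> \<psi> ` V" using D by auto
  show "(\<psi>' \<circ> inv_into V \<psi>) (snd z) = (\<psi>' \<circ> snd \<circ> inv_into W \<kappa>) z"
   using inv_into_map_prod[OF chart_inj[OF M c(3)] chart_inj[OF N c(4)] z] by (simp add: c)
 qed
qed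

subsection \<open>The circle\<close>

lemma cis_eq_iff: "cis s = cis t \<longleftrightarrow> (EX n::int. s = t + 2 * pi * n)"
 using sin_cos_eq_iff[of s t] by (auto simp: complex_eq_iff)

lemma inj_on_cis: "inj_on cis {a<..<a + 2 * pi}"
proof (rule inj_onI)
 fix s t assume st: "s \<in> {a<..<a + 2 * pi}" "t \<in> {a<..<a + 2 * pi}" "cis s = cis t"
 then obtain n :: int where n: "s = t + 2 * pi * n" by (auto simp: cis_eq_iff)
 have "\<bar>s - t\<bar> < 2 * pi" using st by auto
 moreover have "\<bar>s - t\<bar> = 2 * pi * \<bar>real_of_int n\<bar>" by (simp add: n abs_mult)
 ultimately have "\<bar>real_of_int n\<bar> < 1" using mult_less_cancel_left_pos[of "2 * pi" "\<bar>real_of_int n\<bar>" 1] by simp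
 then have "n = 0" by simp
 then show "s = t" using n by simp
qed

lemma cis_image_interval: "cis ` {a<..<a + 2 * pi} = sphere 0 1 - {cis a}"
proof (intro set_eqI iffI)
 fix z assume "z \<in> cis ` {a<..<a + 2 * pi}"
 then obtain t where t: "z = cis t" "a < t" "t < a + 2 * pi" by auto
 have "cis t ~= cis a"
 proof
  assume "cis t = cis a"
  then obtain n :: int where n: "t = a + 2 * pi * n" by (auto simp: cis_eq_iff)
  then have "0 < n" "n < 1" using t by (auto simp: zero_less_mult_iff)
  then show False by simp
 qed
 then show "z \<in> sphere 0 1 - {cis a}" using t by simp
next
 fix z assume z: "z \<in> sphere 0 1 - {cis a}"
 then have "cmod z = 1" by simp
 then obtain s where s: "z = cis s" by (metis cis_Arg complex_sgn_def div_by_1 norm_zero scaleR_one sgn_div_norm inverse_1 zero_neq_one)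
 define n where "n = \<lfloor>(s - a) / (2 * pi)\<rfloor>"
 define t where "t = s - 2 * pi * n"
 have "cis t = z" unfolding s cis_eq_iff t_def by (intro exI[of _ "- n"]) simp
 moreover have "real_of_int n \<le> (s - a) / (2 * pi)" "(s - a) / (2 * pi) < real_of_int n + 1"
  unfolding n_def by linarith+
 then have "a \<le> t" "t < a + 2 * pi" by (auto simp: t_def field_simps)
 ultimately show "z \<in> cis ` {a<..<a + 2 * pi}" using z by (intro image_eqI[of _ _ t]) (auto simp: less_le)
qed

text \<open>Near \<open>z0 = cis t0\<close> the inverse of \<open>cis\<close> is given by
  \<open>t0 + arg0 (z * cnj z0)\<close>. This formula makes sense on an open set of the plane, as an
  extension has to.\<close>

lemma smooth_on_circle_chart:
 "smooth_on (cis ` {a<..<a + 2 * pi}) (inv_into {a<..<a + 2 * pi} cis)"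
proof (rule smooth_onI)
 let ?I = "{a<..<a + 2 * pi}"
 fix z0 assume "z0 \<in> cis ` ?I"
 then obtain t0 where t0: "z0 = cis t0" "t0 \<in> ?I" by blast
 define h where "h z = t0 + arg0 (z * cnj z0)" for z
 let ?O = "{z. Re (z * cnj z0) > 0}"
 have oO: "open ?O" by (intro open_Collect_less continuous_intros)
 have "smooth_on ?O h" unfolding h_def
  by (intro smooth_on_add smooth_on_const smooth_on_arg0 smooth_on_mult smooth_on_ident) auto
 then have h: "Cinf ?O h" using oO smooth_on_open by blast
 have o: "open (?O Int h -` ?I)" using continuous_open_preimage[OF Cinf_continuous[OF h] oO] by auto
 have one: "z0 * cnj z0 = 1" by (simp add: t0 cis_cnj cis_mult)
 have "h y = inv_into ?I cis y" if y: "y \<in> (?O Int h -` ?I) Int cis ` ?I" for y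
 proof -
  have "cmod (y * cnj z0) = 1" using y t0 by (auto simp: norm_mult)
  then have "cis (arg0 (y * cnj z0)) = y * cnj z0" using cis_arg0[of "y * cnj z0"] y by simp
  then have "cis (h y) = z0 * (y * cnj z0)" by (simp add: h_def t0(1) flip: cis_mult)
  then have "cis (h y) = y" using one by (simp add: algebra_simps)
  moreover have "h y \<in> ?I" using y by simp
  ultimately show ?thesis using inv_into_f_f[OF inj_on_cis, of "h y" a] by simp
 qed
 moreover have "Re (z0 * cnj z0) > 0" "h z0 = t0" unfolding h_def one by (simp_all add: arg0_def)
 then have "z0 \<in> ?O Int h -` ?I" using t0(2) by simp
 ultimately show "EX U h. open U & z0 \<in> U & Cinf U h & (ALL y:U Int cis ` ?I. h y = inv_into ?I cis y)"
  using o Cinf_subset[OF h, of "?O Int h -` ?I"] by (intro exI[of _ "?O Int h -` ?I"] exI[of _ h]) auto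
qed

lemma topo_circle [simp]: "topo circle = top_of_set (sphere 0 1)"
 by (simp add: circle_def)

lemma charts_circle: "c \<in> charts circle \<longleftrightarrow> (EX a. c = (cis ` {a<..<a + 2 * pi}, inv_into {a<..<a + 2 * pi} cis))"
 by (auto simp: circle_def)

lemma circle_chart_facts:
 fixes a defines "I \<equiv> {a<..<a + 2 * pi}"
 shows "inv_into I cis ` cis ` I = I" "t \<in> I ==> inv_into (cis ` I) (inv_into I cis) t = cis t"
  "inj_on (inv_into I cis) (cis ` I)"
proof -
 have inj: "inj_on cis I" unfolding I_def by (rule inj_on_cis)
 show 1: "inv_into I cis ` cis ` I = I" using inj by (auto simp: image_iff)
 show 2: "inj_on (inv_into I cis) (cis ` I)" by (rule inj_on_inv_into) auto
 show "inv_into (cis ` I) (inv_into I cis) t = cis t" if "t \<in> I"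
  using inv_into_f_f[OF 2, of "cis t"] that inj by simp
qed

lemma smooth_manifold_circle: "smooth_manifold circle"
proof (rule smooth_manifoldI)
 show "Hausdorff_space (topo circle)" by (simp add: Hausdorff_space_subtopology Hausdorff_space_euclidean)
 show "second_countable (topo circle)" by (simp add: second_countable_subtopology second_countable_euclidean)
 show "EX U \<phi>. (U, \<phi>) \<in> charts circle & p \<in> U" if "p \<in> carr circle" for p
 proof -
  have "p \<in> sphere 0 1 - {cis (Arg p + pi)}"
  proof -
   have "p ~= 0" using that by auto
   then have "p = cis (Arg p)" using that cis_Arg[of p] by (auto simp: sgn_div_norm)
   have "cis (Arg p + pi) = cis (Arg p) * cis pi" by (simp only: cis_mult)
   then have "cis (Arg p + pi) = - p" by (simp flip: \<open>p = cis (Arg p)\<close>)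
   then show ?thesis using that by auto
  qed
  then show ?thesis unfolding charts_circle cis_image_interval[symmetric] by blast
 qed
 fix U \<phi> assume "(U, \<phi>) \<in> charts circle"
 then obtain a where a: "U = cis ` {a<..<a + 2 * pi}" "\<phi> = inv_into {a<..<a + 2 * pi} cis"
  by (auto simp: charts_circle)
 note facts = circle_chart_facts[of a, folded a]
 show "openin (topo circle) U" unfolding a cis_image_interval by (simp add: openin_delete)
 show "model_open (\<phi> ` U)" unfolding a circle_chart_facts(1) by (simp add: model_open_def)
 show "inj_on \<phi> U" unfolding a by (rule circle_chart_facts(3))
 have U: "sphere 0 1 Int U = U" unfolding a cis_image_interval by auto
 show "continuous_map (subtopology (topo circle) U) euclidean \<phi>"
  using smooth_on_continuous[OF smooth_on_circle_chart[of a]] U by (simp add: subtopology_subtopology flip: a)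
 have "continuous_on (\<phi> ` U) (inv_into U \<phi>)"
 proof (rule continuous_on_eq[of _ cis])
  show "continuous_on (\<phi> ` U) cis" by (intro continuous_intros)
  show "cis t = inv_into U \<phi> t" if "t \<in> \<phi> ` U" for t
   using that unfolding a circle_chart_facts(1) by (simp add: circle_chart_facts(2))
 qed
 moreover have "inv_into U \<phi> ` \<phi> ` U <= sphere 0 1" using U inv_into_into[of _ \<phi> U] by blast
 ultimately show "continuous_map (top_of_set (\<phi> ` U)) (topo circle) (inv_into U \<phi>)"
  by (auto simp: continuous_map_in_subtopology)
 fix V \<psi> assume "(V, \<psi>) \<in> charts circle"
 then obtain b where b: "V = cis ` {b<..<b + 2 * pi}" "\<psi> = inv_into {b<..<b + 2 * pi} cis"
  by (auto simp: charts_circle)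
 have eq: "inv_into U \<phi> t = cis t" if "t \<in> \<phi> ` U" for t
  using that unfolding a circle_chart_facts(1) by (simp add: circle_chart_facts(2))
 have inv: "inv_into U \<phi> (\<phi> z) = z" if "z \<in> U" for z using \<open>inj_on \<phi> U\<close> that by simp
 have "smooth_on (\<phi> ` (U Int V)) (%t. \<psi> (cis t))"
  unfolding b by (rule smooth_on_compose[OF smooth_on_circle_chart smooth_on_cis[OF smooth_on_ident]])
   (use eq inv in \<open>fastforce simp: b\<close>)
 then show "smooth_on (\<phi> ` (U Int V)) (\<psi> \<circ> inv_into U \<phi>)"
  by (rule smooth_on_cong) (use eq in auto)
qed

lemma mboundary_circle: "mboundary circle = {}"
proof -
 have "interior (\<phi> ` U) = \<phi> ` U" if "(U, \<phi>) \<in> charts circle" for U \<phi>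
  using that unfolding charts_circle
  by (elim exE) (simp only: prod.inject circle_chart_facts(1) interior_open open_greaterThanLessThan)
 then show ?thesis by (auto simp: mboundary_def)
qed

lemma sfun_circle: "sfun circle S (%z. z)"
proof (rule sfunI)
 fix U \<phi> assume "(U, \<phi>) \<in> charts circle"
 then obtain a where a: "U = cis ` {a<..<a + 2 * pi}" "\<phi> = inv_into {a<..<a + 2 * pi} cis"
  by (auto simp: charts_circle)
 show "smooth_on (\<phi> ` (U Int S)) (%x. inv_into U \<phi> x)"
 proof (rule smooth_on_cong[OF smooth_on_cis[OF smooth_on_ident]])
  fix t assume "t \<in> \<phi> ` (U Int S)"
  then have "t \<in> \<phi> ` U" by auto
  then show "cis t = inv_into U \<phi> t" unfolding a circle_chart_facts(1) by (simp add: circle_chart_facts(2))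
 qed
qed

text \<open>Allows maps into the circle to be treated as complex-valued functions of modulus 1, so
  that they can be multiplied, conjugated and differentiated without charts of the circle.\<close>

lemma smooth_map_circle:
 assumes M: "smooth_manifold M" and S: "S <= carr M"
 shows "smooth_map M S circle T f \<longleftrightarrow> sfun M S f & f ` S <= T Int sphere 0 1"
proof
 assume f: "smooth_map M S circle T f"
 have *: "f ` S <= T Int sphere 0 1" using smooth_map_in[OF f] S by auto
 then have "sfun M S f"
  using sfun_compose[OF M smooth_manifold_circle S f sfun_circle[of "T Int sphere 0 1"]] by auto
 then show "sfun M S f & f ` S <= T Int sphere 0 1" using * by auto
next
 assume f: "sfun M S f & f ` S <= T Int sphere 0 1"
 show "smooth_map M S circle T f"
 proof (rule smooth_mapI)
  show "continuous_map (subtopology (topo M) S) (subtopology (topo circle) T) f"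
   using sfun_continuous[OF M S] f by (auto simp: continuous_map_in_subtopology)
  fix U \<phi> V \<psi> assume c: "(U, \<phi>) \<in> charts M" "(V, \<psi>) \<in> charts circle"
  then obtain a where a: "V = cis ` {a<..<a + 2 * pi}" "\<psi> = inv_into {a<..<a + 2 * pi} cis"
   by (auto simp: charts_circle)
  have "smooth_on (\<phi> ` {p \<in> U Int S. f p \<in> V}) (%x. f (inv_into U \<phi> x))"
   by (rule smooth_on_subset[OF sfunD[OF _ c(1)] image_mono]) (use f in auto)
  then have "smooth_on (\<phi> ` {p \<in> U Int S. f p \<in> V}) (%x. \<psi> (f (inv_into U \<phi> x)))"
   unfolding a by (rule smooth_on_compose[OF smooth_on_circle_chart]) (use chart_inj[OF M c(1)] in \<open>auto simp: a\<close>)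
  then show "smooth_on (\<phi> ` {p \<in> U Int S. f p \<in> V}) (\<psi> \<circ> f \<circ> inv_into U \<phi>)" by (simp add: o_def)
 qed
qed

section \<open>Bump functions\<close>

text \<open>For \<open>n = 0\<close> this is the classical flat function exp(-1/x). The powers of
  1/x are carried along because differentiation leads from \<open>n\<close> to \<open>n + 1\<close>
  and \<open>n + 2\<close>, so that the family is closed under it.\<close>

definition flat :: "nat => real => real" where
 "flat n x = (if x > 0 then inverse x ^ n / exp (inverse x) else 0)"

lemma flat_pos: "x > 0 ==> flat n x > 0" and flat_nonneg: "flat n x \<ge> 0" and flat_nonpos: "x \<le> 0 ==> flat n x = 0"
 by (auto simp: flat_def)

lemma flat_tendsto_0: "(flat n \<longlongrightarrow> 0) (at 0)"
proof (rule filterlim_split_at)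
 have "((%x::real. inverse x ^ n / exp (inverse x)) \<longlongrightarrow> 0) (at_right 0)"
  by (rule filterlim_compose[OF tendsto_power_div_exp_0 filterlim_inverse_at_top_right])
 moreover have "eventually (%x. inverse x ^ n / exp (inverse x) = flat n x) (at_right 0)"
  by (auto simp: eventually_at_filter flat_def)
 ultimately show "(flat n \<longlongrightarrow> 0) (at_right 0)" by (rule Lim_transform_eventually)
 have "eventually (%x. 0 = flat n x) (at_left 0)"
  by (auto simp: eventually_at_filter flat_def)
 then show "(flat n \<longlongrightarrow> 0) (at_left 0)" by (rule Lim_transform_eventually[OF tendsto_const])
qed

lemma flat_deriv: "(flat n has_real_derivative (flat (n + 2) x - n * flat (n + 1) x)) (at x)"
proof (cases x "0::real" rule: linorder_cases)
 case less
 have "((%x. 0) has_real_derivative 0) (at x)" by simp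
 then have "(flat n has_real_derivative 0) (at x)"
  by (rule has_field_derivative_transform_within_open[where S="{..<0}"]) (use less in \<open>auto simp: flat_def\<close>)
 then show ?thesis using less by (simp add: flat_def)
next
 case equal
 have "((%y. (flat n y - flat n 0) / (y - 0)) \<longlongrightarrow> 0) (at 0)"
 proof (rule Lim_transform_eventually[OF flat_tendsto_0[of "n + 1"]])
  show "eventually (%y. flat (n + 1) y = (flat n y - flat n 0) / (y - 0)) (at 0)"
   by (auto simp: eventually_at_filter flat_def field_simps)
 qed
 then show ?thesis by (simp add: equal has_field_derivative_iff flat_nonpos)
next
 case greater
 have d: "((%x. inverse x) has_real_derivative - (inverse x * inverse x)) (at x)"
  using DERIV_inverse[of x UNIV] greater by (simp add: power2_eq_square flip: numeral_2_eq_2)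
 have "((%x. inverse x ^ n * exp (- inverse x)) has_real_derivative
   (real n * inverse x ^ (n - 1) * (- (inverse x * inverse x)) * exp (- inverse x)
    + inverse x ^ n * (exp (- inverse x) * (inverse x * inverse x)))) (at x)"
  using DERIV_mult[OF DERIV_power[OF d, of n] DERIV_fun_exp[OF DERIV_minus[OF d]]]
  by (simp add: algebra_simps)
 also have "real n * inverse x ^ (n - 1) * (- (inverse x * inverse x)) * exp (- inverse x)
    + inverse x ^ n * (exp (- inverse x) * (inverse x * inverse x)) = flat (n + 2) x - n * flat (n + 1) x"
  using greater by (cases n) (auto simp: flat_def exp_minus field_simps)
 finally show ?thesis
  by (rule has_field_derivative_transform_within_open[where S="{0<..}"])
   (use greater in \<open>auto simp: flat_def exp_minus divide_inverse\<close>)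
qed

lemma C_on_flat: "C_on k UNIV (flat n)"
proof (induction k arbitrary: n)
 case 0
 show ?case using DERIV_isCont[OF flat_deriv] by (simp add: continuous_at_imp_continuous_on)
next
 case (Suc k)
 show ?case
 proof (rule C_on_SucI_real[where f'="%x. flat (n + 2) x + (- real n) *\<^sub>R flat (n + 1) x"])
  show "(flat n has_vector_derivative flat (n + 2) x + (- real n) *\<^sub>R flat (n + 1) x) (at x)" for x
   using flat_deriv[of n x] by (simp add: has_real_derivative_iff_has_vector_derivative)
  show "C_on k UNIV (%x. flat (n + 2) x + (- real n) *\<^sub>R flat (n + 1) x)"
   by (intro C_on_add C_on_linear_compose[OF bounded_linear_scaleR_right] Suc) auto
 qed auto
qed

definition smooth_step :: "real => real" where
 "smooth_step x = flat 0 x / (flat 0 x + flat 0 (1 - x))"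

lemma smooth_step_denom: "flat 0 x + flat 0 (1 - x) > 0"
proof (cases "x > 0")
 case True then show ?thesis using flat_pos[of x 0] flat_nonneg[of 0 "1 - x"] by linarith
next
 case False then show ?thesis using flat_pos[of "1 - x" 0] flat_nonneg[of 0 x] by linarith
qed

lemma smooth_on_flat: "smooth_on S f ==> smooth_on S (%x. flat n (f x))"
 by (rule smooth_on_Cinf_compose[of UNIV "flat n"]) (auto simp: Cinf_def C_on_flat)

lemma smooth_on_smooth_step:
 assumes "smooth_on S f" shows "smooth_on S (%x. smooth_step (f x))"
 unfolding smooth_step_def
 by (intro smooth_on_divide smooth_on_flat smooth_on_add smooth_on_diff smooth_on_const assms)
  (metis order_less_irrefl smooth_step_denom)

lemma smooth_step_0: "x \<le> 0 ==> smooth_step x = 0"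
 and smooth_step_1: "x \<ge> 1 ==> smooth_step x = 1"
 and smooth_step_range: "0 \<le> smooth_step x" "smooth_step x \<le> 1"
 using smooth_step_denom[of x] flat_nonneg[of 0 "1 - x"] flat_nonneg[of 0 x]
 by (auto simp: smooth_step_def flat_nonpos divide_simps)

text \<open>The strict positivity inside \<open>(0, 1)\<close> is what later gives a positive lower
  bound of the slope on a compact subinterval.\<close>

lemma smooth_step_deriv:
 obtains D where "(smooth_step has_real_derivative D) (at x)" "D \<ge> 0" "0 < x ==> x < 1 ==> D > 0"
proof
 let ?d = "flat 0 x + flat 0 (1 - x)"
 have 1: "(flat 0 has_real_derivative flat 2 x) (at x)" using flat_deriv[of 0 x] by (simp add: numeral_2_eq_2)
 have 2: "((%x. flat 0 (1 - x)) has_real_derivative - flat 2 (1 - x)) (at x)"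
 proof -
  have "((%x. 1 - x) has_real_derivative -1) (at x)" by (auto intro!: derivative_eq_intros)
  then show ?thesis
   using DERIV_chain2[where f="flat 0" and g="%x. 1 - x" and Da="flat 2 (1 - x)" and Db="-1" and x=x and s=UNIV]
    flat_deriv[of 0 "1 - x"] by (simp add: numeral_2_eq_2)
 qed
 have "((%x. flat 0 x / (flat 0 x + flat 0 (1 - x))) has_real_derivative
   (flat 2 x * ?d - flat 0 x * (flat 2 x + - flat 2 (1 - x))) / (?d * ?d)) (at x)"
  by (rule DERIV_divide[OF 1 DERIV_add[OF 1 2]]) (use smooth_step_denom[of x] in auto)
 then show "(smooth_step has_real_derivative
   (flat 2 x * flat 0 (1 - x) + flat 0 x * flat 2 (1 - x)) / (?d * ?d)) (at x)"
  by (simp add: smooth_step_def[abs_def] algebra_simps)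
 show "(flat 2 x * flat 0 (1 - x) + flat 0 x * flat 2 (1 - x)) / (?d * ?d) \<ge> 0"
  by (simp add: flat_nonneg)
 show "(flat 2 x * flat 0 (1 - x) + flat 0 x * flat 2 (1 - x)) / (?d * ?d) > 0" if "0 < x" "x < 1"
  using that flat_pos[of x] flat_pos[of "1 - x"] smooth_step_denom[of x]
  by (intro divide_pos_pos add_pos_pos mult_pos_pos) auto
qed

lemma smooth_bump:
 fixes c :: "'a::euclidean_space"
 assumes "r > 0"
 obtains b :: "'a => real" where "smooth_on UNIV b" "!!x. 0 \<le> b x" "!!x. b x \<le> 1"
  "!!x. x \<in> cball c r ==> b x = 1" "!!x. x \<notin> ball c (2 * r) ==> b x = 0"
proof
 \<comment> \<open>The squared norm is smooth at \<open>c\<close> as well. The argument of the step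
   is at least 1 at distance at most \<open>r\<close> from \<open>c\<close>, and at most -2 at
   distance at least \<open>2 * r\<close>.\<close>
 define b where "b x = smooth_step (2 + (- inverse (r\<^sup>2)) *\<^sub>R ((x - c) \<bullet> (x - c)))" for x
 have b: "b x = smooth_step (2 - (norm (x - c) / r)\<^sup>2)" for x
  by (simp add: b_def power2_norm_eq_inner[symmetric] power_mult_distrib power_inverse divide_inverse_commute)
 show "smooth_on UNIV b" unfolding b_def
  by (intro smooth_on_smooth_step smooth_on_add smooth_on_const smooth_on_diff smooth_on_ident
    smooth_on_linear_compose[OF bounded_linear_scaleR_right] smooth_on_bilinear[OF bounded_bilinear_inner])
 show "0 \<le> b x" "b x \<le> 1" for x by (simp_all add: b smooth_step_range)
 show "b x = 1" if "x \<in> cball c r" for x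
 proof -
  have "norm (x - c) / r \<le> 1" using that assms by (simp add: dist_norm norm_minus_commute)
  then have "(norm (x - c) / r)\<^sup>2 \<le> 1" using assms by (simp add: power_le_one)
  then show ?thesis by (simp add: b smooth_step_1)
 qed
 show "b x = 0" if "x \<notin> ball c (2 * r)" for x
 proof -
  have "2 \<le> norm (x - c) / r" using that assms by (simp add: dist_norm norm_minus_commute field_simps)
  then have "2\<^sup>2 \<le> (norm (x - c) / r)\<^sup>2" by (intro power_mono) auto
  then show ?thesis by (simp add: b smooth_step_0)
 qed
qed

section \<open>Regular points\<close>

text \<open>The differential is nonzero at \<open>p\<close>. It is tested on a curve through
  \<open>p\<close>, so that no tangent spaces are needed and the property travels along smooth maps
  by composing the curve.\<close>

definition regular_at :: "('a, 'e::euclidean_space) manifold => ('a => 'b::euclidean_space) => 'a => bool" where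
 "regular_at M f p \<longleftrightarrow>
  (EX \<gamma> D. smooth_map eu {-1<..<1::real} M (carr M) \<gamma> & \<gamma> 0 = p &
    ((%t. f (\<gamma> t)) has_vector_derivative D) (at 0) & D ~= 0)"

lemma smooth_map_eu_ball:
 assumes "smooth_map eu S M T \<gamma>" "open S" "x \<in> S" "openin (topo M) V" "\<gamma> x \<in> V"
 obtains d where "d > 0" "ball x d <= S" "!!y. y \<in> ball x d ==> \<gamma> y \<in> V"
proof -
 obtain G where G: "openin (topo eu) G" "{p \<in> carr eu Int S. \<gamma> p \<in> V} = S Int G"
  using smooth_map_preimage[OF assms(1,4)] by metis
 have "open (S Int G)" "x \<in> S Int G" using assms(2,3,5) G by auto
 then obtain d where "d > 0" "ball x d <= S Int G" using open_contains_ball by blast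
 then show ?thesis using that[of d] G(2) by blast
qed

lemma regular_chart:
 assumes M: "smooth_manifold M" and c: "(U, \<phi>) \<in> charts M" "p \<in> U" and reg: "regular_at M f p"
  and A: "((%x. f (inv_into U \<phi> x)) has_derivative A) (at (\<phi> p))"
 shows "EX v. A v ~= 0"
proof -
 obtain \<gamma> D where g: "smooth_map eu {-1<..<1::real} M (carr M) \<gamma>" "\<gamma> 0 = p"
  "((%t. f (\<gamma> t)) has_vector_derivative D) (at 0)" "D ~= 0"
  using reg by (auto simp: regular_at_def)
 obtain d where d: "d > 0" "ball 0 d <= {-1<..<1::real}" "!!y. y \<in> ball 0 d ==> \<gamma> y \<in> U"
  by (rule smooth_map_eu_ball[OF g(1), of 0 U]) (use chart_open[OF M c(1)] c(2) g(2) in auto)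
 have "smooth_map eu (ball 0 d) M U \<gamma>"
  by (rule smooth_map_subset[OF g(1) d(2)]) (use d(3) in auto)
 from smooth_map_compose[OF smooth_manifold_eu M this chart_smooth[OF M c(1)]]
 have "smooth_on (ball 0 d) (%t. \<phi> (\<gamma> t))" by (simp add: smooth_map_eu)
 then have "Cinf (ball 0 d) (%t. \<phi> (\<gamma> t))" by (simp add: smooth_on_open)
 then obtain C where "!!x. x \<in> ball 0 d ==> ((%t. \<phi> (\<gamma> t)) has_derivative C x) (at x)"
  using Cinf_derivative[of "ball 0 d"] by (metis open_ball)
 then have C: "((%t. \<phi> (\<gamma> t)) has_derivative C 0) (at 0)" using d(1) by simp
 have "((%t. f (inv_into U \<phi> (\<phi> (\<gamma> t)))) has_derivative (%t. A (C 0 t))) (at 0)"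
  using diff_chain_at[OF C, of "%x. f (inv_into U \<phi> x)" A] A g(2) by (simp add: o_def)
 then have "((%t. f (\<gamma> t)) has_derivative (%t. A (C 0 t))) (at 0)"
  by (rule has_derivative_transform_within_open[of _ _ _ _ "ball 0 d"])
   (use d chart_inj[OF M c(1)] in auto)
 then have "(%t. A (C 0 t)) = (%t. t *\<^sub>R D)"
  using g(3) has_derivative_unique unfolding has_vector_derivative_def by blast
 then have "A (C 0 1) = D" by (metis scaleR_one)
 then show ?thesis using g(4) by blast
qed

text \<open>Orthogonal projection along \<open>v\<close>, followed by an isomorphism of the
  hyperplane. It supplies the missing coordinates for a function whose derivative does not vanish on
  \<open>v\<close>.\<close>

lemma linear_with_kernel:
 fixes v :: "'a::euclidean_space"
 assumes "v ~= 0" "DIM('a) = Suc DIM('b)"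
 shows "EX L :: 'a => 'b::euclidean_space. linear L & (ALL w. L w = 0 --> (EX c. w = c *\<^sub>R v))"
proof -
 let ?S = "{x. v \<bullet> x = 0}"
 have "dim ?S = dim (UNIV :: 'b set)" using dim_hyperplane[OF assms(1)] assms(2) by simp
 then obtain f :: "'a => 'b" where f: "linear f" "inj_on f ?S"
  using subspace_isomorphism[OF subspace_hyperplane[of v] subspace_UNIV] by blast
 define g where "g w = w - ((v \<bullet> w) / (v \<bullet> v)) *\<^sub>R v" for w
 have g: "linear g" unfolding g_def
  by (rule linearI) (auto simp: inner_add_right algebra_simps add_divide_distrib)
 have gS: "g w \<in> ?S" for w using assms(1) by (simp add: g_def inner_diff_right)
 show ?thesis
 proof (intro exI[of _ "%w. f (g w)"] conjI allI impI)
  show "linear (%w. f (g w))" using linear_compose[OF g f(1)] by (simp add: o_def)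
  fix w assume "f (g w) = 0"
  then have "f (g w) = f 0" using f(1) by (simp add: linear_0)
  then have "g w = 0" using f(2) gS[of w] by (auto dest: inj_onD)
  then show "EX c. w = c *\<^sub>R v" by (auto simp: g_def)
 qed
qed

section \<open>Submanifolds\<close>

text \<open>The atlas consists of all diffeomorphisms, in the sense of \<open>X\<close>, from
  relatively open subsets of \<open>S\<close> onto open subsets of the model space. It is formed for
  every \<open>S\<close>; that it covers \<open>S\<close> is the point to be proved in each
  case.\<close>

definition submanifold :: "('a, 'e::euclidean_space) manifold => 'a set => ('a, 'd::euclidean_space) manifold" where
 "submanifold X S = \<lparr>topo = subtopology (topo X) S,
  charts = {(V, \<psi>). openin (subtopology (topo X) S) V & open (\<psi> ` V) & diffeo X V eu (\<psi> ` V) \<psi>}\<rparr>"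

lemma topo_submanifold [simp]: "topo (submanifold X S) = subtopology (topo X) S"
 by (simp add: submanifold_def)

lemma charts_submanifold: "(V, \<psi>) \<in> charts (submanifold X S) \<longleftrightarrow>
  openin (subtopology (topo X) S) V & open (\<psi> ` V) & diffeo X V eu (\<psi> ` V) \<psi>"
 by (simp add: submanifold_def)

context
 fixes X :: "('a, 'e::euclidean_space) manifold" and S :: "'a set"
  and L :: "('a, 'd::euclidean_space) manifold"
 assumes X: "smooth_manifold X" and S: "S <= carr X" and L_def: "L = submanifold X S"
begin

lemma submanifold_chartD:
 assumes "(V, \<psi>) \<in> charts L"
 shows "V <= S" "V <= carr X" "diffeo X V eu (\<psi> ` V) \<psi>" "inj_on \<psi> V" "openin (subtopology (topo X) S) V" "open (\<psi> ` V)"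
proof -
 show "diffeo X V eu (\<psi> ` V) \<psi>" and o: "openin (subtopology (topo X) S) V" "open (\<psi> ` V)"
  using assms by (auto simp: L_def charts_submanifold)
 then show "inj_on \<psi> V" using diffeo_bij bij_betw_def by blast
 show "V <= S" "V <= carr X" using openin_subset[OF o(1)] by auto
qed

lemma submanifold_transition:
 assumes U: "(U, \<phi>) \<in> charts L" and V: "(V, \<psi>) \<in> charts L"
 shows "smooth_on (\<phi> ` (U Int V)) (\<psi> \<circ> inv_into U \<phi>)"
proof -
 have "smooth_map eu (\<phi> ` (U Int V)) X (U Int V) (inv_into U \<phi>)"
  by (rule smooth_map_subset[OF diffeo_inv_smooth[OF submanifold_chartD(3)[OF U]]])
   (use submanifold_chartD(4)[OF U] in auto)
 moreover have "smooth_map X (U Int V) eu UNIV \<psi>"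
  by (rule smooth_map_subset[OF diffeo_smooth[OF submanifold_chartD(3)[OF V]]]) auto
 ultimately have "smooth_map eu (\<phi> ` (U Int V)) eu UNIV (%x. \<psi> (inv_into U \<phi> x))"
  by (rule smooth_map_compose[OF smooth_manifold_eu X])
 then show ?thesis by (simp add: smooth_map_eu o_def)
qed

lemma smooth_manifold_submanifold:
 assumes cov: "!!p. p \<in> S ==> EX V \<psi>. (V, \<psi>) \<in> charts L & p \<in> V"
 shows "smooth_manifold L"
proof (rule smooth_manifoldI)
 show "Hausdorff_space (topo L)" "second_countable (topo L)"
  using X by (auto simp: L_def smooth_manifold_def Hausdorff_space_subtopology second_countable_subtopology)
 show "EX U \<phi>. (U, \<phi>) \<in> charts L & p \<in> U" if "p \<in> carr L" for p
  using cov that by (auto simp: L_def)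
 fix U \<phi> assume U: "(U, \<phi>) \<in> charts L"
 note UD = submanifold_chartD[OF U]
 show "openin (topo L) U" "model_open (\<phi> ` U)" "inj_on \<phi> U"
  using UD by (auto simp: L_def model_open_def)
 have US: "subtopology (topo L) U = subtopology (topo X) U"
  using UD(1) by (simp add: L_def subtopology_subtopology inf_absorb2)
 show "continuous_map (subtopology (topo L) U) euclidean \<phi>"
  using smooth_map_continuous[OF diffeo_smooth[OF UD(3)]] unfolding US by (simp add: continuous_map_in_subtopology)
 show "continuous_map (top_of_set (\<phi> ` U)) (topo L) (inv_into U \<phi>)"
  using smooth_map_continuous[OF diffeo_inv_smooth[OF UD(3)]] UD(1)
  by (auto simp: L_def continuous_map_in_subtopology inv_into_into)
 show "smooth_on (\<phi> ` (U Int V)) (\<psi> \<circ> inv_into U \<phi>)" if "(V, \<psi>) \<in> charts L" for V \<psi>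
  by (rule submanifold_transition[OF U that])
qed

lemma mboundary_submanifold: "mboundary L = {}"
 unfolding mboundary_def using submanifold_chartD(6) by (fastforce simp: interior_open)

lemma smooth_map_submanifold_incl:
 assumes "T <= S" shows "smooth_map L T X T (%x. x)"
proof (rule smooth_mapI)
 show "continuous_map (subtopology (topo L) T) (subtopology (topo X) T) (%x. x)"
  using assms by (simp add: L_def subtopology_subtopology inf_absorb2)
 fix V \<psi> U \<phi> assume V: "(V, \<psi>) \<in> charts L" and U: "(U, \<phi>) \<in> charts X"
 let ?D = "\<psi> ` {p \<in> V Int T. p \<in> U}"
 have "smooth_map eu ?D X U (inv_into V \<psi>)"
  by (rule smooth_map_subset[OF diffeo_inv_smooth[OF submanifold_chartD(3)[OF V]]])
   (use submanifold_chartD(4)[OF V] in auto)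
 from smooth_map_compose[OF smooth_manifold_eu X this chart_smooth[OF X U]]
 show "smooth_on ?D (\<phi> \<circ> (%x. x) \<circ> inv_into V \<psi>)" by (simp add: smooth_map_eu o_def)
qed

text \<open>The charts of \<open>L\<close> are smooth in the sense of \<open>X\<close>, so composing
  them with a map that is smooth into \<open>X\<close> gives a smooth expression in
  coordinates.\<close>

lemma smooth_map_into_submanifold:
 assumes M: "smooth_manifold M" and f: "smooth_map M A X T f" and T: "T <= S"
 shows "smooth_map M A L T f"
proof (rule smooth_mapI)
 show "continuous_map (subtopology (topo M) A) (subtopology (topo L) T) f"
  using smooth_map_continuous[OF f] T by (simp add: L_def subtopology_subtopology inf_absorb2)
 fix U \<phi> V \<psi> assume U: "(U, \<phi>) \<in> charts M" and V: "(V, \<psi>) \<in> charts L"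
 let ?B = "{p \<in> U Int A. f p \<in> V}"
 have 1: "smooth_map eu (\<phi> ` ?B) M ?B (inv_into U \<phi>)"
  by (rule smooth_map_subset[OF chart_inv_smooth[OF M U]]) (use chart_inj[OF M U] in auto)
 have 2: "smooth_map M ?B X V f" by (rule smooth_map_subset[OF f]) auto
 from smooth_map_compose[OF smooth_manifold_eu X smooth_map_compose[OF smooth_manifold_eu M 1 2]
   diffeo_smooth[OF submanifold_chartD(3)[OF V]]]
 show "smooth_on (\<phi> ` ?B) (\<psi> \<circ> f \<circ> inv_into U \<phi>)" by (simp add: smooth_map_eu o_def)
qed

end

section \<open>Submersions of closed manifolds onto the circle\<close>

lemma has_vector_derivative_cis: "(cis has_vector_derivative \<i> * cis x) (at x)"
proof -
 have "((%t. cis t) has_derivative (%h. h *\<^sub>R (\<i> * cis x))) (at x)"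
  by (rule derivative_eq_intros refl | simp add: scaleR_conv_of_real)+
 then show ?thesis by (simp add: has_vector_derivative_def)
qed

lemma unit_mult_cnj: "cmod z = 1 ==> z * cnj z = 1"
 using complex_norm_square[of z] by simp

lemma smooth_map_openin_preimage:
 assumes "smooth_map M S N T f" "openin (topo N) V" "openin (topo M) S"
 shows "openin (topo M) {p \<in> S. f p \<in> V}"
proof -
 obtain G where G: "openin (topo M) G" "{p \<in> carr M Int S. f p \<in> V} = S Int G"
  by (rule smooth_map_preimage[OF assms(1,2)])
 have "{p \<in> S. f p \<in> V} = {p \<in> carr M Int S. f p \<in> V}" using openin_subset[OF assms(3)] by auto
 then show ?thesis using G assms(3) by (simp add: openin_Int)
qed

section \<open>Fibers of a circle-valued function without critical points\<close>

locale circle_submersion =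
 fixes X :: "('a, real^4) manifold" and h :: "'a => complex"
 assumes X: "smooth_manifold X" and bd: "mboundary X = {}" and compact: "compact_space (topo X)"
  and sfun_h: "sfun X (carr X) h" and norm_h: "!!x. x \<in> carr X ==> cmod (h x) = 1"
  and reg: "!!x. x \<in> carr X ==> regular_at X h x"
begin

text \<open>Coordinates whose first component is the angle of \<open>h\<close> relative to
  \<open>z\<close>. The bound \<open>pi / 2\<close> makes this angle recoverable as
  \<open>arg0 (h y * cnj z)\<close>, so that the fiber over \<open>z\<close> is exactly the slice
  where it vanishes.\<close>

definition adapted :: "complex => 'a set => ('a => real \<times> (real^3)) => bool" where
 "adapted z V \<kappa> \<longleftrightarrow> openin (topo X) V & open (\<kappa> ` V) & diffeo X V eu (\<kappa> ` V) \<kappa> &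
  (ALL y:V. h y = z * cis (fst (\<kappa> y)) & \<bar>fst (\<kappa> y)\<bar> < pi / 2)"

definition fib :: "complex => 'a set" where "fib z = {x \<in> carr X. h x = z}"

definition level :: "complex => ('a, real^3) manifold" where "level z = submanifold X (fib z)"

lemma fib_subset: "fib z <= carr X"
 by (auto simp: fib_def)

lemma adaptedD:
 assumes "adapted z V \<kappa>"
 shows "openin (topo X) V" "open (\<kappa> ` V)" "diffeo X V eu (\<kappa> ` V) \<kappa>" "V <= carr X" "inj_on \<kappa> V"
  "y \<in> V ==> h y = z * cis (fst (\<kappa> y))" "y \<in> V ==> \<bar>fst (\<kappa> y)\<bar> < pi / 2"
 using assms openin_subset[of "topo X" V] diffeo_bij[of X V eu "\<kappa> ` V" \<kappa>]
 by (auto simp: adapted_def bij_betw_def)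

lemma adapted_arg:
 assumes "adapted z V \<kappa>" "cmod z = 1" "y \<in> V"
 shows "arg0 (h y * cnj z) = fst (\<kappa> y)" "Re (h y * cnj z) > 0" "h y = z \<longleftrightarrow> fst (\<kappa> y) = 0"
proof -
 have zz: "z * cnj z = 1" using assms(2) by (rule unit_mult_cnj)
 have "h y * cnj z = (z * cnj z) * cis (fst (\<kappa> y))" using adaptedD(6)[OF assms(1,3)] by simp
 then have *: "h y * cnj z = cis (fst (\<kappa> y))" unfolding zz by simp
 note b = adaptedD(7)[OF assms(1,3)]
 show 1: "arg0 (h y * cnj z) = fst (\<kappa> y)" unfolding * by (rule arg0_cis) (use b in \<open>auto simp: abs_less_iff\<close>)
 show "Re (h y * cnj z) > 0" unfolding * using b by (simp add: cos_gt_zero_pi abs_less_iff)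
 show "h y = z \<longleftrightarrow> fst (\<kappa> y) = 0"
 proof
  assume "h y = z"
  then have "arg0 1 = fst (\<kappa> y)" using 1 zz by simp
  then show "fst (\<kappa> y) = 0" by (simp add: arg0_def)
 next
  assume "fst (\<kappa> y) = 0" then show "h y = z" using adaptedD(6)[OF assms(1,3)] by simp
 qed
qed

text \<open>Implicit function theorem: the angle \<open>T\<close> of \<open>h\<close> relative to
  \<open>h p\<close> has nonzero derivative on some \<open>v\<close>, and \<open>L\<close> is linear
  with kernel in the line of \<open>v\<close>. So the derivative of \<open>(T, L)\<close> at the
  point is injective, and the inverse function theorem turns this pair into coordinates.\<close>

lemma adapted_exists:
 assumes p: "p \<in> carr X"
 obtains V \<kappa> where "adapted (h p) V \<kappa>" "p \<in> V"
proof -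
 obtain U \<phi> where c: "(U, \<phi>) \<in> charts X" "p \<in> U" using chart_at[OF X p] .
 note inj = chart_inj[OF X c(1)]
 define F where "F x = h (inv_into U \<phi> x)" for x
 define G where "G x = F x * cnj (h p)" for x
 have pp: "h p * cnj (h p) = 1" using norm_h[OF p] by (rule unit_mult_cnj)
 have oU: "open (\<phi> ` U)" by (rule chart_image_interior[OF bd c(1)])
 have sF: "smooth_on (\<phi> ` U) F"
  using sfunD[OF sfun_h c(1)] chart_subset[OF X c(1)] by (simp add: F_def[abs_def] inf_absorb1)
 then have sG: "smooth_on (\<phi> ` U) G" unfolding G_def by (intro smooth_on_mult smooth_on_const)
 define D where "D = \<phi> ` U Int G -` {w. Re w > 0}"
 have oD: "open D" unfolding D_def
  by (rule continuous_open_preimage[OF smooth_on_continuous[OF sG] oU]) (intro open_Collect_less continuous_intros)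
 define T where "T x = arg0 (G x)" for x
 have "smooth_on D T" unfolding T_def
  by (rule smooth_on_arg0[OF smooth_on_subset[OF sG]]) (auto simp: D_def)
 then have sT: "Cinf D T" using oD smooth_on_open by blast
 have FG: "F x = h p * cis (T x)" if "x \<in> D" for x
 proof -
  have "inv_into U \<phi> x \<in> carr X" using that chart_subset[OF X c(1)] by (auto simp: D_def inv_into_into)
  then have "cmod (G x) = 1" using norm_h p by (simp add: G_def F_def norm_mult)
  then have "cis (T x) = G x" using cis_arg0[of "G x"] that by (simp add: T_def D_def)
  then have "h p * cis (T x) = (h p * cnj (h p)) * F x" by (simp add: G_def)
  then show ?thesis unfolding pp by simp
 qed
 have Fp: "F (\<phi> p) = h p" using inj c(2) by (simp add: F_def)
 have "Re (G (\<phi> p)) > 0" unfolding G_def Fp pp by simp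
 then have pD: "\<phi> p \<in> D" using c(2) by (simp add: D_def)
 have T0: "T (\<phi> p) = 0" unfolding T_def G_def Fp pp by (simp add: arg0_def)
 obtain T' where T': "(T has_derivative T') (at (\<phi> p))"
  using Cinf_derivative[OF sT oD] pD by metis
 have "((%x. h p * cis (T x)) has_derivative (%v. h p * (T' v *\<^sub>R (\<i> * cis (T (\<phi> p)))))) (at (\<phi> p))"
  using diff_chain_at[OF T' has_vector_derivative_cis[unfolded has_vector_derivative_def]]
  by (intro has_derivative_mult_right) (simp add: o_def)
 then have "(F has_derivative (%v. h p * (T' v *\<^sub>R (\<i> * cis (T (\<phi> p)))))) (at (\<phi> p))"
  by (rule has_derivative_transform_within_open[OF _ oD pD]) (simp add: FG)
 then obtain v where "h p * (T' v *\<^sub>R (\<i> * cis (T (\<phi> p)))) ~= 0"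
  using regular_chart[OF X c reg[OF p]] unfolding F_def by blast
 then have v: "T' v ~= 0" by auto
 have linT: "linear T'" using T' has_derivative_linear by blast
 then have "v ~= 0" using v by (auto simp: linear_0)
 then obtain L :: "real^4 => real^3" where L: "linear L" "!!w. L w = 0 ==> EX c. w = c *\<^sub>R v"
  using linear_with_kernel[of v, where 'b="real^3"] by auto
 have bL: "bounded_linear L" using L(1) by (simp add: linear_linear)
 define f where "f x = (T x, L x)" for x
 have "smooth_on D f" unfolding f_def
  by (intro smooth_on_Pair smooth_on_linear[OF bL] \<open>smooth_on D T\<close>)
 then have sf: "Cinf D f" using oD smooth_on_open by blast
 have df: "(f has_derivative (%w. (T' w, L w))) (at (\<phi> p))"
  unfolding f_def by (intro has_derivative_Pair T' bounded_linear_imp_has_derivative bL)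
 have "linear (%w. (T' w, L w))" using df has_derivative_linear by blast
 moreover have "w = 0" if w: "(T' w, L w) = 0" for w
 proof -
  obtain c where "w = c *\<^sub>R v" using L(2)[of w] w by (auto simp: zero_prod_def)
  then show ?thesis using w v linT by (simp add: zero_prod_def linear_scale)
 qed
 ultimately have injf: "inj (%w. (T' w, L w))" using linear_injective_0 by blast
 obtain O' V' g where ift: "open O'" "\<phi> p \<in> O'" "O' <= D" "open V'" "homeomorphism O' V' f g" "Cinf V' g"
  by (rule smooth_inverse_function[where 'n=4, OF _ _ oD sf pD df injf]) simp_all
 define V where "V = {y \<in> U. \<phi> y \<in> O'}"
 define \<kappa> where "\<kappa> y = f (\<phi> y)" for y
 have oV: "openin (topo X) V" unfolding V_def
  by (rule smooth_map_openin_preimage[OF chart_smooth[OF X c(1)]]) (use chart_open[OF X c(1)] ift(1) in auto)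
 have phiV: "\<phi> ` V = O'" using ift(3) by (auto simp: V_def D_def)
 have im: "\<kappa> ` V = V'"
 proof -
  have "\<kappa> ` V = f ` \<phi> ` V" by (auto simp: \<kappa>_def)
  then show ?thesis unfolding phiV using ift(5) by (simp add: homeomorphism_def)
 qed
 have fg: "g (f x) = x" "f x \<in> V'" if "x \<in> O'" for x using ift(5) that by (auto simp: homeomorphism_def)
 have gf: "f (g y) = y" "g y \<in> O'" if "y \<in> V'" for y using ift(5) that by (auto simp: homeomorphism_def)
 have 1: "smooth_map X V eu O' \<phi>"
  by (rule smooth_map_subset[OF chart_smooth[OF X c(1)]]) (auto simp: V_def)
 have 2: "smooth_map eu O' eu V' f"
  using smooth_on_subset[OF \<open>smooth_on D f\<close> ift(3)] fg by (auto simp: smooth_map_eu)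
 have 3: "smooth_map eu V' eu O' g"
  using ift(4,6) smooth_on_open gf by (auto simp: smooth_map_eu)
 have 4: "smooth_map eu O' X V (inv_into U \<phi>)"
  by (rule smooth_map_subset[OF chart_inv_smooth[OF X c(1)]])
   (use ift(3) inj in \<open>auto simp: V_def D_def\<close>)
 have diff: "diffeo X V eu V' \<kappa>"
 proof (rule diffeoI)
  show "smooth_map X V eu V' \<kappa>"
   unfolding \<kappa>_def by (rule smooth_map_compose[OF X smooth_manifold_eu 1 2])
  show "smooth_map eu V' X V (%y. inv_into U \<phi> (g y))"
   by (rule smooth_map_compose[OF smooth_manifold_eu smooth_manifold_eu 3 4])
  show "inv_into U \<phi> (g (\<kappa> x)) = x" if "x \<in> V" for x
   using that fg inj by (auto simp: V_def \<kappa>_def)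
  show "\<kappa> (inv_into U \<phi> (g y)) = y" if "y \<in> V'" for y
  proof -
   have "g y \<in> \<phi> ` U" using gf(2)[OF that] ift(3) by (auto simp: D_def)
   then show ?thesis using gf[OF that] by (simp add: \<kappa>_def f_inv_into_f)
  qed
  show "V <= carr X" using openin_subset[OF oV] .
 qed (auto intro: smooth_manifold_eu)
 have "adapted (h p) V \<kappa>"
  unfolding adapted_def
 proof (intro conjI ballI)
  fix y assume y: "y \<in> V"
  then have yD: "\<phi> y \<in> D" using ift(3) by (auto simp: V_def)
  show "h y = h p * cis (fst (\<kappa> y))"
   using FG[OF yD] inj y by (simp add: F_def \<kappa>_def f_def V_def)
  show "\<bar>fst (\<kappa> y)\<bar> < pi / 2" unfolding \<kappa>_def f_def T_def fst_conv by (rule abs_arg0_less)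
 qed (use oV im ift(4) diff in auto)
 moreover have "p \<in> V" using c(2) ift(2) by (simp add: V_def)
 ultimately show ?thesis by (rule that)
qed

lemma adapted_level_chart:
 assumes a: "adapted z V \<kappa>" and z: "cmod z = 1"
 shows "(V Int fib z, %y. snd (\<kappa> y)) \<in> charts (level z)"
proof -
 note aD = adaptedD[OF a]
 let ?V = "V Int fib z" and ?\<psi> = "%y. snd (\<kappa> y)"
 have fst0: "fst (\<kappa> y) = 0" if "y \<in> ?V" for y
  using adapted_arg(3)[OF a z, of y] that by (auto simp: fib_def)
 have inv: "inv_into V \<kappa> (\<kappa> y) = y" if "y \<in> V" for y using aD(5) that by simp
 have im: "?\<psi> ` ?V = (%w. (0, w)) -` (\<kappa> ` V)"
 proof (intro set_eqI iffI)
  fix w assume "w \<in> ?\<psi> ` ?V"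
  then obtain y where y: "y \<in> ?V" "w = snd (\<kappa> y)" by blast
  then have "\<kappa> y = (0, w)" using fst0[OF y(1)] by (metis prod.collapse)
  then show "w \<in> (%w. (0, w)) -` (\<kappa> ` V)" using y by (auto intro: image_eqI[of _ _ y])
 next
  fix w assume "w \<in> (%w. (0, w)) -` (\<kappa> ` V)"
  then obtain y where y: "y \<in> V" "(0, w) = \<kappa> y" by auto
  then have "fst (\<kappa> y) = 0" "snd (\<kappa> y) = w" by (metis fst_conv, metis snd_conv)
  then have "y \<in> ?V" using adapted_arg(3)[OF a z y(1)] y(1) aD(4) by (auto simp: fib_def)
  then show "w \<in> ?\<psi> ` ?V" using \<open>snd (\<kappa> y) = w\<close> by blast
 qed
 have o: "open (?\<psi> ` ?V)" unfolding im
  using aD(2) continuous_on_open_vimage[of UNIV "%w. (0::real, w::real^3)"] by (auto intro!: continuous_intros)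
 have "diffeo X ?V eu (?\<psi> ` ?V) ?\<psi>"
 proof (rule diffeoI[OF smooth_manifold_eu])
  have "smooth_map X ?V eu UNIV \<kappa>"
   by (rule smooth_map_subset[OF diffeo_smooth[OF aD(3)]]) auto
  moreover have "smooth_map eu UNIV eu UNIV (snd :: real \<times> (real^3) => _)"
   by (auto simp: smooth_map_eu intro: smooth_on_snd smooth_on_ident)
  ultimately have "smooth_map X ?V eu UNIV ?\<psi>" by (rule smooth_map_compose[OF X smooth_manifold_eu])
  then show "smooth_map X ?V eu (?\<psi> ` ?V) ?\<psi>" by (rule smooth_map_subset) auto
  have "smooth_map eu (?\<psi> ` ?V) eu (\<kappa> ` V) (%w. (0, w))"
   unfolding im by (auto simp: smooth_map_eu intro!: smooth_on_Pair smooth_on_const smooth_on_ident)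
  from smooth_map_compose[OF smooth_manifold_eu smooth_manifold_eu this diffeo_inv_smooth[OF aD(3)]]
  have "smooth_map eu (?\<psi> ` ?V) X V (%w. inv_into V \<kappa> (0, w))" .
  then show "smooth_map eu (?\<psi> ` ?V) X ?V (%w. inv_into V \<kappa> (0, w))"
  proof (rule smooth_map_subset)
   fix w assume "w \<in> ?\<psi> ` ?V"
   then obtain y where y: "y \<in> ?V" "w = snd (\<kappa> y)" by blast
   then have "\<kappa> y = (0, w)" using fst0[OF y(1)] by (metis prod.collapse)
   then show "inv_into V \<kappa> (0, w) \<in> ?V" using inv[of y] y by auto
  qed simp
  show "inv_into V \<kappa> (0, ?\<psi> y) = y" if "y \<in> ?V" for y
   using fst0[OF that] inv[of y] that by (metis IntD1 prod.collapse)
  show "?\<psi> (inv_into V \<kappa> (0, w)) = w" if "w \<in> ?\<psi> ` ?V" for w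
   using that unfolding im by (simp add: f_inv_into_f)
 qed (use aD(4) in auto)
 moreover have "openin (subtopology (topo X) (fib z)) ?V"
  using openin_subtopology_Int[OF aD(1)] .
 ultimately show ?thesis using o by (simp add: level_def charts_submanifold)
qed

lemma smooth_manifold_level:
 assumes "cmod z = 1"
 shows "smooth_manifold (level z)" "mboundary (level z) = {}"
proof -
 show "smooth_manifold (level z)"
 proof (rule smooth_manifold_submanifold[OF X fib_subset level_def])
  fix p assume "p \<in> fib z"
  then have p: "p \<in> carr X" "h p = z" by (auto simp: fib_def)
  obtain V \<kappa> where "adapted z V \<kappa>" "p \<in> V" using adapted_exists[OF p(1)] p(2) by metis
  then show "EX V \<psi>. (V, \<psi>) \<in> charts (level z) & p \<in> V"
   using adapted_level_chart[OF _ assms] \<open>p \<in> fib z\<close> by blast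
 qed
 show "mboundary (level z) = {}"
  by (rule mboundary_submanifold[OF X fib_subset level_def])
qed

lemma carr_level: "carr (level z) = fib z"
 using fib_subset by (auto simp: level_def)

section \<open>Retraction of a neighbourhood onto a fiber\<close>

text \<open>In adapted coordinates \<open>(t, \<xi>)\<close>, the fiber is pushed onto itself by scaling \<open>t\<close> with a
  factor that vanishes near the point.\<close>

lemma local_push:
 assumes p: "p \<in> fib z"
 obtains P G where "smooth_map X (carr X) X (carr X) P" "!!y. y \<in> fib z ==> P y = y"
  "openin (topo X) G" "p \<in> G" "!!y. y \<in> G ==> P y \<in> fib z"
proof -
 have pX: "p \<in> carr X" and hp: "h p = z" using p by (auto simp: fib_def)
 have z: "cmod z = 1" using norm_h[OF pX] hp by simp
 obtain V \<kappa> where a: "adapted z V \<kappa>" and pV: "p \<in> V" using adapted_exists[OF pX] hp by metis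
 note aD = adaptedD[OF a]
 define k0 where "k0 = \<kappa> p"
 have k00: "fst k0 = 0" using adapted_arg(3)[OF a z pV] hp by (simp add: k0_def)
 obtain r where r: "r > 0" "cball k0 (2 * r) <= \<kappa> ` V"
 proof -
  obtain R where "R > 0" "cball k0 R <= \<kappa> ` V"
   using aD(2) pV open_contains_cball unfolding k0_def by blast
  then show ?thesis using that[of "R / 2"] by simp
 qed
 obtain b :: "real \<times> (real^3) => real" where b: "smooth_on UNIV b" "!!x. 0 \<le> b x" "!!x. b x \<le> 1"
  "!!x. x \<in> cball k0 r ==> b x = 1" "!!x. x \<notin> ball k0 (2 * r) ==> b x = 0"
  using smooth_bump[OF r(1)] by metis
 define M where "M k = ((1 - b k) * fst k, snd k)" for k
 have sM: "smooth_on S M" for S unfolding M_def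
  by (intro smooth_on_Pair smooth_on_mult smooth_on_diff smooth_on_const smooth_on_subset[OF b(1)]
    smooth_on_fst smooth_on_snd smooth_on_ident) auto
 have MK: "M k \<in> \<kappa> ` V" if "k \<in> \<kappa> ` V" for k
 proof (cases "k \<in> ball k0 (2 * r)")
  case False
  then show ?thesis using b(5)[of k] that by (simp add: M_def)
 next
  case True
  \<comment> \<open>Only the first coordinate changes, and it shrinks towards
    \<open>fst k0 = 0\<close>. So \<open>M\<close> brings points closer to \<open>k0\<close> and
    does not leave the ball, which lies in the chart.\<close>
  have "\<bar>(1 - b k) * fst k\<bar> \<le> 1 * \<bar>fst k\<bar>"
   unfolding abs_mult by (rule mult_right_mono) (use b(2,3)[of k] in auto)
  then have "((1 - b k) * fst k)\<^sup>2 \<le> (fst k)\<^sup>2" by (simp add: abs_le_square_iff)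
  then have "dist k0 (M k) \<le> dist k0 k"
   unfolding dist_prod_def by (auto simp: M_def k00 dist_norm intro!: real_sqrt_le_mono add_right_mono)
  then show ?thesis using True r(2) by auto
 qed
 define P where "P y = (if y \<in> V then inv_into V \<kappa> (M (\<kappa> y)) else y)" for y
 \<comment> \<open>Outside this compact set the push is the identity. \<open>C\<close> is closed
   because \<open>X\<close> is Hausdorff, so the push extends smoothly by the identity beyond the
   chart.\<close>
 define C where "C = inv_into V \<kappa> ` cball k0 (2 * r)"
 have inv: "inv_into V \<kappa> (\<kappa> y) = y" if "y \<in> V" for y using aD(5) that by simp
 have sP1: "smooth_map X V X V (%y. inv_into V \<kappa> (M (\<kappa> y)))"
 proof (rule smooth_map_compose[OF X smooth_manifold_eu _ diffeo_inv_smooth[OF aD(3)]])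
  have "smooth_map eu (\<kappa> ` V) eu (\<kappa> ` V) M" unfolding smooth_map_eu by (intro conjI sM image_subsetI MK)
  then show "smooth_map X V eu (\<kappa> ` V) (%y. M (\<kappa> y))"
   by (rule smooth_map_compose[OF X smooth_manifold_eu diffeo_smooth[OF aD(3)]])
 qed
 have clC: "closedin (topo X) C"
 proof -
  have "continuous_map (subtopology euclidean (\<kappa> ` V)) (topo X) (inv_into V \<kappa>)"
   using smooth_map_continuous[OF diffeo_inv_smooth[OF aD(3)]] by (simp add: continuous_map_in_subtopology)
  then have "compactin (topo X) C" unfolding C_def
   using image_compactin[of "top_of_set (\<kappa> ` V)" "cball k0 (2 * r)"] r(2) by (simp add: compactin_subtopology)
  then show ?thesis using X compactin_imp_closedin by (auto simp: smooth_manifold_def)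
 qed
 have Pid: "P y = y" if "y \<notin> C" for y
 proof (cases "y \<in> V")
  case True
  then have "\<kappa> y \<notin> cball k0 (2 * r)" using that inv[OF True] by (force simp: C_def)
  then have "M (\<kappa> y) = \<kappa> y" using b(5)[of "\<kappa> y"] by (simp add: M_def)
  then show ?thesis using True inv by (simp add: P_def)
 qed (simp add: P_def)
 have CV: "C <= V" using r(2) by (auto simp: C_def intro: inv_into_into)
 have smP: "smooth_map X (carr X) X (carr X) P"
 proof (rule smooth_map_local[OF X])
  fix y assume y: "y \<in> carr X"
  show "EX G. openin (topo X) G & y \<in> G & smooth_map X (G Int carr X) X (carr X) P"
  proof (cases "y \<in> V")
   case True
   have "smooth_map X V X (carr X) (%y. inv_into V \<kappa> (M (\<kappa> y)))"
    by (rule smooth_map_subset[OF sP1]) (use smooth_map_in[OF sP1] in auto)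
   then have "smooth_map X V X (carr X) P"
    by (rule smooth_map_cong[OF X]) (simp add: P_def)
   then show ?thesis using aD(1,4) True by (metis inf_absorb1)
  next
   case False
   let ?G = "carr X - C"
   have "smooth_map X ?G X (carr X) P"
    by (rule smooth_map_cong[OF X smooth_map_ident[OF X]]) (auto simp: Pid)
   moreover have "openin (topo X) ?G" using clC by (simp add: openin_diff)
   moreover have "?G Int carr X = ?G" by auto
   ultimately show ?thesis using y False CV by (intro exI[of _ ?G]) auto
  qed
 qed simp
 have fixP: "P y = y" if "y \<in> fib z" for y
 proof (cases "y \<in> V")
  case True
  then have "fst (\<kappa> y) = 0" using adapted_arg(3)[OF a z True] that by (simp add: fib_def)
  then have "M (\<kappa> y) = \<kappa> y" by (simp add: M_def prod_eq_iff)
  then show ?thesis using True inv by (simp add: P_def)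
 qed (simp add: P_def)
 define G where "G = {y \<in> V. \<kappa> y \<in> ball k0 r}"
 have oG: "openin (topo X) G" unfolding G_def
  by (rule smooth_map_openin_preimage[OF diffeo_smooth[OF aD(3)]]) (use aD(1) in auto)
 have "P y \<in> fib z" if "y \<in> G" for y
 proof -
  have y: "y \<in> V" "M (\<kappa> y) = (0, snd (\<kappa> y))" using that b(4)[of "\<kappa> y"] by (auto simp: G_def M_def)
  have in1: "M (\<kappa> y) \<in> \<kappa> ` V" using MK y(1) by blast
  then have "P y \<in> V" "\<kappa> (P y) = M (\<kappa> y)" using y(1) by (auto simp: P_def inv_into_into f_inv_into_f)
  then show ?thesis using adaptedD(6)[OF a, of "P y"] y(2) aD(4) by (auto simp: fib_def)
 qed
 moreover have "p \<in> G" using pV r(1) by (simp add: G_def k0_def)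
 ultimately show ?thesis using that[OF smP fixP oG] by blast
qed

lemma closedin_fib: "closedin (topo X) (fib z)"
 using closedin_continuous_map_preimage[OF sfun_continuous[OF X _ sfun_h], of "{z}"]
 by (simp add: fib_def)

text \<open>Takes the place of a tubular neighbourhood: finitely many local pushes are composed.
  Each fixes the fiber pointwise. Near a fiber point of \<open>G i\<close> the earlier pushes still
  lead into \<open>G i\<close>, by continuity, and \<open>P i\<close> then moves to the fiber;
  points already pushed onto the fiber are not moved again.\<close>

lemma push_retraction:
 assumes "cmod z = 1"
 obtains P N where "smooth_map X (carr X) X (carr X) P" "!!y. y \<in> fib z ==> P y = y"
  "openin (topo X) N" "fib z <= N" "!!y. y \<in> N ==> P y \<in> fib z"
proof -
 have "ALL p:fib z. EX P G. smooth_map X (carr X) X (carr X) P & (ALL y:fib z. P y = y) &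
   openin (topo X) G & p \<in> G & (ALL y:G. P y \<in> fib z)"
  by (intro ballI, erule local_push) blast
 from bchoice[OF this] obtain P where "ALL p:fib z. EX G. smooth_map X (carr X) X (carr X) (P p) & (ALL y:fib z. P p y = y) &
   openin (topo X) G & p \<in> G & (ALL y:G. P p y \<in> fib z)" ..
 from bchoice[OF this] obtain G where "ALL p:fib z. smooth_map X (carr X) X (carr X) (P p) & (ALL y:fib z. P p y = y) &
   openin (topo X) (G p) & p \<in> G p & (ALL y:G p. P p y \<in> fib z)" ..
 then have PG: "!!p. p \<in> fib z ==> smooth_map X (carr X) X (carr X) (P p)"
  "!!p y. p \<in> fib z ==> y \<in> fib z ==> P p y = y" "!!p. p \<in> fib z ==> openin (topo X) (G p)"
  "!!p. p \<in> fib z ==> p \<in> G p" "!!p y. p \<in> fib z ==> y \<in> G p ==> P p y \<in> fib z"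
  by simp_all
 have "compactin (topo X) (fib z)"
  using closedin_compact_space[OF compact closedin_fib] .
 then have "EX \<F>. finite \<F> & \<F> <= G ` fib z & fib z <= \<Union>\<F>"
  by (rule compactinD) (use PG(3,4) in auto)
 then obtain \<F> where \<F>: "finite \<F>" "\<F> <= G ` fib z" "fib z <= \<Union>\<F>" by auto
 obtain I where I: "finite I" "I <= fib z" "\<F> = G ` I"
  using finite_subset_image[OF \<F>(1,2)] by auto
 have "EX Q. smooth_map X (carr X) X (carr X) Q & (ALL y:fib z. Q y = y) &
   (ALL y:fib z Int (\<Union>i\<in>I. G i). EX B. openin (topo X) B & y \<in> B & Q ` B <= fib z)"
  using I(1,2)
 proof (induction I)
  case empty
  then show ?case using smooth_map_ident[OF X order_refl] by auto
 next
  case (insert i I)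
  then have i: "i \<in> fib z" by auto
  obtain Q where Q: "smooth_map X (carr X) X (carr X) Q" "ALL y:fib z. Q y = y"
   "ALL y:fib z Int (\<Union>i\<in>I. G i). EX B. openin (topo X) B & y \<in> B & Q ` B <= fib z"
   using insert by auto
  show ?case
  proof (intro exI[of _ "%y. P i (Q y)"] conjI ballI)
   show "smooth_map X (carr X) X (carr X) (%y. P i (Q y))"
    by (rule smooth_map_compose[OF X X Q(1) PG(1)[OF i]])
   show "P i (Q y) = y" if "y \<in> fib z" for y using that Q(2) PG(2)[OF i] by simp
   fix y assume y: "y \<in> fib z Int (\<Union>i\<in>insert i I. G i)"
   show "EX B. openin (topo X) B & y \<in> B & (%y. P i (Q y)) ` B <= fib z"
   proof (cases "y \<in> G i")
    case True
    let ?B = "{x \<in> carr X. Q x \<in> G i}"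
    have "openin (topo X) ?B" by (rule smooth_map_openin_preimage[OF Q(1) PG(3)[OF i]]) simp
    moreover have "y \<in> ?B" using y True Q(2) fib_subset by auto
    ultimately show ?thesis using PG(5)[OF i] by (intro exI[of _ ?B]) auto
   next
    case False
    then obtain B where "openin (topo X) B" "y \<in> B" "Q ` B <= fib z" using Q(3) y by auto
    then show ?thesis using PG(2)[OF i] by (intro exI[of _ B]) auto
   qed
  qed
 qed
 then obtain Q where Q: "smooth_map X (carr X) X (carr X) Q" "ALL y:fib z. Q y = y"
   "ALL y:fib z Int (\<Union>i\<in>I. G i). EX B. openin (topo X) B & y \<in> B & Q ` B <= fib z" by blast
 define N where "N = \<Union>{B. openin (topo X) B & Q ` B <= fib z}"
 have "openin (topo X) N" unfolding N_def by (rule openin_Union) auto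
 moreover have "fib z <= N"
 proof
  fix y assume "y \<in> fib z"
  then have "y \<in> fib z Int (\<Union>i\<in>I. G i)" using \<F>(3) I(3) by auto
  then show "y \<in> N" using Q(3) unfolding N_def by blast
 qed
 moreover have "Q y \<in> fib z" if "y \<in> N" for y using that by (auto simp: N_def)
 ultimately show ?thesis using that[OF Q(1)] Q(2) by blast
qed

end

text \<open>The complement of \<open>G\<close> has compact image under \<open>k\<close>, and this
  image misses 0. In this way statements on a neighbourhood of a level set become statements on the
  preimage of an interval.\<close>

lemma tube_function:
 fixes k :: "'y => real"
 assumes Y: "compact_space Y" and k: "continuous_map Y euclidean k" and G: "openin Y G"
  and sub: "!!y. y \<in> topspace Y ==> k y = 0 ==> y \<in> G"
 obtains e where "e > 0" "!!y. y \<in> topspace Y ==> \<bar>k y\<bar> < e ==> y \<in> G"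
proof -
 let ?C = "topspace Y - G"
 have "compactin Y ?C" using closedin_compact_space[OF Y] G by (simp add: closedin_diff)
 then have "compact (k ` ?C)" using image_compactin[OF _ k] by simp
 then have "open (- (k ` ?C))" by (intro open_Compl compact_imp_closed)
 moreover have "0 \<in> - (k ` ?C)" using sub by auto
 ultimately obtain e where e: "e > 0" "ball 0 e <= - (k ` ?C)" using open_contains_ball by blast
 show ?thesis
 proof (rule that[OF e(1)])
  fix y assume y: "y \<in> topspace Y" "\<bar>k y\<bar> < e"
  then have "k y \<in> - (k ` ?C)" using e(2) by (auto simp: dist_norm)
  then show "y \<in> G" using y(1) by blast
 qed
qed

section \<open>Local triviality near a fiber\<close>

context circle_submersion
begin

text \<open>In adapted coordinates the map becomes \<open>M\<close>, which keeps the first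
  coordinate and is the identity on the slice \<open>fst k = 0\<close> near \<open>k0\<close>, as
  \<open>P\<close> fixes the fiber. Hence its derivative \<open>A\<close> preserves first components
  and fixes all \<open>(0, w)\<close>. A vector in its kernel has first component 0, so it is of the
  form \<open>(0, w)\<close> and vanishes. The inverse function theorem applies.\<close>

lemma Pair_push_local_inverse:
 assumes z: "cmod z = 1" and y0: "y0 \<in> fib z"
  and P: "smooth_map X (carr X) X (carr X) P" "!!y. y \<in> fib z ==> P y = y"
  and N: "openin (topo X) N" "fib z <= N" "!!y. y \<in> N ==> P y \<in> fib z"
 defines "B \<equiv> prod_manifold circle (level z)" and "\<Phi> \<equiv> (%x. (h x, P x))"
 obtains G g where "openin (topo X) G" "y0 \<in> G" "G <= N" "openin (topo B) (\<Phi> ` G)"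
  "smooth_map B (\<Phi> ` G) X G g" "!!x. x \<in> G ==> g (\<Phi> x) = x"
proof -
 have y0X: "y0 \<in> carr X" "h y0 = z" using y0 by (auto simp: fib_def)
 obtain V \<kappa> where a: "adapted z V \<kappa>" and yV: "y0 \<in> V" using adapted_exists[OF y0X(1)] y0X(2) by metis
 note aD = adaptedD[OF a]
 note L = smooth_manifold_level[OF z]
 have B: "smooth_manifold B" unfolding B_def
  by (rule smooth_manifold_prod[OF smooth_manifold_circle L(1) mboundary_circle])
 have inv: "inv_into V \<kappa> (\<kappa> y) = y" if "y \<in> V" for y using aD(5) that by simp
 have V0: "\<kappa> y = (0, snd (\<kappa> y))" if "y \<in> V" "y \<in> fib z" for y
  using adapted_arg(3)[OF a z that(1)] that(2) by (simp add: fib_def prod_eq_iff)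
 define K1 where "K1 = \<kappa> ` {y \<in> V Int N. P y \<in> V}"
 have oA: "openin (topo X) {y \<in> V Int N. P y \<in> V}"
  by (rule smooth_map_openin_preimage[OF smooth_map_subset[OF P(1)] aD(1)])
   (use aD(1,4) N(1) smooth_map_in[OF P(1)] in auto)
 have K1V: "K1 <= \<kappa> ` V" by (auto simp: K1_def)
 have oK1: "open K1"
 proof -
  have "openin (topo (eu :: (real \<times> (real^3), _) manifold)) {k \<in> \<kappa> ` V. inv_into V \<kappa> k \<in> {y \<in> V Int N. P y \<in> V}}"
   by (rule smooth_map_openin_preimage[OF diffeo_inv_smooth[OF aD(3)] oA]) (use aD(2) in auto)
  moreover have "{k \<in> \<kappa> ` V. inv_into V \<kappa> k \<in> {y \<in> V Int N. P y \<in> V}} = K1"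
   using inv by (auto simp: K1_def)
  ultimately show ?thesis by simp
 qed
 have inK1: "inv_into V \<kappa> k \<in> V & inv_into V \<kappa> k \<in> N & P (inv_into V \<kappa> k) \<in> V & \<kappa> (inv_into V \<kappa> k) = k"
  if "k \<in> K1" for k using that inv by (auto simp: K1_def)
 define M where "M k = (fst k, snd (\<kappa> (P (inv_into V \<kappa> k))))" for k
 have c1: "smooth_map eu K1 X {y \<in> V Int N. P y \<in> V} (inv_into V \<kappa>)"
  by (rule smooth_map_subset[OF diffeo_inv_smooth[OF aD(3)]]) (use inK1 K1V in auto)
 have c2: "smooth_map X {y \<in> V Int N. P y \<in> V} X V P"
  by (rule smooth_map_subset[OF P(1)]) (use aD(4) in auto)
 from smooth_map_compose[OF smooth_manifold_eu X smooth_map_compose[OF smooth_manifold_eu X c1 c2]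
   diffeo_smooth[OF aD(3)]]
 have "smooth_on K1 (%k. \<kappa> (P (inv_into V \<kappa> k)))" by (simp add: smooth_map_eu)
 then have sM: "smooth_on K1 M" unfolding M_def
  by (intro smooth_on_Pair smooth_on_fst smooth_on_snd smooth_on_ident)
 then have cM: "Cinf K1 M" using oK1 smooth_on_open by blast
 define k0 where "k0 = \<kappa> y0"
 have k0: "k0 \<in> K1" using yV y0 N(2) P(2)[OF y0] by (auto simp: k0_def K1_def)
 have k00: "k0 = (0, snd k0)" unfolding k0_def using V0[OF yV y0] .
 obtain A where A: "(M has_derivative A) (at k0)" using Cinf_derivative[OF cM oK1] k0 by metis
 have linA: "linear A" using A has_derivative_linear by blast
 have "fst (A v) = fst v" for v
 proof -
  have "((%k. fst (M k)) has_derivative (%v. fst (A v))) (at k0)" by (rule has_derivative_fst[OF A])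
  moreover have "((%k. fst (M k)) has_derivative fst) (at k0)"
   by (simp add: M_def bounded_linear_imp_has_derivative bounded_linear_fst)
  ultimately show ?thesis using has_derivative_unique by metis
 qed
 moreover have "A (0, w) = (0, w)" for w
 proof -
  have e0: "k0 + 0 *\<^sub>R (0, w) = k0" by (simp only: scaleR_zero_left add_0_right)
  have bl: "bounded_linear (%t::real. t *\<^sub>R (0::real, w))" by (rule bounded_linear_scaleR_left)
  have d: "((%t::real. k0 + t *\<^sub>R (0, w)) has_derivative (%t. t *\<^sub>R (0, w))) (at 0)"
   using has_derivative_add[OF has_derivative_const bounded_linear_imp_has_derivative[OF bl]] by simp
  have "((%t. M (k0 + t *\<^sub>R (0, w))) has_derivative (%t. A (t *\<^sub>R (0, w)))) (at 0)"
  proof -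
   have "(M has_derivative A) (at (k0 + 0 *\<^sub>R (0, w)))" unfolding e0 by (rule A)
   from diff_chain_at[OF d this] show ?thesis by (simp only: o_def)
  qed
  moreover have "((%t. M (k0 + t *\<^sub>R (0, w))) has_derivative (%t. t *\<^sub>R (0, w))) (at 0)"
  proof (rule has_derivative_transform_within_open[OF d])
   show "open ((%t::real. k0 + t *\<^sub>R (0, w)) -` K1)"
    by (rule open_vimage[OF oK1]) (intro continuous_intros)
   show "0 \<in> (%t::real. k0 + t *\<^sub>R (0, w)) -` K1" unfolding vimage_eq e0 by (rule k0)
   fix t assume "t \<in> (%t::real. k0 + t *\<^sub>R (0, w)) -` K1"
   then have t: "k0 + t *\<^sub>R (0, w) \<in> K1" by simp
   let ?x = "inv_into V \<kappa> (k0 + t *\<^sub>R (0, w))"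
   have x: "?x \<in> V" "\<kappa> ?x = k0 + t *\<^sub>R (0, w)" using inK1[OF t] by auto
   have f0: "fst (k0 + t *\<^sub>R (0, w)) = 0" by (subst k00) simp
   then have "?x \<in> fib z" using adapted_arg(3)[OF a z x(1)] x aD(4) by (auto simp: fib_def)
   then have "M (k0 + t *\<^sub>R (0, w)) = (fst (k0 + t *\<^sub>R (0, w)), snd (k0 + t *\<^sub>R (0, w)))"
    unfolding M_def using P(2) x(2) by simp
   then show "k0 + t *\<^sub>R (0, w) = M (k0 + t *\<^sub>R (0, w))" by (simp only: prod.collapse)
  qed
  ultimately have "(%t. A (t *\<^sub>R (0, w))) = (%t. t *\<^sub>R (0, w))" by (rule has_derivative_unique)
  then have "A (1 *\<^sub>R (0, w)) = 1 *\<^sub>R (0, w)" by metis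
  then show ?thesis by simp
 qed
 ultimately have "v = 0" if "A v = 0" for v
 proof -
  have "fst v = 0" using \<open>!!v. fst (A v) = fst v\<close>[of v] that by simp
  then have "v = (0, snd v)" by (simp add: prod_eq_iff)
  then show ?thesis using \<open>!!w. A (0, w) = (0, w)\<close>[of "snd v"] that by simp
 qed
 then have injA: "inj A" using linA linear_injective_0 by blast
 obtain K2 K3 m where ift: "open K2" "k0 \<in> K2" "K2 <= K1" "open K3" "homeomorphism K2 K3 M m" "Cinf K3 m"
  by (rule smooth_inverse_function[where 'n=4, OF _ _ oK1 cM k0 A injA]) simp_all
 have mM: "m (M k) = k" "M k \<in> K3" if "k \<in> K2" for k using ift(5) that by (auto simp: homeomorphism_def)
 have Mm: "M (m k) = k" "m k \<in> K2" if "k \<in> K3" for k using ift(5) that by (auto simp: homeomorphism_def)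
 define G where "G = {y \<in> V. \<kappa> y \<in> K2}"
 have oG: "openin (topo X) G" unfolding G_def
  by (rule smooth_map_openin_preimage[OF diffeo_smooth[OF aD(3)]]) (use aD(1) ift(1) in auto)
 have GN: "G <= N"
 proof
  fix y assume "y \<in> G"
  then have "\<kappa> y \<in> K1" "y \<in> V" using ift(3) by (auto simp: G_def)
  then show "y \<in> N" using inK1[of "\<kappa> y"] inv by auto
 qed
 have MG: "M (\<kappa> x) = (arg0 (h x * cnj z), snd (\<kappa> (P x)))" "P x \<in> V" if "x \<in> G" for x
 proof -
  have x: "x \<in> V" "\<kappa> x \<in> K1" using that ift(3) by (auto simp: G_def)
  show "M (\<kappa> x) = (arg0 (h x * cnj z), snd (\<kappa> (P x)))"
   by (simp add: M_def inv[OF x(1)] adapted_arg(1)[OF a z x(1)])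
  show "P x \<in> V" using inK1[OF x(2)] inv[OF x(1)] by simp
 qed
 define S1 where "S1 = {w \<in> sphere 0 1. Re (w * cnj z) > 0}"
 define W0 where "W0 = S1 \<times> (V Int fib z)"
 define q where "q = (%(w, b). (arg0 (w * cnj z), snd (\<kappa> b)))"
 have oS1: "openin (topo circle) S1"
 proof -
  have "S1 = sphere 0 1 Int {w. Re (w * cnj z) > 0}" by (auto simp: S1_def)
  moreover have "open {w. Re (w * cnj z) > 0}" by (intro open_Collect_less continuous_intros)
  ultimately show ?thesis by (auto simp: openin_open)
 qed
 have oVf: "openin (topo (level z)) (V Int fib z)"
  using openin_subtopology_Int[OF aD(1), of "fib z"] by (simp add: level_def)
 have oW0: "openin (topo B) W0" using oS1 oVf by (simp add: B_def W0_def openin_prod_Times_iff)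
 have W0B: "W0 <= carr B" using openin_subset[OF oW0] .
 have sq: "smooth_map B W0 eu UNIV q"
 proof -
  have "smooth_map B W0 circle S1 fst" "smooth_map B W0 (level z) (V Int fib z) snd"
   unfolding B_def W0_def
   by (rule smooth_map_fst[OF smooth_manifold_circle L(1) mboundary_circle],
     rule smooth_map_snd[OF smooth_manifold_circle L(1) mboundary_circle])
  moreover have "sfun circle S1 (%w. arg0 (w * cnj z))"
   by (intro sfun_arg0 smooth_manifold_circle sfun_mult sfun_circle sfun_const) (simp add: S1_def)
  then have "smooth_map circle S1 eu UNIV (%w. arg0 (w * cnj z))"
   using smooth_map_to_eu[OF smooth_manifold_circle] openin_subset[OF oS1] by auto
  moreover have "smooth_map (level z) (V Int fib z) eu UNIV (%b. snd (\<kappa> b))"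
   by (rule smooth_map_subset[OF chart_smooth[OF L(1) adapted_level_chart[OF a z]]]) auto
  ultimately have "smooth_map B W0 eu UNIV (%p. arg0 (fst p * cnj z))" "smooth_map B W0 eu UNIV (%p. snd (\<kappa> (snd p)))"
   using smooth_map_compose[OF B smooth_manifold_circle] smooth_map_compose[OF B L(1)] by blast+
  then have "sfun B W0 (%p. (arg0 (fst p * cnj z), snd (\<kappa> (snd p))))"
   by (intro sfun_Pair smooth_map_to_eu[OF B W0B, THEN iffD1, THEN conjunct1])
  then show ?thesis by (intro smooth_map_to_eu[OF B W0B, THEN iffD2]) (simp add: q_def case_prod_unfold)
 qed
 have qK: "q (\<Phi> x) = M (\<kappa> x)" if "x \<in> G" for x using MG[OF that] by (simp add: q_def \<Phi>_def)
 \<comment> \<open>The image is the preimage of the open set \<open>K3\<close> under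
   \<open>q\<close> and therefore open in the product. A preimage \<open>x\<close> of
   \<open>(w, b)\<close> is found by solving in coordinates: equal angles give
   \<open>h x = w\<close>, and equal second coordinates on the fiber give
   \<open>P x = b\<close>.\<close>
 have im: "\<Phi> ` G = {p \<in> W0. q p \<in> K3}"
 proof (intro set_eqI iffI)
  fix p assume "p \<in> \<Phi> ` G"
  then obtain x where x: "x \<in> G" "p = \<Phi> x" by blast
  then have xV: "x \<in> V" "\<kappa> x \<in> K2" by (auto simp: G_def)
  have "cmod (h x) = 1" using norm_h aD(4) xV by auto
  then have "p \<in> W0" using x MG(2)[OF x(1)] N(3)[of x] GN adapted_arg(2)[OF a z xV(1)]
   by (auto simp: \<Phi>_def W0_def S1_def)
  moreover have "q p \<in> K3" using qK[OF x(1)] x(2) mM(2)[OF xV(2)] by simp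
  ultimately show "p \<in> {p \<in> W0. q p \<in> K3}" by simp
 next
  fix p assume p: "p \<in> {p \<in> W0. q p \<in> K3}"
  obtain w b where wb: "p = (w, b)" by (cases p)
  have w: "cmod w = 1" "Re (w * cnj z) > 0" and b: "b \<in> V" "b \<in> fib z" and qp: "q p \<in> K3"
   using p by (auto simp: wb W0_def S1_def)
  define k where "k = m (q p)"
  have k: "k \<in> K2" "M k = q p" using Mm[OF qp] by (auto simp: k_def)
  have kK1: "k \<in> K1" using k(1) ift(3) by auto
  define x where "x = inv_into V \<kappa> k"
  have x: "x \<in> V" "\<kappa> x = k" "P x \<in> V" "x \<in> N" using inK1[OF kK1] by (auto simp: x_def)
  have xG: "x \<in> G" using x k(1) by (simp add: G_def)
  have eq: "fst k = arg0 (w * cnj z)" "snd (\<kappa> (P x)) = snd (\<kappa> b)"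
   using k(2) by (auto simp: M_def q_def wb x_def)
  have "h x = z * cis (arg0 (w * cnj z))" using adaptedD(6)[OF a x(1)] x(2) eq(1) by simp
  moreover have "cis (arg0 (w * cnj z)) = w * cnj z"
   using cis_arg0[OF w(2)] w(1) z by (simp add: norm_mult)
  ultimately have "h x = (z * cnj z) * w" by (simp add: mult_ac)
  then have hx: "h x = w" using unit_mult_cnj[OF z] by simp
  have "\<kappa> (P x) = \<kappa> b" using V0[OF x(3) N(3)[OF x(4)]] V0[OF b] eq(2) by metis
  then have "P x = b" using aD(5) x(3) b(1) by (auto dest: inj_onD)
  then show "p \<in> \<Phi> ` G" using hx xG by (auto simp: \<Phi>_def wb)
 qed
 have oim: "openin (topo B) (\<Phi> ` G)"
  unfolding im by (rule smooth_map_openin_preimage[OF sq _ oW0]) (use ift(4) in auto)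
 have "smooth_map B (\<Phi> ` G) X V (%p. inv_into V \<kappa> (m (q p)))"
 proof (rule smooth_map_compose[OF B smooth_manifold_eu _ diffeo_inv_smooth[OF aD(3)]])
  have "smooth_map B (\<Phi> ` G) eu K3 q" by (rule smooth_map_subset[OF sq]) (auto simp: im)
  moreover have "smooth_map eu K3 eu (\<kappa> ` V) m"
   unfolding smooth_map_eu smooth_on_open[OF ift(4)]
   by (intro conjI ift(6) image_subsetI subsetD[OF K1V] subsetD[OF ift(3)] Mm(2))
  ultimately show "smooth_map B (\<Phi> ` G) eu (\<kappa> ` V) (%p. m (q p))"
   by (rule smooth_map_compose[OF B smooth_manifold_eu])
 qed
 moreover have gx: "inv_into V \<kappa> (m (q (\<Phi> x))) = x" if "x \<in> G" for x
  using qK[OF that] mM(1)[of "\<kappa> x"] that inv[of x] by (simp add: G_def)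
 ultimately have sg: "smooth_map B (\<Phi> ` G) X G (%p. inv_into V \<kappa> (m (q p)))"
  by (elim smooth_map_subset) auto
 have "y0 \<in> G" using yV ift(2) by (simp add: G_def k0_def)
 then show ?thesis using that[OF oG _ GN oim sg gx] by simp
qed

text \<open>The pair of \<open>h\<close> and the retraction is a local diffeomorphism at all points
  of the fiber. Compactness is used three times to pass to all points with \<open>h x\<close> close
  to \<open>z\<close>: \<open>e1\<close> puts them in the region with local inverses,
  \<open>e2\<close> makes the pair injective there, and \<open>e3\<close> makes it onto a
  product.\<close>

lemma local_trivialization_exists:
 assumes z: "cmod z = 1"
 obtains U \<Phi> where "z \<in> U" "local_trivialization X circle (level z) h U \<Phi>"
proof -
 define B where "B = prod_manifold circle (level z)"
 note L = smooth_manifold_level[OF z]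
 have B: "smooth_manifold B" unfolding B_def
  by (rule smooth_manifold_prod[OF smooth_manifold_circle L(1) mboundary_circle])
 obtain P N where P: "smooth_map X (carr X) X (carr X) P" "!!y. y \<in> fib z ==> P y = y"
  and N: "openin (topo X) N" "fib z <= N" "!!y. y \<in> N ==> P y \<in> fib z"
  using push_retraction[OF z] by metis
 define \<Phi> where "\<Phi> = (%x. (h x, P x))"
 define good where "good G g \<longleftrightarrow> openin (topo X) G & G <= N & openin (topo B) (\<Phi> ` G) &
  smooth_map B (\<Phi> ` G) X G g & (ALL x:G. g (\<Phi> x) = x)" for G g
 define N1 where "N1 = \<Union>{G. EX g. good G g}"
 have goodat: "EX G g. good G g & y \<in> G" if "y \<in> fib z" for y
 proof -
  obtain G g where "openin (topo X) G" "y \<in> G" "G <= N" "openin (topo B) (\<Phi> ` G)"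
   "smooth_map B (\<Phi> ` G) X G g" "!!x. x \<in> G ==> g (\<Phi> x) = x"
   unfolding B_def \<Phi>_def by (rule Pair_push_local_inverse[OF z \<open>y \<in> fib z\<close> P N]) (assumption, assumption, rule that[unfolded B_def \<Phi>_def])
  then show ?thesis by (intro exI[of _ G] exI[of _ g]) (simp add: good_def)
 qed
 have oN1: "openin (topo X) N1" unfolding N1_def by (rule openin_Union) (auto simp: good_def)
 have fN1: "fib z <= N1" using goodat by (fastforce simp: N1_def)
 have N1N: "N1 <= N" by (auto simp: N1_def good_def)
 have ch: "continuous_map (topo X) euclidean h" using sfun_continuous[OF X _ sfun_h] by simp
 have cd: "continuous_map euclidean euclidean (%w. cmod (w - z))"
  by (auto intro!: continuous_intros)
 have ck: "continuous_map (topo X) euclidean (%x. cmod (h x - z))"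
  using continuous_map_compose[OF ch cd] by (simp add: o_def)
 obtain e1 where e1: "e1 > 0" "!!x. x \<in> carr X ==> cmod (h x - z) < e1 ==> x \<in> N1"
  by (rule tube_function[OF compact ck oN1]) (use fN1 in \<open>auto simp: fib_def\<close>)
 \<comment> \<open>An open set of pairs on which the map separates points. It contains
   \<open>fib z \<times> fib z\<close>: on the diagonal by the local inverses, and off it because
   \<open>P\<close> fixes the fiber and distinct points of the fiber have disjoint
   neighbourhoods.\<close>
 define GG where "GG = \<Union>{A \<times> A' | A A'. openin (topo X) A & openin (topo X) A' & (ALL a:A. ALL b:A'. \<Phi> a = \<Phi> b --> a = b)}"
 have oGG: "openin (prod_topology (topo X) (topo X)) GG"
  unfolding GG_def by (rule openin_Union) (auto simp: openin_prod_Times_iff)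
 have GG: "(a, b) \<in> GG" if ab: "a \<in> fib z" "b \<in> fib z" for a b
 proof (cases "a = b")
  case True
  obtain G g where g: "good G g" "a \<in> G" using goodat[OF ab(1)] by blast
  have "x = y" if "x \<in> G" "y \<in> G" "\<Phi> x = \<Phi> y" for x y using g(1) that unfolding good_def by metis
  then show ?thesis unfolding GG_def using g True by (intro UnionI[of "G \<times> G"]) (auto simp: good_def)
 next
  case False
  obtain A0 B0 where AB: "openin (topo X) A0" "openin (topo X) B0" "a \<in> A0" "b \<in> B0" "disjnt A0 B0"
  proof -
   have "Hausdorff_space (topo X)" using X by (simp add: smooth_manifold_def)
   then have "a \<in> carr X & b \<in> carr X & a ~= b -->
     (EX U V. openin (topo X) U & openin (topo X) V & a \<in> U & b \<in> V & disjnt U V)"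
    unfolding Hausdorff_space_def by (elim allE)
   moreover have "a \<in> carr X" "b \<in> carr X" using ab by (auto simp: fib_def)
   ultimately have "EX U V. openin (topo X) U & openin (topo X) V & a \<in> U & b \<in> V & disjnt U V"
    using False by simp
   then show ?thesis using that by auto
  qed
  let ?A = "{x \<in> carr X. P x \<in> A0}" and ?B = "{x \<in> carr X. P x \<in> B0}"
  have "openin (topo X) ?A" "openin (topo X) ?B"
   by (rule smooth_map_openin_preimage[OF P(1)]; use AB in simp)+
  moreover have "a \<in> ?A" "b \<in> ?B" using AB P(2) ab fib_subset by auto
  moreover have "x = y" if "x \<in> ?A" "y \<in> ?B" "\<Phi> x = \<Phi> y" for x y
   using that AB(5) by (auto simp: \<Phi>_def disjnt_iff)
  ultimately show ?thesis unfolding GG_def by (intro UnionI[of "?A \<times> ?B"]) auto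
 qed
 have ck2: "continuous_map (prod_topology (topo X) (topo X)) euclidean (%p. cmod (h (fst p) - z) + cmod (h (snd p) - z))"
  using continuous_map_compose[OF continuous_map_fst ck] continuous_map_compose[OF continuous_map_snd ck]
  by (intro continuous_map_add) (auto simp: o_def)
 have cXX: "compact_space (prod_topology (topo X) (topo X))" using compact by (simp add: compact_space_prod_topology)
 obtain e2 where e2: "e2 > 0" "!!p. p \<in> carr X \<times> carr X ==>
   \<bar>cmod (h (fst p) - z) + cmod (h (snd p) - z)\<bar> < e2 ==> p \<in> GG"
 proof (rule tube_function[OF cXX ck2 oGG])
  fix p assume p: "p \<in> topspace (prod_topology (topo X) (topo X))" "cmod (h (fst p) - z) + cmod (h (snd p) - z) = 0"
  then have "cmod (h (fst p) - z) = 0" "cmod (h (snd p) - z) = 0"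
   using norm_ge_zero[of "h (fst p) - z"] norm_ge_zero[of "h (snd p) - z"] by linarith+
  then show "p \<in> GG" using p(1) GG[of "fst p" "snd p"] by (auto simp: fib_def)
 qed auto
 have carrB: "carr B = sphere 0 1 \<times> fib z" by (simp add: B_def carr_level)
 have cB: "compact_space (topo B)"
  using compact closedin_compact_space[OF compact closedin_fib, of z]
  by (simp add: B_def level_def compact_space_prod_topology compact_space_subtopology)
 have oPN1: "openin (topo B) (\<Phi> ` N1)"
 proof -
  have "\<Phi> ` N1 = \<Union>{\<Phi> ` G | G. EX g. good G g}" by (auto simp: N1_def)
  moreover have "openin (topo B) (\<Union>{\<Phi> ` G | G. EX g. good G g})"
   by (rule openin_Union) (auto simp: good_def)
  ultimately show ?thesis by simp
 qed
 have "continuous_map (topo B) euclidean (%p. cmod (fst p - z))"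
  using continuous_map_compose[OF continuous_map_fst continuous_map_from_subtopology[OF cd],
   of "sphere 0 1" "topo (level z)"]
  by (simp add: B_def o_def)
 then obtain e3 where e3: "e3 > 0" "!!p. p \<in> carr B ==> \<bar>cmod (fst p - z)\<bar> < e3 ==> p \<in> \<Phi> ` N1"
 proof (rule tube_function[OF cB _ oPN1])
  fix p assume p: "p \<in> carr B" "cmod (fst p - z) = 0"
  have y: "snd p \<in> fib z" using p(1) unfolding carrB by (simp add: mem_Times_iff)
  have "fst p = z" using p(2) by simp
  have "h (snd p) = z" using y(1) by (simp add: fib_def)
  then have "\<Phi> (snd p) = p" using P(2)[OF y] \<open>fst p = z\<close> by (intro prod_eqI) (simp_all add: \<Phi>_def)
  then show "p \<in> \<Phi> ` N1" using fN1 y by (metis image_eqI subsetD)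
 qed auto
 \<comment> \<open>Half of \<open>e2\<close>, because there the sum of two distances has to stay
   below the bound.\<close>
 define e where "e = min e1 (min (e2 / 2) e3)"
 define U where "U = sphere 0 1 Int ball z e"
 have epos: "e > 0" using e1 e2 e3 by (simp add: e_def)
 have zU: "z \<in> U" using z epos by (simp add: U_def)
 have oU: "openin (topo circle) U" by (auto simp: U_def openin_open)
 have Ue: "cmod (w - z) < e" if "w \<in> U" for w using that by (simp add: U_def dist_norm norm_minus_commute)
 define S where "S = {x \<in> carr X. h x \<in> U}"
 have SN1: "S <= N1" using e1(2) Ue by (auto simp: S_def e_def)
 have inj: "inj_on \<Phi> S"
 proof (rule inj_onI)
  fix a b assume ab: "a \<in> S" "b \<in> S" "\<Phi> a = \<Phi> b"
  have "(a, b) \<in> GG"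
   using e2(2)[of "(a, b)"] ab Ue[of "h a"] Ue[of "h b"] by (auto simp: S_def e_def)
  then show "a = b" using ab(3) by (auto simp: GG_def)
 qed
 have im: "\<Phi> ` S = U \<times> fib z"
 proof (intro set_eqI iffI)
  fix p assume "p \<in> \<Phi> ` S"
  then show "p \<in> U \<times> fib z" using N(3) N1N SN1 by (auto simp: \<Phi>_def S_def)
 next
  fix p assume p: "p \<in> U \<times> fib z"
  then have "p \<in> carr B" unfolding carrB by (auto simp: U_def)
  then have "p \<in> \<Phi> ` N1" using e3(2)[of p] Ue[of "fst p"] p by (auto simp: e_def)
  then obtain x where x: "x \<in> N1" "p = \<Phi> x" by blast
  then have "x \<in> S" using p openin_subset[OF oN1] by (auto simp: S_def \<Phi>_def)
  then show "p \<in> \<Phi> ` S" using x by blast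
 qed
 have SX: "S <= carr X" by (auto simp: S_def)
 have sPhi: "smooth_map X S B (U \<times> fib z) \<Phi>"
  unfolding B_def \<Phi>_def
 proof (rule smooth_map_Pair[OF X])
  show "smooth_map X S circle U h"
   unfolding smooth_map_circle[OF X SX] using sfun_subset[OF sfun_h SX] by (auto simp: S_def U_def)
  have "smooth_map X S X (fib z) P"
   by (rule smooth_map_subset[OF P(1) SX]) (use N(3) N1N SN1 in auto)
  then show "smooth_map X S (level z) (fib z) P"
   by (rule smooth_map_into_submanifold[OF X fib_subset level_def X]) simp
 qed
 have sinv: "smooth_map B (U \<times> fib z) X S (inv_into S \<Phi>)"
 proof (rule smooth_map_local[OF B])
  show UB: "U \<times> fib z <= carr B" unfolding carrB by (auto simp: U_def)
  fix p assume "p \<in> U \<times> fib z"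
  then obtain x where x: "x \<in> S" "p = \<Phi> x" using im by blast
  then obtain G g where g: "good G g" "x \<in> G" using SN1 by (auto simp: N1_def)
  have GX: "G <= carr X" using g(1) openin_subset by (auto simp: good_def)
  have pre: "EX x'. x' \<in> G Int S & q = \<Phi> x'" if q: "q \<in> \<Phi> ` G Int U \<times> fib z" for q
  proof -
   obtain x' where x': "x' \<in> G" "q = \<Phi> x'" using q by blast
   then have "x' \<in> S" using q GX by (auto simp: S_def \<Phi>_def)
   then show ?thesis using x' by blast
  qed
  have gPhi: "g (\<Phi> x') = x'" if "x' \<in> G" for x' using g(1) that by (simp add: good_def)
  have "smooth_map B (\<Phi> ` G Int U \<times> fib z) X S (inv_into S \<Phi>)"
  proof (rule smooth_map_cong[OF B])
   show "smooth_map B (\<Phi> ` G Int U \<times> fib z) X S g"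
   proof (rule smooth_map_subset)
    show "smooth_map B (\<Phi> ` G) X G g" using g(1) by (simp add: good_def)
    show "g q \<in> S" if "q \<in> \<Phi> ` G Int U \<times> fib z" for q using pre[OF that] gPhi by auto
   qed auto
   show "g q = inv_into S \<Phi> q" if "q \<in> \<Phi> ` G Int U \<times> fib z" for q using pre[OF that] gPhi inj by auto
  qed
  moreover have "openin (topo B) (\<Phi> ` G)" using g(1) by (simp add: good_def)
  ultimately show "EX G. openin (topo B) G & p \<in> G & smooth_map B (G Int U \<times> fib z) X S (inv_into S \<Phi>)"
   using x(2) g(2) by blast
 qed
 have "local_trivialization X circle (level z) h U \<Phi>"
  unfolding local_trivialization_def carr_level
  using oU inj im sPhi sinv by (auto simp: diffeo_def bij_betw_def S_def B_def \<Phi>_def)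
 then show ?thesis by (rule that[OF zU])
qed

section \<open>Identification of the fibers with one another\<close>

lemma fiber_diffeo:
 fixes F :: "('b, 'd::euclidean_space) manifold"
 assumes F: "smooth_manifold F" and lt: "local_trivialization X circle F h U \<Phi>" and w: "w \<in> U"
 defines "d \<equiv> %y. inv_into {e \<in> carr X. h e \<in> U} \<Phi> (w, y)"
 shows "diffeo F (carr F) (level w) (fib w) d"
  and "!!e. e \<in> carr X ==> h e = w ==> snd (\<Phi> e) \<in> carr F & d (snd (\<Phi> e)) = e"
proof -
 let ?S = "{e \<in> carr X. h e \<in> U}" and ?B = "prod_manifold circle F"
 have oU: "openin (topo circle) U" and df: "diffeo X ?S ?B (U \<times> carr F) \<Phi>"
  and fs: "!!e. e \<in> ?S ==> fst (\<Phi> e) = h e"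
  using lt by (auto simp: local_trivialization_def)
 have U1: "U <= carr circle" using openin_subset[OF oU] .
 then have w1: "cmod w = 1" using w by auto
 note L = smooth_manifold_level[OF w1]
 have B: "smooth_manifold ?B" by (rule smooth_manifold_prod[OF smooth_manifold_circle F mboundary_circle])
 show *: "snd (\<Phi> e) \<in> carr F & d (snd (\<Phi> e)) = e" if "e \<in> carr X" "h e = w" for e
 proof -
  have e: "e \<in> ?S" using that w by simp
  have "\<Phi> e = (w, snd (\<Phi> e))" using fs[OF e] that(2) by (metis prod.collapse)
  moreover have "snd (\<Phi> e) \<in> carr F" using diffeo_in[OF df e] by (auto simp: mem_Times_iff)
  ultimately show ?thesis using diffeo_inv_left[OF df e] by (auto simp: d_def)
 qed
 have dy: "d y \<in> ?S" "\<Phi> (d y) = (w, y)" if "y \<in> carr F" for y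
  using diffeo_inv_in[OF df, of "(w, y)"] diffeo_inv_right[OF df, of "(w, y)"] w that by (auto simp: d_def)
 have dfib: "d y \<in> fib w" if "y \<in> carr F" for y
  using dy[OF that] fs[OF dy(1)[OF that]] by (simp add: fib_def)
 show "diffeo F (carr F) (level w) (fib w) d"
 proof (rule diffeoI[OF L(1)])
  have "smooth_map F (carr F) ?B (U \<times> carr F) (%y. (w, y))"
   by (rule smooth_map_Pair[OF F _ smooth_map_ident[OF F]])
    (use w w1 in \<open>auto simp: smooth_map_circle[OF F] sfun_const\<close>)
  from smooth_map_compose[OF F B this diffeo_inv_smooth[OF df]]
  have "smooth_map F (carr F) X (fib w) d"
   unfolding d_def[symmetric] by (rule smooth_map_subset) (use dfib in auto)
  then show "smooth_map F (carr F) (level w) (fib w) d"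
   by (rule smooth_map_into_submanifold[OF X fib_subset level_def F]) simp
  have 1: "smooth_map (level w) (fib w) X (fib w) (%x. x)"
   by (rule smooth_map_submanifold_incl[OF X fib_subset level_def]) simp
  have "fib w <= ?S" using w by (auto simp: fib_def)
  then have "smooth_map X (fib w) ?B (U \<times> carr F) \<Phi>"
   by (rule smooth_map_subset[OF diffeo_smooth[OF df]]) (use diffeo_in[OF df] \<open>fib w <= ?S\<close> in auto)
  then have "smooth_map X (fib w) F (carr F) (%x. snd (\<Phi> x))"
   using smooth_map_compose[OF X B _ smooth_map_snd[OF smooth_manifold_circle F mboundary_circle]] by blast
  with 1 show "smooth_map (level w) (fib w) F (carr F) (%x. snd (\<Phi> x))"
   by (rule smooth_map_compose[OF L(1) X])
  show "snd (\<Phi> (d y)) = y" if "y \<in> carr F" for y using dy[OF that] by simp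
  show "d (snd (\<Phi> e)) = e" if "e \<in> fib w" for e using * that by (simp add: fib_def)
  show "fib w <= carr (level w)" by (simp add: carr_level)
 qed simp
qed

text \<open>A local trivialization identifies all fibers over its domain, so being diffeomorphic is
  an equivalence relation with open classes on the connected circle.\<close>

lemma level_diffeo:
 assumes "cmod z = 1" "cmod w = 1"
 shows "EX d. diffeo (level z) (fib z) (level w) (fib w) d"
proof -
 have inv: "EX d. diffeo (level b) (fib b) (level a) (fib a) d"
  if "diffeo (level a) (fib a) (level b) (fib b) d" "cmod a = 1" for a b d
  using diffeo_inverse[OF smooth_manifold_level(1)[OF that(2)] that(1)] by (auto simp: carr_level)
 have trans: "EX d. diffeo (level a) (fib a) (level c) (fib c) d"
  if "diffeo (level a) (fib a) (level b) (fib b) d" "diffeo (level b) (fib b) (level c) (fib c) d'"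
   "cmod a = 1" "cmod b = 1" "cmod c = 1" for a b c d d'
  using diffeo_compose[OF smooth_manifold_level(1)[OF that(3)] smooth_manifold_level(1)[OF that(4)]
    smooth_manifold_level(1)[OF that(5)] that(1,2)] by (auto simp: carr_level)
 have conn: "connected (sphere (0::complex) 1)" by (rule connected_sphere) simp
 show ?thesis
 proof (rule connected_equivalence_relation[OF conn, where R="%a b. EX d. diffeo (level a) (fib a) (level b) (fib b) d"])
  show "EX T. openin (top_of_set (sphere 0 1)) T & a \<in> T & (ALL x:T. EX d. diffeo (level a) (fib a) (level x) (fib x) d)"
   if "a \<in> sphere 0 1" for a :: complex
  proof -
   have a: "cmod a = 1" using that by simp
   obtain U \<Phi> where U: "a \<in> U" "local_trivialization X circle (level a) h U \<Phi>"
    using local_trivialization_exists[OF a] by metis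
   have "openin (top_of_set (sphere 0 1)) U" using U(2) by (simp add: local_trivialization_def)
   then show ?thesis
    using U fiber_diffeo(1)[OF smooth_manifold_level(1)[OF a] U(2)] by (auto simp: carr_level)
  qed
  show "z \<in> sphere 0 1" "w \<in> sphere 0 1" using assms by auto
  show "EX d. diffeo (level y) (fib y) (level x) (fib x) d"
   if "EX d. diffeo (level x) (fib x) (level y) (fib y) d" "x \<in> sphere 0 1" "y \<in> sphere 0 1" for x y
   using that inv by auto
  show "EX d. diffeo (level x) (fib x) (level z) (fib z) d"
   if "EX d. diffeo (level x) (fib x) (level y) (fib y) d" "EX d. diffeo (level y) (fib y) (level z) (fib z) d"
    "x \<in> sphere 0 1" "y \<in> sphere 0 1" "z \<in> sphere 0 1" for x y z
   using that trans[of x y _ z] by auto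
 qed
qed

lemma closed_manifold: "closed_manifold X"
 using X bd compact by (simp add: closed_manifold_def)

text \<open>The trivialization near \<open>z\<close> has its own model fiber \<open>level z\<close>;
  composing with a diffeomorphism to \<open>level 1\<close> makes the fiber uniform. As the
  structure group is all of \<open>Diff F\<close>, a transition function only has to be a
  diffeomorphism on each fiber, namely the composite of two identifications with that fiber.\<close>

theorem fibers_over_circle: "fibers_over_circle X"
proof -
 define F where "F = level 1"
 have F: "smooth_manifold F" and cF: "carr F = fib 1"
  using smooth_manifold_level[of 1] carr_level[of 1] by (auto simp: F_def)
 have triv: "EX U \<Phi>. z \<in> U & local_trivialization X circle F h U \<Phi>" if z: "cmod z = 1" for z
 proof -
  obtain U \<Phi> where U: "z \<in> U" "local_trivialization X circle (level z) h U \<Phi>"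
   using local_trivialization_exists[OF z] by metis
  obtain d where d: "diffeo (level z) (fib z) F (carr F) d" using level_diffeo[OF z, of 1] cF F_def by auto
  note L = smooth_manifold_level[OF z]
  let ?S = "{e \<in> carr X. h e \<in> U}"
  have oU: "openin (topo circle) U" and df: "diffeo X ?S (prod_manifold circle (level z)) (U \<times> fib z) \<Phi>"
   and fs: "!!e. e \<in> ?S ==> fst (\<Phi> e) = h e"
   using U(2) by (auto simp: local_trivialization_def carr_level)
  have B: "smooth_manifold (prod_manifold circle (level z))" "smooth_manifold (prod_manifold circle F)"
   using smooth_manifold_prod[OF smooth_manifold_circle L(1) mboundary_circle]
    smooth_manifold_prod[OF smooth_manifold_circle F mboundary_circle] by simp_all
  have Uc: "U <= carr circle" using openin_subset[OF oU] .
  have dd: "diffeo (prod_manifold circle (level z)) (U \<times> fib z) (prod_manifold circle F) (U \<times> carr F) (%p. (fst p, d (snd p)))"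
  proof (rule diffeoI[OF B(2)])
   show "smooth_map (prod_manifold circle (level z)) (U \<times> fib z) (prod_manifold circle F) (U \<times> carr F) (%p. (fst p, d (snd p)))"
    by (intro smooth_map_Pair[OF B(1)] smooth_map_fst smooth_manifold_circle L mboundary_circle
      smooth_map_compose[OF B(1) L(1) smooth_map_snd[OF smooth_manifold_circle L(1) mboundary_circle] diffeo_smooth[OF d]])
   show "smooth_map (prod_manifold circle F) (U \<times> carr F) (prod_manifold circle (level z)) (U \<times> fib z)
     (%p. (fst p, inv_into (fib z) d (snd p)))"
    by (intro smooth_map_Pair[OF B(2)] smooth_map_fst smooth_manifold_circle F mboundary_circle
      smooth_map_compose[OF B(2) F smooth_map_snd[OF smooth_manifold_circle F mboundary_circle] diffeo_inv_smooth[OF d]])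
  qed (use Uc diffeo_inv_left[OF d] diffeo_inv_right[OF d] in \<open>auto simp: carr_level\<close>)
  have "diffeo X ?S (prod_manifold circle F) (U \<times> carr F) (%e. (fst (\<Phi> e), d (snd (\<Phi> e))))"
   using diffeo_compose[OF X B df dd] Uc by auto
  then have "local_trivialization X circle F h U (%e. (fst (\<Phi> e), d (snd (\<Phi> e))))"
   using oU fs by (simp add: local_trivialization_def)
  then show ?thesis using U(1) by blast
 qed
 define \<T> where "\<T> = {(U, \<Phi>). local_trivialization X circle F h U \<Phi>}"
 have trans: "EX k:Diff F. ALL e:carr X. h e = x --> snd (\<Phi> e) = k (snd (\<Psi> e))"
  if lt: "local_trivialization X circle F h U \<Phi>" "local_trivialization X circle F h V \<Psi>" and x: "x \<in> U" "x \<in> V"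
  for U \<Phi> V \<Psi> x
 proof -
  have "openin (topo circle) U" using lt by (simp add: local_trivialization_def)
  then have x1: "cmod x = 1" using x openin_subset[of "topo circle" U] by auto
  define dU where "dU = (%y. inv_into {e \<in> carr X. h e \<in> U} \<Phi> (x, y))"
  define dV where "dV = (%y. inv_into {e \<in> carr X. h e \<in> V} \<Psi> (x, y))"
  note U = fiber_diffeo[OF F lt(1) x(1), folded dU_def] and V = fiber_diffeo[OF F lt(2) x(2), folded dV_def]
  note L = smooth_manifold_level[OF x1]
  have Ui: "diffeo (level x) (fib x) F (carr F) (inv_into (carr F) dU)"
   by (rule diffeo_inverse[OF F U(1)]) (simp_all add: carr_level)
  have "diffeo F (carr F) F (carr F) (%y. inv_into (carr F) dU (dV y))"
   by (rule diffeo_compose[OF F L(1) F V(1) Ui]) auto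
  then have "(%y. inv_into (carr F) dU (dV y)) \<in> Diff F" by (simp add: Diff_def)
  moreover have "snd (\<Phi> e) = inv_into (carr F) dU (dV (snd (\<Psi> e)))" if e: "e \<in> carr X" "h e = x" for e
  proof -
   have "dU (snd (\<Phi> e)) = e" "dV (snd (\<Psi> e)) = e" "snd (\<Phi> e) \<in> carr F"
    using U(2)[OF e] V(2)[OF e] by (simp_all add: dU_def dV_def)
   then show ?thesis using diffeo_inv_left[OF U(1), of "snd (\<Phi> e)"] by simp
  qed
  ultimately show ?thesis by (intro bexI[of _ "%y. inv_into (carr F) dU (dV y)"]) auto
 qed
 have cov: "(\<Union>(U, \<Phi>)\<in>\<T>. U) = carr circle"
 proof
  show "(\<Union>(U, \<Phi>)\<in>\<T>. U) <= carr circle"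
  proof
   fix x assume "x \<in> (\<Union>(U, \<Phi>)\<in>\<T>. U)"
   then obtain U \<Phi> where "local_trivialization X circle F h U \<Phi>" "x \<in> U" by (auto simp: \<T>_def)
   then show "x \<in> carr circle"
    using openin_subset[of "topo circle" U] by (auto simp: local_trivialization_def)
  qed
  show "carr circle <= (\<Union>(U, \<Phi>)\<in>\<T>. U)" using triv by (fastforce simp: \<T>_def)
 qed
 have "smooth_map X (carr X) circle (carr circle) h"
  using sfun_h norm_h by (auto simp: smooth_map_circle[OF X])
 then have "fiber_bundle X circle F (Diff F) h"
  unfolding fiber_bundle_def
  using X F smooth_manifold_circle mboundary_circle cov trans
  by (intro conjI exI[of _ \<T>]) (auto simp: \<T>_def)
 then show ?thesis unfolding fibers_over_circle_def using closed_manifold by blast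
qed

end

section \<open>Circle-valued maps that lift to the line\<close>

text \<open>The form in which being null-homotopic is used. It suits the later steps better than a
  homotopy, since lifts can be added, shifted by multiples of \<open>2 * pi\<close> and
  smoothed.\<close>

definition lifts :: "'y topology => ('y => complex) => bool" where
 "lifts Y k \<longleftrightarrow> (EX u. continuous_map Y euclideanreal u & (ALL y:topspace Y. k y = cis (u y)))"

lemma continuous_map_op:
 assumes "continuous_map Y euclidean f" "continuous_on UNIV g"
 shows "continuous_map Y euclidean (%y. g (f y))"
 using continuous_map_compose[OF assms(1), of euclidean g] assms(2) by (simp add: o_def)

lemma continuous_map_op2:
 assumes "continuous_map Y euclidean f" "continuous_map Y euclidean g" "continuous_on UNIV (%p. k (fst p) (snd p))"
 shows "continuous_map Y euclidean (%y. k (f y) (g y))"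
proof -
 have "continuous_map Y (prod_topology euclidean euclidean) (%y. (f y, g y))"
  using assms(1,2) by (rule continuous_map_pairedI)
 then have "continuous_map Y euclidean (%y. (f y, g y))" by simp
 from continuous_map_op[OF this assms(3)] show ?thesis by simp
qed

lemma Ints_valued_constant:
 assumes "connected_space Z" "continuous_map Z euclideanreal f" "!!z. z \<in> topspace Z ==> f z \<in> \<int>"
 shows "EX n::int. ALL z:topspace Z. f z = of_int n"
proof -
 have conn: "connected (f ` topspace Z)"
  using connectedin_continuous_map_image[OF assms(2), of "topspace Z"] assms(1)
  by (simp add: connectedin_topspace)
 have no: "\<not> f a < f b" if ab: "a \<in> topspace Z" "b \<in> topspace Z" for a b
 proof
  assume lt: "f a < f b"
  obtain i :: int where i: "f a = of_int i" using assms(3)[OF ab(1)] by (auto elim: Ints_cases)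
  obtain j :: int where j: "f b = of_int j" using assms(3)[OF ab(2)] by (auto elim: Ints_cases)
  note ij = i j
  have "{f a..f b} <= f ` topspace Z" by (rule connected_contains_Icc[OF conn]) (use ab in auto)
  moreover have "of_int i + 1 / 2 \<in> {f a..f b}" using lt by (simp add: ij)
  ultimately have "of_int i + 1 / 2 \<in> f ` topspace Z" by (rule subsetD)
  then obtain z where z: "of_int i + 1 / 2 = f z" "z \<in> topspace Z" by blast
  have "(of_int i + 1 / 2 :: real) \<in> \<int>" unfolding z(1) by (rule assms(3)[OF z(2)])
  then obtain m :: int where "of_int i + 1 / 2 = (of_int m :: real)" by (auto elim: Ints_cases)
  then have "of_int (2 * i + 1) = (of_int (2 * m) :: real)" by simp
  then have "2 * i + 1 = 2 * m" by (simp only: of_int_eq_iff)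
  then show False by presburger
 qed
 show ?thesis
 proof (cases "topspace Z = {}")
  case False
  then obtain a where a: "a \<in> topspace Z" by blast
  obtain i :: int where "f a = of_int i" using assms(3)[OF a] by (auto elim: Ints_cases)
  then show ?thesis using no a by (metis linorder_less_linear)
 qed simp
qed

text \<open>By compactness there is an \<open>e\<close> such that \<open>H\<close> turns by less
  than a right angle during any time less than \<open>e\<close>, uniformly in \<open>Z\<close>. The
  lift is then explicit: \<open>h j\<close> is \<open>H\<close> stopped at time \<open>s j\<close>,
  and \<open>u\<close> adds the small angles from \<open>h j\<close> to \<open>h (Suc j)\<close> to
  \<open>u0\<close>. Continuity is visible from the formula, without assumptions on paths in
  \<open>Z\<close>.\<close>

lemma lift_homotopy:
 fixes Z :: "'z topology" and H :: "real \<times> 'z => complex"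
 defines "I \<equiv> top_of_set {0..2 * pi}"
 assumes Z: "compact_space Z" and H: "continuous_map (prod_topology I Z) euclidean H"
  and H1: "!!p. p \<in> {0..2 * pi} \<times> topspace Z ==> cmod (H p) = 1"
  and u0: "continuous_map Z euclideanreal u0" "!!z. z \<in> topspace Z ==> H (0, z) = cis (u0 z)"
 obtains u where "continuous_map (prod_topology I Z) euclideanreal u"
  "!!p. p \<in> {0..2 * pi} \<times> topspace Z ==> H p = cis (u p)" "!!z. z \<in> topspace Z ==> u (0, z) = u0 z"
proof -
 define Y where "Y = prod_topology (prod_topology I I) Z"
 have topI: "topspace I = {0..2 * pi}" by (simp add: I_def)
 have cI: "compact_space I" unfolding I_def by (simp add: compact_space_subtopology)
 have cY: "compact_space Y" unfolding Y_def by (simp add: compact_space_prod_topology cI Z)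
 have c0: "continuous_map Y (prod_topology I I) fst" "continuous_map Y Z snd"
  unfolding Y_def by (rule continuous_map_fst, rule continuous_map_snd)
 have c1: "continuous_map Y I (%p. fst (fst p))" "continuous_map Y I (%p. snd (fst p))" "continuous_map Y Z snd"
  using continuous_map_compose[OF c0(1) continuous_map_fst] continuous_map_compose[OF c0(1) continuous_map_snd] c0(2)
  by (simp_all add: o_def)
 have cH: "continuous_map Y euclidean (%p. H (fst (fst p), snd p))" "continuous_map Y euclidean (%p. H (snd (fst p), snd p))"
  using continuous_map_compose[OF continuous_map_pairedI[OF c1(1,3)] H]
   continuous_map_compose[OF continuous_map_pairedI[OF c1(2,3)] H] by (auto simp: o_def)
 have cG: "continuous_map Y euclideanreal (%p. Re (H (snd (fst p), snd p) * cnj (H (fst (fst p), snd p))))"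
  by (rule continuous_map_op2[OF cH(2,1), of "%a b. Re (a * cnj b)"]) (intro continuous_intros)
 define G where "G = {p \<in> topspace Y. Re (H (snd (fst p), snd p) * cnj (H (fst (fst p), snd p))) \<in> {0<..}}"
 have oG: "openin Y G" unfolding G_def by (rule openin_continuous_map_preimage[OF cG]) simp
 have "continuous_map Y euclideanreal (%p. fst (fst p))" "continuous_map Y euclideanreal (%p. snd (fst p))"
  using c1(1,2) by (auto simp: I_def continuous_map_in_subtopology)
 then have cd: "continuous_map Y euclideanreal (%p. fst (fst p) - snd (fst p))"
  by (rule continuous_map_op2) (intro continuous_intros)
 obtain e where e: "e > 0" "!!p. p \<in> topspace Y ==> \<bar>fst (fst p) - snd (fst p)\<bar> < e ==> p \<in> G"
 proof (rule tube_function[OF cY cd oG])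
  fix p assume p: "p \<in> topspace Y" "fst (fst p) - snd (fst p) = 0"
  then have eq: "snd (fst p) = fst (fst p)" by simp
  have "(fst (fst p), snd p) \<in> {0..2 * pi} \<times> topspace Z"
   using p(1) by (simp add: Y_def topI mem_Times_iff)
  then have R: "Re (H (fst (fst p), snd p) * cnj (H (fst (fst p), snd p))) = 1"
   unfolding unit_mult_cnj[OF H1[OF \<open>(fst (fst p), snd p) \<in> {0..2 * pi} \<times> topspace Z\<close>]] by simp
  show "p \<in> G" unfolding G_def mem_Collect_eq eq R using p(1) by simp
 qed auto
 have pos: "Re (H (t', z) * cnj (H (t, z))) > 0"
  if "t \<in> {0..2 * pi}" "t' \<in> {0..2 * pi}" "\<bar>t - t'\<bar> < e" "z \<in> topspace Z" for t t' z
  using e(2)[of "((t, t'), z)"] that by (simp add: G_def Y_def topI)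
 obtain N :: nat where N: "2 * pi / e < N" using reals_Archimedean2 by blast
 have "2 * pi / e > 0" using e(1) by simp
 then have N0: "N > 0" using N by (cases N) auto
 define s where "s j = 2 * pi * real j / real N" for j
 have sd: "s (Suc j) - s j < e" "s j \<le> s (Suc j)" "0 \<le> s j" for j
  using N e(1) N0 by (auto simp: s_def field_simps)
 have s0N: "s 0 = 0" "s N = 2 * pi" using N0 by (auto simp: s_def)
 define h where "h j p = H (min (fst p) (s j), snd p)" for j p
 define u where "u p = u0 (snd p) + (\<Sum>j<N. arg0 (h (Suc j) p * cnj (h j p)))" for p
 have cf: "continuous_map (prod_topology I Z) euclideanreal (%p. min (fst p) (s j))" for j
 proof -
  have "continuous_map (prod_topology I Z) euclideanreal fst"
   using continuous_map_fst[of I Z] by (simp add: I_def continuous_map_in_subtopology)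
  then show ?thesis by (rule continuous_map_op[where g="%t. min t (s j)"]) (intro continuous_intros)
 qed
 have ch: "continuous_map (prod_topology I Z) euclidean (h j)" for j
 proof -
  have "continuous_map (prod_topology I Z) I (%p. min (fst p) (s j))"
   using cf[of j] sd(3)[of j] by (auto simp: I_def continuous_map_in_subtopology)
  from continuous_map_compose[OF continuous_map_pairedI[OF this continuous_map_snd] H]
  show ?thesis by (simp add: h_def[abs_def] o_def)
 qed
 have hpos: "Re (h (Suc j) p * cnj (h j p)) > 0" if "p \<in> {0..2 * pi} \<times> topspace Z" for j p
  unfolding h_def by (rule pos) (use that sd[of j] sd(3)[of "Suc j"] in \<open>auto simp: min_def\<close>)
 have h1: "cmod (h j p) = 1" if "p \<in> {0..2 * pi} \<times> topspace Z" for j p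
  unfolding h_def by (rule H1) (use that sd(3)[of j] in \<open>auto simp: min_def\<close>)
 have ca: "continuous_map (prod_topology I Z) euclideanreal (%p. arg0 (h (Suc j) p * cnj (h j p)))" for j
 proof -
  have "continuous_map (prod_topology I Z) euclidean (%p. h (Suc j) p * cnj (h j p))"
   by (rule continuous_map_op2[OF ch ch]) (intro continuous_intros)
  then have "continuous_map (prod_topology I Z) (top_of_set {w. Re w > 0}) (%p. h (Suc j) p * cnj (h j p))"
   using hpos by (auto simp: continuous_map_in_subtopology topI)
  moreover have "continuous_map (top_of_set {w. Re w > 0}) euclideanreal arg0"
   using smooth_on_continuous[OF smooth_on_arg0[OF smooth_on_ident, of "{w. Re w > 0}"]] by simp
  ultimately show ?thesis using continuous_map_compose[of _ "top_of_set {w. Re w > 0}"] by (simp only: o_def)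
 qed
 have "continuous_map (prod_topology I Z) euclideanreal u"
  unfolding u_def
  using continuous_map_compose[OF continuous_map_snd u0(1), of I] ca
  by (intro continuous_map_add continuous_map_sum) (auto simp: o_def)
 moreover have "H p = cis (u p)" if p: "p \<in> {0..2 * pi} \<times> topspace Z" for p
 proof -
  have "h n p = cis (u0 (snd p) + (\<Sum>j<n. arg0 (h (Suc j) p * cnj (h j p))))" for n
  proof (induction n)
   case 0
   have "min (fst p) (s 0) = 0" using p s0N by auto
   then show ?case using u0(2)[of "snd p"] p by (simp add: h_def mem_Times_iff)
  next
   case (Suc n)
   have "cmod (h (Suc n) p * cnj (h n p)) = 1" using h1[OF p] by (simp add: norm_mult)
   then have "cis (arg0 (h (Suc n) p * cnj (h n p))) = h (Suc n) p * cnj (h n p)"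
    using cis_arg0[OF hpos[OF p, of n]] by simp
   moreover have "h n p * (h (Suc n) p * cnj (h n p)) = (h n p * cnj (h n p)) * h (Suc n) p" by (simp add: mult_ac)
   ultimately have "h n p * cis (arg0 (h (Suc n) p * cnj (h n p))) = h (Suc n) p"
    using unit_mult_cnj[OF h1[OF p, of n]] by simp
   then show ?case using Suc by (simp add: cis_mult add.assoc[symmetric] flip: cis_mult)
  qed
  from this[of N] show ?thesis using p s0N by (auto simp: h_def u_def min_def mem_Times_iff split: if_splits)
 qed
 moreover have "u (0, z) = u0 z" if z: "z \<in> topspace Z" for z
 proof -
  have "min 0 (s j) = 0" for j using sd(3)[of j] by simp
  then have "h (Suc j) (0, z) * cnj (h j (0, z)) = 1" for j
   using unit_mult_cnj[OF H1[of "(0, z)"]] z by (simp add: h_def)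
  then show ?thesis by (simp add: u_def arg0_def)
 qed
 ultimately show ?thesis by (rule that)
qed

text \<open>Cut the circle open at 1 and lift over \<open>{0..2 * pi}\<close>. The lifts at both
  ends differ by \<open>2 * pi * n\<close> with an integer \<open>n\<close> that is constant because
  \<open>Z\<close> is connected. Subtracting \<open>n * t\<close> makes the lift periodic, and it
  descends along the quotient map \<open>q\<close>; this corresponds to the factor
  \<open>fst p powi (- n)\<close>.\<close>

lemma lifts_circle_times:
 fixes Z :: "'z topology" and k :: "complex \<times> 'z => complex"
 defines "Y \<equiv> prod_topology (top_of_set (sphere 0 1)) Z"
 assumes Z: "compact_space Z" "Hausdorff_space Z" "connected_space Z"
  and k: "continuous_map Y euclidean k" "!!p. p \<in> topspace Y ==> cmod (k p) = 1"
  and l: "lifts Z (%z. k (1, z))"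
 shows "EX n::int. lifts Y (%p. k p * fst p powi n)"
proof -
 define I where "I = top_of_set {0..2 * pi}"
 define q where "q = (%p::real \<times> 'z. (cis (fst p), snd p))"
 have topI: "topspace I = {0..2 * pi}" by (simp add: I_def)
 have cq: "continuous_map (prod_topology I Z) Y q"
  unfolding q_def Y_def
 proof (rule continuous_map_pairedI[OF _ continuous_map_snd])
  have "continuous_map (prod_topology I Z) euclideanreal fst"
   using continuous_map_fst[of I Z] by (simp add: I_def continuous_map_in_subtopology)
  then have "continuous_map (prod_topology I Z) euclidean (%p. cis (fst p))"
   by (rule continuous_map_op) (intro continuous_intros)
  then show "continuous_map (prod_topology I Z) (top_of_set (sphere 0 1)) (%p. cis (fst p))"
   by (simp add: continuous_map_in_subtopology)
 qed
 obtain u0 where u0: "continuous_map Z euclideanreal u0" "!!z. z \<in> topspace Z ==> k (1, z) = cis (u0 z)"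
  using l by (auto simp: lifts_def)
 obtain u where u: "continuous_map (prod_topology I Z) euclideanreal u"
  "!!p. p \<in> {0..2 * pi} \<times> topspace Z ==> k (q p) = cis (u p)"
 proof (rule lift_homotopy[OF Z(1), of "%p. k (q p)" u0, folded I_def])
  show "continuous_map (prod_topology I Z) euclidean (%p. k (q p))"
   using continuous_map_compose[OF cq k(1)] by (simp add: o_def)
  show "cmod (k (q p)) = 1" if "p \<in> {0..2 * pi} \<times> topspace Z" for p
   by (rule k(2)) (use that in \<open>auto simp: q_def Y_def\<close>)
  show "continuous_map Z euclideanreal u0" by (rule u0)
  show "k (q (0, z)) = cis (u0 z)" if "z \<in> topspace Z" for z using u0(2)[OF that] by (simp add: q_def)
 qed (rule that)
 have cz: "continuous_map Z euclideanreal (%z. u (t, z))" if "t \<in> {0..2 * pi}" for t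
 proof -
  have "continuous_map Z (prod_topology I Z) (%z. (t, z))"
   by (rule continuous_map_pairedI) (use that in \<open>auto simp: topI\<close>)
  from continuous_map_compose[OF this u(1)] show ?thesis by (simp add: o_def)
 qed
 define D where "D z = (u (2 * pi, z) - u (0, z)) / (2 * pi)" for z
 have "continuous_map Z euclideanreal D" unfolding D_def
  by (rule continuous_map_op2[OF cz cz]) (auto intro!: continuous_intros)
 moreover have "D z \<in> \<int>" if "z \<in> topspace Z" for z
 proof -
  have "cis (u (2 * pi, z)) = cis (u (0, z))" using u(2)[of "(2 * pi, z)"] u(2)[of "(0, z)"] that by (simp add: q_def)
  then obtain m :: int where "u (2 * pi, z) = u (0, z) + 2 * pi * m" by (auto simp: cis_eq_iff)
  then have "D z = of_int m" by (simp add: D_def)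
  then show ?thesis by simp
 qed
 ultimately obtain n :: int where n: "!!z. z \<in> topspace Z ==> D z = of_int n"
  using Ints_valued_constant[OF Z(3)] by blast
 have un: "u (2 * pi, z) - 2 * pi * n = u (0, z)" if "z \<in> topspace Z" for z
  using n[OF that] by (simp add: D_def field_simps)
 define v where "v p = u p - of_int n * fst p" for p
 define w where "w p = (if fst p = 1 then v (0, snd p) else v (Arg2pi (fst p), snd p))" for p
 have vw: "w (q p) = v p" if p: "p \<in> {0..2 * pi} \<times> topspace Z" for p
 proof (cases "fst p = 2 * pi")
  case True
  then have "v p = v (0, snd p)" using un[of "snd p"] p by (cases p) (auto simp: v_def mult_ac)
  then show ?thesis using True by (simp add: w_def q_def)
 next
  case False
  then have "Arg2pi (cis (fst p)) = fst p"
   using p by (intro Arg2pi_unique[of 1]) (auto simp: cis_conv_exp)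
  moreover have "cis (fst p) = 1 ==> fst p = 0"
  proof -
   assume "cis (fst p) = 1"
   then show "fst p = 0" using calculation Arg2pi_of_real[of 1] by simp
  qed
  ultimately show ?thesis by (cases p) (auto simp: w_def q_def)
 qed
 have cv: "continuous_map (prod_topology I Z) euclideanreal v"
 proof -
  have "continuous_map (prod_topology I Z) euclideanreal fst"
   using continuous_map_fst[of I Z] by (simp add: I_def continuous_map_in_subtopology)
  with u(1) show ?thesis unfolding v_def by (rule continuous_map_op2) (intro continuous_intros)
 qed
 have cI: "compact_space (prod_topology I Z)"
  using Z(1) by (simp add: I_def compact_space_prod_topology compact_space_subtopology)
 have HY: "Hausdorff_space Y"
  using Z(2) by (simp add: Y_def Hausdorff_space_prod_topology Hausdorff_space_subtopology Hausdorff_space_euclidean)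
 have onto: "EX t:{0..2 * pi}. z = cis t" if "cmod z = 1" for z
  using that Arg2pi_ge_0[of z] Arg2pi_lt_2pi[of z] Arg2pi_eq[of z]
  by (intro bexI[of _ "Arg2pi z"]) (auto simp: cis_conv_exp)
 have surj: "q ` topspace (prod_topology I Z) = topspace Y"
 proof
  show "q ` topspace (prod_topology I Z) <= topspace Y" by (auto simp: q_def Y_def)
  show "topspace Y <= q ` topspace (prod_topology I Z)"
  proof
   fix p assume p: "p \<in> topspace Y"
   then obtain t where "t \<in> {0..2 * pi}" "fst p = cis t" using onto[of "fst p"] by (auto simp: Y_def)
   then have "p = q (t, snd p)" "(t, snd p) \<in> topspace (prod_topology I Z)"
    using p by (auto simp: q_def topI Y_def prod_eq_iff)
   then show "p \<in> q ` topspace (prod_topology I Z)" by blast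
  qed
 qed
 have "quotient_map (prod_topology I Z) Y q"
  using continuous_closed_imp_quotient_map[OF cq continuous_imp_closed_map[OF cq cI HY] surj] .
 moreover have "continuous_map (prod_topology I Z) euclideanreal (w \<circ> q)"
  by (rule continuous_map_eq[OF cv]) (use vw in \<open>auto simp: topI\<close>)
 ultimately have cw: "continuous_map Y euclideanreal w"
  by (rule continuous_compose_quotient_map)
 have "k p * fst p powi (- n) = cis (w p)" if "p \<in> topspace Y" for p
 proof -
  have "p \<in> q ` topspace (prod_topology I Z)" using that surj by simp
  then obtain r where r: "p = q r" "r \<in> {0..2 * pi} \<times> topspace Z" by (auto simp: topI)
  have "cis (u r) * cis (- of_int n * fst r) = cis (v r)" unfolding cis_mult by (simp add: v_def)
  then show ?thesis
   using u(2)[OF r(2)] vw[OF r(2)] by (simp add: r(1) q_def cis_power_int)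
 qed
 then show ?thesis using cw unfolding lifts_def by blast
qed

section \<open>Circle-valued maps on closed one-manifolds\<close>

text \<open>An open embedding of the whole line. With the line as domain no endpoints occur, and
  pieces of a curve can be joined and reversed without changing the domain.\<close>

definition arc_in :: "'c topology => (real => 'c) => bool" where
 "arc_in C \<gamma> \<longleftrightarrow> continuous_map euclideanreal C \<gamma> & open_map euclideanreal C \<gamma> & inj \<gamma>"

lemma arc_inD:
 assumes "arc_in C \<gamma>"
 shows "continuous_map euclideanreal C \<gamma>" "inj \<gamma>" "open V ==> openin C (\<gamma> ` V)" "openin C (range \<gamma>)" "range \<gamma> <= topspace C"
 using assms continuous_map_image_subset_topspace[of euclideanreal C \<gamma>] by (auto simp: arc_in_def open_map_def)

lemma arc_in_reverse:
 assumes "arc_in C \<gamma>"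
 shows "arc_in C (%x. \<gamma> (- x))" "range (%x. \<gamma> (- x)) = range \<gamma>"
proof -
 have c: "continuous_map euclideanreal C (%x. \<gamma> (- x))"
  using continuous_map_compose[of euclideanreal euclideanreal uminus C \<gamma>] arc_inD(1)[OF assms]
  by (auto simp: o_def intro: continuous_intros)
 have im: "(%x. \<gamma> (- x)) ` V = \<gamma> ` uminus ` V" for V by auto
 have o: "openin C ((%x. \<gamma> (- x)) ` V)" if "open V" for V
  unfolding im by (rule arc_inD(3)[OF assms open_negations[OF that]])
 have "inj (%x. \<gamma> (- x))" by (rule injI) (use injD[OF arc_inD(2)[OF assms]] in force)
 with c o show "arc_in C (%x. \<gamma> (- x))" by (auto simp: arc_in_def open_map_def)
 show "range (%x. \<gamma> (- x)) = range \<gamma>" unfolding im by simp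
qed

lemma arc_inv_continuous:
 assumes "arc_in C \<gamma>"
 shows "continuous_map (subtopology C (range \<gamma>)) euclideanreal (inv \<gamma>)"
 unfolding continuous_map_def
proof (intro conjI allI impI)
 fix V :: "real set" assume "openin euclideanreal V"
 then have "openin C (\<gamma> ` V)" using arc_inD(3)[OF assms] by simp
 moreover have "{y \<in> topspace (subtopology C (range \<gamma>)). inv \<gamma> y \<in> V} = \<gamma> ` V Int range \<gamma>"
  using arc_inD(2,5)[OF assms] by (auto dest: injD)
 ultimately show "openin (subtopology C (range \<gamma>)) {y \<in> topspace (subtopology C (range \<gamma>)). inv \<gamma> y \<in> V}"
  by (simp add: openin_subtopology_Int)
qed simp

section \<open>The overlap of two arcs\<close>

locale two_arcs =
 fixes C :: "'c topology" and \<alpha> \<beta> :: "real => 'c"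
 assumes Hausdorff: "Hausdorff_space C" and \<alpha>: "arc_in C \<alpha>" and \<beta>: "arc_in C \<beta>"
begin

text \<open>The overlap seen in the parameter of \<alpha>, followed by the transition function to
  the parameter of \<beta>.\<close>

definition "ov = {x. \<alpha> x \<in> range \<beta>}"
definition "tr x = inv \<beta> (\<alpha> x)"

lemma tr: "x \<in> ov ==> \<beta> (tr x) = \<alpha> x"
 by (simp add: ov_def tr_def f_inv_into_f)

lemma tr_eqI: "\<alpha> x = \<beta> y ==> x \<in> ov & tr x = y"
 using arc_inD(2)[OF \<beta>] by (simp add: ov_def tr_def)

lemma inj_tr: "inj_on tr ov"
 by (rule inj_onI) (metis tr arc_inD(2)[OF \<alpha>] injD)

lemma open_ov: "open ov"
 using openin_continuous_map_preimage[OF arc_inD(1)[OF \<alpha>] arc_inD(4)[OF \<beta>]] by (simp add: ov_def)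

lemma continuous_tr: "continuous_on ov tr"
proof -
 have "continuous_map (top_of_set ov) (subtopology C (range \<beta>)) \<alpha>"
  using arc_inD(1)[OF \<alpha>] by (auto simp: continuous_map_in_subtopology continuous_map_from_subtopology ov_def)
 from continuous_map_compose[OF this arc_inv_continuous[OF \<beta>]] show ?thesis
  by (simp add: o_def tr_def[abs_def])
qed

text \<open>A compact piece of \<beta> is closed as \<open>C\<close> is Hausdorff, and \<alpha> is
  not on it at the parameter \<open>q\<close>, hence also not nearby. So the transition function
  runs to infinity at the ends of the overlap.\<close>

lemma escape:
 assumes "q \<notin> ov"
 obtains \<delta> where "\<delta> > 0" "!!x. x \<in> ov ==> \<bar>x - q\<bar> < \<delta> ==> tr x \<notin> {c..d}"
proof -
 have "compactin C (\<beta> ` {c..d})" using image_compactin[OF _ arc_inD(1)[OF \<beta>]] by simp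
 then have "closedin C (\<beta> ` {c..d})" using compactin_imp_closedin[OF Hausdorff] by simp
 then have cl: "closed {x. \<alpha> x \<in> \<beta> ` {c..d}}"
  using closedin_continuous_map_preimage[OF arc_inD(1)[OF \<alpha>]] by simp
 have "q \<notin> {x. \<alpha> x \<in> \<beta> ` {c..d}}" using assms by (auto simp: ov_def)
 then have "q \<in> - {x. \<alpha> x \<in> \<beta> ` {c..d}}" by simp
 then obtain \<delta> where d: "\<delta> > 0" "ball q \<delta> <= - {x. \<alpha> x \<in> \<beta> ` {c..d}}"
  using open_contains_ball[of "- {x. \<alpha> x \<in> \<beta> ` {c..d}}"] open_Compl[OF cl] by metis
 show ?thesis
 proof (rule that[OF d(1)])
  fix x assume x: "x \<in> ov" "\<bar>x - q\<bar> < \<delta>"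
  then have "x \<in> ball q \<delta>" by (simp add: dist_real_def abs_minus_commute)
  then have "\<alpha> x \<notin> \<beta> ` {c..d}" using d(2) by blast
  then show "tr x \<notin> {c..d}" using tr[OF x(1)] by (metis image_eqI)
 qed
qed

lemma tr_monotone:
 assumes "{a..b} <= ov" "a < x" "x < b"
 shows "(tr a < tr x & tr x < tr b) \<or> (tr b < tr x & tr x < tr a)"
 using continuous_inj_imp_mono[OF assms(2,3)] continuous_on_subset[OF continuous_tr assms(1)]
  inj_on_subset[OF inj_tr assms(1)] by blast

text \<open>On a bounded component of the overlap the transition map leaves every compact set at both
  ends, hence is onto.\<close>

lemma bounded_component:
 assumes pq: "p \<notin> ov" "q \<notin> ov" and x0: "x0 \<in> ov" "p < x0" "x0 < q"
 shows "range \<beta> <= range \<alpha>"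
proof -
 have clc: "closed (- ov)" using open_ov by (simp add: closed_Compl)
 define q' where "q' = Inf ({x0..} - ov)"
 define p' where "p' = Sup ({..x0} - ov)"
 have "q \<in> {x0..} Int - ov" "p \<in> {..x0} Int - ov" using pq x0 by auto
 then have ne: "{x0..} Int - ov ~= {}" "{..x0} Int - ov ~= {}" by blast+
 have q': "q' \<in> {x0..} - ov" unfolding q'_def Diff_eq
  by (rule closed_contains_Inf[OF ne(1)]) (use clc in \<open>auto intro!: closed_Int\<close>)
 have p': "p' \<in> {..x0} - ov" unfolding p'_def Diff_eq
  by (rule closed_contains_Sup[OF ne(2)]) (use clc in \<open>auto intro!: closed_Int\<close>)
 have sub: "{p'<..<q'} <= ov"
 proof
  fix x assume x: "x \<in> {p'<..<q'}"
  show "x \<in> ov"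
  proof (rule ccontr)
   assume "x \<notin> ov"
   show False
   proof (cases "x0 \<le> x")
    case True
    then have "q' \<le> x" unfolding q'_def using \<open>x \<notin> ov\<close> by (intro cInf_lower) auto
    then show False using x by simp
   next
    case False
    then have "x \<le> p'" unfolding p'_def using \<open>x \<notin> ov\<close> by (intro cSup_upper) auto
    then show False using x by simp
   qed
  qed
 qed
 have lt: "p' < x0" "x0 < q'" using p' q' x0(1) by (auto simp: less_le)
 have right: "EX x1. x0 < x1 & x1 < q' & tr x1 \<notin> {c..d}" for c d
 proof -
  obtain \<delta> where d: "\<delta> > 0" "!!x. x \<in> ov ==> \<bar>x - q'\<bar> < \<delta> ==> tr x \<notin> {c..d}"
   using escape[of q'] q' by blast
  define x1 where "x1 = max ((x0 + q') / 2) (q' - \<delta> / 2)"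
  have "x0 < x1" "x1 < q'" "q' - \<delta> / 2 \<le> x1" using d(1) lt by (auto simp: x1_def less_max_iff_disj)
  moreover from this have "\<bar>x1 - q'\<bar> < \<delta>" using d(1) by auto
  moreover have "x1 \<in> ov" by (rule subsetD[OF sub]) (use calculation lt in auto)
  ultimately show ?thesis using d(2)[of x1] by (intro exI[of _ x1]) simp
 qed
 have left: "EX x1. p' < x1 & x1 < x0 & tr x1 \<notin> {c..d}" for c d
 proof -
  obtain \<delta> where d: "\<delta> > 0" "!!x. x \<in> ov ==> \<bar>x - p'\<bar> < \<delta> ==> tr x \<notin> {c..d}"
   using escape[of p'] p' by blast
  define x1 where "x1 = min ((x0 + p') / 2) (p' + \<delta> / 2)"
  have "x1 < x0" "p' < x1" "x1 \<le> p' + \<delta> / 2" using d(1) lt by (auto simp: x1_def min_less_iff_disj)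
  moreover from this have "\<bar>x1 - p'\<bar> < \<delta>" using d(1) by auto
  moreover have "x1 \<in> ov" by (rule subsetD[OF sub]) (use calculation lt in auto)
  ultimately show ?thesis using d(2)[of x1] by (intro exI[of _ x1]) simp
 qed
 have conn: "connected (tr ` {p'<..<q'})"
  by (rule connected_continuous_image[OF continuous_on_subset[OF continuous_tr sub]]) simp
 \<comment> \<open>If \<open>y\<close> is missed, the connected image lies on one side of
   \<open>y\<close>. The values at \<open>x1\<close> and \<open>x2\<close> leave the segment between
   \<open>y\<close> and \<open>tr x0\<close>, hence both lie beyond \<open>tr x0\<close> on the side
   away from \<open>y\<close>. As \<open>x0\<close> is between \<open>x1\<close> and
   \<open>x2\<close>, this contradicts monotonicity.\<close>
 have onto: "y \<in> tr ` {p'<..<q'}" for y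
 proof (rule ccontr)
  assume y: "y \<notin> tr ` {p'<..<q'}"
  have x0i: "tr x0 \<in> tr ` {p'<..<q'}" using lt by auto
  then have ne: "tr x0 ~= y" using y by auto
  obtain x1 where x1: "x0 < x1" "x1 < q'" "tr x1 \<notin> {min y (tr x0)..max y (tr x0)}" using right by blast
  obtain x2 where x2: "p' < x2" "x2 < x0" "tr x2 \<notin> {min y (tr x0)..max y (tr x0)}" using left by blast
  have i: "tr x1 \<in> tr ` {p'<..<q'}" "tr x2 \<in> tr ` {p'<..<q'}" using x1 x2 lt by auto
  have no: "\<not> (a \<le> y & y \<le> b)" if "a \<in> tr ` {p'<..<q'}" "b \<in> tr ` {p'<..<q'}" for a b
   using connected_contains_Icc[OF conn that] y by auto
  have "{x2..x1} <= ov" using sub x1 x2 by auto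
  from tr_monotone[OF this x2(2) x1(1)] show False
   using x1(3) x2(3) ne no[OF x0i i(1)] no[OF i(1) x0i] no[OF x0i i(2)] no[OF i(2) x0i]
   by (auto simp: min_def max_def split: if_splits)
 qed
 show ?thesis
 proof
  fix c assume "c \<in> range \<beta>"
  then obtain y where "c = \<beta> y" by auto
  moreover obtain x where "x \<in> {p'<..<q'}" "y = tr x" using onto[of y] by auto
  ultimately have "c = \<alpha> x" using tr sub by auto
  then show "c \<in> range \<alpha>" by simp
 qed
qed

text \<open>By \<open>bounded_component\<close> the overlap has no bounded gap-to-gap component, so
  its complement is convex. It is closed and nonempty, hence a ray or a compact interval; the whole
  line is excluded because the arcs meet.\<close>

lemma ov_cases:
 assumes "\<not> range \<alpha> <= range \<beta>" "\<not> range \<beta> <= range \<alpha>" "ov ~= {}"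
 obtains (right) q where "ov = {q<..}" | (left) p where "ov = {..<p}"
  | (both) p q where "p \<le> q" "ov = {..<p} Un {q<..}"
proof -
 let ?K = "- ov"
 have clK: "closed ?K" using open_ov by (simp add: closed_Compl)
 have K0: "?K ~= {}" using assms(1) by (auto simp: ov_def)
 have conv: "x \<in> ?K" if "p \<in> ?K" "q \<in> ?K" "p \<le> x" "x \<le> q" for p q x
  using bounded_component[of p q x] that assms(2) by (cases "x = p \<or> x = q") auto
 show ?thesis
 proof (cases "bdd_below ?K"; cases "bdd_above ?K")
  assume b: "bdd_below ?K" "bdd_above ?K"
  have "Inf ?K \<in> ?K" "Sup ?K \<in> ?K"
   using closed_contains_Inf[OF K0 b(1) clK] closed_contains_Sup[OF K0 b(2) clK] by auto
  note inn = this
  have 1: "Inf ?K \<le> Sup ?K" using cInf_le_cSup[OF K0 b(2,1)] .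
  have 2: "x \<in> ov \<longleftrightarrow> x < Inf ?K \<or> Sup ?K < x" for x
   using conv[OF inn, of x] cInf_lower[of x ?K] cSup_upper[of x ?K] b by (metis Compl_iff not_le)
  have "ov = {..<Inf ?K} Un {Sup ?K<..}" by (intro set_eqI) (simp only: 2 Un_iff lessThan_iff greaterThan_iff)
  with 1 show ?thesis by (rule both)
 next
  assume b: "bdd_below ?K" "\<not> bdd_above ?K"
  have i: "Inf ?K \<in> ?K" using closed_contains_Inf[OF K0 b(1) clK] .
  have 2: "x \<in> ov \<longleftrightarrow> x < Inf ?K" for x
  proof -
   obtain y where "y \<in> ?K" "x \<le> y" using b(2) unfolding bdd_above_def by (meson linear)
   then show ?thesis using conv[OF i, of y x] cInf_lower[of x ?K] b(1) by (metis Compl_iff not_le)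
  qed
  have "ov = {..<Inf ?K}" by (intro set_eqI) (simp only: 2 lessThan_iff)
  then show ?thesis by (rule left)
 next
  assume b: "\<not> bdd_below ?K" "bdd_above ?K"
  have i: "Sup ?K \<in> ?K" using closed_contains_Sup[OF K0 b(2) clK] .
  have 2: "x \<in> ov \<longleftrightarrow> Sup ?K < x" for x
  proof -
   obtain y where "y \<in> ?K" "y \<le> x" using b(1) unfolding bdd_below_def by (meson linear)
   then show ?thesis using conv[OF _ i, of y x] cSup_upper[of x ?K] b(2) by (metis Compl_iff not_le)
  qed
  have "ov = {Sup ?K<..}" by (intro set_eqI) (simp only: 2 greaterThan_iff)
  then show ?thesis by (rule right)
 next
  assume b: "\<not> bdd_below ?K" "\<not> bdd_above ?K"
  have "x \<in> ?K" for x
  proof -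
   obtain y where "y \<in> ?K" "y \<le> x" using b(1) unfolding bdd_below_def by (meson linear)
   moreover obtain y' where "y' \<in> ?K" "x \<le> y'" using b(2) unfolding bdd_above_def by (meson linear)
   ultimately show ?thesis using conv by blast
  qed
  then show ?thesis using assms(3) by auto
 qed
qed

text \<open>Towards \<open>q\<close> the transition function must leave every compact set while
  staying below \<open>p\<close>, so it tends to minus infinity and is increasing. Hence one may
  follow \<alpha> up to some \<open>x0\<close> in the overlap and \<beta> from there on, without
  meeting a point twice.\<close>

lemma join:
 assumes q: "ov = {q<..}" and p: "{y. \<beta> y \<in> range \<alpha>} = {..<p}"
 obtains \<gamma> where "arc_in C \<gamma>" "range \<gamma> = range \<alpha> Un range \<beta>"
proof -
 have trp: "tr x < p" if "x \<in> ov" for x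
 proof -
  have "\<beta> (tr x) \<in> range \<alpha>" using tr[OF that] by simp
  then show ?thesis using p by auto
 qed
 have tr_less: "tr x1 < tr x2" if "q < x1" "x1 < x2" for x1 x2
 proof -
  obtain \<delta> where d: "\<delta> > 0" "!!x. x \<in> ov ==> \<bar>x - q\<bar> < \<delta> ==> tr x \<notin> {tr x1..p}"
   by (rule escape[of q "tr x1" p]) (auto simp: q)
  define w where "w = min ((q + x1) / 2) (q + \<delta> / 2)"
  have w: "q < w" "w < x1" "w \<le> q + \<delta> / 2" using d(1) that by (auto simp: w_def min_less_iff_disj)
  then have "\<bar>w - q\<bar> < \<delta>" using d(1) by auto
  with w have "tr w < tr x1" using d(2)[of w] trp[of w] by (auto simp: q)
  moreover have "{w..x2} <= ov" using w by (auto simp: q)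
  ultimately show ?thesis using tr_monotone[OF _ w(2) that(2)] by auto
 qed
 define x0 where "x0 = q + 1"
 define y0 where "y0 = tr x0"
 have x0: "x0 \<in> ov" by (simp add: q x0_def)
 have ab: "\<alpha> x0 = \<beta> y0" using tr[OF x0] by (simp add: y0_def)
 define \<gamma> where "\<gamma> x = (if x \<le> x0 then \<alpha> x else \<beta> (x - x0 + y0))" for x
 have tr_le_iff: "tr x \<le> y0 \<longleftrightarrow> x \<le> x0" if "x \<in> ov" for x
  using tr_less[of x x0] tr_less[of x0 x] that by (cases x x0 rule: linorder_cases) (auto simp: q y0_def x0_def)
 have sh: "continuous_map euclideanreal C (%x. \<beta> (x - x0 + y0))"
 proof -
  have "continuous_on UNIV (%x. x - x0 + y0)" by (intro continuous_intros)
  then show ?thesis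
   using continuous_map_compose[of euclideanreal euclideanreal "%x. x - x0 + y0" C \<beta>] arc_inD(1)[OF \<beta>]
   by (simp add: o_def)
 qed
 have c: "continuous_map euclideanreal C \<gamma>"
  unfolding \<gamma>_def
  by (rule continuous_map_cases_le)
   (use sh arc_inD(1)[OF \<alpha>] ab in \<open>auto intro: continuous_map_from_subtopology continuous_intros\<close>)
 have inj: "inj \<gamma>"
 proof (rule linorder_injI)
  fix x y :: real assume xy: "x < y"
  show "\<gamma> x ~= \<gamma> y"
  proof
   assume eq: "\<gamma> x = \<gamma> y"
   consider "y \<le> x0" | "x0 < x" | "x \<le> x0" "x0 < y" by linarith
   then show False
   proof cases
    case 1 then show False using eq xy arc_inD(2)[OF \<alpha>] by (simp add: \<gamma>_def inj_eq)
   next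
    case 2 then show False using eq xy arc_inD(2)[OF \<beta>] by (simp add: \<gamma>_def inj_eq)
   next
    case 3
    then have "x \<in> ov & tr x = y - x0 + y0" using eq by (intro tr_eqI) (simp add: \<gamma>_def)
    then show False using tr_le_iff[of x] 3 by simp
   qed
  qed
 qed
 have o: "openin C (\<gamma> ` V)" if V: "open V" for V
  unfolding openin_subopen[of C "\<gamma> ` V"]
 proof
  fix c assume "c \<in> \<gamma> ` V"
  then obtain x where x: "x \<in> V" "c = \<gamma> x" by auto
  consider "x < x0" | "x > x0" | "x = x0" by linarith
  then show "EX T. openin C T & c \<in> T & T <= \<gamma> ` V"
  proof cases
   case 1
   have "openin C (\<alpha> ` (V Int {..<x0}))" by (rule arc_inD(3)[OF \<alpha>]) (use V in auto)
   moreover have "\<alpha> ` (V Int {..<x0}) <= \<gamma> ` V" by (force simp: \<gamma>_def)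
   ultimately show ?thesis using x 1 by (intro exI[of _ "\<alpha> ` (V Int {..<x0})"]) (auto simp: \<gamma>_def)
  next
   case 2
   let ?W = "(%y. y - y0 + x0) -` (V Int {x0<..})"
   have "open ?W" by (rule open_vimage) (use V in \<open>auto intro!: continuous_intros\<close>)
   then have "openin C (\<beta> ` ?W)" by (rule arc_inD(3)[OF \<beta>])
   moreover have "\<beta> ` ?W <= \<gamma> ` V"
   proof
    fix c assume "c \<in> \<beta> ` ?W"
    then obtain y where y: "c = \<beta> y" "y - y0 + x0 \<in> V" "x0 < y - y0 + x0" by auto
    then have "c = \<gamma> (y - y0 + x0)" by (simp add: \<gamma>_def)
    then show "c \<in> \<gamma> ` V" using y(2) by blast
   qed
   moreover have "c \<in> \<beta> ` ?W" using x 2 by (intro image_eqI[of _ _ "x - x0 + y0"]) (auto simp: \<gamma>_def)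
   ultimately show ?thesis by blast
  next
   case 3
   then obtain \<epsilon> where e: "\<epsilon> > 0" "ball x0 \<epsilon> <= V" using V x open_contains_ball by blast
   have "isCont tr x0" using continuous_tr open_ov x0 by (simp add: continuous_on_eq_continuous_at)
   then obtain \<delta> where d: "\<delta> > 0" "!!x. \<bar>x - x0\<bar> < \<delta> ==> \<bar>tr x - y0\<bar> < \<epsilon>"
    using e(1) unfolding continuous_at_eps_delta by (auto simp: dist_real_def y0_def)
   \<comment> \<open>At the seam openness is read off from \<alpha> alone: points of
     \<open>W\<close> beyond \<open>x0\<close> are also points of \<beta>, with parameters close to
     \<open>y0\<close> by continuity of \<open>tr\<close>, and therefore values of \<gamma> on
     \<open>V\<close>.\<close>
   define W where "W = {x0 - \<epsilon><..<x0 + \<delta>} Int ov"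
   have "openin C (\<alpha> ` W)" by (rule arc_inD(3)[OF \<alpha>]) (auto simp: W_def open_ov)
   moreover have "\<alpha> ` W <= \<gamma> ` V"
   proof
    fix c assume "c \<in> \<alpha> ` W"
    then obtain w where w: "c = \<alpha> w" "x0 - \<epsilon> < w" "w < x0 + \<delta>" "w \<in> ov" by (auto simp: W_def)
    show "c \<in> \<gamma> ` V"
    proof (cases "w \<le> x0")
     case True
     then have "w \<in> V" "c = \<gamma> w" using w e by (auto simp: \<gamma>_def dist_real_def subset_iff)
     then show ?thesis by blast
    next
     case False
     then have "\<bar>tr w - y0\<bar> < \<epsilon>" "y0 < tr w" using d(2)[of w] w tr_le_iff[OF w(4)] by auto
     then have "tr w - y0 + x0 \<in> V" "c = \<gamma> (tr w - y0 + x0)"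
      using w(1) tr[OF w(4)] e(2) by (auto simp: \<gamma>_def dist_real_def subset_iff)
     then show ?thesis by blast
    qed
   qed
   moreover have "c \<in> \<alpha> ` W" using x 3 e(1) d(1) x0 by (auto simp: \<gamma>_def W_def)
   ultimately show ?thesis by blast
  qed
 qed
 have "arc_in C \<gamma>" using c o inj by (auto simp: arc_in_def open_map_def)
 moreover have "range \<gamma> = range \<alpha> Un range \<beta>"
 proof (intro set_eqI iffI)
  fix c assume "c \<in> range \<alpha> Un range \<beta>"
  then consider x where "c = \<alpha> x" | y where "c = \<beta> y" by auto
  then show "c \<in> range \<gamma>"
  proof cases
   case 1
   show ?thesis
   proof (cases "x \<le> x0")
    case True then show ?thesis using 1 by (intro range_eqI[of _ _ x]) (simp add: \<gamma>_def)
   next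
    case False
    then have "x \<in> ov" by (simp add: q x0_def)
    then have "y0 < tr x" "\<beta> (tr x) = c" using False tr_le_iff[of x] tr[of x] 1 by auto
    then show ?thesis by (intro range_eqI[of _ _ "tr x - y0 + x0"]) (simp add: \<gamma>_def)
   qed
  next
   case 2
   show ?thesis
   proof (cases "y \<le> y0")
    case False then show ?thesis using 2 by (intro range_eqI[of _ _ "y - y0 + x0"]) (simp add: \<gamma>_def)
   next
    case True
    then have "y \<in> {y. \<beta> y \<in> range \<alpha>}" unfolding p using trp[OF x0] by (simp add: y0_def)
    then obtain x where "\<alpha> x = \<beta> y" by auto
    then have "x \<in> ov" "tr x = y" using tr_eqI by blast+
    then show ?thesis using True tr_le_iff[of x] 2 \<open>\<alpha> x = \<beta> y\<close> by (intro range_eqI[of _ _ x]) (simp add: \<gamma>_def)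
   qed
  qed
 qed (auto simp: \<gamma>_def)
 ultimately show ?thesis by (rule that)
qed

text \<open>The union looks like a circle. Near \<open>p\<close> and near \<open>q\<close> the
  transition function runs off to the two ends of \<beta>, so each arc is covered by the other
  outside a compact piece. The union is then the union of two compact pieces, hence closed.\<close>

lemma closedin_both:
 assumes pq: "p \<le> q" "ov = {..<p} Un {q<..}"
 shows "closedin C (range \<alpha> Un range \<beta>)"
proof -
 have inov: "x \<in> ov \<longleftrightarrow> x < p \<or> q < x" for x unfolding pq(2) by simp
 have s: "{p - 1..<p} <= ov" "{q<..q + 1} <= ov" by (intro subsetI; simp add: inov)+
 have c1: "connected (tr ` {p - 1..<p})" "connected (tr ` {q<..q + 1})"
  using connected_continuous_image[OF continuous_on_subset[OF continuous_tr s(1)]]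
   connected_continuous_image[OF continuous_on_subset[OF continuous_tr s(2)]] by simp_all
 have u1: "\<not> tr ` {p - 1..<p} <= {c..d}" for c d
 proof -
  obtain \<delta> where d: "\<delta> > 0" "!!x. x \<in> ov ==> \<bar>x - p\<bar> < \<delta> ==> tr x \<notin> {c..d}"
   by (rule escape[of p c d]) (use pq(1) inov in auto)
  define x where "x = max (p - 1) (p - \<delta> / 2)"
  have x: "x \<in> {p - 1..<p}" "\<bar>x - p\<bar> < \<delta>" using d(1) by (auto simp: x_def max_def)
  then have "tr x \<notin> {c..d}" using d(2)[of x] subsetD[OF s(1), of x] by simp
  then show ?thesis using x(1) by (metis imageI subsetD)
 qed
 have u2: "\<not> tr ` {q<..q + 1} <= {c..d}" for c d
 proof -
  obtain \<delta> where d: "\<delta> > 0" "!!x. x \<in> ov ==> \<bar>x - q\<bar> < \<delta> ==> tr x \<notin> {c..d}"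
   by (rule escape[of q c d]) (use pq(1) inov in auto)
  define x where "x = min (q + 1) (q + \<delta> / 2)"
  have x: "x \<in> {q<..q + 1}" "\<bar>x - q\<bar> < \<delta>" using d(1) by (auto simp: x_def min_def)
  then have "tr x \<notin> {c..d}" using d(2)[of x] subsetD[OF s(2), of x] by simp
  then show ?thesis using x(1) by (metis imageI subsetD)
 qed
 have half: "(EX c. {..c} <= T) \<or> (EX c. {c..} <= T)" if T: "connected T" "!!c d. \<not> T <= {c..d}" for T :: "real set"
 proof -
  obtain t where t: "t \<in> T" using T(2)[of 0 0] by auto
  show ?thesis
  proof (cases "EX d. ALL x:T. x \<le> d")
   case True
   then obtain d where d: "!!x. x \<in> T ==> x \<le> d" by auto
   have "{..t} <= T"
   proof
    fix x assume "x \<in> {..t}"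
    moreover obtain y where "y \<in> T" "y \<notin> {x..d}" using T(2)[of x d] by blast
    moreover from this have "y < x" using d[of y] by simp
    ultimately show "x \<in> T" using connected_contains_Icc[OF T(1) _ t, of y] by auto
   qed
   then show ?thesis by auto
  next
   case False
   have "{t..} <= T"
   proof
    fix x assume "x \<in> {t..}"
    moreover obtain y where "y \<in> T" "x < y" using False by (auto simp: not_le)
    ultimately show "x \<in> T" using connected_contains_Icc[OF T(1) t, of y] by auto
   qed
   then show ?thesis by auto
  qed
 qed
 have disj: "tr ` {p - 1..<p} Int tr ` {q<..q + 1} = {}"
 proof -
  have "{p - 1..<p} Int {q<..q + 1} = {}" using pq(1) by auto
  then show ?thesis using inj_on_image_Int[OF inj_tr s] by simp
 qed
 \<comment> \<open>By \<open>half\<close> both images contain a half-line. Half-lines in the same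
   direction would meet, against the injectivity of \<open>tr\<close>, so together they contain both
   ends of the line.\<close>
 obtain c d where cd: "!!y. y < c \<or> d < y ==> y \<in> tr ` {p - 1..<p} Un tr ` {q<..q + 1}"
 proof -
  from half[OF c1(1) u1] half[OF c1(2) u2] show ?thesis
  proof (elim disjE exE)
   fix a b assume "{..a} <= tr ` {p - 1..<p}" "{..b} <= tr ` {q<..q + 1}"
   then have "min a b \<in> tr ` {p - 1..<p} Int tr ` {q<..q + 1}" by auto
   then show thesis using disj by simp
  next
   fix a b assume "{a..} <= tr ` {p - 1..<p}" "{b..} <= tr ` {q<..q + 1}"
   then have "max a b \<in> tr ` {p - 1..<p} Int tr ` {q<..q + 1}" by auto
   then show thesis using disj by simp
  next
   fix a b assume "{..a} <= tr ` {p - 1..<p}" "{b..} <= tr ` {q<..q + 1}"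
   then show thesis by (intro that[of a b]) (meson UnI1 UnI2 atLeast_iff atMost_iff less_imp_le subsetD)
  next
   fix a b assume "{a..} <= tr ` {p - 1..<p}" "{..b} <= tr ` {q<..q + 1}"
   then show thesis by (intro that[of b a]) (meson UnI1 UnI2 atLeast_iff atMost_iff less_imp_le subsetD)
  qed
 qed
 have "range \<alpha> Un range \<beta> = \<alpha> ` {p - 1..q + 1} Un \<beta> ` {c..d}"
 proof (intro set_eqI iffI)
  have *: "\<beta> y \<in> \<alpha> ` {p - 1..q + 1} Un \<beta> ` {c..d}" for y
  proof (cases "y \<in> {c..d}")
   case False
   then have "y \<in> tr ` ({p - 1..<p} Un {q<..q + 1})" unfolding image_Un by (intro cd) auto
   then obtain x where x: "x \<in> {p - 1..<p} Un {q<..q + 1}" "y = tr x" by blast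
   then have "x \<in> ov" by (auto simp: inov)
   then have "\<beta> y = \<alpha> x" using tr[of x] x(2) by simp
   moreover have "x \<in> {p - 1..q + 1}" using x(1) pq(1) by auto
   ultimately show ?thesis by blast
  qed blast
  fix z assume "z \<in> range \<alpha> Un range \<beta>"
  then consider y where "z = \<beta> y" | x where "z = \<alpha> x" by auto
  then show "z \<in> \<alpha> ` {p - 1..q + 1} Un \<beta> ` {c..d}"
  proof cases
   case 2
   show ?thesis
   proof (cases "x \<in> {p - 1..q + 1}")
    case False
    then have "x \<in> ov" by (auto simp: inov)
    then show ?thesis using *[of "tr x"] tr[of x] 2 by simp
   qed (use 2 in blast)
  qed (use * in blast)
 qed auto
 moreover have "compactin C (\<alpha> ` {p - 1..q + 1})" "compactin C (\<beta> ` {c..d})"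
  using image_compactin[OF _ arc_inD(1)[OF \<alpha>]] image_compactin[OF _ arc_inD(1)[OF \<beta>]] by auto
 ultimately show ?thesis
  using compactin_imp_closedin[OF Hausdorff] by (metis closedin_Un)
qed

end

lemma arc_lift:
 assumes \<gamma>: "arc_in C \<gamma>" and \<phi>: "continuous_map C euclidean \<phi>" "!!y. y \<in> topspace C ==> cmod (\<phi> y) = 1"
 obtains u where "continuous_on UNIV u" "!!x. \<phi> (\<gamma> x) = cis (u x)"
proof -
 have c: "continuous_on UNIV (%x. \<phi> (\<gamma> x))"
  using continuous_map_compose[OF arc_inD(1)[OF \<gamma>] \<phi>(1)] by (simp add: o_def)
 have n: "cmod (\<phi> (\<gamma> x)) = 1" for x using \<phi>(2) arc_inD(5)[OF \<gamma>] by blast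
 have nz: "\<phi> (\<gamma> x) ~= 0" for x using n[of x] by auto
 obtain g where g: "continuous_on UNIV g" "!!x. \<phi> (\<gamma> x) = exp (g x)"
  using continuous_logarithm_on_contractible[OF c contractible_UNIV] nz by (metis UNIV_I)
 show ?thesis
 proof (rule that[of "%x. Im (g x)"])
  show "continuous_on UNIV (%x. Im (g x))" by (intro continuous_intros g)
  have "Re (g x) = 0" for x using n[of x] by (simp add: g(2))
  then show "\<phi> (\<gamma> x) = cis (Im (g x))" for x by (simp add: g(2) exp_eq_polar)
 qed
qed

section \<open>Lifts over a circle covered by two arcs\<close>

context two_arcs
begin

text \<open>On each of the two components of the overlap the lifts along \<alpha> and \<beta> differ
  by a constant multiple of \<open>2 * pi\<close>. When the two arcs cover the curve,
  \<open>m - n\<close> is, up to sign, the degree of \<phi> on it.\<close>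

lemma lift_jump:
 assumes pq: "p \<le> q" "ov = {..<p} Un {q<..}"
  and \<phi>: "continuous_map C euclidean \<phi>" "!!y. y \<in> topspace C ==> cmod (\<phi> y) = 1"
 obtains u v and m n :: int where "continuous_on UNIV u" "continuous_on UNIV v" "!!x. \<phi> (\<alpha> x) = cis (u x)"
  "!!x. \<phi> (\<beta> x) = cis (v x)" "!!x. x < p ==> u x - v (tr x) = 2 * pi * m"
  "!!x. q < x ==> u x - v (tr x) = 2 * pi * n"
proof -
 obtain u where u: "continuous_on UNIV u" "!!x. \<phi> (\<alpha> x) = cis (u x)" by (rule arc_lift[OF \<alpha> \<phi>]) (assumption, rule that)
 obtain v where v: "continuous_on UNIV v" "!!x. \<phi> (\<beta> x) = cis (v x)" by (rule arc_lift[OF \<beta> \<phi>]) (assumption, rule that)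
 have inov: "x \<in> ov \<longleftrightarrow> x < p \<or> q < x" for x unfolding pq(2) by simp
 define D where "D x = (u x - v (tr x)) / (2 * pi)" for x
 have "continuous_on ov (%x. v (tr x))"
  by (rule continuous_on_compose2[OF v(1) continuous_tr]) simp
 then have cD: "continuous_on ov D" unfolding D_def
  by (intro continuous_intros continuous_on_subset[OF u(1)]) auto
 have ZD: "D x \<in> \<int>" if "x \<in> ov" for x
 proof -
  have "cis (u x) = cis (v (tr x))" using tr[OF that] u(2)[of x] v(2)[of "tr x"] by simp
  then obtain m :: int where "u x = v (tr x) + 2 * pi * m" by (auto simp: cis_eq_iff)
  then have "D x = of_int m" by (simp add: D_def)
  then show ?thesis by simp
 qed
 have const: "EX n::int. ALL x:S. D x = n" if "connected S" "S <= ov" for S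
 proof -
  have "connected_space (top_of_set S)"
   using that(1) unfolding connectedin_iff_connected[symmetric] connectedin_def by simp
  then show ?thesis
   using Ints_valued_constant[of "top_of_set S" D] ZD continuous_on_subset[OF cD that(2)] that(2) by auto
 qed
 have S: "{..<p} <= ov" "{q<..} <= ov" by (auto simp: inov)
 obtain m :: int where m: "!!x. x < p ==> D x = m" using const[OF _ S(1)] by auto
 obtain n :: int where n: "!!x. q < x ==> D x = n" using const[OF _ S(2)] by auto
 show ?thesis
 proof (rule that[OF u(1) v(1) u(2) v(2)])
  show "u x - v (tr x) = 2 * pi * m" if "x < p" for x using m[OF that] by (simp add: D_def field_simps)
  show "u x - v (tr x) = 2 * pi * n" if "q < x" for x using n[OF that] by (simp add: D_def field_simps)
 qed
qed

text \<open>Shifting \<open>v\<close> by \<open>2 * pi * of_int m\<close> does not change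
  \<open>cis\<close> and makes the two lifts agree on the overlap.\<close>

lemma glue_lifts:
 assumes cov: "range \<alpha> Un range \<beta> = topspace C" and uv: "continuous_on UNIV u" "continuous_on UNIV v"
  and k: "!!x. k (\<alpha> x) = cis (u x)" "!!x. k (\<beta> x) = cis (v x)"
  and eq: "!!x. x \<in> ov ==> u x = v (tr x) + 2 * pi * of_int m"
 shows "lifts C k"
proof -
 define w where "w y = (if y \<in> range \<alpha> then u (inv \<alpha> y) else v (inv \<beta> y) + 2 * pi * of_int m)" for y
 have wa: "w (\<alpha> x) = u x" for x using arc_inD(2)[OF \<alpha>] by (simp add: w_def)
 have wb: "w (\<beta> y) = v y + 2 * pi * of_int m" for y
 proof (cases "\<beta> y \<in> range \<alpha>")
  case True
  then obtain x where "\<alpha> x = \<beta> y" by auto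
  then show ?thesis using tr_eqI[of x y] eq[of x] wa[of x] by auto
 next
  case False then show ?thesis using arc_inD(2)[OF \<beta>] by (simp add: w_def)
 qed
 have c: "continuous_map (subtopology C (range \<gamma>)) euclideanreal w"
  if g: "arc_in C \<gamma>" and f: "continuous_on UNIV f" "!!x. w (\<gamma> x) = f x" for \<gamma> and f :: "real => real"
 proof (rule continuous_map_eq)
  show "continuous_map (subtopology C (range \<gamma>)) euclideanreal (%y. f (inv \<gamma> y))"
   by (rule continuous_map_op[OF arc_inv_continuous[OF g] f(1)])
  show "f (inv \<gamma> y) = w y" if "y \<in> topspace (subtopology C (range \<gamma>))" for y
   using that f(2) arc_inD(2)[OF g] by auto
 qed
 have "continuous_map (subtopology C (topspace C)) euclideanreal w"
 proof (rule continuous_map_locally)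
  fix y assume y: "y \<in> topspace C"
  have cvb: "continuous_on UNIV (%x. v x + 2 * pi * of_int m)" by (intro continuous_intros uv)
  have cb: "continuous_map (subtopology C (range \<beta> Int topspace C)) euclideanreal w"
   and ca: "continuous_map (subtopology C (range \<alpha> Int topspace C)) euclideanreal w"
   using c[OF \<beta> cvb wb] c[OF \<alpha> uv(1) wa] arc_inD(5)[OF \<alpha>] arc_inD(5)[OF \<beta>] by (simp_all add: inf_absorb1)
  have "y \<in> range \<alpha> \<or> y \<in> range \<beta>" using y cov by auto
  then show "EX G. openin C G & y \<in> G & continuous_map (subtopology C (G Int topspace C)) euclideanreal w"
  proof
   assume "y \<in> range \<alpha>"
   then show ?thesis using ca arc_inD(4)[OF \<alpha>] by (intro exI[of _ "range \<alpha>"]) simp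
  next
   assume "y \<in> range \<beta>"
   then show ?thesis using cb arc_inD(4)[OF \<beta>] by (intro exI[of _ "range \<beta>"]) simp
  qed
 qed simp
 then have "continuous_map C euclideanreal w" by simp
 moreover have "k y = cis (w y)" if "y \<in> topspace C" for y
 proof -
  from that cov have "y \<in> range \<alpha> \<or> y \<in> range \<beta>" by auto
  then show ?thesis
  proof
   assume "y \<in> range \<beta>"
   then obtain x where "y = \<beta> x" by auto
   moreover have "cis (v x) = cis (v x + 2 * pi * of_int m)" unfolding cis_eq_iff by (intro exI[of _ "- m"]) simp
   ultimately show ?thesis using k(2)[of x] wb[of x] by simp
  qed (use k(1) wa in auto)
 qed
 ultimately show ?thesis by (auto simp: lifts_def)
qed

lemma both_lift:
 assumes pq: "p \<le> q" "ov = {..<p} Un {q<..}" and cov: "range \<alpha> Un range \<beta> = topspace C"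
  and \<phi>: "continuous_map C euclidean \<phi>" "!!y. y \<in> topspace C ==> cmod (\<phi> y) = 1"
  and \<psi>: "continuous_map C euclidean \<psi>" "!!y. y \<in> topspace C ==> cmod (\<psi> y) = 1"
 shows "EX a b::int. (a ~= 0 \<or> b ~= 0) & lifts C (%y. \<phi> y powi a * \<psi> y powi b)"
proof -
 obtain u v and m n :: int where 1: "continuous_on UNIV u" "continuous_on UNIV v" "!!x. \<phi> (\<alpha> x) = cis (u x)"
  "!!x. \<phi> (\<beta> x) = cis (v x)" "!!x. x < p ==> u x - v (tr x) = 2 * pi * m"
  "!!x. q < x ==> u x - v (tr x) = 2 * pi * n" by (rule lift_jump[OF pq \<phi>]) (assumption, rule that)
 obtain u' v' and m' n' :: int where 2: "continuous_on UNIV u'" "continuous_on UNIV v'" "!!x. \<psi> (\<alpha> x) = cis (u' x)"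
  "!!x. \<psi> (\<beta> x) = cis (v' x)" "!!x. x < p ==> u' x - v' (tr x) = 2 * pi * m'"
  "!!x. q < x ==> u' x - v' (tr x) = 2 * pi * n'" by (rule lift_jump[OF pq \<psi>]) (assumption, rule that)
 \<comment> \<open>The product has degree zero: its jumps on both components of the overlap agree
   exactly under the second condition. If both degrees vanish any exponents do; otherwise each
   exponent is the degree of the other map, with one sign changed.\<close>
 obtain a b :: int where ab: "a ~= 0 \<or> b ~= 0" "a * (m - n) + b * (m' - n') = 0"
 proof (cases "m - n = 0 & m' - n' = 0")
  case True then show ?thesis by (intro that[of 1 0]) auto
 next
  case False then show ?thesis by (intro that[of "m' - n'" "- (m - n)"]) (auto simp: algebra_simps)
 qed
 have e1: "u x = v (tr x) + 2 * pi * m" "u' x = v' (tr x) + 2 * pi * m'" if "x < p" for x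
  using 1(5)[OF that] 2(5)[OF that] by linarith+
 have e2: "u x = v (tr x) + 2 * pi * n" "u' x = v' (tr x) + 2 * pi * n'" if "q < x" for x
  using 1(6)[OF that] 2(6)[OF that] by linarith+
 have mn: "a * n + b * n' = a * m + b * m'" using ab(2) by (simp add: algebra_simps)
 then have mnr: "of_int a * of_int n + of_int b * of_int n' = of_int a * of_int m + of_int b * (of_int m' :: real)"
  by (metis of_int_add of_int_mult)
 have "lifts C (%y. \<phi> y powi a * \<psi> y powi b)"
 proof (rule glue_lifts[OF cov, where u="%x. of_int a * u x + of_int b * u' x"
    and v="%x. of_int a * v x + of_int b * v' x" and m="a * m + b * m'"])
  show "continuous_on UNIV (%x. of_int a * u x + of_int b * u' x)"
   "continuous_on UNIV (%x. of_int a * v x + of_int b * v' x)"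
   by (intro continuous_intros 1 2)+
  show "\<phi> (\<alpha> x) powi a * \<psi> (\<alpha> x) powi b = cis (of_int a * u x + of_int b * u' x)"
   "\<phi> (\<beta> x) powi a * \<psi> (\<beta> x) powi b = cis (of_int a * v x + of_int b * v' x)" for x
   by (simp_all add: 1 2 cis_power_int cis_mult)
  fix x assume "x \<in> ov"
  then consider "x < p" | "q < x" unfolding pq(2) by auto
  then show "of_int a * u x + of_int b * u' x = of_int a * v (tr x) + of_int b * v' (tr x) + 2 * pi * of_int (a * m + b * m')"
  proof cases
   case 1
   show ?thesis unfolding e1[OF 1] by (simp add: algebra_simps)
  next
   case 2
   have "of_int a * u x + of_int b * u' x = of_int a * v (tr x) + of_int b * v' (tr x)
     + 2 * pi * (of_int a * of_int n + of_int b * of_int n')"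
    unfolding e2[OF 2] by (simp add: algebra_simps)
   then show ?thesis unfolding mnr by simp
  qed
 qed
 then show ?thesis using ab(1) by blast
qed

end

text \<open>If the overlap is a ray in the parameter of \<alpha>, it is connected, and so is its
  image in the parameter of \<beta>, which is therefore a ray too. After reversing arcs as necessary
  the rays point in the directions required by \<open>join\<close>.\<close>

lemma two_arcs_join:
 assumes "Hausdorff_space C" "arc_in C \<alpha>" "arc_in C \<beta>" "\<not> range \<alpha> <= range \<beta>" "\<not> range \<beta> <= range \<alpha>"
  "range \<alpha> Int range \<beta> ~= {}"
 shows "(EX \<gamma>. arc_in C \<gamma> & range \<gamma> = range \<alpha> Un range \<beta>) \<or>
  (EX p q. p \<le> q & two_arcs.ov \<alpha> \<beta> = {..<p} Un {q<..})"
proof -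
 interpret A: two_arcs C \<alpha> \<beta> using assms by unfold_locales auto
 interpret B: two_arcs C \<beta> \<alpha> using assms by unfold_locales auto
 from assms(6) obtain c where "c \<in> range \<alpha>" "c \<in> range \<beta>" by blast
 moreover from this obtain x0 where "c = \<alpha> x0" by blast
 moreover from calculation obtain y0 where "c = \<beta> y0" by blast
 ultimately have xy0: "\<alpha> x0 = \<beta> y0" by simp
 have "x0 \<in> A.ov" "y0 \<in> B.ov" using A.tr_eqI[OF xy0] B.tr_eqI[OF xy0[symmetric]] by simp_all
 then have Aov: "A.ov ~= {}" and Bov: "B.ov ~= {}" by blast+
 have Bov_im: "B.ov = A.tr ` A.ov"
 proof (intro set_eqI iffI)
  fix y assume "y \<in> B.ov"
  then obtain x where "\<alpha> x = \<beta> y" by (auto simp: B.ov_def)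
  then show "y \<in> A.tr ` A.ov" using A.tr_eqI by blast
 next
  fix y assume "y \<in> A.tr ` A.ov"
  then obtain x where "x \<in> A.ov" "y = A.tr x" by auto
  then have "\<beta> y = \<alpha> x" using A.tr by simp
  then show "y \<in> B.ov" by (simp add: B.ov_def)
 qed
 have ray: "EX \<alpha>'. arc_in C \<alpha>' & range \<alpha>' = range \<alpha> & (EX q. two_arcs.ov \<alpha>' \<beta> = {q<..})"
  if "A.ov = {..<p}" for p
 proof -
  have "two_arcs.ov (%x. \<alpha> (- x)) \<beta> = {- p<..}"
  proof -
   interpret R: two_arcs C "%x. \<alpha> (- x)" \<beta>
    using assms arc_in_reverse(1)[OF assms(2)] by unfold_locales auto
   have "x \<in> R.ov \<longleftrightarrow> - x \<in> A.ov" for x by (simp add: R.ov_def A.ov_def)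
   then have "x \<in> R.ov \<longleftrightarrow> x \<in> {- p<..}" for x unfolding that by (simp add: minus_less_iff)
   then show ?thesis by blast
  qed
  then show ?thesis using arc_in_reverse[OF assms(2)] by (intro exI[of _ "%x. \<alpha> (- x)"] conjI exI[of _ "- p"])
 qed
 have key: "EX \<gamma>. arc_in C \<gamma> & range \<gamma> = range \<alpha>' Un range \<beta>"
  if a: "arc_in C \<alpha>'" "range \<alpha>' = range \<alpha>" and q: "two_arcs.ov \<alpha>' \<beta> = {q<..}" for \<alpha>' q
 proof -
  interpret A': two_arcs C \<alpha>' \<beta> using assms a by unfold_locales auto
  have "connected (A'.tr ` A'.ov)"
   by (rule connected_continuous_image[OF A'.continuous_tr]) (simp add: q)
  moreover have "A'.tr ` A'.ov = B.ov"
  proof (intro set_eqI iffI)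
   fix y assume "y \<in> B.ov"
   then have "\<beta> y \<in> range \<alpha>'" using a(2) by (simp add: B.ov_def)
   then obtain x where "\<alpha>' x = \<beta> y" by auto
   then show "y \<in> A'.tr ` A'.ov" using A'.tr_eqI by blast
  next
   fix y assume "y \<in> A'.tr ` A'.ov"
   then obtain x where "x \<in> A'.ov" "y = A'.tr x" by auto
   then have "\<beta> y = \<alpha>' x" using A'.tr by simp
   then show "y \<in> B.ov" using a(2) by (auto simp: B.ov_def)
  qed
  ultimately have conn: "connected B.ov" by simp
  have Bo: "{y. \<beta> y \<in> range \<alpha>'} = B.ov" using a(2) by (simp add: B.ov_def)
  show ?thesis
  proof (cases rule: B.ov_cases[OF assms(5,4) Bov])
   case (1 r)
   interpret R: two_arcs C \<alpha>' "%x. \<beta> (- x)"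
    using assms a arc_in_reverse(1)[OF assms(3)] by unfold_locales auto
   have Rr: "R.ov = {q<..}"
    using q arc_in_reverse(2)[OF assms(3)] by (simp add: R.ov_def A'.ov_def)
   have Rs: "{y. \<beta> (- y) \<in> range \<alpha>'} = {..<- r}"
   proof -
    have "\<beta> (- y) \<in> range \<alpha>' \<longleftrightarrow> - y \<in> B.ov" for y using a(2) by (simp add: B.ov_def)
    then have "\<beta> (- y) \<in> range \<alpha>' \<longleftrightarrow> y < - r" for y unfolding 1 by (simp add: less_minus_iff)
    then show ?thesis by auto
   qed
   obtain \<gamma> where "arc_in C \<gamma>" "range \<gamma> = range \<alpha>' Un range (%x. \<beta> (- x))"
    by (rule R.join[OF Rr Rs])
   then show ?thesis using arc_in_reverse(2)[OF assms(3)] by auto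
  next
   case (2 r)
   obtain \<gamma> where "arc_in C \<gamma>" "range \<gamma> = range \<alpha>' Un range \<beta>"
    by (rule A'.join[OF q Bo[unfolded 2]])
   then show ?thesis by auto
  next
   case (3 r s)
   have "{r - 1..s + 1} <= B.ov" by (rule connected_contains_Icc[OF conn]) (auto simp: 3)
   moreover have "r \<in> {r - 1..s + 1}" "r \<notin> B.ov" using 3 by auto
   ultimately show ?thesis by blast
  qed
 qed
 show ?thesis
 proof (cases rule: A.ov_cases[OF assms(4,5) Aov])
  case (1 q)
  then show ?thesis using key[OF assms(2) refl] by auto
 next
  case (2 p)
  from ray[OF 2] obtain \<alpha>' q where a: "arc_in C \<alpha>'" "range \<alpha>' = range \<alpha>" "two_arcs.ov \<alpha>' \<beta> = {q<..}" by auto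
  show ?thesis using key[OF a] a(2) by auto
 next
  case (3 p q)
  then show ?thesis by blast
 qed
qed

text \<open>Among all arcs, \<open>A\<close> contains as many members of a finite cover as possible.
  If \<open>A\<close> is not everything, some point of its closure lies outside it, in a member
  \<open>B\<close> that meets \<open>A\<close>. By maximality \<open>A\<close> and \<open>B\<close>
  cannot be joined to one arc, so their overlap has two ends. Their union is open and closed, hence
  everything, and \<open>both_lift\<close> applies.\<close>

theorem one_manifold_lifts:
 assumes C: "compact_space C" "Hausdorff_space C" "connected_space C"
  and arcs: "!!y. y \<in> topspace C ==> EX \<gamma>. arc_in C \<gamma> & y \<in> range \<gamma>"
  and \<phi>: "continuous_map C euclidean \<phi>" "!!y. y \<in> topspace C ==> cmod (\<phi> y) = 1"
  and \<psi>: "continuous_map C euclidean \<psi>" "!!y. y \<in> topspace C ==> cmod (\<psi> y) = 1"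
 shows "EX a b::int. (a ~= 0 \<or> b ~= 0) & lifts C (%y. \<phi> y powi a * \<psi> y powi b)"
proof (cases "topspace C = {}")
 case True
 have "continuous_map C euclideanreal (%_. 0)" by simp
 then have "lifts C (%y. \<phi> y powi 1 * \<psi> y powi 0)" using True unfolding lifts_def by blast
 then show ?thesis by (intro exI[of _ 1] exI[of _ 0]) simp
next
 case False
 define R where "R = {range \<gamma> | \<gamma>. arc_in C \<gamma>}"
 have Ro: "openin C A" if "A \<in> R" for A using that arc_inD(4) by (auto simp: R_def)
 have "topspace C <= \<Union>R"
 proof
  fix y assume "y \<in> topspace C"
  then show "y \<in> \<Union>R" using arcs[of y] by (auto simp: R_def)
 qed
 then have "EX \<F>. finite \<F> & \<F> <= R & topspace C <= \<Union>\<F>"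
  using compactinD[of C "topspace C" R] C(1) Ro by (simp add: compact_space_def)
 then obtain \<F> where F: "finite \<F>" "\<F> <= R" "topspace C <= \<Union>\<F>" by auto
 \<comment> \<open>A bounded measure of size for arcs: a strictly larger value results whenever an
   arc is enlarged so as to contain a new member of the cover. It makes a maximal arc available
   without a limit process.\<close>
 define N where "N A = card {B \<in> \<F>. B <= A}" for A
 have Nle: "N A \<le> card \<F>" for A unfolding N_def by (rule card_mono[OF F(1)]) auto
 have Nless: "N A < N A'" if "A <= A'" "B \<in> \<F>" "B <= A'" "\<not> B <= A" for A A' B
  unfolding N_def by (rule psubset_card_mono) (use F(1) that in auto)
 obtain y0 where "y0 \<in> topspace C" using False by blast
 then obtain \<gamma>0 where "arc_in C \<gamma>0" using arcs[of y0] by auto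
 then have "range \<gamma>0 \<in> R" unfolding R_def by blast
 then obtain B0 where "B0 \<in> R" by blast
 obtain A where A: "A \<in> R" "!!A'. A' \<in> R ==> N A' \<le> N A"
 proof -
  have "finite (N ` R)" by (rule finite_subset[of _ "{..card \<F>}"]) (use Nle in auto)
  moreover have "N ` R ~= {}" using \<open>B0 \<in> R\<close> by auto
  ultimately have "Max (N ` R) \<in> N ` R" by (rule Max_in)
  then obtain A where "A \<in> R" "N A = Max (N ` R)" by auto
  then show ?thesis using \<open>finite (N ` R)\<close> by (intro that[of A]) auto
 qed
 obtain \<alpha> where arcA: "arc_in C \<alpha>" "A = range \<alpha>" using A(1) by (auto simp: R_def)
 show ?thesis
 proof (cases "A = topspace C")
  case True
  obtain u where u: "continuous_on UNIV u" "!!x. \<phi> (\<alpha> x) = cis (u x)" by (rule arc_lift[OF arcA(1) \<phi>]) (assumption, rule that)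
  have "continuous_map (subtopology C (range \<alpha>)) euclideanreal (%y. u (inv \<alpha> y))"
   by (rule continuous_map_op[OF arc_inv_continuous[OF arcA(1)] u(1)])
  then have "continuous_map C euclideanreal (%y. u (inv \<alpha> y))" using True arcA(2) by simp
  moreover have "\<phi> y = cis (u (inv \<alpha> y))" if "y \<in> topspace C" for y
   using that u(2) True arcA(2) by (metis f_inv_into_f)
  ultimately have "lifts C (%y. \<phi> y powi 1 * \<psi> y powi 0)" by (auto simp: lifts_def)
  then show ?thesis by (intro exI[of _ 1] exI[of _ 0]) simp
 next
  case False
  have oA: "openin C A" using Ro A(1) .
  have A0: "A ~= {}" using arcA(2) by auto
  have "\<not> closedin C A"
   using C(3) oA A0 False unfolding connected_space_clopen_in by auto
  then obtain y where y: "y \<in> C closure_of A" "y \<notin> A"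
   using closure_of_subset_eq[of A C] openin_subset[OF oA] by auto
  have "y \<in> topspace C" using y(1) closure_of_subset_topspace[of C A] by auto
  then obtain B where B: "B \<in> \<F>" "y \<in> B" using F(3) by auto
  then obtain \<beta> where arcB: "arc_in C \<beta>" "B = range \<beta>" using F(2) by (auto simp: R_def)
  have "A Int B ~= {}" using y(1) B(2) Ro[of B] B(1) F(2) by (auto simp: in_closure_of)
  then have ne: "range \<alpha> Int range \<beta> ~= {}" using arcA(2) arcB(2) by simp
  have nBA: "\<not> range \<beta> <= range \<alpha>" using y(2) B(2) arcA(2) arcB(2) by auto
  have nAB: "\<not> range \<alpha> <= range \<beta>"
  proof
   assume "range \<alpha> <= range \<beta>"
   then have "N A < N B" using Nless[of A B B] B(1) nBA arcA(2) arcB(2) by auto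
   then show False using A(2)[of B] B(1) F(2) by auto
  qed
  interpret two_arcs C \<alpha> \<beta> using C arcA arcB by unfold_locales auto
  have "\<nexists>\<gamma>. arc_in C \<gamma> & range \<gamma> = range \<alpha> Un range \<beta>"
  proof
   assume "EX \<gamma>. arc_in C \<gamma> & range \<gamma> = range \<alpha> Un range \<beta>"
   then obtain \<gamma> where "arc_in C \<gamma>" "A Un B = range \<gamma>" using arcA(2) arcB(2) by auto
   then have "A Un B \<in> R" unfolding R_def by blast
   moreover have "N A < N (A Un B)" using Nless[of A "A Un B" B] B(1) nBA arcA(2) arcB(2) by auto
   ultimately show False using A(2)[of "A Un B"] by auto
  qed
  then obtain p q where pq: "p \<le> q" "ov = {..<p} Un {q<..}"
   using two_arcs_join[OF C(2) arcA(1) arcB(1) nAB nBA ne] by auto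
  have "closedin C (range \<alpha> Un range \<beta>)" by (rule closedin_both[OF pq])
  moreover have "openin C (range \<alpha> Un range \<beta>)"
   using arc_inD(4)[OF arcA(1)] arc_inD(4)[OF arcB(1)] by (rule openin_Un)
  ultimately have "range \<alpha> Un range \<beta> = topspace C"
   using C(3) unfolding connected_space_clopen_in by auto
  then show ?thesis by (rule both_lift[OF pq _ \<phi> \<psi>])
 qed
qed

text \<open>The difference of \<open>of_int n * t\<close> and the lift is an integral multiple of
  \<open>2 * pi\<close>, hence constant in \<open>t\<close>; comparing \<open>t = 0\<close> with
  \<open>t = 2 * pi\<close>, where the lift has the same value, leaves \<open>n = 0\<close>.\<close>

lemma power_not_lifts:
 assumes "lifts (top_of_set (sphere (0::complex) 1)) (%z. z powi n)" shows "n = 0"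
proof -
 obtain u where u: "continuous_on (sphere 0 1) u" "!!z. cmod z = 1 ==> z powi n = cis (u z)"
  using assms by (auto simp: lifts_def)
 define f where "f t = (of_int n * t - u (cis t)) / (2 * pi)" for t
 have "continuous_on UNIV (%t. u (cis t))"
  by (rule continuous_on_compose2[OF u(1)]) (auto intro!: continuous_intros)
 then have "continuous_on UNIV f" unfolding f_def by (intro continuous_intros) auto
 have "f t \<in> \<int>" for t
 proof -
  have "cis (of_int n * t) = cis (u (cis t))" using u(2)[of "cis t"] by (simp add: cis_power_int)
  then obtain m :: int where "of_int n * t = u (cis t) + 2 * pi * m" by (auto simp: cis_eq_iff)
  then have "f t = of_int m" by (simp add: f_def)
  then show ?thesis by simp
 qed
 then obtain m :: int where m: "!!t. f t = m"
 proof -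
  have "connected_space euclideanreal" using connected_UNIV[where 'a=real]
   unfolding connectedin_iff_connected[symmetric] connectedin_def by simp
  then show ?thesis
   using Ints_valued_constant[of euclideanreal f] \<open>continuous_on UNIV f\<close> \<open>!!t. f t \<in> \<int>\<close> that by auto
 qed
 have "f (2 * pi) - f 0 = of_int n" by (simp add: f_def diff_divide_distrib)
 then show ?thesis using m[of 0] m[of "2 * pi"] by simp
qed

section \<open>Boundary points\<close>

text \<open>Invariance of domain. It makes the boundary independent of the chart, although
  \<open>mboundary\<close> asks for a single chart in which the point is not interior.\<close>

lemma not_mboundaryI:
 fixes M :: "('a, 'e::euclidean_space) manifold" and g :: "'d::euclidean_space => 'a"
 assumes M: "smooth_manifold M" and D: "open D" and g: "continuous_map (top_of_set D) (topo M) g" "inj_on g D"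
  and d0: "d0 \<in> D" and dim: "DIM('d) = DIM('e)"
 shows "g d0 \<notin> mboundary M"
proof
 assume "g d0 \<in> mboundary M"
 then obtain U \<psi> where c: "(U, \<psi>) \<in> charts M" "g d0 \<in> U" "\<psi> (g d0) \<notin> interior (\<psi> ` U)"
  by (auto simp: mboundary_def)
 let ?D = "{x \<in> D. g x \<in> U}"
 have "openin (top_of_set D) ?D"
  using openin_continuous_map_preimage[OF g(1) chart_open[OF M c(1)]] by simp
 then have oD: "open ?D" using D openin_open_trans by blast
 have "continuous_map (top_of_set ?D) (subtopology (topo M) U) g"
  using continuous_map_from_subtopology_mono[OF g(1), of ?D] by (auto simp: continuous_map_in_subtopology)
 from continuous_map_compose[OF this chart_continuous[OF M c(1)]]
 have cont: "continuous_on ?D (%x. \<psi> (g x))" by (simp add: o_def)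
 have "inj_on (%x. \<psi> (g x)) ?D"
  using g(2) chart_inj[OF M c(1)] by (auto simp: inj_on_def)
 then have "open ((%x. \<psi> (g x)) ` ?D)" by (rule invariance_of_domain_gen[OF oD cont]) (simp add: dim)
 moreover have "(%x. \<psi> (g x)) ` ?D <= \<psi> ` U" by auto
 moreover have "\<psi> (g d0) \<in> (%x. \<psi> (g x)) ` ?D" using d0 c(2) by auto
 ultimately show False using c(3) interiorI by blast
qed

lemma interior_param:
 fixes M :: "('a, 'e::euclidean_space) manifold"
 assumes M: "smooth_manifold M" and p: "p \<in> carr M" "p \<notin> mboundary M"
 obtains D and g :: "'e => 'a" and d0 where "open D" "d0 \<in> D" "g d0 = p" "continuous_map (top_of_set D) (topo M) g"
  "inj_on g D" "openin (topo M) (g ` D)"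
proof -
 obtain U \<phi> where c: "(U, \<phi>) \<in> charts M" "p \<in> U" using chart_at[OF M p(1)] .
 let ?D = "interior (\<phi> ` U)"
 have sub: "?D <= \<phi> ` U" by (rule interior_subset)
 have im: "inv_into U \<phi> ` ?D = {x \<in> U. \<phi> x \<in> ?D}"
 proof (intro set_eqI iffI)
  fix x assume "x \<in> inv_into U \<phi> ` ?D"
  then obtain y where "y \<in> ?D" "x = inv_into U \<phi> y" by blast
  moreover from this sub have "y \<in> \<phi> ` U" by blast
  ultimately show "x \<in> {x \<in> U. \<phi> x \<in> ?D}" by (simp add: f_inv_into_f inv_into_into)
 next
  fix x assume x: "x \<in> {x \<in> U. \<phi> x \<in> ?D}"
  then have "x = inv_into U \<phi> (\<phi> x)" using chart_inj[OF M c(1)] by simp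
  then show "x \<in> inv_into U \<phi> ` ?D" using x by blast
 qed
 show ?thesis
 proof (rule that[of ?D "\<phi> p" "inv_into U \<phi>"])
  show "\<phi> p \<in> ?D" using p(2) c by (auto simp: mboundary_def)
  show "inv_into U \<phi> (\<phi> p) = p" using chart_inj[OF M c(1)] c(2) by simp
  show "continuous_map (top_of_set ?D) (topo M) (inv_into U \<phi>)"
   using continuous_map_from_subtopology_mono[OF chart_inv_continuous_carr[OF M c(1)] sub] .
  show "inj_on (inv_into U \<phi>) ?D" by (rule inj_on_inv_into[OF sub])
  show "openin (topo M) (inv_into U \<phi> ` ?D)"
   unfolding im by (rule smooth_map_openin_preimage[OF chart_smooth[OF M c(1)]]) (use chart_open[OF M c(1)] in auto)
 qed simp
qed

text \<open>Compose a parametrization near \<open>q\<close> with \<open>f\<close> and use invariance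
  of domain. It compares boundaries both for the inclusions into the glued manifold and for local
  trivializations.\<close>

lemma not_mboundary_image:
 fixes M :: "('a, 'e::euclidean_space) manifold" and N :: "('b, 'd::euclidean_space) manifold"
 assumes M: "smooth_manifold M" and N: "smooth_manifold N" and dim: "DIM('e) = DIM('d)"
  and S: "openin (topo M) S" and f: "continuous_map (subtopology (topo M) S) (topo N) f" "inj_on f S"
  and q: "q \<in> S" "q \<notin> mboundary M"
 shows "f q \<notin> mboundary N"
proof -
 have "q \<in> carr M" using q(1) openin_subset[OF S] by auto
 then obtain D and g :: "'e => 'a" and d0 where D: "open D" "d0 \<in> D" "g d0 = q"
  "continuous_map (top_of_set D) (topo M) g" "inj_on g D"
  by (rule interior_param[OF M _ q(2)])
 let ?D = "{x \<in> D. g x \<in> S}"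
 have "openin (top_of_set D) ?D"
  using openin_continuous_map_preimage[OF D(4) S] by simp
 then have oD: "open ?D" using D(1) openin_open_trans by blast
 have "continuous_map (top_of_set ?D) (subtopology (topo M) S) g"
  using continuous_map_from_subtopology_mono[OF D(4), of ?D] by (auto simp: continuous_map_in_subtopology)
 from continuous_map_compose[OF this f(1)]
 have "continuous_map (top_of_set ?D) (topo N) (%x. f (g x))" by (simp add: o_def)
 moreover have "inj_on (%x. f (g x)) ?D"
  using f(2) D(5) by (auto simp: inj_on_def)
 ultimately have "f (g d0) \<notin> mboundary N"
  by (rule not_mboundaryI[OF N oD]) (use D q dim in auto)
 then show ?thesis using D(3) by simp
qed

lemma mboundary_subset:
 assumes "smooth_manifold M" shows "mboundary M <= carr M"
 using chart_subset[OF assms] by (auto simp: mboundary_def)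

lemma closedin_mboundary:
 fixes M :: "('a, 'e::euclidean_space) manifold"
 assumes M: "smooth_manifold M" shows "closedin (topo M) (mboundary M)"
proof -
 have "openin (topo M) (carr M - mboundary M)"
  unfolding openin_subopen[of "topo M" "carr M - mboundary M"]
 proof
  fix p assume p: "p \<in> carr M - mboundary M"
  then obtain D and g :: "'e => 'a" and d0 where D: "open D" "d0 \<in> D" "g d0 = p" "continuous_map (top_of_set D) (topo M) g" "inj_on g D"
   "openin (topo M) (g ` D)" using interior_param[OF M, of p] by (metis DiffD1 DiffD2)
  have "g ` D <= carr M - mboundary M"
   using openin_subset[OF D(6)] not_mboundaryI[OF M D(1,4,5)] by blast
  then show "EX T. openin (topo M) T & p \<in> T & T <= carr M - mboundary M"
   using D(2,3,6) by (intro exI[of _ "g ` D"]) auto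
 qed
 then show ?thesis using mboundary_subset[OF M] by (simp add: closedin_def)
qed

section \<open>Derivatives and charts at boundary points\<close>

lemma model_open_closure:
 fixes S :: "'e::euclidean_space set"
 assumes "model_open S" shows "S <= closure (interior S)"
 using assms unfolding model_open_def
proof
 assume "open S" then show ?thesis by (simp add: interior_open closure_subset)
next
 assume "EX b:Basis. openin (top_of_set {x. 0 \<le> x \<bullet> b}) S"
 then obtain b T where b: "b \<in> Basis" "open T" "S = {x. 0 \<le> x \<bullet> b} Int T" by (auto simp: openin_open)
 have "open ({x. 0 < x \<bullet> b} Int T)" using b(2) by (intro open_Int open_Collect_less continuous_intros)
 then have sub: "{x. 0 < x \<bullet> b} Int T <= interior S" by (rule interior_maximal[rotated]) (auto simp: b(3))
 show ?thesis
 proof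
  fix x assume x: "x \<in> S"
  show "x \<in> closure (interior S)"
   unfolding closure_approachable
  proof (intro allI impI)
   fix e :: real assume e: "e > 0"
   obtain d where d: "d > 0" "ball x d <= T" using b(2,3) x open_contains_ball by blast
   define t where "t = min e d / 2"
   have t: "t > 0" "t < e" "t < d" using e d(1) by (auto simp: t_def)
   have "x + t *\<^sub>R b \<in> T" using d(2) t b(1) by (auto simp: dist_norm subset_iff)
   moreover have "0 < (x + t *\<^sub>R b) \<bullet> b" using x b t by (simp add: inner_add_left inner_Basis add_nonneg_pos)
   ultimately have "x + t *\<^sub>R b \<in> interior S" using sub by auto
   moreover have "dist (x + t *\<^sub>R b) x < e" using t b(1) by (simp add: dist_norm)
   ultimately show "EX y:interior S. dist y x < e" by blast
  qed
 qed
qed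

text \<open>At a boundary point the derivative of an extension is determined by the values on the
  half-space.\<close>

lemma derivative_id_at_boundary:
 fixes F :: "'e::euclidean_space => 'e"
 assumes O': "open O'" and F: "Cinf O' F" and S: "model_open S" and eq: "!!x. x \<in> S Int O' ==> F x = x"
  and x0: "x0 \<in> S" "x0 \<in> O'" and A: "(F has_derivative A) (at x0)"
 shows "A v = v"
proof -
 obtain F' where F': "!!x. x \<in> O' ==> (F has_derivative F' x) (at x)" "!!v. Cinf O' (%x. F' x v)"
  using Cinf_derivative[OF F O'] by blast
 have int: "F' x v = v" if x: "x \<in> interior S Int O'" for x
 proof -
  have o: "open (interior S Int O')" using O' by auto
  have "((%x. x) has_derivative (%v. v)) (at x)" by simp
  then have "(F has_derivative (%v. v)) (at x)"
   by (rule has_derivative_transform_within_open[OF _ o x]) (use eq interior_subset in force)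
  then have "F' x = (%v. v)" using has_derivative_unique F'(1) x by blast
  then show ?thesis by simp
 qed
 have x0c: "x0 \<in> closure (interior S Int O')"
  using open_Int_closure_subset[OF O', of "interior S"] model_open_closure[OF S] x0 by (auto simp: Int_commute)
 have c: "continuous (at x0) (%x. F' x v)"
  using Cinf_continuous[OF F'(2)] O' x0(2) by (simp add: continuous_on_eq_continuous_at)
 have "F' x0 v = v"
 proof (rule ccontr)
  assume "F' x0 v ~= v"
  then have "0 < dist (F' x0 v) v" by simp
  then obtain d where d: "d > 0" "!!x. dist x x0 < d ==> dist (F' x v) (F' x0 v) < dist (F' x0 v) v"
   using c unfolding continuous_at_eps_delta by (metis dist_commute)
  obtain y where "y \<in> interior S Int O'" "dist y x0 < d" using x0c d(1) closure_approachable by blast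
  then show False using d(2)[of y] int[of y] by (simp add: dist_commute)
 qed
 then show ?thesis using has_derivative_unique[OF F'(1)[OF x0(2)] A] by simp
qed

text \<open>A chart around a boundary point cannot have an open image, so it is modelled on a
  half-space. Off the bounding hyperplane points have open neighbourhoods in the image and are not
  boundary points by invariance of domain; on it they are not interior.\<close>

lemma boundary_chart:
 fixes M :: "('a, 'e::euclidean_space) manifold"
 assumes M: "smooth_manifold M" and c: "(U, \<phi>) \<in> charts M" and q: "q \<in> U" "q \<in> mboundary M"
 obtains b T where "b \<in> Basis" "open T" "\<phi> ` U = {x. 0 \<le> x \<bullet> b} Int T" "\<phi> q \<bullet> b = 0"
  "!!u. u \<in> U ==> u \<in> mboundary M \<longleftrightarrow> \<phi> u \<bullet> b = 0"
proof -
 note inj = chart_inj[OF M c]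
 have open_no: "u \<notin> mboundary M" if "open D" "D <= \<phi> ` U" "u \<in> U" "\<phi> u \<in> D" for D u
 proof -
  have "inv_into U \<phi> (\<phi> u) \<notin> mboundary M"
   by (rule not_mboundaryI[OF M that(1) continuous_map_from_subtopology_mono[OF chart_inv_continuous_carr[OF M c] that(2)]
     inj_on_inv_into[OF that(2)] that(4)]) simp
  then show ?thesis using inj that(3) by simp
 qed
 have "\<not> open (\<phi> ` U)" using open_no[of "\<phi> ` U" q] q by auto
 then obtain b T where b: "b \<in> Basis" "open T" "\<phi> ` U = {x. 0 \<le> x \<bullet> b} Int T"
  using chart_model[OF M c] by (auto simp: model_open_def openin_open)
 have iff: "u \<in> mboundary M \<longleftrightarrow> \<phi> u \<bullet> b = 0" if u: "u \<in> U" for u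
 proof
  assume "u \<in> mboundary M"
  show "\<phi> u \<bullet> b = 0"
  proof (rule ccontr)
   assume ne: "\<phi> u \<bullet> b ~= 0"
   have "\<phi> u \<in> \<phi> ` U" using u by auto
   then have "\<phi> u \<in> {x. 0 < x \<bullet> b} Int T" using ne unfolding b(3) by auto
   moreover have "open ({x. 0 < x \<bullet> b} Int T)" using b(2) by (intro open_Int open_Collect_less continuous_intros)
   moreover have "{x. 0 < x \<bullet> b} Int T <= \<phi> ` U" unfolding b(3) by auto
   ultimately show False using open_no u \<open>u \<in> mboundary M\<close> by blast
  qed
 next
  assume 0: "\<phi> u \<bullet> b = 0"
  have "\<phi> u \<notin> interior (\<phi> ` U)"
  proof
   assume "\<phi> u \<in> interior (\<phi> ` U)"
   then obtain e where e: "e > 0" "ball (\<phi> u) e <= \<phi> ` U" using mem_interior by blast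
   have "\<phi> u - (e / 2) *\<^sub>R b \<in> ball (\<phi> u) e" using e(1) b(1) by (simp add: dist_norm)
   then have "\<phi> u - (e / 2) *\<^sub>R b \<in> {x. 0 \<le> x \<bullet> b}" using e(2) unfolding b(3) by blast
   then show False using 0 b(1) e(1) by (simp add: inner_diff_left inner_Basis)
  qed
  then show "u \<in> mboundary M" by (rule mboundaryI[OF c u])
 qed
 show ?thesis by (rule that[OF b]) (use iff q in auto)
qed

section \<open>Extension of boundary charts\<close>

text \<open>At a boundary point the inclusion is given on a half-space only, so both its expression
  in charts and the inverse are extended, to \<open>H\<close> and \<open>K\<close>. The composite
  \<open>K (H x)\<close> is the identity on the model set, hence has the identity as derivative even
  at the boundary point. So \<open>H\<close> is a local diffeomorphism in full dimension, and its
  inverse \<open>G\<close> straightens \<open>T\<close> to the model set.\<close>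

lemma embedding_coordinates:
 fixes M :: "('w, real^4) manifold" and X :: "('x, real^4) manifold"
 assumes M: "smooth_manifold M" and X: "smooth_manifold X" and T: "T <= carr X"
  and i: "diffeo M (carr M) X T i"
  and c: "(U, \<phi>) \<in> charts M" "q \<in> U" and d: "(V, \<psi>) \<in> charts X" "i q \<in> V"
 obtains O1 O2 H G where "open O1" "\<phi> q \<in> O1" "open O2" "homeomorphism O1 O2 H G" "Cinf O1 H" "Cinf O2 G"
  "!!x. x \<in> \<phi> ` U ==> x \<in> O1 ==> i (inv_into U \<phi> x) \<in> V & \<psi> (i (inv_into U \<phi> x)) = H x"
  "!!y. y \<in> V ==> \<psi> y \<in> O2 ==> (y \<in> T \<longleftrightarrow> G (\<psi> y) \<in> \<phi> ` U) & (y \<in> T --> i (inv_into U \<phi> (G (\<psi> y))) = y)"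
proof -
 define j where "j = inv_into (carr M) i"
 note iD = diffeoD[OF i, folded j_def]
 note injU = chart_inj[OF M c(1)] and injV = chart_inj[OF X d(1)]
 have UM: "U <= carr M" by (rule chart_subset[OF M c(1)])
 have invU: "inv_into U \<phi> (\<phi> u) = u" if "u \<in> U" for u using injU that by simp
 have invV: "inv_into V \<psi> (\<psi> y) = y" if "y \<in> V" for y using injV that by simp
 \<comment> \<open>a smooth extension of \<open>\<psi> \<circ> i \<circ> \<phi>\<inverse>\<close>\<close>
 obtain E1 where E1: "open E1" "!!u. u \<in> U ==> \<phi> u \<in> E1 \<longleftrightarrow> i u \<in> V"
 proof -
  obtain Q where Q: "openin (topo M) Q" "{p \<in> carr M Int carr M. i p \<in> V} = carr M Int Q"
   by (rule smooth_map_preimage[OF iD(2) chart_open[OF X d(1)]])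
  obtain E where E: "open E" "\<phi> ` (U Int Q) = \<phi> ` U Int E" by (rule chart_image_open[OF M c(1) Q(1)])
  have "\<phi> u \<in> E \<longleftrightarrow> i u \<in> V" if u: "u \<in> U" for u
  proof -
   have "\<phi> u \<in> E \<longleftrightarrow> \<phi> u \<in> \<phi> ` (U Int Q)" using E(2) u by auto
   also have "\<dots> \<longleftrightarrow> u \<in> Q" using injU u by (auto dest: inj_onD)
   also have "\<dots> \<longleftrightarrow> i u \<in> V" using Q(2) u UM by blast
   finally show ?thesis .
  qed
  then show ?thesis using that E(1) by blast
 qed
 have "smooth_on (\<phi> ` {p \<in> U Int carr M. i p \<in> V}) (\<psi> \<circ> i \<circ> inv_into U \<phi>)"
  by (rule smooth_map_charts[OF iD(2) c(1) d(1)])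
 then obtain E2 H where E2: "open E2" "\<phi> q \<in> E2" "Cinf E2 H"
  "!!y. y \<in> E2 Int \<phi> ` {p \<in> U Int carr M. i p \<in> V} ==> H y = (\<psi> \<circ> i \<circ> inv_into U \<phi>) y"
  by (rule smooth_onE[of _ _ "\<phi> q"]) (use c d UM in auto)
 have Hx: "i (inv_into U \<phi> x) \<in> V & H x = \<psi> (i (inv_into U \<phi> x))" if x: "x \<in> \<phi> ` U" "x \<in> E1" "x \<in> E2" for x
 proof -
  obtain u where u: "u \<in> U" "x = \<phi> u" using x(1) by auto
  then have "i u \<in> V" using E1(2)[OF u(1)] x(2) by simp
  moreover have "x \<in> \<phi> ` {p \<in> U Int carr M. i p \<in> V}" using u UM \<open>i u \<in> V\<close> by auto
  ultimately show ?thesis using E2(4)[of x] x(3) u invU by simp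
 qed
 \<comment> \<open>a smooth extension of its inverse\<close>
 obtain E3 where E3: "open E3" "!!y. y \<in> V ==> y \<in> T ==> \<psi> y \<in> E3 \<longleftrightarrow> j y \<in> U"
 proof -
  obtain Q where Q: "openin (topo X) Q" "{p \<in> carr X Int T. j p \<in> U} = T Int Q"
   by (rule smooth_map_preimage[OF iD(3) chart_open[OF M c(1)]])
  obtain E where E: "open E" "\<psi> ` (V Int Q) = \<psi> ` V Int E" by (rule chart_image_open[OF X d(1) Q(1)])
  have "\<psi> y \<in> E \<longleftrightarrow> j y \<in> U" if y: "y \<in> V" "y \<in> T" for y
  proof -
   have "\<psi> y \<in> E \<longleftrightarrow> \<psi> y \<in> \<psi> ` (V Int Q)" using E(2) y by auto
   also have "\<dots> \<longleftrightarrow> y \<in> Q" using injV y by (auto dest: inj_onD)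
   also have "\<dots> \<longleftrightarrow> j y \<in> U" using Q(2) y T by blast
   finally show ?thesis .
  qed
  then show ?thesis using that E(1) by blast
 qed
 have qT: "i q \<in> T" "j (i q) = q" using iD(4,6) c(2) UM by auto
 have "smooth_on (\<psi> ` {p \<in> V Int T. j p \<in> U}) (\<phi> \<circ> j \<circ> inv_into V \<psi>)"
  by (rule smooth_map_charts[OF iD(3) d(1) c(1)])
 then obtain E4 K where E4: "open E4" "\<psi> (i q) \<in> E4" "Cinf E4 K"
  "!!y. y \<in> E4 Int \<psi> ` {p \<in> V Int T. j p \<in> U} ==> K y = (\<phi> \<circ> j \<circ> inv_into V \<psi>) y"
  by (rule smooth_onE[of _ _ "\<psi> (i q)"]) (use c d qT in auto)
 have Ky: "j y \<in> U & K (\<psi> y) = \<phi> (j y)" if y: "y \<in> V" "y \<in> T" "\<psi> y \<in> E3" "\<psi> y \<in> E4" for y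
 proof -
  have "j y \<in> U" using E3(2)[OF y(1,2)] y(3) by simp
  moreover have "\<psi> y \<in> \<psi> ` {p \<in> V Int T. j p \<in> U}" using y \<open>j y \<in> U\<close> by auto
  ultimately show ?thesis using E4(4)[of "\<psi> y"] y(4) invV[OF y(1)] by simp
 qed
 define E where "E = (E1 Int E2) Int H -` (E3 Int E4)"
 have cH: "Cinf (E1 Int E2) H" by (rule Cinf_subset[OF E2(3)]) auto
 have oE: "open E" unfolding E_def
  by (rule continuous_open_preimage[OF Cinf_continuous[OF cH]]) (use E1 E2 E3 E4 in auto)
 have cHE: "Cinf E H" by (rule Cinf_subset[OF E2(3)]) (auto simp: E_def)
 have qE12: "\<phi> q \<in> E1" "\<phi> q \<in> E2" using E1(2)[OF c(2)] d(2) E2(2) by auto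
 have Hq: "H (\<phi> q) = \<psi> (i q)" using Hx[of "\<phi> q"] qE12 c(2) invU by auto
 have qE: "\<phi> q \<in> E" using qE12 E3(2)[OF d(2) qT(1)] qT(2) c(2) E4(2) by (simp add: E_def Hq)
 have KH: "K (H x) = x" if xUE: "x \<in> \<phi> ` U Int E" for x
 proof -
  obtain u where u: "u \<in> U" "x = \<phi> u" using xUE by auto
  have 1: "i u \<in> V" "H x = \<psi> (i u)" using Hx[of x] xUE u invU[OF u(1)] by (auto simp: E_def)
  have "i u \<in> T" "j (i u) = u" using iD(4,6) u(1) UM by auto
  then show ?thesis using Ky[OF 1(1)] 1(2) xUE u(2) by (auto simp: E_def)
 qed
 have cK: "Cinf E (%x. K (H x))"
  by (rule Cinf_compose[OF E4(3) cHE oE E4(1)]) (auto simp: E_def)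
 obtain A where A: "(H has_derivative A) (at (\<phi> q))" using Cinf_derivative[OF cHE oE] qE by metis
 obtain B where B: "(K has_derivative B) (at (H (\<phi> q)))"
  using Cinf_derivative[OF E4(3,1)] E4(2) unfolding Hq by metis
 have "((%x. K (H x)) has_derivative (%v. B (A v))) (at (\<phi> q))"
  using diff_chain_at[OF A B] by (simp add: o_def)
 from derivative_id_at_boundary[OF oE cK chart_model[OF M c(1)] _ _ qE this] KH c(2)
 have "B (A v) = v" for v by auto
 then have injA: "inj A" by (metis injI)
 obtain F1 F2 G where F: "open F1" "\<phi> q \<in> F1" "F1 <= E" "open F2" "homeomorphism F1 F2 H G" "Cinf F2 G"
  by (rule smooth_inverse_function[where 'n=4, OF _ _ oE cHE qE A injA]) simp_all
 have HG: "G (H x) = x" "H x \<in> F2" if "x \<in> F1" for x using F(5) that by (auto simp: homeomorphism_def)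
 have GH: "H (G y) = y" "G y \<in> F1" if "y \<in> F2" for y using F(5) that by (auto simp: homeomorphism_def)
 have F2E: "y \<in> E3 & y \<in> E4" if "y \<in> F2" for y using GH[OF that] F(3) by (auto simp: E_def)
 \<comment> \<open>Besides the inverse function \<open>G\<close> there is the extension
   \<open>K\<close> of the inverse of the inclusion. Requiring \<open>K\<close> to land in
   \<open>F1\<close> makes the two agree at points of \<open>T\<close>: there
   \<open>K (\<psi> y) = \<phi> (j y)\<close> is a point of \<open>F1\<close> which \<open>H\<close>
   maps to \<open>\<psi> y\<close>, so it equals \<open>G (\<psi> y)\<close>.\<close>
 define O2 where "O2 = F2 Int K -` F1"
 define O1 where "O1 = F1 Int H -` O2"
 have cKF: "continuous_on F2 K" by (rule continuous_on_subset[OF Cinf_continuous[OF E4(3)]]) (use F2E in auto)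
 have oO2: "open O2" unfolding O2_def by (rule continuous_open_preimage[OF cKF F(4,1)])
 have cHF: "Cinf F1 H" by (rule Cinf_subset[OF cHE F(3)])
 have oO1: "open O1" unfolding O1_def by (rule continuous_open_preimage[OF Cinf_continuous[OF cHF] F(1) oO2])
 have homeo: "homeomorphism O1 O2 H G"
 proof (rule homeomorphismI)
  show "continuous_on O1 H" by (rule continuous_on_subset[OF Cinf_continuous[OF cHF]]) (auto simp: O1_def)
  show "continuous_on O2 G" by (rule continuous_on_subset[OF Cinf_continuous[OF F(6)]]) (auto simp: O2_def)
  show "H ` O1 <= O2" by (auto simp: O1_def)
  show "G ` O2 <= O1" using GH by (auto simp: O1_def O2_def)
  show "G (H x) = x" if "x \<in> O1" for x using HG that by (simp add: O1_def)
  show "H (G y) = y" if "y \<in> O2" for y using GH that by (simp add: O2_def)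
 qed
 show ?thesis
 proof (rule that[OF oO1 _ oO2 homeo])
  have "K (H (\<phi> q)) = \<phi> q" using KH[of "\<phi> q"] c(2) qE by auto
  then show "\<phi> q \<in> O1" using F(2) HG[OF F(2)] by (simp add: O1_def O2_def)
  show "Cinf O1 H" by (rule Cinf_subset[OF cHF]) (auto simp: O1_def)
  show "Cinf O2 G" by (rule Cinf_subset[OF F(6)]) (auto simp: O2_def)
  show A: "i (inv_into U \<phi> x) \<in> V & \<psi> (i (inv_into U \<phi> x)) = H x" if "x \<in> \<phi> ` U" "x \<in> O1" for x
  proof -
   have "x \<in> E1" "x \<in> E2" using that(2) F(3) by (auto simp: O1_def E_def)
   from Hx[OF that(1) this] show ?thesis by simp
  qed
  fix y assume y: "y \<in> V" "\<psi> y \<in> O2"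
  have yF2: "\<psi> y \<in> F2" "K (\<psi> y) \<in> F1" using y(2) by (auto simp: O2_def)
  have bk: "i (inv_into U \<phi> (G (\<psi> y))) = y" if "G (\<psi> y) \<in> \<phi> ` U"
  proof -
   have "G (\<psi> y) \<in> O1" using homeo y(2) by (auto simp: homeomorphism_def)
   from A[OF that this] have "i (inv_into U \<phi> (G (\<psi> y))) \<in> V" "\<psi> (i (inv_into U \<phi> (G (\<psi> y)))) = \<psi> y"
    using GH(1)[OF yF2(1)] by auto
   then show ?thesis using injV y(1) by (auto dest: inj_onD)
  qed
  have fwd: "G (\<psi> y) \<in> \<phi> ` U" if yT: "y \<in> T"
  proof -
   have 1: "j y \<in> U" "K (\<psi> y) = \<phi> (j y)" using Ky[OF y(1) yT] F2E[OF yF2(1)] by auto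
   have x: "\<phi> (j y) \<in> \<phi> ` U" "\<phi> (j y) \<in> F1" using 1 yF2(2) by auto
   have "H (\<phi> (j y)) = \<psi> y"
    using Hx[of "\<phi> (j y)"] x F(3) invU[OF 1(1)] iD(7)[OF yT] by (auto simp: E_def)
   then have "G (\<psi> y) = \<phi> (j y)" using HG(1)[OF x(2)] by simp
   then show ?thesis using x(1) by simp
  qed
  have "y \<in> T" if "G (\<psi> y) \<in> \<phi> ` U"
  proof -
   have "inv_into U \<phi> (G (\<psi> y)) \<in> carr M" using inv_into_into[OF that] UM by auto
   then show ?thesis using bk[OF that] iD(4) by metis
  qed
  then show "(y \<in> T \<longleftrightarrow> G (\<psi> y) \<in> \<phi> ` U) & (y \<in> T --> i (inv_into U \<phi> (G (\<psi> y))) = y)"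
   using bk fwd by blast
 qed
qed

section \<open>Gluing\<close>

lemma eventually_at_right_0: "(\<forall>\<^sub>F t in at_right (0::real). P t) \<longleftrightarrow> (\<exists>d>0. ALL t. 0 < t & t < d --> P t)"
 by (simp add: eventually_at_right_field) (metis add_0)

lemma eventually_ray:
 fixes x v :: "'e::euclidean_space"
 assumes "open T" "x \<in> T" shows "\<forall>\<^sub>F t in at_right 0. x + t *\<^sub>R v \<in> T"
proof -
 have "((%t. x + t *\<^sub>R v) \<longlongrightarrow> x + 0 *\<^sub>R v) (at_right 0)" by (intro tendsto_intros)
 then show ?thesis using assms topological_tendstoD by force
qed

lemma deriv_along_ray:
 fixes f :: "'e::euclidean_space => 'd::euclidean_space"
 assumes "(f has_derivative A) (at x)"
 shows "((%t. f (x + t *\<^sub>R v) \<bullet> c) has_real_derivative A v \<bullet> c) (at 0)"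
proof -
 have "((%t::real. x + t *\<^sub>R v) has_derivative (%t. t *\<^sub>R v)) (at 0)" by (auto intro!: derivative_eq_intros)
 from has_derivative_compose[OF this, of f A] assms
 have "((%t. f (x + t *\<^sub>R v)) has_derivative (%t. A (t *\<^sub>R v))) (at 0)" by simp
 then have "((%t. f (x + t *\<^sub>R v) \<bullet> c) has_derivative (%t. A (t *\<^sub>R v) \<bullet> c)) (at 0)"
  by (rule has_derivative_inner_left)
 moreover have "linear A" using assms has_derivative_linear by blast
 ultimately show ?thesis
  by (simp add: has_field_derivative_def linear_scale mult.commute[of "A v \<bullet> c"] mult_commute_abs)
qed

text \<open>If the boundary point \<open>i q\<close> of the image were a boundary point of \<open>X\<close>, then the image would
  contain all points just above it in a boundary chart of \<open>X\<close>.\<close>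

lemma side_points:
 fixes M :: "('w, real^4) manifold" and X :: "('x, real^4) manifold"
 assumes M: "smooth_manifold M" and X: "smooth_manifold X" and T: "T <= carr X"
  and i: "diffeo M (carr M) X T i"
  and d: "(V, \<psi>) \<in> charts X" "i q \<in> V" and q: "q \<in> mboundary M"
  and b': "b' \<in> Basis" "open T'" "\<psi> ` V = {x. 0 \<le> x \<bullet> b'} Int T'" "\<psi> (i q) \<bullet> b' = 0"
 shows "\<forall>\<^sub>F t in at_right 0. inv_into V \<psi> (\<psi> (i q) + t *\<^sub>R b') \<in> i ` (carr M - mboundary M)"
proof -
 have "q \<in> carr M" using q mboundary_subset[OF M] by auto
 then obtain U \<phi> where c: "(U, \<phi>) \<in> charts M" "q \<in> U" by (rule chart_at[OF M])
 obtain b T0 where b: "b \<in> Basis" "open T0" "\<phi> ` U = {x. 0 \<le> x \<bullet> b} Int T0" "\<phi> q \<bullet> b = 0"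
  "!!u. u \<in> U ==> u \<in> mboundary M \<longleftrightarrow> \<phi> u \<bullet> b = 0"
  by (rule boundary_chart[OF M c q]) (rule that)
 obtain O1 O2 H G where HG: "open O1" "\<phi> q \<in> O1" "open O2" "homeomorphism O1 O2 H G" "Cinf O1 H" "Cinf O2 G"
  "!!x. x \<in> \<phi> ` U ==> x \<in> O1 ==> i (inv_into U \<phi> x) \<in> V & \<psi> (i (inv_into U \<phi> x)) = H x"
  "!!y. y \<in> V ==> \<psi> y \<in> O2 ==> (y \<in> T \<longleftrightarrow> G (\<psi> y) \<in> \<phi> ` U) & (y \<in> T --> i (inv_into U \<phi> (G (\<psi> y))) = y)"
  by (rule embedding_coordinates[OF M X T i c d]) (rule that)
 define x0 where "x0 = \<phi> q"
 define y0 where "y0 = \<psi> (i q)"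
 have x0U: "x0 \<in> \<phi> ` U" "x0 \<in> O1" using c(2) HG(2) by (auto simp: x0_def)
 have invq: "inv_into U \<phi> x0 = q" using chart_inj[OF M c(1)] c(2) by (simp add: x0_def)
 have Hx0: "H x0 = y0" using HG(7)[OF x0U] invq by (simp add: y0_def)
 have hom: "!!x. x \<in> O1 ==> G (H x) = x" "!!x. x \<in> O1 ==> H x \<in> O2" "!!y. y \<in> O2 ==> H (G y) = y"
  using HG(4) by (auto simp: homeomorphism_def)
 have y0: "y0 \<in> O2" "G y0 = x0" using hom(1,2)[OF x0U(2)] Hx0 by auto
 obtain L where L: "(H has_derivative L) (at x0)" using Cinf_derivative[OF HG(5,1)] x0U(2) by metis
 obtain K where K: "(G has_derivative K) (at y0)" using Cinf_derivative[OF HG(6,3)] y0(1) by metis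
 have LK: "L (K v) = v" for v
 proof -
  have "((%y. H (G y)) has_derivative (%v. L (K v))) (at y0)"
   using has_derivative_compose[OF K, of H L] L y0(2) by simp
  moreover have "((%y. H (G y)) has_derivative (%v. v)) (at y0)"
   by (rule has_derivative_transform_within_open[OF has_derivative_ident HG(3) y0(1)]) (simp add: hom(3))
  ultimately show ?thesis using has_derivative_unique by metis
 qed
 have lin: "linear L" using L has_derivative_linear by blast
 \<comment> \<open>Inward directions of \<open>M\<close> go to directions that do not point out of
   the half-space of \<open>X\<close>; otherwise \<open>H\<close> would leave the image of the chart
   \<open>V\<close> along the ray.\<close>
 have pos: "L v \<bullet> b' \<ge> 0" if v: "v \<bullet> b > 0" for v
 proof (rule ccontr)
  assume "\<not> L v \<bullet> b' \<ge> 0"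
  then obtain e where e: "e > 0" "!!h. 0 < h ==> h < e ==> H (x0 + h *\<^sub>R v) \<bullet> b' < H (x0 + 0 *\<^sub>R v) \<bullet> b'"
   using DERIV_neg_dec_right[OF deriv_along_ray[OF L, of v b']] by auto
  then have "\<forall>\<^sub>F t in at_right 0. H (x0 + t *\<^sub>R v) \<bullet> b' < 0"
   unfolding eventually_at_right_0 using b'(4) by (intro exI[of _ e]) (auto simp: Hx0 y0_def)
  moreover have "\<forall>\<^sub>F t in at_right 0. x0 + t *\<^sub>R v \<in> T0 Int O1"
   by (rule eventually_ray) (use b(2,3) HG(1) x0U in auto)
  moreover have "\<forall>\<^sub>F t in at_right (0::real). t > 0" by (simp add: eventually_at_right_less)
  ultimately have "\<forall>\<^sub>F t in at_right (0::real). False"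
  proof eventually_elim
   case (elim t)
   have "(x0 + t *\<^sub>R v) \<bullet> b \<ge> 0" using v elim(3) b(4) by (simp add: inner_add_left x0_def)
   then have "x0 + t *\<^sub>R v \<in> \<phi> ` U" "x0 + t *\<^sub>R v \<in> O1" using elim(2) unfolding b(3) by auto
   from HG(7)[OF this] have "H (x0 + t *\<^sub>R v) \<in> \<psi> ` V" by force
   then show ?case using elim(1) unfolding b'(3) by simp
  qed
  then show False by simp
 qed
 have Kb: "K b' \<bullet> b > 0"
 proof (rule ccontr)
  assume n: "\<not> K b' \<bullet> b > 0"
  \<comment> \<open>If \<open>K b'\<close> did not point strictly inward,
    \<open>\<eta> *\<^sub>R b - K b'\<close> would. Its image under \<open>L\<close> has the
    component \<open>\<eta> * (L b \<bullet> b') - 1\<close> along \<open>b'\<close>, and \<eta> is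
    so small that this is at most \<open>- 1 / 2\<close>.\<close>
  define \<eta> where "\<eta> = 1 / (2 * (1 + \<bar>L b \<bullet> b'\<bar>))"
  have \<eta>: "\<eta> > 0" by (simp add: \<eta>_def add_pos_nonneg)
  have "(\<eta> *\<^sub>R b - K b') \<bullet> b > 0" using n \<eta> b(1) by (simp add: inner_diff_left)
  from pos[OF this] have "\<eta> * (L b \<bullet> b') - 1 \<ge> 0"
   using lin b'(1) by (simp add: linear_diff linear_scale LK inner_diff_left)
  moreover have "\<eta> * (L b \<bullet> b') \<le> \<eta> * (1 + \<bar>L b \<bullet> b'\<bar>)" using \<eta> by (intro mult_left_mono) auto
  moreover have "\<eta> * (1 + \<bar>L b \<bullet> b'\<bar>) = 1 / 2" by (simp add: \<eta>_def)
  ultimately show False by linarith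
 qed
 obtain e where e: "e > 0" "!!h. 0 < h ==> h < e ==> G (y0 + 0 *\<^sub>R b') \<bullet> b < G (y0 + h *\<^sub>R b') \<bullet> b"
  using DERIV_pos_inc_right[OF deriv_along_ray[OF K, of b' b] Kb] by auto
 have "\<forall>\<^sub>F t in at_right 0. 0 < G (y0 + t *\<^sub>R b') \<bullet> b"
  unfolding eventually_at_right_0 using e b(4) by (intro exI[of _ e]) (auto simp: y0 x0_def)
 moreover have "\<forall>\<^sub>F t in at_right 0. y0 + t *\<^sub>R b' \<in> T' Int (O2 Int G -` T0)"
 proof (rule eventually_ray)
  have "open (O2 Int G -` T0)" by (rule continuous_open_preimage[OF Cinf_continuous[OF HG(6)] HG(3) b(2)])
  then show "open (T' Int (O2 Int G -` T0))" using b'(2) by auto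
  have "y0 \<in> \<psi> ` V" using d(2) by (simp add: y0_def)
  then show "y0 \<in> T' Int (O2 Int G -` T0)" using y0 x0U(1) unfolding b'(3) b(3) by auto
 qed
 moreover have "\<forall>\<^sub>F t in at_right (0::real). t > 0" by (simp add: eventually_at_right_less)
 ultimately show ?thesis unfolding y0_def[symmetric]
 proof eventually_elim
  case (elim t)
  let ?y = "y0 + t *\<^sub>R b'"
  have "?y \<in> \<psi> ` V" using elim(2,3) b'(1,4) unfolding b'(3) by (simp add: inner_add_left y0_def)
  then obtain z where z: "z \<in> V" "\<psi> z = ?y" by (metis imageE)
  then have iz: "inv_into V \<psi> ?y = z" using chart_inj[OF X d(1)] by (metis inv_into_f_f)
  have GU: "G ?y \<in> \<phi> ` U" using elim(1,2) unfolding b(3) by auto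
  define u where "u = inv_into U \<phi> (G ?y)"
  have u: "u \<in> U" "\<phi> u = G ?y" using GU by (auto simp: u_def inv_into_into f_inv_into_f)
  have "i u = z" using HG(8)[OF z(1)] GU elim(2) by (simp add: z(2) u_def)
  moreover have "u \<notin> mboundary M" using b(5)[OF u(1)] elim(1) u(2) by simp
  ultimately show ?case using u(1) chart_subset[OF M c(1)] by (auto simp: iz)
 qed
qed

section \<open>The glued manifold and its hypersurface\<close>

locale gluing =
 fixes X :: "('x, real^4) manifold" and W :: "('w, real^4) manifold" and W' :: "('v, real^4) manifold"
  and f :: "'v => 'w" and i i'
 assumes W: "smooth_manifold W" "compact_space (topo W)" and W': "smooth_manifold W'" "compact_space (topo W')"
  and f: "diffeo W' (mboundary W') W (mboundary W) f" and glue: "is_gluing X W W' f i i'"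
begin

definition "A = i ` carr W"
definition "B = i' ` carr W'"
definition "N = i ` mboundary W"

lemma X: "smooth_manifold X" and i: "diffeo W (carr W) X A i" and i': "diffeo W' (carr W') X B i'"
 and carrX: "carr X = A Un B" and AB: "A Int B = N"
 and glue_f: "p \<in> mboundary W' ==> i' p = i (f p)"
 using glue by (auto simp: is_gluing_def A_def B_def N_def)

lemma sub: "A <= carr X" "B <= carr X" "N <= carr X" "N <= A" "N <= B"
 using carrX AB by auto

lemma N': "N = i' ` mboundary W'"
proof -
 have "f ` mboundary W' = mboundary W" using diffeo_bij[OF f] by (simp add: bij_betw_def)
 then have "N = (%p. i (f p)) ` mboundary W'" unfolding N_def by (metis image_image)
 also have "\<dots> = i' ` mboundary W'" by (rule image_cong) (simp_all add: glue_f)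
 finally show ?thesis .
qed

lemma i_bd: "q \<in> carr W ==> i q \<in> N \<longleftrightarrow> q \<in> mboundary W"
 using diffeo_bij[OF i] mboundary_subset[OF W(1)] unfolding N_def bij_betw_def by (meson inj_on_image_mem_iff)

lemma compactin_image:
 assumes "compact_space (topo M)" "diffeo M (carr M) X T j" shows "compactin (topo X) (j ` carr M)"
proof -
 have "continuous_map (topo M) (subtopology (topo X) T) j"
  using smooth_map_continuous[OF diffeo_smooth[OF assms(2)]] by simp
 then have "continuous_map (topo M) (topo X) j" using continuous_map_in_subtopology by blast
 then show ?thesis using assms(1) image_compactin by (metis compact_space_def)
qed

lemma compactX: "compact_space (topo X)"
 unfolding compact_space_def carrX A_def B_def
 by (intro compactin_Un compactin_image[OF W(2) i] compactin_image[OF W'(2) i'])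

lemma closed_AB: "closedin (topo X) A" "closedin (topo X) B"
proof -
 have H: "Hausdorff_space (topo X)" using X by (simp add: smooth_manifold_def)
 show "closedin (topo X) A" "closedin (topo X) B"
  unfolding A_def B_def by (auto intro!: compactin_imp_closedin[OF H] compactin_image[OF W(2) i] compactin_image[OF W'(2) i'])
qed

text \<open>The notion of gluing says nothing about the boundary of the result. Interior points of
  the pieces stay interior, so a boundary point lies on \<open>N\<close>. By
  \<open>side_points\<close> the points just above it would then be images of interior points of
  both pieces, whereas the images meet only in \<open>N\<close>.\<close>

lemma mboundaryX: "mboundary X = {}"
proof (rule ccontr)
 assume "mboundary X ~= {}"
 then obtain p where p: "p \<in> mboundary X" by auto
 have pX: "p \<in> carr X" using p mboundary_subset[OF X] by auto
 have int: "j q \<notin> mboundary X" if q: "q \<in> carr M" "q \<notin> mboundary M" and M: "smooth_manifold M" and j: "diffeo M (carr M) X T j"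
  for M :: "('m, real^4) manifold" and q j T
 proof -
  have "continuous_map (subtopology (topo M) (carr M)) (topo X) j"
   using smooth_map_continuous[OF diffeo_smooth[OF j]] continuous_map_in_subtopology by blast
  then show ?thesis
   by (rule not_mboundary_image[OF M X refl openin_topspace _ _ q]) (use diffeo_bij[OF j] in \<open>auto simp: bij_betw_def\<close>)
 qed
 have "p \<in> N"
 proof -
  consider (a) q where "q \<in> carr W" "p = i q" | (b) q where "q \<in> carr W'" "p = i' q"
   using pX unfolding carrX A_def B_def by blast
  then show ?thesis
  proof cases
   case a
   then have "q \<in> mboundary W" using int[OF a(1) _ W(1) i] p by blast
   then show ?thesis using a by (auto simp: N_def)
  next
   case b
   then have "q \<in> mboundary W'" using int[OF b(1) _ W'(1) i'] p by blast
   then show ?thesis using b by (auto simp: N')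
  qed
 qed
 then obtain q q' where q: "q \<in> mboundary W" "p = i q" "q' \<in> mboundary W'" "p = i' q'"
  unfolding N_def using N' N_def by blast
 obtain V \<psi> where d: "(V, \<psi>) \<in> charts X" "p \<in> V" using chart_at[OF X pX] .
 obtain b' T' where b': "b' \<in> Basis" "open T'" "\<psi> ` V = {x. 0 \<le> x \<bullet> b'} Int T'" "\<psi> p \<bullet> b' = 0"
  by (rule boundary_chart[OF X d p]) (rule that)
 have "\<forall>\<^sub>F t in at_right 0. inv_into V \<psi> (\<psi> p + t *\<^sub>R b') \<in> i ` (carr W - mboundary W)"
  using side_points[OF W(1) X sub(1) i d(1) _ q(1) b'(1-3)] d(2) b'(4) q(2) by simp
 moreover have "\<forall>\<^sub>F t in at_right 0. inv_into V \<psi> (\<psi> p + t *\<^sub>R b') \<in> i' ` (carr W' - mboundary W')"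
  using side_points[OF W'(1) X sub(2) i' d(1) _ q(3) b'(1-3)] d(2) b'(4) q(4) by simp
 ultimately have "\<forall>\<^sub>F t in at_right (0::real). False"
 proof eventually_elim
  case (elim t)
  then have "inv_into V \<psi> (\<psi> p + t *\<^sub>R b') \<in> A Int B" by (auto simp: A_def B_def)
  then show ?case using elim(1) i_bd unfolding AB by auto
 qed
 then show False by simp
qed

text \<open>In coordinates that straighten the piece \<open>A\<close>, take minus the coordinate
  normal to the boundary. A curve crossing from \<open>A\<close> to \<open>B\<close> is provided as
  well: the sign of derivatives along it is what survives when several such functions are
  averaged.\<close>

lemma local_defining_function:
 assumes p: "p \<in> N"
 obtains G \<sigma> where "openin (topo X) G" "p \<in> G" "sfun X G \<sigma>"
  "!!y. y \<in> G ==> (y \<in> A \<longleftrightarrow> \<sigma> y \<le> 0) & (y \<in> N \<longleftrightarrow> \<sigma> y = (0::real))"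
  "!!y. y \<in> G ==> y \<in> N ==> EX \<gamma> D. smooth_map eu {-1<..<1} X (carr X) \<gamma> & \<gamma> 0 = y &
   (ALL t:{-1<..<1}. \<gamma> t \<in> (if t \<le> 0 then A else B)) & ((%t. \<sigma> (\<gamma> t)) has_real_derivative D) (at 0) & D > 0"
proof -
 obtain q where q: "q \<in> mboundary W" "p = i q" using p by (auto simp: N_def)
 have "q \<in> carr W" using q(1) mboundary_subset[OF W(1)] by auto
 then obtain U \<phi> where c: "(U, \<phi>) \<in> charts W" "q \<in> U" by (rule chart_at[OF W(1)])
 have "p \<in> carr X" using p sub by auto
 then obtain V \<psi> where d: "(V, \<psi>) \<in> charts X" "p \<in> V" by (rule chart_at[OF X])
 obtain b T0 where b: "b \<in> Basis" "open T0" "\<phi> ` U = {x. 0 \<le> x \<bullet> b} Int T0" "\<phi> q \<bullet> b = 0"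
  "!!u. u \<in> U ==> u \<in> mboundary W \<longleftrightarrow> \<phi> u \<bullet> b = 0"
  by (rule boundary_chart[OF W(1) c q(1)]) (rule that)
 obtain O1 O2 H G where HG: "open O1" "\<phi> q \<in> O1" "open O2" "homeomorphism O1 O2 H G" "Cinf O1 H" "Cinf O2 G"
  "!!x. x \<in> \<phi> ` U ==> x \<in> O1 ==> i (inv_into U \<phi> x) \<in> V & \<psi> (i (inv_into U \<phi> x)) = H x"
  "!!y. y \<in> V ==> \<psi> y \<in> O2 ==> (y \<in> A \<longleftrightarrow> G (\<psi> y) \<in> \<phi> ` U) & (y \<in> A --> i (inv_into U \<phi> (G (\<psi> y))) = y)"
  by (rule embedding_coordinates[OF W(1) X sub(1) i c d(1) d(2)[unfolded q(2)]]) (rule that)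
 have hom: "!!x. x \<in> O1 ==> G (H x) = x" "!!x. x \<in> O1 ==> H x \<in> O2" "!!y. y \<in> O2 ==> H (G y) = y" "!!y. y \<in> O2 ==> G y \<in> O1"
  using HG(4) by (auto simp: homeomorphism_def)
 have oV: "open (\<psi> ` V)" by (rule chart_image_interior[OF mboundaryX d(1)])
 note injV = chart_inj[OF X d(1)]
 define O3 where "O3 = O2 Int G -` T0"
 have oO3: "open O3" unfolding O3_def by (rule continuous_open_preimage[OF Cinf_continuous[OF HG(6)] HG(3) b(2)])
 define Q where "Q = {y \<in> V. \<psi> y \<in> O3}"
 define \<sigma> where "\<sigma> y = - (G (\<psi> y) \<bullet> b)" for y
 have psi: "smooth_map X V eu (\<psi> ` V) \<psi>" by (rule chart_smooth[OF X d(1)])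
 have oQ: "openin (topo X) Q" unfolding Q_def
  by (rule smooth_map_openin_preimage[OF psi]) (use chart_open[OF X d(1)] oO3 in auto)
 have QV: "Q <= V" "\<psi> ` Q <= O2" by (auto simp: Q_def O3_def)
 have sQ: "sfun X Q \<sigma>"
 proof -
  have "sfun X V \<psi>" using smooth_map_to_eu[OF X chart_subset[OF X d(1)], THEN iffD1, OF psi] by simp
  then have 1: "sfun X Q \<psi>" by (rule sfun_subset[OF _ QV(1)])
  have "smooth_on O2 G" using HG(6) HG(3) by (simp add: smooth_on_open)
  then have "smooth_on O2 (%y. - (G y \<bullet> b))"
   by (rule smooth_on_linear_compose[rotated]) (intro bounded_linear_minus bounded_linear_inner_left)
  from sfun_compose_smooth_on[OF X 1 this QV(2)] show ?thesis by (simp add: \<sigma>_def[abs_def])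
 qed
 have iqb: "i (inv_into U \<phi> (\<phi> q)) = p" using chart_inj[OF W(1) c(1)] c(2) q(2) by simp
 have Hq: "H (\<phi> q) = \<psi> p" using HG(7)[of "\<phi> q"] c(2) HG(2) iqb by auto
 have Gp: "G (\<psi> p) = \<phi> q" "\<psi> p \<in> O2" using hom(1,2)[OF HG(2)] Hq by auto
 have "\<phi> q \<in> T0" using c(2) b(3) by blast
 then have pQ: "p \<in> Q" using d(2) Gp by (simp add: Q_def O3_def)
 have cases: "(y \<in> A \<longleftrightarrow> \<sigma> y \<le> 0) & (y \<in> N \<longleftrightarrow> \<sigma> y = 0)" if y: "y \<in> Q" for y
 proof -
  have y1: "y \<in> V" "\<psi> y \<in> O2" "G (\<psi> y) \<in> T0" using y by (auto simp: Q_def O3_def)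
  have yA: "y \<in> A \<longleftrightarrow> \<sigma> y \<le> 0" using HG(8)[OF y1(1,2)] y1(3) unfolding b(3) by (simp add: \<sigma>_def)
  have "y \<in> N \<longleftrightarrow> \<sigma> y = 0"
  proof (cases "y \<in> A")
   case True
   define u where "u = inv_into U \<phi> (G (\<psi> y))"
   have GU: "G (\<psi> y) \<in> \<phi> ` U" "i u = y" using HG(8)[OF y1(1,2)] True by (auto simp: u_def)
   have u: "u \<in> U" "\<phi> u = G (\<psi> y)" using GU(1) by (auto simp: u_def inv_into_into f_inv_into_f)
   have "y \<in> N \<longleftrightarrow> u \<in> mboundary W" using i_bd[of u] u(1) chart_subset[OF W(1) c(1)] GU(2) by auto
   then show ?thesis using b(5)[OF u(1)] u(2) by (simp add: \<sigma>_def)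
  next
   case False then show ?thesis using yA sub(4) by auto
  qed
  then show ?thesis using yA by blast
 qed
 show ?thesis
 proof (rule that[OF oQ pQ sQ cases])
  fix y assume y: "y \<in> Q" "y \<in> N"
  have y1: "y \<in> V" "\<psi> y \<in> O2" "G (\<psi> y) \<in> T0" using y(1) by (auto simp: Q_def O3_def)
  have G0: "G (\<psi> y) \<bullet> b = 0" using cases[OF y(1)] y(2) by (simp add: \<sigma>_def)
  let ?S = "(O1 Int H -` (\<psi> ` V Int O3))"
  have "open ?S" by (rule continuous_open_preimage[OF Cinf_continuous[OF HG(5)] HG(1)]) (use oV oO3 in auto)
  moreover have GyS: "G (\<psi> y) \<in> ?S" using y1 y(1) hom by (auto simp: Q_def)
  ultimately obtain r where r: "r > 0" "ball (G (\<psi> y)) r <= ?S" using open_contains_ball by blast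
  define l where "l t = G (\<psi> y) - (r * t) *\<^sub>R b" for t
  have lS: "l t \<in> ?S" if "t \<in> {-1<..<1}" for t
  proof -
   have "\<bar>r * t\<bar> < r * 1" using that r(1) by (simp add: abs_mult abs_less_iff)
   then show ?thesis using r b(1) by (intro subsetD[OF r(2)]) (simp add: l_def dist_norm)
  qed
  define \<gamma> where "\<gamma> t = inv_into V \<psi> (H (l t))" for t
  have \<gamma>: "\<gamma> t \<in> Q" "\<sigma> (\<gamma> t) = r * t" if "t \<in> {-1<..<1}" for t
  proof -
   have "\<psi> (\<gamma> t) = H (l t)" "\<gamma> t \<in> V" using lS[OF that] by (auto simp: \<gamma>_def f_inv_into_f inv_into_into)
   then show "\<gamma> t \<in> Q" "\<sigma> (\<gamma> t) = r * t" using lS[OF that] hom(1)[of "l t"] G0 b(1)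
    by (auto simp: Q_def \<sigma>_def l_def inner_diff_left)
  qed
  have "smooth_map eu {-1<..<1} X V \<gamma>"
  proof -
   have l: "smooth_on {-1<..<1} l"
    unfolding l_def by (intro smooth_on_diff smooth_on_const) (intro smooth_on_linear bounded_linear_intros)
   have "smooth_on O1 H" using HG(1,5) by (simp add: smooth_on_open)
   then have "smooth_on {-1<..<1} (%t. H (l t))" by (rule smooth_on_compose[OF _ l]) (use lS in auto)
   then have "smooth_map eu {-1<..<1} eu (\<psi> ` V) (%t. H (l t))" using lS by (auto simp: smooth_map_eu)
   from smooth_map_compose[OF smooth_manifold_eu smooth_manifold_eu this chart_inv_smooth[OF X d(1)]]
   show ?thesis by (simp add: \<gamma>_def[abs_def])
  qed
  then have 1: "smooth_map eu {-1<..<1} X (carr X) \<gamma>"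
   by (rule smooth_map_subset) (use \<gamma>(1) oQ openin_subset in blast)+
  have 2: "\<gamma> 0 = y" using hom(3)[OF y1(2)] injV y1(1) by (simp add: \<gamma>_def l_def)
  have 3: "\<gamma> t \<in> (if t \<le> 0 then A else B)" if t: "t \<in> {-1<..<1}" for t
  proof -
   have "\<gamma> t \<in> A \<longleftrightarrow> t \<le> 0" using cases[OF \<gamma>(1)[OF t]] \<gamma>(2)[OF t] r(1) by (simp add: mult_le_0_iff)
   moreover have "\<gamma> t \<in> A Un B" using \<gamma>(1)[OF t] oQ openin_subset carrX by blast
   ultimately show ?thesis by auto
  qed
  have "((%t. r * t) has_real_derivative r) (at 0)" by (auto intro!: derivative_eq_intros)
  then have 4: "((%t. \<sigma> (\<gamma> t)) has_real_derivative r) (at 0)"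
   by (rule has_field_derivative_transform_within_open[where S = "{-1<..<1}"]) (simp_all add: \<gamma>)
  show "EX \<gamma> D. smooth_map eu {-1<..<1} X (carr X) \<gamma> & \<gamma> 0 = y &
   (ALL t:{-1<..<1}. \<gamma> t \<in> (if t \<le> 0 then A else B)) & ((%t. \<sigma> (\<gamma> t)) has_real_derivative D) (at 0) & D > 0"
   using 1 2 3 4 r(1) by blast
 qed
qed

end

section \<open>Partitions of unity\<close>

lemma sfun_extend_by_zero:
 fixes f :: "'a => 'b::euclidean_space"
 assumes X: "smooth_manifold X" and \<rho>: "sfun X (carr X) \<rho>" and f: "sfun X G f" and G: "openin (topo X) G"
  and C: "closedin (topo X) C" "C <= G" "!!x. x \<in> carr X ==> x \<notin> C ==> \<rho> x = (0::real)"
 shows "sfun X (carr X) (%x. \<rho> x *\<^sub>R f x)"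
proof (rule sfun_local[OF X subset_refl])
 fix p assume p: "p \<in> carr X"
 show "EX G. openin (topo X) G & p \<in> G & sfun X (G Int carr X) (%x. \<rho> x *\<^sub>R f x)"
 proof (cases "p \<in> G")
  case True
  have "sfun X (G Int carr X) (%x. \<rho> x *\<^sub>R f x)"
   by (rule sfun_bilinear[OF bounded_bilinear_scaleR sfun_subset[OF \<rho>] sfun_subset[OF f]]) auto
  then show ?thesis using True G by blast
 next
  case False
  have "sfun X (carr X - C) (%x. \<rho> x *\<^sub>R f x)"
   by (rule sfun_cong[OF X sfun_const[of X _ 0]]) (use C(3) in auto)
  then have "sfun X ((carr X - C) Int carr X) (%x. \<rho> x *\<^sub>R f x)" by (simp add: Int_absorb2)
  then show ?thesis using False C(1,2) p by (intro exI[of _ "carr X - C"]) (auto simp: closedin_def)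
 qed
qed

lemma manifold_bump:
 fixes X :: "('a, 'e::euclidean_space) manifold"
 assumes X: "smooth_manifold X" and bd: "mboundary X = {}" and G: "openin (topo X) G" "p \<in> G"
 obtains \<beta> C V where "sfun X (carr X) \<beta>" "!!x. x \<in> carr X ==> 0 \<le> \<beta> x" "closedin (topo X) C" "C <= G"
  "!!x. x \<in> carr X ==> x \<notin> C ==> \<beta> x = (0::real)" "openin (topo X) V" "p \<in> V" "!!x. x \<in> V ==> \<beta> x > 0"
proof -
 have "p \<in> carr X" using G openin_subset by blast
 then obtain U \<phi> where c: "(U, \<phi>) \<in> charts X" "p \<in> U" by (rule chart_at[OF X])
 obtain T where T: "open T" "\<phi> ` (U Int G) = \<phi> ` U Int T" by (rule chart_image_open[OF X c(1) G(1)])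
 have "open (\<phi> ` (U Int G))" unfolding T(2) using chart_image_interior[OF bd c(1)] T(1) by auto
 then obtain e where e: "e > 0" "ball (\<phi> p) e <= \<phi> ` (U Int G)"
  using c(2) G(2) open_contains_ball by (metis IntI imageI)
 define r where "r = e / 4"
 have r: "r > 0" using e by (simp add: r_def)
 obtain b :: "'e => real" where b: "smooth_on UNIV b" "!!x. 0 \<le> b x" "!!x. b x \<le> 1"
  "!!x. x \<in> cball (\<phi> p) r ==> b x = 1" "!!x. x \<notin> ball (\<phi> p) (2 * r) ==> b x = 0"
  using smooth_bump[OF r] by blast
 define K where "K = cball (\<phi> p) (2 * r)"
 have K: "K <= \<phi> ` (U Int G)" using e r by (auto simp: K_def r_def subset_iff)
 define C where "C = inv_into U \<phi> ` K"
 have "continuous_map (top_of_set K) (topo X) (inv_into U \<phi>)"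
  by (rule continuous_map_from_subtopology_mono[OF chart_inv_continuous_carr[OF X c(1)]]) (use K in auto)
 then have "compactin (topo X) (inv_into U \<phi> ` K)"
  by (rule image_compactin[rotated]) (simp add: K_def compactin_subtopology)
 then have C: "closedin (topo X) C" unfolding C_def
  by (rule compactin_imp_closedin[rotated]) (use X in \<open>simp add: smooth_manifold_def\<close>)
 have inj: "inv_into U \<phi> (\<phi> x) = x" if "x \<in> U" for x using chart_inj[OF X c(1)] that by simp
 have CG: "C <= U Int G" using K inj by (auto simp: C_def)
 have CK: "x \<in> C" if "x \<in> U" "\<phi> x \<in> K" for x using that inj[OF that(1)] unfolding C_def by (metis imageI)
 define \<beta> where "\<beta> x = (if x \<in> U then b (\<phi> x) else 0)" for x
 have "sfun X U \<beta>"
 proof -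
  have "sfun X U \<phi>" using smooth_map_to_eu[OF X chart_subset[OF X c(1)], THEN iffD1, OF chart_smooth[OF X c(1)]] by simp
  from sfun_compose_smooth_on[OF X this b(1)] have "sfun X U (%x. b (\<phi> x))" by simp
  then show ?thesis by (rule sfun_cong[OF X]) (simp add: \<beta>_def)
 qed
 have zero: "\<beta> x = 0" if "x \<notin> C" for x
 proof (cases "x \<in> U")
  case True
  then have "\<phi> x \<notin> K" using that CK by blast
  then have "\<phi> x \<notin> ball (\<phi> p) (2 * r)" using ball_subset_cball unfolding K_def by blast
  then show ?thesis using b(5) True by (simp add: \<beta>_def)
 qed (simp add: \<beta>_def)
 show ?thesis
 proof (rule that[of \<beta> C "{x \<in> U. \<phi> x \<in> ball (\<phi> p) r}"])
  show "sfun X (carr X) \<beta>"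
  proof (rule sfun_local[OF X subset_refl])
   fix q assume q: "q \<in> carr X"
   show "EX G. openin (topo X) G & q \<in> G & sfun X (G Int carr X) \<beta>"
   proof (cases "q \<in> U")
    case True
    then show ?thesis using chart_open[OF X c(1)] sfun_subset[OF \<open>sfun X U \<beta>\<close>] by (meson inf_le1)
   next
    case False
    have "sfun X ((carr X - C) Int carr X) \<beta>"
     by (rule sfun_cong[OF X sfun_const[of X _ 0]]) (use zero in auto)
    then show ?thesis using False C CG q by (intro exI[of _ "carr X - C"]) (auto simp: closedin_def)
   qed
  qed
  show "openin (topo X) {x \<in> U. \<phi> x \<in> ball (\<phi> p) r}"
   by (rule smooth_map_openin_preimage[OF chart_smooth[OF X c(1)]]) (use chart_open[OF X c(1)] in auto)
 qed (use C CG zero b c(2) r in \<open>auto simp: \<beta>_def\<close>)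
qed

text \<open>Finitely many bumps with positive sum, divided by this sum. The last clause is the one
  that matters in use: a function that is smooth only on \<open>G p\<close> becomes globally smooth
  after multiplication, because the bump vanishes outside a closed set inside
  \<open>G p\<close>.\<close>

lemma partition_of_unity:
 fixes X :: "('a, 'e::euclidean_space) manifold"
 assumes X: "smooth_manifold X" and bd: "mboundary X = {}" and compact: "compact_space (topo X)"
  and G: "!!p. p \<in> carr X ==> openin (topo X) (G p) & p \<in> G p"
 obtains P \<rho> where "finite P" "P <= carr X" "!!x. x \<in> carr X ==> (\<Sum>p\<in>P. \<rho> p x) = (1::real)"
  "!!p x. p \<in> P ==> x \<in> carr X ==> 0 \<le> \<rho> p x" "!!p x. p \<in> P ==> x \<in> carr X ==> x \<notin> G p ==> \<rho> p x = 0"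
  "!!p. p \<in> P ==> sfun X (carr X) (\<rho> p)"
  "!!p f :: 'a => 'b::euclidean_space. p \<in> P ==> sfun X (G p) f ==> sfun X (carr X) (%x. \<rho> p x *\<^sub>R f x)"
proof -
 have "ALL p:carr X. EX \<beta> C V. sfun X (carr X) \<beta> & (ALL x:carr X. 0 \<le> \<beta> x) & closedin (topo X) C & C <= G p &
  (ALL x:carr X. x \<notin> C --> \<beta> x = (0::real)) & openin (topo X) V & p \<in> V & (ALL x:V. \<beta> x > 0)"
 proof
  fix p assume p: "p \<in> carr X"
  show "EX \<beta> C V. sfun X (carr X) \<beta> & (ALL x:carr X. 0 \<le> \<beta> x) & closedin (topo X) C & C <= G p &
   (ALL x:carr X. x \<notin> C --> \<beta> x = (0::real)) & openin (topo X) V & p \<in> V & (ALL x:V. \<beta> x > 0)"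
   by (rule manifold_bump[OF X bd conjunct1[OF G[OF p]] conjunct2[OF G[OF p]]]) blast
 qed
 from bchoice[OF this] obtain \<beta> where "ALL p:carr X. EX C V. sfun X (carr X) (\<beta> p) & (ALL x:carr X. 0 \<le> \<beta> p x) & closedin (topo X) C & C <= G p &
  (ALL x:carr X. x \<notin> C --> \<beta> p x = (0::real)) & openin (topo X) V & p \<in> V & (ALL x:V. \<beta> p x > 0)" ..
 from bchoice[OF this] obtain C where "ALL p:carr X. EX V. sfun X (carr X) (\<beta> p) & (ALL x:carr X. 0 \<le> \<beta> p x) & closedin (topo X) (C p) & C p <= G p &
  (ALL x:carr X. x \<notin> C p --> \<beta> p x = (0::real)) & openin (topo X) V & p \<in> V & (ALL x:V. \<beta> p x > 0)" ..
 from bchoice[OF this] obtain V where bV: "ALL p:carr X. sfun X (carr X) (\<beta> p) & (ALL x:carr X. 0 \<le> \<beta> p x) & closedin (topo X) (C p) & C p <= G p &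
  (ALL x:carr X. x \<notin> C p --> \<beta> p x = (0::real)) & openin (topo X) (V p) & p \<in> V p & (ALL x:V p. \<beta> p x > 0)" ..
 have "ALL U:V ` carr X. openin (topo X) U" "carr X <= \<Union>(V ` carr X)" using bV by auto
 then obtain \<F> where "finite \<F>" "\<F> <= V ` carr X" "carr X <= \<Union>\<F>"
  using compact unfolding compact_space_alt by metis
 then obtain P where P: "finite P" "P <= carr X" "carr X <= \<Union>(V ` P)"
  using finite_subset_image by metis
 define S where "S x = (\<Sum>p\<in>P. \<beta> p x)" for x
 have S: "S x > 0" if x: "x \<in> carr X" for x
 proof -
  obtain p where "p \<in> P" "x \<in> V p" using P(3) x by auto
  then show ?thesis unfolding S_def by (intro sum_pos2[OF P(1)]) (use bV P(2) x in auto)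
 qed
 have sS: "sfun X (carr X) (%x. inverse (S x))"
  by (rule sfun_inverse[OF X]) (use S bV P(2) in \<open>force simp: S_def[abs_def] intro!: sfun_sum\<close>)+
 have sr: "sfun X (carr X) (%x. \<beta> p x * inverse (S x))" if "p \<in> P" for p
  by (rule sfun_mult[OF _ sS]) (use bV P(2) that in auto)
 show ?thesis
 proof (rule that[OF P(1,2), of "%p x. \<beta> p x * inverse (S x)"])
  fix x assume "x \<in> carr X"
  then show "(\<Sum>p\<in>P. \<beta> p x * inverse (S x)) = 1"
   using S[of x] by (simp add: sum_distrib_right[symmetric] flip: S_def)
 next
  fix p and f :: "'a => 'b" assume p: "p \<in> P" and f: "sfun X (G p) f"
  have pX: "p \<in> carr X" using p P(2) by auto
  show "sfun X (carr X) (%x. (\<beta> p x * inverse (S x)) *\<^sub>R f x)"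
   by (rule sfun_extend_by_zero[OF X sr[OF p] f, of "C p"]) (use bV G pX in auto)
 next
  fix p x assume p: "p \<in> P" and x: "x \<in> carr X"
  then have pX: "p \<in> carr X" using P(2) by auto
  then show "0 \<le> \<beta> p x * inverse (S x)" using bV x S[OF x] by simp
  assume "x \<notin> G p"
  then have "\<beta> p x = 0" using bV pX x by blast
  then show "\<beta> p x * inverse (S x) = 0" by simp
 qed (rule sr)
qed

text \<open>Smoothness on the closed set \<open>A\<close> provides extensions near each of its
  points, and away from \<open>A\<close> the zero function serves; a partition of unity averages
  them. This lets the map on one piece be continued across the hypersurface.\<close>

lemma smooth_Tietze:
 fixes X :: "('a, 'e::euclidean_space) manifold" and f :: "'a => 'b::euclidean_space"
 assumes X: "smooth_manifold X" and bd: "mboundary X = {}" and compact: "compact_space (topo X)"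
  and A: "closedin (topo X) A" and f: "sfun X A f"
 obtains h where "sfun X (carr X) h" "!!x. x \<in> A ==> h x = f x"
proof -
 have "ALL p:carr X. EX G. EX g :: 'a => 'b. openin (topo X) G & p \<in> G & sfun X G g & (ALL x:A Int G. g x = f x)"
 proof
  fix p assume p: "p \<in> carr X"
  show "EX G. EX g :: 'a => 'b. openin (topo X) G & p \<in> G & sfun X G g & (ALL x:A Int G. g x = f x)"
  proof (cases "p \<in> A")
   case False
   have "openin (topo X) (carr X - A)" using A by (simp add: closedin_def)
   then show ?thesis using False p sfun_const[of X "carr X - A" "0::'b"] by (intro exI[of _ "carr X - A"] exI) auto
  next
   case True
   obtain U \<phi> where c: "(U, \<phi>) \<in> charts X" "p \<in> U" by (rule chart_at[OF X p])
   have inj: "inv_into U \<phi> (\<phi> x) = x" if "x \<in> U" for x using chart_inj[OF X c(1)] that by simp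
   obtain O' h where h: "open O'" "\<phi> p \<in> O'" "Cinf O' h"
    "!!y. y \<in> O' Int \<phi> ` (U Int A) ==> h y = f (inv_into U \<phi> y)"
    by (rule smooth_onE[OF sfunD[OF f c(1)], of "\<phi> p"]) (use c(2) True in auto)
   let ?G = "{x \<in> U. \<phi> x \<in> O'}"
   have oG: "openin (topo X) ?G"
    by (rule smooth_map_openin_preimage[OF chart_smooth[OF X c(1)]]) (use chart_open[OF X c(1)] h(1) in auto)
   have "sfun X U \<phi>" using smooth_map_to_eu[OF X chart_subset[OF X c(1)], THEN iffD1, OF chart_smooth[OF X c(1)]] by simp
   then have "sfun X ?G \<phi>" by (rule sfun_subset) auto
   moreover have "smooth_on O' h" using h(1,3) by (simp add: smooth_on_open)
   ultimately have "sfun X ?G (%x. h (\<phi> x))" by (rule sfun_compose_smooth_on[OF X]) auto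
   moreover have "h (\<phi> x) = f x" if "x \<in> A Int ?G" for x using h(4)[of "\<phi> x"] that inj[of x] by auto
   ultimately show ?thesis using oG c(2) h(2) by (intro exI[of _ ?G] exI[of _ "%x. h (\<phi> x)"]) auto
  qed
 qed
 from bchoice[OF this] obtain G where "ALL p:carr X. EX g :: 'a => 'b. openin (topo X) (G p) & p \<in> G p & sfun X (G p) g & (ALL x:A Int G p. g x = f x)" ..
 from bchoice[OF this] obtain g where g: "ALL p:carr X. openin (topo X) (G p) & p \<in> G p & sfun X (G p) (g p :: 'a => 'b) & (ALL x:A Int G p. g p x = f x)" ..
 have G: "openin (topo X) (G p) & p \<in> G p" if "p \<in> carr X" for p using g that by blast
 obtain P and \<rho> :: "'a => 'a => real" where P: "finite P" "P <= carr X" "!!x. x \<in> carr X ==> (\<Sum>p\<in>P. \<rho> p x) = 1"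
  "!!p x. p \<in> P ==> x \<in> carr X ==> x \<notin> G p ==> \<rho> p x = 0"
  "!!p f :: 'a => 'b. p \<in> P ==> sfun X (G p) f ==> sfun X (carr X) (%x. \<rho> p x *\<^sub>R f x)"
  by (rule partition_of_unity[OF X bd compact G, where 'b = 'b]) (assumption, rule that)
 show ?thesis
 proof (rule that[of "%x. \<Sum>p\<in>P. \<rho> p x *\<^sub>R g p x"])
  show "sfun X (carr X) (%x. \<Sum>p\<in>P. \<rho> p x *\<^sub>R g p x)"
   by (rule sfun_sum, rule P(5)) (use g P(2) in auto)
  fix x assume x: "x \<in> A"
  then have xX: "x \<in> carr X" using A closedin_subset by blast
  have "\<rho> p x *\<^sub>R g p x = \<rho> p x *\<^sub>R f x" if "p \<in> P" for p
   using P(4)[OF that xX] g P(2) that x by (cases "x \<in> G p") auto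
  then have "(\<Sum>p\<in>P. \<rho> p x *\<^sub>R g p x) = (\<Sum>p\<in>P. \<rho> p x *\<^sub>R f x)" by (rule sum.cong[OF refl])
  also have "\<dots> = f x" using P(3)[OF xX] by (simp add: scaleR_left.sum[symmetric])
  finally show "(\<Sum>p\<in>P. \<rho> p x *\<^sub>R g p x) = f x" .
 qed
qed

text \<open>The lift found by topology is merely continuous. Locally constant approximations are
  averaged with a partition of unity. The accuracy 1 suffices since it is below
  \<open>pi / 2\<close>, after which the error can be removed by \<open>arg0\<close>.\<close>

lemma smooth_approximation:
 fixes X :: "('a, 'e::euclidean_space) manifold" and u :: "'a => real"
 assumes X: "smooth_manifold X" and bd: "mboundary X = {}" and compact: "compact_space (topo X)"
  and N: "closedin (topo X) N" and u: "continuous_map (subtopology (topo X) N) euclideanreal u"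
 obtains v :: "'a => real" where "sfun X (carr X) v" "!!x. x \<in> N ==> \<bar>v x - u x\<bar> < 1"
proof -
 have "ALL p:carr X. EX G. openin (topo X) G & p \<in> G & (EX c. ALL x:N Int G. \<bar>c - u x\<bar> < 1)"
 proof
  fix p assume p: "p \<in> carr X"
  show "EX G. openin (topo X) G & p \<in> G & (EX c. ALL x:N Int G. \<bar>c - u x\<bar> < 1)"
  proof (cases "p \<in> N")
   case False
   have "openin (topo X) (carr X - N)" using N by (simp add: closedin_def)
   then show ?thesis using False p by (intro exI[of _ "carr X - N"]) auto
  next
   case True
   have "openin (subtopology (topo X) N) {x \<in> topspace (subtopology (topo X) N). u x \<in> ball (u p) 1}"
    by (rule openin_continuous_map_preimage[OF u]) simp
   then obtain G where G: "openin (topo X) G" "{x \<in> topspace (subtopology (topo X) N). u x \<in> ball (u p) 1} = G Int N"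
    by (auto simp: openin_subtopology)
   have iff: "x \<in> G Int N \<longleftrightarrow> x \<in> carr X & x \<in> N & \<bar>u p - u x\<bar> < 1" for x
    unfolding G(2)[symmetric] by (simp add: dist_real_def)
   have "p \<in> G" using iff[of p] True p by simp
   moreover have "ALL x:N Int G. \<bar>u p - u x\<bar> < 1" using iff by blast
   ultimately show ?thesis using G(1) by (intro exI[of _ G] conjI exI[of _ "u p"])
  qed
 qed
 from bchoice[OF this] obtain G where "ALL p:carr X. openin (topo X) (G p) & p \<in> G p & (EX c. ALL x:N Int G p. \<bar>c - u x\<bar> < 1)" ..
 then have G: "!!p. p \<in> carr X ==> openin (topo X) (G p) & p \<in> G p" and "ALL p:carr X. EX c. ALL x:N Int G p. \<bar>c - u x\<bar> < 1" by simp_all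
 from bchoice[OF this(2)] obtain c where c: "ALL p:carr X. ALL x:N Int G p. \<bar>c p - u x\<bar> < 1" ..
 obtain P and \<rho> :: "'a => 'a => real" where P: "finite P" "P <= carr X" "!!x. x \<in> carr X ==> (\<Sum>p\<in>P. \<rho> p x) = 1"
  "!!p x. p \<in> P ==> x \<in> carr X ==> 0 \<le> \<rho> p x"
  "!!p x. p \<in> P ==> x \<in> carr X ==> x \<notin> G p ==> \<rho> p x = 0" "!!p. p \<in> P ==> sfun X (carr X) (\<rho> p)"
  by (rule partition_of_unity[OF X bd compact G, where 'b = real]) (assumption, rule that)
 show ?thesis
 proof (rule that[of "%x. \<Sum>p\<in>P. \<rho> p x * c p"])
  show "sfun X (carr X) (%x. \<Sum>p\<in>P. \<rho> p x * c p)"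
   by (intro sfun_sum sfun_mult P(6) sfun_const)
  fix x assume x: "x \<in> N"
  then have xX: "x \<in> carr X" using N closedin_subset by blast
  have "EX p:P. \<rho> p x ~= 0" using P(3)[OF xX] by (metis sum.neutral zero_neq_one)
  then obtain p0 where p0: "p0 \<in> P" "\<rho> p0 x > 0" using P(4)[OF _ xX] by (metis order_le_imp_less_or_eq)
  have le: "\<rho> p x * \<bar>c p - u x\<bar> \<le> \<rho> p x" "\<rho> p x > 0 ==> \<rho> p x * \<bar>c p - u x\<bar> < \<rho> p x" if p: "p \<in> P" for p
  proof -
   have "\<bar>c p - u x\<bar> < 1" if "x \<in> G p" using c p P(2) x that by auto
   moreover have "x \<in> G p" if "\<rho> p x > 0" using P(5)[OF p xX] that by force
   ultimately show *: "\<rho> p x * \<bar>c p - u x\<bar> < \<rho> p x" if "\<rho> p x > 0" using that by simp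
   show "\<rho> p x * \<bar>c p - u x\<bar> \<le> \<rho> p x" using * P(4)[OF p xX] by (cases "\<rho> p x = 0") auto
  qed
  have "(\<Sum>p\<in>P. \<rho> p x * c p) - u x = (\<Sum>p\<in>P. \<rho> p x * (c p - u x))"
   using P(3)[OF xX] by (simp add: algebra_simps sum_subtractf sum_distrib_left[symmetric])
  also have "\<bar>\<dots>\<bar> \<le> (\<Sum>p\<in>P. \<bar>\<rho> p x * (c p - u x)\<bar>)" by (rule sum_abs)
  also have "\<dots> = (\<Sum>p\<in>P. \<rho> p x * \<bar>c p - u x\<bar>)" by (rule sum.cong) (simp_all add: abs_mult P(4)[OF _ xX])
  also have "\<dots> < (\<Sum>p\<in>P. \<rho> p x)"
  proof (rule sum_strict_mono_ex1[OF P(1)])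
   show "ALL p:P. \<rho> p x * \<bar>c p - u x\<bar> \<le> \<rho> p x" using le(1) by blast
   show "EX p:P. \<rho> p x * \<bar>c p - u x\<bar> < \<rho> p x" using le(2)[OF p0] p0(1) by (intro bexI[of _ p0])
  qed
  finally show "\<bar>(\<Sum>p\<in>P. \<rho> p x * c p) - u x\<bar> < 1" using P(3)[OF xX] by simp
 qed
qed

section \<open>A global function that cuts out the hypersurface\<close>

context gluing begin

text \<open>All local functions have the same signs, with constants -1 and 1 serving away from
  \<open>N\<close>, so their average vanishes on \<open>N\<close> only. At \<open>x\<close> in
  \<open>N\<close>, all summands have nonnegative derivative along a curve that crosses from
  \<open>A\<close> to \<open>B\<close>. The one to which the curve belongs has positive derivative,
  since the weight is positive and its own derivative is multiplied by the value 0.\<close>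

lemma defining_function:
 obtains s :: "'x => real" where "sfun X (carr X) s" "!!x. x \<in> A ==> s x \<le> 0" "!!x. x \<in> B ==> s x \<ge> 0"
  "!!x. x \<in> carr X ==> s x = 0 \<longleftrightarrow> x \<in> N" "!!x. x \<in> N ==> regular_at X s x"
proof -
 define good where "good G \<sigma> \<longleftrightarrow> openin (topo X) G & sfun X G \<sigma> &
  (ALL y:G. (y \<in> A \<longleftrightarrow> \<sigma> y \<le> 0) & (y \<in> N \<longleftrightarrow> \<sigma> y = (0::real))) &
  (ALL y:G Int N. EX \<gamma> D. smooth_map eu {-1<..<1} X (carr X) \<gamma> & \<gamma> 0 = y &
   (ALL t:{-1<..<1}. \<gamma> t \<in> (if t \<le> 0 then A else B)) & ((%t. \<sigma> (\<gamma> t)) has_real_derivative D) (at 0) & D > 0)" for G \<sigma>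
 have "ALL p:carr X. EX G. p \<in> G & (EX \<sigma>. good G \<sigma>)"
 proof
  fix p assume p: "p \<in> carr X"
  consider "p \<in> N" | "p \<in> A - N" | "p \<in> B - N" using p carrX by auto
  then show "EX G. p \<in> G & (EX \<sigma>. good G \<sigma>)"
  proof cases
   case 1
   obtain G \<sigma> where g: "openin (topo X) G" "p \<in> G" "sfun X G \<sigma>"
    "!!y. y \<in> G ==> (y \<in> A \<longleftrightarrow> \<sigma> y \<le> 0) & (y \<in> N \<longleftrightarrow> \<sigma> y = (0::real))"
    "!!y. y \<in> G ==> y \<in> N ==> EX \<gamma> D. smooth_map eu {-1<..<1} X (carr X) \<gamma> & \<gamma> 0 = y &
     (ALL t:{-1<..<1}. \<gamma> t \<in> (if t \<le> 0 then A else B)) & ((%t. \<sigma> (\<gamma> t)) has_real_derivative D) (at 0) & D > 0"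
    by (rule local_defining_function[OF 1]) (rule that)
   have "good G \<sigma>" unfolding good_def
    by (intro conjI ballI g(1) g(3) g(4)[THEN conjunct1] g(4)[THEN conjunct2] g(5)) auto
   then show ?thesis using g(2) by (intro exI[of _ G] exI[of _ \<sigma>] conjI)
  next
   case 2
   have "p \<in> carr X - B" using 2 AB p by auto
   moreover have "good (carr X - B) (%_. -1)"
    using closed_AB(2) carrX sub by (auto simp: good_def closedin_def sfun_const)
   ultimately show ?thesis by blast
  next
   case 3
   have "p \<in> carr X - A" using 3 AB p by auto
   moreover have "good (carr X - A) (%_. 1)"
    using closed_AB(1) carrX sub by (auto simp: good_def closedin_def sfun_const)
   ultimately show ?thesis by blast
  qed
 qed
 from bchoice[OF this] obtain G where "ALL p:carr X. p \<in> G p & (EX \<sigma>. good (G p) \<sigma>)" ..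
 then have G0: "!!p. p \<in> carr X ==> p \<in> G p" and "ALL p:carr X. EX \<sigma>. good (G p) \<sigma>" by simp_all
 from bchoice[OF this(2)] obtain \<sigma> where good: "ALL p:carr X. good (G p) (\<sigma> p)" ..
 have G: "openin (topo X) (G p) & p \<in> G p" if "p \<in> carr X" for p using G0[OF that] good that by (simp add: good_def)
 obtain P and \<rho> :: "'x => 'x => real" where P: "finite P" "P <= carr X" "!!x. x \<in> carr X ==> (\<Sum>p\<in>P. \<rho> p x) = 1"
  "!!p x. p \<in> P ==> x \<in> carr X ==> 0 \<le> \<rho> p x"
  "!!p x. p \<in> P ==> x \<in> carr X ==> x \<notin> G p ==> \<rho> p x = 0" "!!p. p \<in> P ==> sfun X (carr X) (\<rho> p)"
  "!!p f :: 'x => real. p \<in> P ==> sfun X (G p) f ==> sfun X (carr X) (%x. \<rho> p x *\<^sub>R f x)"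
  by (rule partition_of_unity[OF X mboundaryX compactX G, where 'b = real]) (assumption, rule that)
 define s where "s x = (\<Sum>p\<in>P. \<rho> p x * \<sigma> p x)" for x
 have sg: "(y \<in> A \<longleftrightarrow> \<sigma> p y \<le> 0) & (y \<in> N \<longleftrightarrow> \<sigma> p y = 0)" if "p \<in> P" "y \<in> G p" for p y
  using good P(2) that by (auto simp: good_def)
 have pos: "EX p:P. \<rho> p x > 0 & x \<in> G p" if xX: "x \<in> carr X" for x
 proof -
  have "EX p:P. \<rho> p x ~= 0" using P(3)[OF xX] by (metis sum.neutral zero_neq_one)
  then show ?thesis using P(4,5)[OF _ xX] by (metis order_le_imp_less_or_eq)
 qed
 have le: "\<rho> p x * \<sigma> p x \<le> 0" if "p \<in> P" "x \<in> A" for p x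
  using P(4,5)[OF that(1), of x] sg[OF that(1), of x] that(2) sub(1) by (cases "x \<in> G p") (auto simp: mult_le_0_iff)
 have ge: "\<rho> p x * \<sigma> p x \<ge> 0" if "p \<in> P" "x \<in> B" for p x
 proof -
  have "\<sigma> p x \<ge> 0" if "x \<in> G p" using sg[OF \<open>p \<in> P\<close> that] \<open>x \<in> B\<close> AB by fastforce
  then show ?thesis using P(4,5)[OF that(1), of x] that(2) sub(2) by (cases "x \<in> G p") auto
 qed
 have sA: "s x \<le> 0" if "x \<in> A" for x unfolding s_def by (intro sum_nonpos le that)
 have sB: "s x \<ge> 0" if "x \<in> B" for x unfolding s_def by (intro sum_nonneg ge that)
 have z: "\<rho> p x * \<sigma> p x = 0" if "p \<in> P" "x \<in> N" for p x
  using le[OF that(1)] ge[OF that(1)] that(2) sub(4,5) by (meson antisym subsetD)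
 have s0: "s x = 0 \<longleftrightarrow> x \<in> N" if xX: "x \<in> carr X" for x
 proof
  assume "x \<in> N" then show "s x = 0" unfolding s_def by (intro sum.neutral ballI z)
 next
  assume s: "s x = 0"
  obtain p where p: "p \<in> P" "\<rho> p x > 0" "x \<in> G p" using pos[OF xX] by auto
  have "\<rho> p x * \<sigma> p x = 0"
  proof (cases "x \<in> A")
   case True
   have "(\<Sum>p\<in>P. - (\<rho> p x * \<sigma> p x)) = 0" using s by (simp add: s_def sum_negf)
   then have "- (\<rho> p x * \<sigma> p x) = 0"
    using sum_nonneg_eq_0_iff[OF P(1), of "%p. - (\<rho> p x * \<sigma> p x)"] le[OF _ True] p(1) by auto
   then show ?thesis by simp
  next
   case False
   then have "x \<in> B" using xX carrX by auto
   then show ?thesis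
    using sum_nonneg_eq_0_iff[OF P(1), of "%p. \<rho> p x * \<sigma> p x"] ge p(1) s by (auto simp: s_def)
  qed
  then show "x \<in> N" using p sg by auto
 qed
 show ?thesis
 proof (rule that[of s])
  show "sfun X (carr X) s" unfolding s_def[abs_def]
  proof (rule sfun_sum)
   fix p assume p: "p \<in> P"
   then have "sfun X (G p) (\<sigma> p)" using good P(2) by (auto simp: good_def)
   from P(7)[OF p this] show "sfun X (carr X) (%x. \<rho> p x * \<sigma> p x)" by simp
  qed
 next
  fix x assume x: "x \<in> N"
  then have xX: "x \<in> carr X" using sub(3) by auto
  obtain p where p: "p \<in> P" "\<rho> p x > 0" "x \<in> G p" using pos[OF xX] by auto
  obtain \<gamma> D where \<gamma>: "smooth_map eu {-1<..<1} X (carr X) \<gamma>" "\<gamma> 0 = x"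
   "ALL t:{-1<..<1}. \<gamma> t \<in> (if t \<le> 0 then A else B)" "((%t. \<sigma> p (\<gamma> t)) has_real_derivative D) (at 0)" "D > 0"
   using good p x P(2) unfolding good_def by blast
  have comp: "EX E. ((%t. k (\<gamma> t)) has_real_derivative E) (at 0)" if "sfun X (carr X) k" for k
  proof -
   have "sfun eu {-1<..<1::real} (%t. k (\<gamma> t))"
    by (rule sfun_compose[OF smooth_manifold_eu X _ \<gamma>(1) that]) (use smooth_map_in[OF \<gamma>(1)] in auto)
   then have "Cinf {-1<..<1} (%t. k (\<gamma> t))" by (simp add: sfun_eu smooth_on_open)
   then obtain f' where "!!t. t \<in> {-1<..<1} ==> ((%t. k (\<gamma> t)) has_derivative f' t) (at t)"
    by (rule Cinf_derivative[of "{-1<..<1}" "%t. k (\<gamma> t)"]) (simp, rule that)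
   from this[of 0] have "(%t. k (\<gamma> t)) differentiable (at 0)" by (auto simp: differentiable_def)
   then show ?thesis by (simp add: real_differentiable_def)
  qed
  have "ALL q:P. EX E. ((%t. \<rho> q (\<gamma> t) * \<sigma> q (\<gamma> t)) has_real_derivative E) (at 0)"
  proof
   fix q assume q: "q \<in> P"
   then have "sfun X (G q) (\<sigma> q)" using good P(2) by (auto simp: good_def)
   from P(7)[OF q this] have "sfun X (carr X) (%x. \<rho> q x * \<sigma> q x)" by simp
   from comp[OF this] show "EX E. ((%t. \<rho> q (\<gamma> t) * \<sigma> q (\<gamma> t)) has_real_derivative E) (at 0)" .
  qed
  from bchoice[OF this] obtain E where E: "!!q. q \<in> P ==> ((%t. \<rho> q (\<gamma> t) * \<sigma> q (\<gamma> t)) has_real_derivative E q) (at 0)" by auto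
  have E0: "E q \<ge> 0" if q: "q \<in> P" for q
  proof (rule ccontr)
   assume "\<not> E q \<ge> 0"
   then obtain d where d: "d > 0" "!!h. 0 < h ==> h < d ==> \<rho> q (\<gamma> (0 + h)) * \<sigma> q (\<gamma> (0 + h)) < \<rho> q (\<gamma> 0) * \<sigma> q (\<gamma> 0)"
    using DERIV_neg_dec_right[OF E[OF q]] by auto
   define h where "h = min (d / 2) (1 / 2)"
   have h: "0 < h" "h < d" "h < 1" using d(1) by (auto simp: h_def)
   then have "\<gamma> h \<in> B" using bspec[OF \<gamma>(3), of h] by simp
   from ge[OF q this] show False using d(2)[OF h(1,2)] z[OF q x] \<gamma>(2) by simp
  qed
  have "E p > 0"
  proof -
   obtain e where "((%t. \<rho> p (\<gamma> t)) has_real_derivative e) (at 0)" using comp[OF P(6)[OF p(1)]] by blast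
   from DERIV_mult[OF this \<gamma>(4)]
   have "((%t. \<rho> p (\<gamma> t) * \<sigma> p (\<gamma> t)) has_real_derivative D * \<rho> p x) (at 0)"
    using sg[OF p(1,3)] x \<gamma>(2) by simp
   then have "E p = D * \<rho> p x" using E[OF p(1)] DERIV_unique by blast
   then show ?thesis using \<gamma>(5) p(2) by simp
  qed
  then have "sum E P > 0" by (intro sum_pos2[OF P(1) p(1)]) (use E0 in auto)
  moreover have "((%t. s (\<gamma> t)) has_real_derivative sum E P) (at 0)"
   unfolding s_def by (rule DERIV_sum) (rule E)
  ultimately show "regular_at X s x"
   unfolding regular_at_def using \<gamma>(1,2) by (intro exI[of _ \<gamma>] exI[of _ "sum E P"]) (simp add: has_real_derivative_iff_has_vector_derivative)
 qed (use sA sB s0 in auto)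
qed

end

section \<open>Regularity in charts\<close>

lemma curve_velocity:
 assumes M: "smooth_manifold M" and c: "(U, \<phi>) \<in> charts M" "p \<in> U"
  and \<gamma>: "smooth_map eu {-1<..<1::real} M S \<gamma>" "\<gamma> 0 = p" and S: "S <= carr M"
 obtains e d where "((%t. \<phi> (\<gamma> t)) has_vector_derivative e) (at 0)" "d > 0" "!!t. t \<in> ball 0 d ==> \<gamma> t \<in> U"
proof -
 obtain d where d: "d > 0" "ball 0 d <= {-1<..<1::real}" "!!y. y \<in> ball 0 d ==> \<gamma> y \<in> U"
  by (rule smooth_map_eu_ball[OF \<gamma>(1), of 0 U]) (use chart_open[OF M c(1)] c(2) \<gamma>(2) in auto)
 have "smooth_map eu (ball 0 d) M U \<gamma>"
  by (rule smooth_map_subset[OF \<gamma>(1) d(2)]) (use d(3) in auto)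
 from smooth_map_compose[OF smooth_manifold_eu M this chart_smooth[OF M c(1)]]
 have "smooth_on (ball 0 d) (%t. \<phi> (\<gamma> t))" by (simp add: smooth_map_eu)
 then have "Cinf (ball 0 d) (%t. \<phi> (\<gamma> t))" by (simp add: smooth_on_open)
 then obtain C where "!!x. x \<in> ball 0 d ==> ((%t. \<phi> (\<gamma> t)) has_derivative C x) (at x)"
  using Cinf_derivative[of "ball 0 d"] by (metis open_ball)
 then have C: "((%t. \<phi> (\<gamma> t)) has_derivative C 0) (at 0)" using d(1) by simp
 moreover have "C 0 = (%t. t *\<^sub>R C 0 1)"
  using has_derivative_linear[OF C] by (metis linear_scale mult.right_neutral real_scaleR_def)
 ultimately show ?thesis using d that[of "C 0 1" d] by (simp add: has_vector_derivative_def)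
qed

lemma velocity_chain:
 assumes M: "smooth_manifold M" and c: "(U, \<phi>) \<in> charts M" and p: "\<gamma> 0 = p"
  and e: "((%t. \<phi> (\<gamma> t)) has_vector_derivative e) (at 0)" "d > 0" "!!t. t \<in> ball 0 d ==> \<gamma> t \<in> U"
  and A: "((%x. f (inv_into U \<phi> x)) has_derivative A) (at (\<phi> p))"
  and f: "((%t. f (\<gamma> t)) has_vector_derivative D) (at 0)"
 shows "A e = D"
proof -
 have "((%t. f (inv_into U \<phi> (\<phi> (\<gamma> t)))) has_derivative (%t. A (t *\<^sub>R e))) (at 0)"
  using diff_chain_at[OF e(1)[unfolded has_vector_derivative_def], of "%x. f (inv_into U \<phi> x)" A] A p by (simp add: o_def)
 then have "((%t. f (\<gamma> t)) has_derivative (%t. A (t *\<^sub>R e))) (at 0)"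
  by (rule has_derivative_transform_within_open[of _ _ _ _ "ball 0 d"])
   (use e chart_inj[OF M c] in auto)
 then have "(%t. A (t *\<^sub>R e)) = (%t. t *\<^sub>R D)"
  using f has_derivative_unique unfolding has_vector_derivative_def by blast
 then show ?thesis by (metis scaleR_one)
qed

text \<open>The converse of \<open>regular_chart\<close> when there is no boundary. The curve is a
  straight segment in the chart in the direction \<open>w\<close>; its speed is reduced by \<delta>
  so that it stays in the chart for all parameters in \<open>(-1, 1)\<close>.\<close>

lemma regular_at_chartI:
 fixes M :: "('a, 'e::euclidean_space) manifold"
 assumes M: "smooth_manifold M" and bd: "mboundary M = {}" and c: "(U, \<phi>) \<in> charts M" "p \<in> U"
  and A: "((%x. f (inv_into U \<phi> x)) has_derivative A) (at (\<phi> p))" "A w ~= 0"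
 shows "regular_at M f p"
proof -
 have "open (\<phi> ` U)" by (rule chart_image_interior[OF bd c(1)])
 then obtain r where r: "r > 0" "ball (\<phi> p) r <= \<phi> ` U" using c(2) open_contains_ball by (metis imageI)
 define \<delta> where "\<delta> = r / (1 + norm w)"
 have \<delta>: "\<delta> > 0" "\<delta> * norm w < r" using r(1) by (auto simp: \<delta>_def add_pos_nonneg field_simps)
 define l where "l t = \<phi> p + (\<delta> * t) *\<^sub>R w" for t
 have lU: "l t \<in> \<phi> ` U" if "t \<in> {-1<..<1}" for t
 proof -
  have "\<bar>t\<bar> \<le> 1" using that by auto
  then have "\<bar>t\<bar> * (\<delta> * norm w) \<le> 1 * (\<delta> * norm w)" using \<delta>(1) by (intro mult_right_mono) auto
  moreover have "norm ((\<delta> * t) *\<^sub>R w) = \<bar>t\<bar> * (\<delta> * norm w)" using \<delta>(1) by (simp add: abs_mult)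
  ultimately have "norm ((\<delta> * t) *\<^sub>R w) < r" using \<delta>(2) by linarith
  then show ?thesis by (intro subsetD[OF r(2)]) (simp add: l_def dist_norm)
 qed
 have "smooth_on {-1<..<1} l" unfolding l_def
  by (intro smooth_on_add smooth_on_const) (intro smooth_on_linear bounded_linear_intros)
 then have "smooth_map eu {-1<..<1} eu (\<phi> ` U) l" using lU by (auto simp: smooth_map_eu)
 from smooth_map_compose[OF smooth_manifold_eu smooth_manifold_eu this chart_inv_smooth[OF M c(1)]]
 have "smooth_map eu {-1<..<1} M U (%t. inv_into U \<phi> (l t))" .
 moreover have "inv_into U \<phi> (l t) \<in> carr M" if "t \<in> {-1<..<1}" for t
  using inv_into_into[OF lU[OF that]] chart_subset[OF M c(1)] by blast
 ultimately have 1: "smooth_map eu {-1<..<1} M (carr M) (%t. inv_into U \<phi> (l t))"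
  by (rule smooth_map_subset[OF _ subset_refl])
 have l0: "l 0 = \<phi> p" by (simp add: l_def)
 have "(l has_derivative (%t. (\<delta> * t) *\<^sub>R w)) (at 0)" unfolding l_def by (auto intro!: derivative_eq_intros)
 from diff_chain_at[OF this, of "%x. f (inv_into U \<phi> x)" A] A(1) l0
 have "((%t. f (inv_into U \<phi> (l t))) has_derivative (%t. A ((\<delta> * t) *\<^sub>R w))) (at 0)" by (simp add: o_def)
 moreover have "(%t. A ((\<delta> * t) *\<^sub>R w)) = (%t. t *\<^sub>R (\<delta> *\<^sub>R A w))"
  using has_derivative_linear[OF A(1)] by (simp add: linear_scale mult.commute)
 ultimately have "((%t. f (inv_into U \<phi> (l t))) has_vector_derivative \<delta> *\<^sub>R A w) (at 0)"
  by (simp add: has_vector_derivative_def)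
 then show ?thesis unfolding regular_at_def
  using 1 A(2) \<delta>(1) l0 chart_inj[OF M c(1)] c(2)
  by (intro exI[of _ "%t. inv_into U \<phi> (l t)"] exI[of _ "\<delta> *\<^sub>R A w"]) auto
qed

lemma regular_at_cong:
 assumes f: "regular_at M f p" and V: "openin (topo M) V" "p \<in> V" and eq: "!!x. x \<in> V ==> f x = g x"
 shows "regular_at M g p"
proof -
 obtain \<gamma> D where \<gamma>: "smooth_map eu {-1<..<1::real} M (carr M) \<gamma>" "\<gamma> 0 = p"
  "((%t. f (\<gamma> t)) has_vector_derivative D) (at 0)" "D ~= 0"
  using f by (auto simp: regular_at_def)
 obtain d where d: "d > 0" "ball 0 d <= {-1<..<1::real}" "!!y. y \<in> ball 0 d ==> \<gamma> y \<in> V"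
  by (rule smooth_map_eu_ball[OF \<gamma>(1), of 0 V]) (use V \<gamma>(2) in auto)
 have "((%t. g (\<gamma> t)) has_vector_derivative D) (at 0)"
  by (rule has_vector_derivative_transform_within_open[OF \<gamma>(3), of "ball 0 d"]) (use d eq in auto)
 then show ?thesis using \<gamma> unfolding regular_at_def by blast
qed

lemma regular_at_mult_const:
 fixes f :: "'a => complex"
 assumes "regular_at M f p" "c ~= 0" shows "regular_at M (%x. f x * c) p"
proof -
 obtain \<gamma> D where \<gamma>: "smooth_map eu {-1<..<1::real} M (carr M) \<gamma>" "\<gamma> 0 = p"
  "((%t. f (\<gamma> t)) has_vector_derivative D) (at 0)" "D ~= 0"
  using assms(1) by (auto simp: regular_at_def)
 have "((%t. f (\<gamma> t) * c) has_vector_derivative D * c) (at 0)"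
  by (rule has_vector_derivative_mult_left[OF \<gamma>(3)])
 then show ?thesis using \<gamma> assms(2) unfolding regular_at_def by (intro exI[of _ \<gamma>] exI[of _ "D * c"]) auto
qed

section \<open>Normalization\<close>

lemma C_on_inverse_sqrt: "C_on k {0<..} (%x::real. inverse (sqrt x))"
proof (induction k)
 case 0
 show ?case by (auto intro!: continuous_intros)
next
 case (Suc k)
 let ?f = "%x::real. inverse (sqrt x)"
 show ?case
 proof (rule C_on_SucI_real[of _ _ "%x. - (1 / 2) * (?f x * ?f x * ?f x)"])
  fix x :: real assume "x \<in> {0<..}"
  then have "(?f has_real_derivative - (1 / 2) * (?f x * ?f x * ?f x)) (at x)"
   by (auto intro!: derivative_eq_intros simp: field_simps)
  then show "(?f has_vector_derivative - (1 / 2) * (?f x * ?f x * ?f x)) (at x)"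
   by (simp add: has_real_derivative_iff_has_vector_derivative)
 qed (rule open_greaterThan, intro C_on_mult C_on_const Suc open_greaterThan)
qed

definition unit :: "complex => complex" where "unit z = inverse (cmod z) *\<^sub>R z"

lemma cmod_unit: "z ~= 0 ==> cmod (unit z) = 1" and unit_eq: "cmod z = 1 ==> unit z = z"
 by (simp_all add: unit_def)

lemma smooth_on_unit: "smooth_on (- {0}) unit"
proof -
 have "smooth_on (- {0}) (%z. inverse (sqrt (Re z * Re z + Im z * Im z)) *\<^sub>R z)"
 proof (intro smooth_on_bilinear[OF bounded_bilinear_scaleR] smooth_on_ident)
  have "smooth_on {0<..} (%x::real. inverse (sqrt x))"
   by (simp add: smooth_on_open Cinf_def C_on_inverse_sqrt)
  then show "smooth_on (- {0}) (%z. inverse (sqrt (Re z * Re z + Im z * Im z)))"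
  proof (rule smooth_on_compose)
   show "smooth_on (- {0}) (%z. Re z * Re z + Im z * Im z)"
    by (intro smooth_on_add smooth_on_mult smooth_on_Re smooth_on_Im smooth_on_ident)
   show "(%z. Re z * Re z + Im z * Im z) ` (- {0}) <= {0<..}"
    by (auto simp: complex_eq_iff sum_squares_gt_zero_iff)
  qed
 qed
 then show ?thesis by (rule smooth_on_cong) (simp add: unit_def cmod_def power2_eq_square)
qed

lemma sfun_unit:
 assumes "smooth_manifold M" "sfun M S f" "!!x. x \<in> S ==> f x ~= 0" shows "sfun M S (%x. unit (f x))"
 by (rule sfun_compose_smooth_on[OF assms(1,2) smooth_on_unit]) (use assms(3) in auto)

section \<open>Interpolation of circle-valued maps in a collar\<close>

text \<open>Written with \<open>cis\<close> as an overall factor, so that the derivative vanishes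
  exactly if the first factor does, which no longer involves the angle itself.\<close>

lemma has_derivative_mult_cis:
 fixes \<alpha> :: "'e::real_normed_vector => complex" and \<xi> :: "'e => real"
 assumes "(\<alpha> has_derivative \<alpha>') (at y)" "(\<xi> has_derivative \<xi>') (at y)"
 shows "((%z. \<alpha> z * cis (\<xi> z)) has_derivative (%w. (\<alpha>' w + \<alpha> y * (\<xi>' w *\<^sub>R \<i>)) * cis (\<xi> y))) (at y)"
proof -
 have "((%z. cis (\<xi> z)) has_derivative (%w. \<xi>' w *\<^sub>R (\<i> * cis (\<xi> y)))) (at y)"
  using diff_chain_at[OF assms(2) has_vector_derivative_cis[unfolded has_vector_derivative_def]] by (simp add: o_def)
 from has_derivative_mult[OF assms(1) this] show ?thesis by (simp add: algebra_simps)
qed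

text \<open>\<open>a\<close> and \<open>b\<close> are the given maps on the two sides and
  \<open>u0\<close> is a lift of their quotient on the hypersurface. \<open>areg\<close> and
  \<open>breg\<close> take care of points away from it. \<open>atan\<close> and \<open>btan\<close>
  demand more on it: the maps vary already along curves inside the hypersurface, and this persists
  on nearby level sets of \<open>s\<close>.\<close>

locale collar =
 fixes X :: "('x, real^4) manifold" and A B :: "'x set" and s u0 :: "'x => real" and a b :: "'x => complex"
 assumes X: "smooth_manifold X" and bd: "mboundary X = {}" and compact: "compact_space (topo X)"
  and closed_A: "closedin (topo X) A" and closed_B: "closedin (topo X) B" and cover: "carr X = A Un B"
  and s: "sfun X (carr X) s" and sA: "!!x. x \<in> A ==> s x \<le> 0" and sB: "!!x. x \<in> B ==> s x \<ge> 0"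
  and s0: "!!x. x \<in> carr X ==> s x = 0 \<longleftrightarrow> x \<in> A Int B" and sreg: "!!x. x \<in> A Int B ==> regular_at X s x"
  and a: "sfun X A a" "!!x. x \<in> A ==> cmod (a x) = 1"
  and b: "sfun X B b" "!!x. x \<in> B ==> cmod (b x) = 1"
  and areg: "!!x. x \<in> A - B ==> regular_at X a x" and breg: "!!x. x \<in> B - A ==> regular_at X b x"
  and atan: "!!x. x \<in> A Int B ==> EX \<gamma> D. smooth_map eu {-1<..<1::real} X (A Int B) \<gamma> & \<gamma> 0 = x &
    ((%t. a (\<gamma> t)) has_vector_derivative D) (at 0) & D ~= 0"
  and btan: "!!x. x \<in> A Int B ==> EX \<gamma> D. smooth_map eu {-1<..<1::real} X (A Int B) \<gamma> & \<gamma> 0 = x &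
    ((%t. b (\<gamma> t)) has_vector_derivative D) (at 0) & D ~= 0"
  and u0: "continuous_map (subtopology (topo X) (A Int B)) euclideanreal u0" "!!x. x \<in> A Int B ==> b x = a x * cis (u0 x)"
begin

lemma openin_preimage:
 assumes "sfun X (carr X) (f :: 'x => 'c::euclidean_space)" "open T" shows "openin (topo X) {x \<in> carr X. f x \<in> T}"
proof -
 have "continuous_map (topo X) euclidean f" using sfun_continuous[OF X subset_refl assms(1)] by simp
 from openin_continuous_map_preimage[OF this, of T] assms(2) show ?thesis by simp
qed

lemma N_closed: "closedin (topo X) (A Int B)" and N_sub: "A Int B <= carr X"
 using closed_A closed_B cover by auto

text \<open>The maps \<open>a\<close> and \<open>b\<close> are extended to a neighbourhood \<open>Q\<close> of the hypersurface, and \<open>u\<close> is a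
  smooth lift of their quotient there.\<close>

lemma extended_maps:
 obtains \<alpha> \<beta> u Q where "openin (topo X) Q" "A Int B <= Q" "sfun X (Q Un A) \<alpha>" "sfun X (Q Un B) \<beta>" "sfun X Q u"
  "!!x. x \<in> Q Un A ==> cmod (\<alpha> x) = 1" "!!x. x \<in> Q Un B ==> cmod (\<beta> x) = 1"
  "!!x. x \<in> A ==> \<alpha> x = a x" "!!x. x \<in> B ==> \<beta> x = b x" "!!x. x \<in> Q ==> \<beta> x = \<alpha> x * cis (u x :: real)"
proof -
 obtain ga where ga: "sfun X (carr X) ga" "!!x. x \<in> A ==> ga x = a x"
  by (rule smooth_Tietze[OF X bd compact closed_A a(1)]) (rule that)
 obtain gb where gb: "sfun X (carr X) gb" "!!x. x \<in> B ==> gb x = b x"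
  by (rule smooth_Tietze[OF X bd compact closed_B b(1)]) (rule that)
 obtain v :: "'x => real" where v: "sfun X (carr X) v" "!!x. x \<in> A Int B ==> \<bar>v x - u0 x\<bar> < 1"
  by (rule smooth_approximation[OF X bd compact N_closed u0(1)]) (rule that)
 \<comment> \<open>The quotient of the two maps, turned back by the smooth approximation
   \<open>v\<close> of the lift. On the hypersurface its angle is \<open>u0 x - v x\<close>, of size
   less than 1, so it lies in the right half-plane there and nearby, and
   \<open>v x + arg0 (q x)\<close> is an exact smooth lift.\<close>
 define q where "q x = gb x * cnj (ga x) * cis (- v x)" for x
 have sq: "sfun X (carr X) q" unfolding q_def[abs_def]
  by (intro sfun_mult gb(1) sfun_linear[OF bounded_linear_cnj ga(1)] sfun_cis sfun_linear[OF bounded_linear_minus[OF bounded_linear_ident] v(1)])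
 define Q where "Q = {x \<in> carr X. q x \<in> {z. Re z > 0}}"
 have oQ: "openin (topo X) Q" unfolding Q_def by (rule openin_preimage[OF sq]) (rule open_halfspace_Re_gt)
 have NQ: "A Int B <= Q"
 proof
  fix x assume x: "x \<in> A Int B"
  have "cis (u0 x - v x) = cis (u0 x) * cis (- v x)" by (simp add: cis_mult)
  then have "q x = a x * cnj (a x) * cis (u0 x - v x)"
   using ga(2) gb(2) u0(2)[OF x] x by (simp add: q_def mult_ac)
  also have "\<dots> = cis (u0 x - v x)" using unit_mult_cnj[OF a(2)] x by simp
  finally have "Re (q x) = cos (u0 x - v x)" by simp
  also have "\<dots> > 0" using v(2)[OF x] pi_gt3 by (intro cos_gt_zero_pi) auto
  finally show "x \<in> Q" using x N_sub by (auto simp: Q_def)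
 qed
 have ne: "ga x ~= 0 & gb x ~= 0" if "x \<in> Q" for x using that by (auto simp: Q_def q_def)
 have neA: "ga x ~= 0" if "x \<in> Q Un A" for x using that ne a(2) ga(2) by fastforce
 have neB: "gb x ~= 0" if "x \<in> Q Un B" for x using that ne b(2) gb(2) by fastforce
 have sub: "Q Un A <= carr X" "Q Un B <= carr X" using cover by (auto simp: Q_def)
 define \<alpha> where "\<alpha> x = unit (ga x)" for x
 define \<beta> where "\<beta> x = unit (gb x)" for x
 define u where "u x = v x + arg0 (q x)" for x
 show ?thesis
 proof (rule that[OF oQ NQ, of \<alpha> \<beta> u])
  show "sfun X (Q Un A) \<alpha>" unfolding \<alpha>_def[abs_def] by (rule sfun_unit[OF X sfun_subset[OF ga(1) sub(1)] neA])
  show "sfun X (Q Un B) \<beta>" unfolding \<beta>_def[abs_def] by (rule sfun_unit[OF X sfun_subset[OF gb(1) sub(2)] neB])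
  show "sfun X Q u" unfolding u_def[abs_def]
  proof (intro sfun_add sfun_arg0[OF X])
   show "sfun X Q v" "sfun X Q q" by (rule sfun_subset[OF v(1)] sfun_subset[OF sq], use sub in auto)+
  qed (simp add: Q_def)
  show "cmod (\<alpha> x) = 1" if "x \<in> Q Un A" for x using neA[OF that] by (simp add: \<alpha>_def cmod_unit)
  show "cmod (\<beta> x) = 1" if "x \<in> Q Un B" for x using neB[OF that] by (simp add: \<beta>_def cmod_unit)
  show "\<alpha> x = a x" if "x \<in> A" for x using ga(2) a(2) that by (simp add: \<alpha>_def unit_eq)
  show "\<beta> x = b x" if "x \<in> B" for x using gb(2) b(2) that by (simp add: \<beta>_def unit_eq)
  fix x assume x: "x \<in> Q"
  have q: "of_real (cmod (q x)) * cis (arg0 (q x)) = q x" using x by (intro cis_arg0) (simp add: Q_def)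
  have m: "cmod (q x) = cmod (gb x) * cmod (ga x)" by (simp add: q_def norm_mult)
  have "of_real (cmod (gb x) * cmod (ga x)) * cis (u x) * ga x = (of_real (cmod (q x)) * cis (arg0 (q x))) * cis (v x) * ga x"
   unfolding m u_def by (simp add: mult_ac flip: cis_mult)
  also have "\<dots> = gb x * (ga x * cnj (ga x)) * (cis (v x) * cis (- v x))" unfolding q by (simp add: q_def mult_ac)
  also have "\<dots> = gb x * of_real ((cmod (ga x))\<^sup>2)" unfolding complex_norm_square cis_mult by simp
  finally have "of_real (cmod (ga x)) * (of_real (cmod (gb x)) * ga x * cis (u x)) = of_real (cmod (ga x)) * (of_real (cmod (ga x)) * gb x)"
   by (simp add: mult_ac power2_eq_square)
  then have "of_real (cmod (gb x)) * ga x * cis (u x) = of_real (cmod (ga x)) * gb x" using ne[OF x] by simp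
  then show "\<beta> x = \<alpha> x * cis (u x)" using ne[OF x] by (simp add: \<alpha>_def \<beta>_def unit_def scaleR_conv_of_real field_simps)
 qed
qed

end

text \<open>Extreme values of the continuous derivative. The lower bound is restricted to the middle
  half because the slope tends to zero at both ends of the transition.\<close>

lemma smooth_step_deriv_bounds:
 obtains c K where "c > 0" "K \<ge> 0" "!!x D. (smooth_step has_real_derivative D) (at x) ==> x \<in> {1/4..3/4} ==> c \<le> D"
  "!!x D. (smooth_step has_real_derivative D) (at x) ==> x \<in> {0..1} ==> 0 \<le> D & D \<le> K"
proof -
 have "smooth_on UNIV (%x::real. smooth_step x)" by (intro smooth_on_smooth_step smooth_on_ident)
 then have "Cinf UNIV smooth_step" by (simp add: smooth_on_open)
 then obtain f' where f': "!!x. (smooth_step has_derivative f' x) (at x)" "!!v. Cinf UNIV (%x. f' x v)"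
  using Cinf_derivative[of UNIV smooth_step] by auto
 define g where "g x = f' x 1" for x
 have cg: "continuous_on S g" for S
  using continuous_on_subset[OF Cinf_continuous[OF f'(2)[of 1]] subset_UNIV] by (simp add: g_def[abs_def])
 have g: "D = g x" if "(smooth_step has_real_derivative D) (at x)" for x D
  using has_derivative_unique[OF f'(1)[of x]] that unfolding has_field_derivative_def g_def by auto
 have g0: "g x \<ge> 0 & (0 < x & x < 1 --> g x > 0)" for x
  by (rule smooth_step_deriv[of x]) (use g in blast)
 obtain x0 where x0: "x0 \<in> {1/4..3/4}" "!!y. y \<in> {1/4..3/4} ==> g x0 \<le> g y"
  using continuous_attains_inf[OF compact_Icc _ cg, of "1/4" "3/4"] by auto
 obtain x1 where x1: "ALL y:{0..1}. g y \<le> g x1"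
  using continuous_attains_sup[OF compact_Icc _ cg, of 0 1] by auto
 show ?thesis
  by (rule that[of "g x0" "g x1"]) (use g0 x0 x1 g in force)+
qed

lemma sfun_chart_derivative:
 fixes f :: "'a => 'b::euclidean_space"
 assumes "sfun X Q f" "(U, \<phi>) \<in> charts X" "open (\<phi> ` (U Int Q))"
 obtains f' where "!!x. x \<in> \<phi> ` (U Int Q) ==> ((%x. f (inv_into U \<phi> x)) has_derivative f' x) (at x)"
  "!!x v. x \<in> \<phi> ` (U Int Q) ==> ((%x. f' x v) \<longlongrightarrow> f' x v) (nhds x)"
proof -
 have "Cinf (\<phi> ` (U Int Q)) (%x. f (inv_into U \<phi> x))"
  using sfunD[OF assms(1,2)] assms(3) by (simp add: smooth_on_open)
 then obtain f' where f': "!!x. x \<in> \<phi> ` (U Int Q) ==> ((%x. f (inv_into U \<phi> x)) has_derivative f' x) (at x)"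
  "!!v. Cinf (\<phi> ` (U Int Q)) (%x. f' x v)"
  by (rule Cinf_derivative[OF _ assms(3)]) (rule that)
 show ?thesis
 proof (rule that[OF f'(1)])
  fix x v assume x: "x \<in> \<phi> ` (U Int Q)"
  have "isCont (%x. f' x v) x"
   using continuous_on_eq_continuous_at[OF assms(3)] Cinf_continuous[OF f'(2)[of v]] x by blast
  then show "((%x. f' x v) \<longlongrightarrow> f' x v) (nhds x)"
   using tendsto_at_iff_tendsto_nhds[of "%x. f' x v" x] by (simp add: isCont_def)
 qed
qed

section \<open>Regularity of the interpolated map near the hypersurface\<close>

context collar begin

definition steep :: "('x => complex) => ('x => real) => real => 'x => bool" where
 "steep \<alpha> u M x \<longleftrightarrow> (ALL g g' c c'. (g has_real_derivative g') (at (s x)) --> (c has_real_derivative c') (at (s x)) -->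
  0 \<le> g' --> \<bar>g (s x)\<bar> \<le> 1 --> g' * M + 2 * M * M < c' -->
  regular_at X (%y. \<alpha> y * cis (g (s y) * u y + c (s y))) x)"

text \<open>Multiplying by a circle-valued function of \<open>s\<close>, with any profile, does not
  destroy regularity at \<open>x\<close>; the source of this is a direction inside the level set of
  \<open>s\<close> along which \<alpha> varies.\<close>

definition transverse :: "('x => complex) => 'x => bool" where
 "transverse \<alpha> x \<longleftrightarrow> (ALL g g'. (g has_real_derivative g') (at (s x)) --> regular_at X (%y. \<alpha> y * cis (g (s y))) x)"

lemma steep_mono:
 assumes "steep \<alpha> u M x" "0 \<le> M" "M \<le> M'" shows "steep \<alpha> u M' x"
 unfolding steep_def
proof (intro allI impI)
 fix g g' c c'
 assume g: "(g has_real_derivative g') (at (s x))" "(c has_real_derivative c') (at (s x))" "0 \<le> g'" "\<bar>g (s x)\<bar> \<le> 1"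
  and c': "g' * M' + 2 * M' * M' < c'"
 have "g' * M \<le> g' * M'" "M * M \<le> M' * M'" using assms g(3) by (auto intro: mult_left_mono mult_mono)
 then have "g' * M + 2 * M * M < c'" using c' by linarith
 then show "regular_at X (%y. \<alpha> y * cis (g (s y) * u y + c (s y))) x"
  using assms(1) g unfolding steep_def by blast
qed

text \<open>The given curve in the hypersurface has a velocity \<open>e1\<close> killed by the
  derivative of \<open>s\<close> but not by that of \<alpha>. At nearby points \<open>e1\<close> is
  corrected by a multiple of \<open>e3\<close>, on which the derivative of \<open>s\<close> is
  nonzero, to a vector \<open>w y\<close> in the kernel. The derivative of \<alpha> on it is
  \<open>F y\<close>, continuous and nonzero at the point.\<close>

lemma transverse_near:
 assumes p: "p \<in> A Int B" and Q: "openin (topo X) Q" "p \<in> Q" and \<alpha>: "sfun X Q \<alpha>"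
  and tan: "EX \<gamma> D. smooth_map eu {-1<..<1::real} X (A Int B) \<gamma> & \<gamma> 0 = p &
    ((%t. \<alpha> (\<gamma> t)) has_vector_derivative D) (at 0) & D ~= 0"
 shows "EX G. openin (topo X) G & p \<in> G & (ALL x:G. transverse \<alpha> x)"
proof -
 have pX: "p \<in> carr X" using p N_sub by auto
 obtain V \<psi> where d: "(V, \<psi>) \<in> charts X" "p \<in> V" using chart_at[OF X pX] .
 have inv: "inv_into V \<psi> (\<psi> x) = x" if "x \<in> V" for x using chart_inj[OF X d(1)] that by simp
 obtain T where T: "open T" "\<psi> ` (V Int Q) = \<psi> ` V Int T" by (rule chart_image_open[OF X d(1) Q(1)])
 let ?D = "\<psi> ` (V Int Q)"
 have oD: "open ?D" unfolding T(2) using chart_image_interior[OF bd d(1)] T(1) by auto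
 have y0: "\<psi> p \<in> ?D" using d(2) Q(2) by auto
 have sQ: "sfun X Q s" by (rule sfun_subset[OF s openin_subset[OF Q(1)]])
 obtain \<alpha>' where \<alpha>': "!!y. y \<in> ?D ==> ((%x. \<alpha> (inv_into V \<psi> x)) has_derivative \<alpha>' y) (at y)"
  "!!y v. y \<in> ?D ==> ((%x. \<alpha>' x v) \<longlongrightarrow> \<alpha>' y v) (nhds y)"
  by (rule sfun_chart_derivative[OF \<alpha> d(1) oD]) (rule that)
 obtain s' where s': "!!y. y \<in> ?D ==> ((%x. s (inv_into V \<psi> x)) has_derivative s' y) (at y)"
  "!!y v. y \<in> ?D ==> ((%x. s' x v) \<longlongrightarrow> s' y v) (nhds y)"
  by (rule sfun_chart_derivative[OF sQ d(1) oD]) (rule that)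
 obtain e3 where e3: "s' (\<psi> p) e3 ~= 0"
  using regular_chart[OF X d sreg[OF p] s'(1)[OF y0]] by blast
 obtain \<gamma> D where \<gamma>: "smooth_map eu {-1<..<1::real} X (A Int B) \<gamma>" "\<gamma> 0 = p"
  "((%t. \<alpha> (\<gamma> t)) has_vector_derivative D) (at 0)" "D ~= 0" using tan by blast
 obtain e1 r where e1: "((%t. \<psi> (\<gamma> t)) has_vector_derivative e1) (at 0)" "r > 0" "!!t. t \<in> ball 0 r ==> \<gamma> t \<in> V"
  by (rule curve_velocity[OF X d \<gamma>(1,2) N_sub]) (rule that)
 have \<alpha>e1: "\<alpha>' (\<psi> p) e1 ~= 0"
  using velocity_chain[where f = \<alpha>, OF X d(1) \<gamma>(2) e1 \<alpha>'(1)[OF y0] \<gamma>(3)] \<gamma>(4) by simp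
 have "((%t. s (\<gamma> t)) has_vector_derivative 0) (at 0)"
 proof (rule has_vector_derivative_transform_within_open[of "%_. 0"])
  fix t :: real assume "t \<in> {-1<..<1}"
  then have "\<gamma> t \<in> A Int B" using smooth_map_in(1)[OF \<gamma>(1)] by simp
  then show "0 = s (\<gamma> t)" using s0 N_sub by (metis subsetD)
 qed auto
 from velocity_chain[where f = s, OF X d(1) \<gamma>(2) e1 s'(1)[OF y0] this] have se1: "s' (\<psi> p) e1 = 0" .
 define w where "w y = e1 - (s' y e1 / s' y e3) *\<^sub>R e3" for y
 define F where "F y = \<alpha>' y e1 - (s' y e1 / s' y e3) *\<^sub>R \<alpha>' y e3" for y
 have lim: "(F \<longlongrightarrow> F (\<psi> p)) (nhds (\<psi> p))"
  unfolding F_def by (intro tendsto_intros \<alpha>'(2) s'(2) y0 e3)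
 have ev: "\<forall>\<^sub>F y in nhds (\<psi> p). F y ~= 0 & s' y e3 ~= 0"
 proof (rule eventually_conj)
  show "\<forall>\<^sub>F y in nhds (\<psi> p). F y ~= 0" by (rule tendsto_imp_eventually_ne[OF lim]) (use \<alpha>e1 se1 in \<open>simp add: F_def\<close>)
  show "\<forall>\<^sub>F y in nhds (\<psi> p). s' y e3 ~= 0" by (rule tendsto_imp_eventually_ne[OF s'(2)[OF y0] e3])
 qed
 then obtain D1 where D1: "open D1" "\<psi> p \<in> D1" "!!y. y \<in> D1 ==> F y ~= 0 & s' y e3 ~= 0"
  unfolding eventually_nhds by blast
 let ?G = "{x \<in> V. \<psi> x \<in> D1 Int ?D}"
 have oG: "openin (topo X) ?G"
  by (rule smooth_map_openin_preimage[OF chart_smooth[OF X d(1)]]) (use chart_open[OF X d(1)] D1 oD in auto)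
 have "transverse \<alpha> x" if x: "x \<in> ?G" for x
  unfolding transverse_def
 proof (intro allI impI)
  fix g g' assume g: "(g has_real_derivative g') (at (s x))"
  let ?y = "\<psi> x"
  have xV: "x \<in> V" "?y \<in> ?D" "F ?y ~= 0" "s' ?y e3 ~= 0" using x D1(3) by auto
  have ls: "linear (s' ?y)" "linear (\<alpha>' ?y)" using s'(1)[OF xV(2)] \<alpha>'(1)[OF xV(2)] has_derivative_linear by auto
  have "((%z. g (s (inv_into V \<psi> z))) has_derivative (%v. g' * s' ?y v)) (at ?y)"
   using has_derivative_compose[OF s'(1)[OF xV(2)], of g "%v. g' * v"] g inv[OF xV(1)] by (simp add: has_field_derivative_def)
  from has_derivative_mult_cis[OF \<alpha>'(1)[OF xV(2)] this]
  show "regular_at X (%y. \<alpha> y * cis (g (s y))) x"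
  proof (rule regular_at_chartI[OF X bd d(1) xV(1)])
   have "s' ?y (w ?y) = 0" "\<alpha>' ?y (w ?y) = F ?y"
    using xV(4) ls by (simp_all add: w_def F_def linear_diff linear_scale)
   then show "(\<alpha>' ?y (w ?y) + \<alpha> (inv_into V \<psi> ?y) * ((g' * s' ?y (w ?y)) *\<^sub>R \<i>)) * cis (g (s (inv_into V \<psi> ?y))) ~= 0"
    using xV(3) by simp
  qed
 qed
 then show ?thesis using oG d(2) D1(2) y0 by (intro exI[of _ ?G]) auto
qed

text \<open>Along a direction \<open>e\<close> on which the derivative of \<open>s\<close> stays
  above \<open>1 / 2\<close>, the angle has derivative larger than \<open>M\<close>: the terms with
  \<open>u\<close> and its derivative cost less than \<open>M\<close> plus \<open>g' * M\<close>
  times the derivative of \<open>s\<close>, and the assumed slope of \<open>c\<close> leaves at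
  least \<open>M * M\<close> for the rest. As \<alpha> changes along \<open>e\<close> at a rate less
  than \<open>M\<close>, the two contributions cannot cancel.\<close>

lemma steep_near:
 assumes p: "p \<in> A Int B" and Q: "openin (topo X) Q" "p \<in> Q" and \<alpha>: "sfun X Q \<alpha>" "!!x. x \<in> Q ==> cmod (\<alpha> x) = 1"
  and u: "sfun X Q u"
 shows "EX G M. openin (topo X) G & p \<in> G & 0 \<le> M & (ALL x:G. steep \<alpha> u M x)"
proof -
 have pX: "p \<in> carr X" using p N_sub by auto
 obtain V \<psi> where d: "(V, \<psi>) \<in> charts X" "p \<in> V" using chart_at[OF X pX] .
 have inv: "inv_into V \<psi> (\<psi> x) = x" if "x \<in> V" for x using chart_inj[OF X d(1)] that by simp
 obtain T where T: "open T" "\<psi> ` (V Int Q) = \<psi> ` V Int T" by (rule chart_image_open[OF X d(1) Q(1)])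
 let ?D = "\<psi> ` (V Int Q)"
 have oD: "open ?D" unfolding T(2) using chart_image_interior[OF bd d(1)] T(1) by auto
 have y0: "\<psi> p \<in> ?D" using d(2) Q(2) by auto
 have sQ: "sfun X Q s" by (rule sfun_subset[OF s openin_subset[OF Q(1)]])
 obtain \<alpha>' where \<alpha>': "!!y. y \<in> ?D ==> ((%x. \<alpha> (inv_into V \<psi> x)) has_derivative \<alpha>' y) (at y)"
  "!!y v. y \<in> ?D ==> ((%x. \<alpha>' x v) \<longlongrightarrow> \<alpha>' y v) (nhds y)"
  by (rule sfun_chart_derivative[OF \<alpha>(1) d(1) oD]) (rule that)
 obtain s' where s': "!!y. y \<in> ?D ==> ((%x. s (inv_into V \<psi> x)) has_derivative s' y) (at y)"
  "!!y v. y \<in> ?D ==> ((%x. s' x v) \<longlongrightarrow> s' y v) (nhds y)"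
  by (rule sfun_chart_derivative[OF sQ d(1) oD]) (rule that)
 obtain u' where u': "!!y. y \<in> ?D ==> ((%x. u (inv_into V \<psi> x)) has_derivative u' y) (at y)"
  "!!y v. y \<in> ?D ==> ((%x. u' x v) \<longlongrightarrow> u' y v) (nhds y)"
  by (rule sfun_chart_derivative[OF u d(1) oD]) (rule that)
 obtain e0 where e0: "s' (\<psi> p) e0 ~= 0"
  using regular_chart[OF X d sreg[OF p] s'(1)[OF y0]] by blast
 define e where "e = inverse (s' (\<psi> p) e0) *\<^sub>R e0"
 have e: "s' (\<psi> p) e = 1" using e0 has_derivative_linear[OF s'(1)[OF y0]] by (simp add: e_def linear_scale)
 \<comment> \<open>The added 1 in each bracket leaves room for the values at nearby points. The
   summand 2 gives \<open>2 * M \<le> M * M\<close>, so that \<open>M * M - M\<close> is still at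
   least \<open>M\<close>.\<close>
 define M where "M = 2 + (norm (\<alpha>' (\<psi> p) e) + 1) + (\<bar>u' (\<psi> p) e\<bar> + 1) + (\<bar>u p\<bar> + 1)"
 have M: "M \<ge> 2" "norm (\<alpha>' (\<psi> p) e) + 1 \<le> M" "\<bar>u' (\<psi> p) e\<bar> + 1 \<le> M" "\<bar>u p\<bar> + 1 \<le> M" by (auto simp: M_def)
 have cu: "((%y. u (inv_into V \<psi> y)) \<longlongrightarrow> u p) (nhds (\<psi> p))"
 proof -
  have "((%y. u (inv_into V \<psi> y)) \<longlongrightarrow> u (inv_into V \<psi> (\<psi> p))) (nhds (\<psi> p))"
   using has_derivative_continuous[OF u'(1)[OF y0]]
    tendsto_at_iff_tendsto_nhds[of "%y. u (inv_into V \<psi> y)" "\<psi> p"] by (simp only: isCont_def)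
  then show ?thesis using inv[OF d(2)] by simp
 qed
 have "\<forall>\<^sub>F y in nhds (\<psi> p). 1 / 2 < s' y e" by (rule order_tendstoD(1)[OF s'(2)[OF y0]]) (simp add: e)
 moreover have "\<forall>\<^sub>F y in nhds (\<psi> p). norm (\<alpha>' y e) < norm (\<alpha>' (\<psi> p) e) + 1"
  by (rule order_tendstoD(2)[OF tendsto_norm[OF \<alpha>'(2)[OF y0]]]) simp
 moreover have "\<forall>\<^sub>F y in nhds (\<psi> p). \<bar>u' y e\<bar> < \<bar>u' (\<psi> p) e\<bar> + 1"
  by (rule order_tendstoD(2)[OF tendsto_rabs[OF u'(2)[OF y0]]]) simp
 moreover have "\<forall>\<^sub>F y in nhds (\<psi> p). \<bar>u (inv_into V \<psi> y)\<bar> < \<bar>u p\<bar> + 1"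
  by (rule order_tendstoD(2)[OF tendsto_rabs[OF cu]]) simp
 ultimately have "\<forall>\<^sub>F y in nhds (\<psi> p). 1 / 2 < s' y e & norm (\<alpha>' y e) < M & \<bar>u' y e\<bar> < M & \<bar>u (inv_into V \<psi> y)\<bar> < M"
  by eventually_elim (use M in auto)
 then obtain D1 where D1: "open D1" "\<psi> p \<in> D1"
  "!!y. y \<in> D1 ==> 1 / 2 < s' y e & norm (\<alpha>' y e) < M & \<bar>u' y e\<bar> < M & \<bar>u (inv_into V \<psi> y)\<bar> < M"
  unfolding eventually_nhds by blast
 let ?G = "{x \<in> V. \<psi> x \<in> D1 Int ?D}"
 have oG: "openin (topo X) ?G"
  by (rule smooth_map_openin_preimage[OF chart_smooth[OF X d(1)]]) (use chart_open[OF X d(1)] D1 oD in auto)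
 have "steep \<alpha> u M x" if x: "x \<in> ?G" for x
  unfolding steep_def
 proof (intro allI impI)
  fix g g' c c'
  assume g: "(g has_real_derivative g') (at (s x))" and c: "(c has_real_derivative c') (at (s x))"
   and g': "0 \<le> g'" and gs: "\<bar>g (s x)\<bar> \<le> 1" and c': "g' * M + 2 * M * M < c'"
  let ?y = "\<psi> x"
  have xV: "x \<in> V" "?y \<in> ?D" and bnd: "1 / 2 < s' ?y e" "norm (\<alpha>' ?y e) < M" "\<bar>u' ?y e\<bar> < M" "\<bar>u x\<bar> < M"
   using x D1(3)[of ?y] inv[of x] by auto
  have xQ: "x \<in> Q" using xV inv by (metis IntE imageE)
  have ds: "((%z. h (s (inv_into V \<psi> z))) has_derivative (%v. h' * s' ?y v)) (at ?y)"
   if "(h has_real_derivative h') (at (s x))" for h h'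
   using has_derivative_compose[OF s'(1)[OF xV(2)], of h "%v. h' * v"] that inv[OF xV(1)] by (simp add: has_field_derivative_def)
  have "((%z. g (s (inv_into V \<psi> z)) * u (inv_into V \<psi> z) + c (s (inv_into V \<psi> z))) has_derivative
   (%v. (g (s x) * u' ?y v + g' * s' ?y v * u x) + c' * s' ?y v)) (at ?y)"
   using has_derivative_add[OF has_derivative_mult[OF ds[OF g] u'(1)[OF xV(2)]] ds[OF c]] inv[OF xV(1)] by simp
  from has_derivative_mult_cis[OF \<alpha>'(1)[OF xV(2)] this]
  show "regular_at X (%y. \<alpha> y * cis (g (s y) * u y + c (s y))) x"
  proof (rule regular_at_chartI[OF X bd d(1) xV(1)])
   let ?\<xi> = "(g (s x) * u' ?y e + g' * s' ?y e * u x) + c' * s' ?y e"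
   have "\<bar>g (s x) * u' ?y e\<bar> \<le> 1 * \<bar>u' ?y e\<bar>" unfolding abs_mult by (rule mult_right_mono[OF gs]) simp
   moreover have "g' * s' ?y e * (- u x) \<le> g' * s' ?y e * M"
    using g' bnd by (intro mult_left_mono) auto
   moreover have "2 * M * M * s' ?y e \<le> (c' - g' * M) * s' ?y e"
    using c' bnd(1) by (intro mult_right_mono) auto
   moreover have "2 * M * M * (1 / 2) \<le> 2 * M * M * s' ?y e"
    using M(1) bnd(1) by (intro mult_left_mono) auto
   moreover have "2 * M \<le> M * M" using M(1) by (intro mult_right_mono) auto
   ultimately have "?\<xi> > M" using bnd(3) by (simp add: algebra_simps)
   then have "norm (\<alpha> x * (?\<xi> *\<^sub>R \<i>)) > norm (\<alpha>' ?y e)"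
    using bnd(2) M(1) \<alpha>(2)[OF xQ] by (simp add: norm_mult)
   then have "\<alpha>' ?y e + \<alpha> x * (?\<xi> *\<^sub>R \<i>) ~= 0"
    by (metis add_eq_0_iff norm_minus_cancel less_irrefl)
   then show "(\<alpha>' ?y e + \<alpha> (inv_into V \<psi> ?y) * (?\<xi> *\<^sub>R \<i>)) *
    cis (g (s (inv_into V \<psi> ?y)) * u (inv_into V \<psi> ?y) + c (s (inv_into V \<psi> ?y))) ~= 0"
    using inv[OF xV(1)] by simp
  qed
 qed
 then show ?thesis using oG d(2) D1(2) y0 M(1) by (intro exI[of _ ?G] exI[of _ M]) auto
qed

text \<open>The map is \<alpha> on one side and \<beta>, up to a constant factor, on the other, with
  angle \<open>g (s x) * u x + c (s x)\<close> added to that of \<alpha> in between. The profile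
  \<open>c\<close> must still be steep wherever \<open>g\<close> moves, and it may level off only
  where the map is \<alpha> or \<beta> times a function of \<open>s\<close>. This dictates a
  transition of \<open>c\<close> that is wider than that of \<open>g\<close>.\<close>

theorem fibers: "fibers_over_circle X"
proof -
 obtain \<alpha> \<beta> u Q where Q: "openin (topo X) Q" "A Int B <= Q" "sfun X (Q Un A) \<alpha>" "sfun X (Q Un B) \<beta>" "sfun X Q u"
  "!!x. x \<in> Q Un A ==> cmod (\<alpha> x) = 1" "!!x. x \<in> Q Un B ==> cmod (\<beta> x) = 1"
  "!!x. x \<in> A ==> \<alpha> x = a x" "!!x. x \<in> B ==> \<beta> x = b x" "!!x. x \<in> Q ==> \<beta> x = \<alpha> x * cis (u x :: real)"
  by (rule extended_maps) (rule that)
 have \<alpha>Q: "sfun X Q \<alpha>" and \<beta>Q: "sfun X Q \<beta>" by (rule sfun_subset[OF Q(3)] sfun_subset[OF Q(4)], auto)+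
 have inN: "\<gamma> t \<in> A Int B" if "smooth_map eu {-1<..<1::real} X (A Int B) \<gamma>" "t \<in> {-1<..<1}" for \<gamma> t
  using smooth_map_in(1)[OF that(1)] that(2) by simp
 have near: "EX G M. openin (topo X) G & p \<in> G & 0 \<le> M & G <= Q & (ALL x:G. steep \<alpha> u M x & transverse \<alpha> x & transverse \<beta> x)"
  if p: "p \<in> A Int B" for p
 proof -
  have pQ: "p \<in> Q" using p Q(2) by auto
  have tr: "((%t. k' (\<gamma> t)) has_vector_derivative D) (at 0)"
   if "smooth_map eu {-1<..<1::real} X (A Int B) \<gamma>" "((%t. k (\<gamma> t)) has_vector_derivative D) (at 0)"
    "!!x. x \<in> A Int B ==> k x = k' x" for k k' :: "'x => complex" and \<gamma> D
   by (rule has_vector_derivative_transform_within_open[OF that(2), of "{-1<..<1}"]) (use that(3) inN[OF that(1)] in auto)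
  obtain \<gamma> D where \<gamma>: "smooth_map eu {-1<..<1::real} X (A Int B) \<gamma>" "\<gamma> 0 = p" "((%t. a (\<gamma> t)) has_vector_derivative D) (at 0)" "D ~= 0"
   using atan[OF p] by blast
  have ta: "((%t. \<alpha> (\<gamma> t)) has_vector_derivative D) (at 0)" by (rule tr[OF \<gamma>(1,3)]) (use Q(8) in auto)
  obtain \<delta> E where \<delta>: "smooth_map eu {-1<..<1::real} X (A Int B) \<delta>" "\<delta> 0 = p" "((%t. b (\<delta> t)) has_vector_derivative E) (at 0)" "E ~= 0"
   using btan[OF p] by blast
  have tb: "((%t. \<beta> (\<delta> t)) has_vector_derivative E) (at 0)" by (rule tr[OF \<delta>(1,3)]) (use Q(9) in auto)
  obtain G1 where G1: "openin (topo X) G1" "p \<in> G1" "ALL x:G1. transverse \<alpha> x"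
   using transverse_near[OF p Q(1) pQ \<alpha>Q] \<gamma>(1,2,4) ta by blast
  obtain G2 where G2: "openin (topo X) G2" "p \<in> G2" "ALL x:G2. transverse \<beta> x"
   using transverse_near[OF p Q(1) pQ \<beta>Q] \<delta>(1,2,4) tb by blast
  obtain G3 M where G3: "openin (topo X) G3" "p \<in> G3" "0 \<le> M" "ALL x:G3. steep \<alpha> u M x"
   using steep_near[OF p Q(1) pQ \<alpha>Q Q(6) Q(5)] by blast
  show ?thesis using G1 G2 G3 Q(1) pQ
   by (intro exI[of _ "G1 Int G2 Int G3 Int Q"] exI[of _ M]) (auto intro: openin_Int)
 qed
 have "ALL p:A Int B. EX G. EX M. openin (topo X) G & p \<in> G & 0 \<le> M & G <= Q & (ALL x:G. steep \<alpha> u M x & transverse \<alpha> x & transverse \<beta> x)"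
  using near by simp
 from bchoice[OF this] obtain G where "ALL p:A Int B. EX M. openin (topo X) (G p) & p \<in> G p & 0 \<le> M & G p <= Q & (ALL x:G p. steep \<alpha> u M x & transverse \<alpha> x & transverse \<beta> x)" ..
 from bchoice[OF this] obtain M' where G: "ALL p:A Int B. openin (topo X) (G p) & p \<in> G p & 0 \<le> M' p & G p <= Q & (ALL x:G p. steep \<alpha> u (M' p) x & transverse \<alpha> x & transverse \<beta> x)" ..
 have "compactin (topo X) (A Int B)" using closedin_compact_space[OF compact N_closed] .
 moreover have "ALL U:G ` (A Int B). openin (topo X) U" "A Int B <= \<Union>(G ` (A Int B))" using G by auto
 ultimately obtain \<F> where "finite \<F>" "\<F> <= G ` (A Int B)" "A Int B <= \<Union>\<F>"
  unfolding compactin_def by metis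
 then obtain P where P: "finite P" "P <= A Int B" "A Int B <= \<Union>(G ` P)"
  using finite_subset_image by metis
 define M where "M = sum M' P"
 have M: "0 \<le> M' p" "M' p \<le> M" if "p \<in> P" for p
  using G P that unfolding M_def by (auto intro!: member_le_sum)
 have M0: "M \<ge> 0" unfolding M_def using M(1) by (rule sum_nonneg)
 have props: "x \<in> Q" "steep \<alpha> u M x" "transverse \<alpha> x" "transverse \<beta> x" if x: "x \<in> \<Union>(G ` P)" for x
 proof -
  obtain p where p: "p \<in> P" "x \<in> G p" using x by auto
  then have "p \<in> A Int B" using P(2) by auto
  then show "x \<in> Q" "transverse \<alpha> x" "transverse \<beta> x" "steep \<alpha> u M x"
   using G p(2) steep_mono[OF _ M[OF p(1)]] by auto
 qed
 have cs: "continuous_map (topo X) euclidean s" using sfun_continuous[OF X subset_refl s] by simp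
 obtain \<eta>0 where \<eta>0: "\<eta>0 > 0" "!!x. x \<in> carr X ==> \<bar>s x\<bar> < \<eta>0 ==> x \<in> \<Union>(G ` P)"
  by (rule tube_function[OF compact cs, of "\<Union>(G ` P)"])
   (use G P s0 in \<open>auto intro!: openin_Union\<close>)
 \<comment> \<open>Four units of \<eta> fit into the region where all local estimates hold: one for
   the transition of \<open>g\<close>, two for that of \<open>c\<close>, and the rest as a
   margin.\<close>
 define \<eta> where "\<eta> = \<eta>0 / 4"
 have \<eta>: "\<eta> > 0" "4 * \<eta> = \<eta>0" using \<eta>0 by (auto simp: \<eta>_def)
 have tube: "x \<in> \<Union>(G ` P)" if "x \<in> carr X" "\<bar>s x\<bar> < 4 * \<eta>" for x using \<eta>0(2) \<eta>(2) that by simp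
 obtain \<kappa> K where K: "\<kappa> > 0" "K \<ge> 0" "!!x D. (smooth_step has_real_derivative D) (at x) ==> x \<in> {1/4..3/4} ==> \<kappa> \<le> D"
  "!!x D. (smooth_step has_real_derivative D) (at x) ==> x \<in> {0..1} ==> 0 \<le> D & D \<le> K"
  using smooth_step_deriv_bounds by metis
 \<comment> \<open>On the part where \<open>g\<close> varies its slope is at most
   \<open>K / (2 * \<eta>)\<close>, and the slope of \<open>c\<close> is at least
   \<open>\<Lambda> * \<kappa> / (4 * \<eta>)\<close>. \<Lambda> is the solution of the inequality
   in \<open>steep\<close>, the summand 1 making it strict.\<close>
 define \<Lambda> where "\<Lambda> = 4 * \<eta> * (K / (2 * \<eta>) * M + 2 * M * M + 1) / \<kappa>"
 have \<Lambda>0: "\<Lambda> \<ge> 0" using \<eta> K M0 by (simp add: \<Lambda>_def)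
 have \<Lambda>: "K / (2 * \<eta>) * M + 2 * M * M < \<Lambda> * \<kappa> / (4 * \<eta>)" using \<eta> K(1) by (simp add: \<Lambda>_def field_simps)
 \<comment> \<open>\<open>g\<close> rises from 0 to 1 between \<open>- \<eta>\<close> and \<eta>,
   and \<open>c\<close> from 0 to \<Lambda> over twice that range. For
   \<open>\<bar>s x\<bar> \<le> \<eta>\<close> the argument of the step in \<open>c\<close> lies in
   \<open>{1/4..3/4}\<close>, where its slope is bounded below.\<close>
 define g where "g t = smooth_step ((t / \<eta> + 1) / 2)" for t
 define c where "c t = \<Lambda> * smooth_step ((t / \<eta> + 2) / 4)" for t
 have g01: "g t = 0" if "t \<le> - \<eta>" for t
  unfolding g_def by (rule smooth_step_0) (use that \<eta> in \<open>simp add: field_simps\<close>)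
 have g1: "g t = 1" if "t \<ge> \<eta>" for t
  unfolding g_def by (rule smooth_step_1) (use that \<eta> in \<open>simp add: field_simps\<close>)
 have c0: "c t = 0" if "t \<le> - 2 * \<eta>" for t
  unfolding c_def by (subst smooth_step_0) (use that \<eta> in \<open>simp_all add: field_simps\<close>)
 have c1: "c t = \<Lambda>" if "t \<ge> 2 * \<eta>" for t
  unfolding c_def by (subst smooth_step_1) (use that \<eta> in \<open>simp_all add: field_simps\<close>)
 have dstep: "EX D. (smooth_step has_real_derivative D) (at x)" for x by (rule smooth_step_deriv) blast
 have dg: "((%t. smooth_step ((t / \<eta> + 1) / 2)) has_real_derivative D * (1 / \<eta> / 2)) (at t)"
  if "(smooth_step has_real_derivative D) (at ((t / \<eta> + 1) / 2))" for D t
  by (rule DERIV_chain2[of smooth_step D "%t. (t / \<eta> + 1) / 2", OF that]) (use \<eta> in \<open>auto intro!: derivative_eq_intros\<close>)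
 have dc: "((%t. \<Lambda> * smooth_step ((t / \<eta> + 2) / 4)) has_real_derivative \<Lambda> * (D * (1 / \<eta> / 4))) (at t)"
  if "(smooth_step has_real_derivative D) (at ((t / \<eta> + 2) / 4))" for D t
  by (rule DERIV_cmult[OF DERIV_chain2[of smooth_step D "%t. (t / \<eta> + 2) / 4", OF that]]) (use \<eta> in \<open>auto intro!: derivative_eq_intros\<close>)
 have sdiv: "smooth_on S (%t::real. smooth_step ((t / \<eta> + d1) / d2))" for S d1 d2
  by (intro smooth_on_smooth_step) (use smooth_on_linear_compose[OF bounded_linear_divide smooth_on_add[OF smooth_on_linear[OF bounded_linear_divide] smooth_on_const]] in auto)
 have smg: "smooth_on UNIV g" unfolding g_def[abs_def] by (rule sdiv)
 have smc: "smooth_on UNIV c" unfolding c_def[abs_def] by (intro smooth_on_mult smooth_on_const sdiv)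
 have sc: "sfun X S (%x. c (s x))" and sg: "sfun X S (%x. g (s x))" if "S <= carr X" for S
  by (rule sfun_compose_smooth_on[OF X sfun_subset[OF s that]], rule smc smg, simp)+
 \<comment> \<open>The middle formula is valid on a larger region, since \<open>u\<close> lifts the
   quotient of \<beta> by \<alpha>: for \<open>g = 0\<close> it gives the first case and for
   \<open>g = 1\<close> the second. So \<open>h\<close> is smooth on three overlapping open
   sets.\<close>
 define h where "h x = (if s x < - \<eta> then \<alpha> x * cis (c (s x)) else if \<eta> < s x then \<beta> x * cis (c (s x))
  else \<alpha> x * cis (g (s x) * u x + c (s x)))" for x
 have mid: "h x = \<alpha> x * cis (g (s x) * u x + c (s x))" if x: "x \<in> carr X" "\<bar>s x\<bar> < 4 * \<eta>" for x
 proof -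
  have "x \<in> Q" using props(1) tube x by blast
  then show ?thesis using g01[of "s x"] g1[of "s x"] Q(10)[of x] by (auto simp: h_def cis_mult)
 qed
 have negA: "x \<in> A - B" if "x \<in> carr X" "s x < 0" for x using that sB cover by force
 have posB: "x \<in> B - A" if "x \<in> carr X" "s x > 0" for x using that sA cover by force
 define U1 where "U1 = {x \<in> carr X. s x \<in> {..<- \<eta>}}"
 define U2 where "U2 = {x \<in> carr X. s x \<in> {\<eta><..}}"
 define U3 where "U3 = {x \<in> carr X. s x \<in> {- 4 * \<eta><..<4 * \<eta>}}"
 have oU: "openin (topo X) U1" "openin (topo X) U2" "openin (topo X) U3"
  unfolding U1_def U2_def U3_def by (rule openin_preimage[OF s]; simp)+
 have cov: "x \<in> U1 \<or> x \<in> U2 \<or> x \<in> U3" if "x \<in> carr X" for x using that \<eta> by (auto simp: U1_def U2_def U3_def)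
 have U1A: "U1 <= A - B" "U2 <= B - A" using negA posB \<eta> by (force simp: U1_def U2_def)+
 have U3Q: "U3 <= Q" using props(1) tube by (auto simp: U3_def abs_less_iff)
 have Usub: "U1 <= carr X" "U2 <= carr X" "U3 <= carr X" by (auto simp: U1_def U2_def U3_def)
 have h1: "h x = \<alpha> x * cis (c (s x))" if "x \<in> U1" for x using that by (simp add: h_def U1_def)
 have h2: "h x = \<beta> x * cis (c (s x))" if "x \<in> U2" for x using that \<eta> by (simp add: h_def U2_def)
 have h3: "h x = \<alpha> x * cis (g (s x) * u x + c (s x))" if "x \<in> U3" for x
  by (rule mid) (use that in \<open>auto simp: U3_def abs_less_iff\<close>)
 have s1: "sfun X U1 h"
  by (rule sfun_cong[OF X sfun_mult[OF sfun_subset[OF Q(3)] sfun_cis[OF sc]]]) (use U1A Usub h1 in auto)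
 have s2: "sfun X U2 h"
  by (rule sfun_cong[OF X sfun_mult[OF sfun_subset[OF Q(4)] sfun_cis[OF sc]]]) (use U1A Usub h2 in auto)
 have s3: "sfun X U3 h"
  by (rule sfun_cong[OF X sfun_mult[OF sfun_subset[OF \<alpha>Q] sfun_cis[OF sfun_add[OF sfun_mult[OF sg sfun_subset[OF Q(5)]] sc]]]])
   (use U3Q Usub h3 in auto)
 have "circle_submersion X h"
 proof (unfold_locales)
  show "smooth_manifold X" "mboundary X = {}" "compact_space (topo X)" by (fact X bd compact)+
  show "sfun X (carr X) h"
  proof (rule sfun_local[OF X subset_refl])
   fix p assume "p \<in> carr X"
   from cov[OF this] show "EX G. openin (topo X) G & p \<in> G & sfun X (G Int carr X) h"
    using oU s1 s2 s3 Usub by (metis inf.absorb1)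
  qed
  fix x assume x: "x \<in> carr X"
  show "cmod (h x) = 1"
   using cov[OF x] h1 h2 h3 Q(6,7) U1A U3Q by (auto simp: norm_mult)
  \<comment> \<open>In \<open>mid\<close> the slope of \<open>c\<close> wins. In \<open>l\<close>
    and \<open>r\<close> the function \<open>g\<close> is constant and \<open>transverse\<close>
    applies to \<alpha> or \<beta>. In \<open>ll\<close> and \<open>rr\<close> also \<open>c\<close>
    is constant, and \<open>h\<close> is \<open>a\<close> or a constant multiple of
    \<open>b\<close>.\<close>
  consider (mid) "\<bar>s x\<bar> \<le> \<eta>" | (l) "- 4 * \<eta> < s x" "s x < - \<eta>" | (r) "\<eta> < s x" "s x < 4 * \<eta>"
   | (ll) "s x < - 2 * \<eta>" | (rr) "s x > 2 * \<eta>" using \<eta>(1) by linarith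
  then show "regular_at X h x"
  proof cases
   case mid
   then have x3: "x \<in> U3" using x \<eta> by (auto simp: U3_def)
   obtain D1 where D1: "(smooth_step has_real_derivative D1) (at ((s x / \<eta> + 1) / 2))" using dstep by blast
   obtain D2 where D2: "(smooth_step has_real_derivative D2) (at ((s x / \<eta> + 2) / 4))" using dstep by blast
   have t: "- 1 \<le> s x / \<eta>" "s x / \<eta> \<le> 1" using mid \<eta>(1) by (auto simp: field_simps abs_le_iff)
   have D1b: "0 \<le> D1" "D1 \<le> K" using K(4)[OF D1] t by auto
   have "(q + 2) / 4 \<in> {1/4..3/4}" if "- 1 \<le> q" "q \<le> 1" for q :: real using that by simp
   from this[OF t] have "(s x / \<eta> + 2) / 4 \<in> {1/4..3/4}" .
   then have D2b: "\<kappa> \<le> D2" by (rule K(3)[OF D2])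
   have "D1 * (1 / \<eta> / 2) * M \<le> K / (2 * \<eta>) * M"
    using D1b \<eta>(1) M0 by (intro mult_right_mono) (auto simp: field_simps)
   moreover have "\<Lambda> * \<kappa> / (4 * \<eta>) \<le> \<Lambda> * (D2 * (1 / \<eta> / 4))"
    using mult_left_mono[OF D2b \<Lambda>0] \<eta>(1) by (simp add: field_simps)
   ultimately have "D1 * (1 / \<eta> / 2) * M + 2 * M * M < \<Lambda> * (D2 * (1 / \<eta> / 4))" using \<Lambda> by linarith
   moreover have "0 \<le> D1 * (1 / \<eta> / 2)" using D1b \<eta>(1) by simp
   moreover have "\<bar>g (s x)\<bar> \<le> 1" using smooth_step_range by (simp add: g_def abs_le_iff order_trans[of _ 0])
   moreover have "steep \<alpha> u M x" using props(2) tube[OF x] mid \<eta>(1) by auto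
   ultimately have "regular_at X (%y. \<alpha> y * cis (g (s y) * u y + c (s y))) x"
    using dg[OF D1] dc[OF D2] unfolding steep_def g_def[symmetric] c_def[symmetric] by blast
   then show ?thesis by (rule regular_at_cong[OF _ oU(3) x3]) (simp add: h3)
  next
   case l
   then have "x \<in> U1" "\<bar>s x\<bar> < 4 * \<eta>" using x \<eta>(1) by (auto simp: U1_def)
   obtain D2 where D2: "(smooth_step has_real_derivative D2) (at ((s x / \<eta> + 2) / 4))" using dstep by blast
   have "regular_at X (%y. \<alpha> y * cis (c (s y))) x"
    using props(3)[OF tube[OF x]] \<open>\<bar>s x\<bar> < 4 * \<eta>\<close> dc[OF D2] unfolding transverse_def c_def[symmetric] by blast
   then show ?thesis by (rule regular_at_cong[OF _ oU(1) \<open>x \<in> U1\<close>]) (simp add: h1)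
  next
   case r
   then have "x \<in> U2" "\<bar>s x\<bar> < 4 * \<eta>" using x \<eta>(1) by (auto simp: U2_def)
   obtain D2 where D2: "(smooth_step has_real_derivative D2) (at ((s x / \<eta> + 2) / 4))" using dstep by blast
   have "regular_at X (%y. \<beta> y * cis (c (s y))) x"
    using props(4)[OF tube[OF x]] \<open>\<bar>s x\<bar> < 4 * \<eta>\<close> dc[OF D2] unfolding transverse_def c_def[symmetric] by blast
   then show ?thesis by (rule regular_at_cong[OF _ oU(2) \<open>x \<in> U2\<close>]) (simp add: h2)
  next
   case ll
   let ?V = "{x \<in> carr X. s x \<in> {..<- 2 * \<eta>}}"
   have o: "openin (topo X) ?V" by (rule openin_preimage[OF s]) simp
   have "x \<in> A - B" using negA[OF x] ll \<eta>(1) by simp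
   show ?thesis
   proof (rule regular_at_cong[OF areg[OF \<open>x \<in> A - B\<close>] o])
    show "x \<in> ?V" using x ll by simp
    fix y assume y: "y \<in> ?V"
    then have "y \<in> U1" "y \<in> A" using negA[of y] \<eta>(1) by (auto simp: U1_def)
    then show "a y = h y" using h1 c0[of "s y"] y Q(8) by simp
   qed
  next
   case rr
   let ?V = "{x \<in> carr X. s x \<in> {2 * \<eta><..}}"
   have o: "openin (topo X) ?V" by (rule openin_preimage[OF s]) simp
   have "x \<in> B - A" using posB[OF x] rr \<eta>(1) by simp
   have "regular_at X (%x. b x * cis \<Lambda>) x" by (rule regular_at_mult_const[OF breg[OF \<open>x \<in> B - A\<close>]]) simp
   then show ?thesis
   proof (rule regular_at_cong[OF _ o])
    show "x \<in> ?V" using x rr by simp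
    fix y assume y: "y \<in> ?V"
    then have "y \<in> U2" "y \<in> B" using posB[of y] \<eta>(1) by (auto simp: U2_def)
    then show "b y * cis \<Lambda> = h y" using h2 c1[of "s y"] y Q(9) by simp
   qed
  qed
 qed
 then show ?thesis by (rule circle_submersion.fibers_over_circle)
qed

end

section \<open>The boundary of a surface\<close>

text \<open>\<open>t / (1 + \<bar>t\<bar>)\<close> maps the line homeomorphically onto the open unit
  interval around 0. It turns a short boundary segment into an arc parametrized by the whole
  line.\<close>

lemma squash_bound: "\<bar>t / (1 + \<bar>t\<bar>)\<bar> < (1::real)"
 by (simp add: abs_divide)

lemma inj_squash:
 fixes r s t :: real
 assumes "r > 0" "r * (t / (1 + \<bar>t\<bar>)) = r * (s / (1 + \<bar>s\<bar>))" shows "t = s"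
proof -
 have eq: "t / (1 + \<bar>t\<bar>) = s / (1 + \<bar>s\<bar>)" using assms mult_left_cancel[of r] by blast
 have n: "1 + \<bar>t\<bar> ~= 0" "1 + \<bar>s\<bar> ~= 0" by auto
 have "\<bar>t / (1 + \<bar>t\<bar>)\<bar> = \<bar>s / (1 + \<bar>s\<bar>)\<bar>" using eq by simp
 then have "\<bar>t\<bar> * (1 + \<bar>s\<bar>) = \<bar>s\<bar> * (1 + \<bar>t\<bar>)" using n by (simp add: abs_divide frac_eq_eq)
 then have "\<bar>t\<bar> = \<bar>s\<bar>" by (simp add: algebra_simps)
 then show "t = s" using eq n by simp
qed

lemma open_squash:
 assumes "open V" "r > (0::real)" shows "open ((%t. r * (t / (1 + \<bar>t\<bar>))) ` V)"
proof (rule invariance_of_domain_gen[OF assms(1)])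
 show "continuous_on V (%t. r * (t / (1 + \<bar>t\<bar>)))" by (intro continuous_intros) (auto simp: add_pos_nonneg)
 show "inj_on (%t. r * (t / (1 + \<bar>t\<bar>))) V" using inj_squash[OF assms(2)] by (rule inj_onI)
qed simp

text \<open>In a half-plane chart the boundary is the line through \<open>\<phi> y\<close> in the
  direction of the second basis vector \<open>e\<close>. A segment of it inside the chart,
  reparametrized by the whole line, is the arc.\<close>

lemma boundary_arc:
 fixes F :: "('f, real^2) manifold"
 assumes F: "smooth_manifold F" and y: "y \<in> mboundary F"
 shows "EX \<gamma>. arc_in (subtopology (topo F) (mboundary F)) \<gamma> & y \<in> range \<gamma>"
proof -
 have "y \<in> carr F" using y mboundary_subset[OF F] by auto
 then obtain U \<phi> where c: "(U, \<phi>) \<in> charts F" "y \<in> U" by (rule chart_at[OF F])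
 obtain b T where b: "b \<in> Basis" "open T" "\<phi> ` U = {x. 0 \<le> x \<bullet> b} Int T" "\<phi> y \<bullet> b = 0"
  "!!u. u \<in> U ==> u \<in> mboundary F \<longleftrightarrow> \<phi> u \<bullet> b = 0"
  by (rule boundary_chart[OF F c y]) (rule that)
 have "card (Basis - {b}) = 1" using b(1) by (simp add: card_Diff_singleton)
 then obtain e where e: "Basis - {b} = {e}" by (auto simp: card_1_singleton_iff)
 then have Bas: "Basis = {b, e}" "e \<in> Basis" "e ~= b" using b(1) by auto
 have rep: "x = (x \<bullet> b) *\<^sub>R b + (x \<bullet> e) *\<^sub>R e" for x
 proof -
  have "(\<Sum>i\<in>{b, e}. (x \<bullet> i) *\<^sub>R i) = x" by (metis Bas(1) euclidean_representation)
  then show ?thesis using Bas(3) by simp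
 qed
 have eb: "e \<bullet> b = 0" "e \<bullet> e = 1" using Bas b(1) by (auto simp: inner_Basis)
 have "\<phi> y \<in> T" using c(2) b(3) by blast
 then obtain r where r: "r > 0" "ball (\<phi> y) r <= T" using b(2) open_contains_ball by blast
 define q where "q t = r * (t / (1 + \<bar>t\<bar>))" for t :: real
 define \<gamma> where "\<gamma> t = inv_into U \<phi> (\<phi> y + q t *\<^sub>R e)" for t
 have qr: "\<bar>q t\<bar> < r" for t
 proof -
  have "\<bar>q t\<bar> = r * \<bar>t / (1 + \<bar>t\<bar>)\<bar>" using r(1) by (simp add: q_def abs_mult)
  also have "\<dots> < r * 1" using squash_bound r(1) by (rule mult_strict_left_mono)
  finally show ?thesis by simp
 qed
 have U: "\<phi> y + q t *\<^sub>R e \<in> \<phi> ` U" for t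
 proof -
  have "norm e = 1" using Bas by (auto intro: norm_Basis)
  then have "\<phi> y + q t *\<^sub>R e \<in> T" using qr[of t] by (intro subsetD[OF r(2)]) (simp add: dist_norm)
  then show ?thesis unfolding b(3) using b(4) eb by (simp add: inner_add_left)
 qed
 have \<gamma>: "\<gamma> t \<in> U" "\<phi> (\<gamma> t) = \<phi> y + q t *\<^sub>R e" for t
  using U[of t] by (auto simp: \<gamma>_def inv_into_into f_inv_into_f)
 have \<gamma>b: "\<gamma> t \<in> mboundary F" for t using b(4,5) \<gamma> eb by (simp add: inner_add_left)
 let ?C = "subtopology (topo F) (mboundary F)"
 have cont: "continuous_map euclideanreal ?C \<gamma>"
 proof -
  have "continuous_on UNIV q" unfolding q_def by (intro continuous_intros) (auto simp: add_pos_nonneg)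
  then have "continuous_on UNIV (%t. \<phi> y + q t *\<^sub>R e)" by (intro continuous_intros)
  then have "continuous_map euclideanreal (top_of_set (\<phi> ` U)) (%t. \<phi> y + q t *\<^sub>R e)"
   using U by (auto simp: continuous_map_in_subtopology)
  from continuous_map_compose[OF this chart_inv_continuous_carr[OF F c(1)]]
  have "continuous_map euclideanreal (topo F) \<gamma>" by (simp add: o_def \<gamma>_def[abs_def])
  then show ?thesis using \<gamma>b by (auto simp: continuous_map_in_subtopology)
 qed
 have inj: "inj \<gamma>"
 proof (rule injI)
  fix t s assume "\<gamma> t = \<gamma> s"
  then have "\<phi> y + q t *\<^sub>R e = \<phi> y + q s *\<^sub>R e" by (simp only: \<gamma>(2)[symmetric])
  then have "q t *\<^sub>R e = q s *\<^sub>R e" by (simp only: add_left_cancel)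
  then have "(q t *\<^sub>R e) \<bullet> e = (q s *\<^sub>R e) \<bullet> e" by (simp only:)
  then have "q t = q s" using eb(2) by simp
  then show "t = s" unfolding q_def by (rule inj_squash[OF r(1)])
 qed
 have op: "openin ?C (\<gamma> ` V)" if V: "open V" for V
 proof -
  have oq: "open (q ` V)" using open_squash[OF V r(1)] by (simp only: q_def[abs_def])
  define O' where "O' = {x. (x - \<phi> y) \<bullet> e \<in> q ` V}"
  have "continuous_on UNIV (%x. (x - \<phi> y) \<bullet> e)"
   by (rule continuous_on_inner[OF continuous_on_diff[OF continuous_on_id continuous_on_const] continuous_on_const])
  from open_vimage[OF oq this] have "open O'" by (simp add: O'_def vimage_def)
  then have oG: "openin (topo F) {u \<in> U. \<phi> u \<in> O'}"
   by (intro smooth_map_openin_preimage[OF chart_smooth[OF F c(1)]]) (use chart_open[OF F c(1)] in auto)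
  have "\<gamma> ` V = {u \<in> U. \<phi> u \<in> O'} Int mboundary F"
  proof (intro equalityI subsetI)
   fix u assume "u \<in> \<gamma> ` V"
   then show "u \<in> {u \<in> U. \<phi> u \<in> O'} Int mboundary F" using \<gamma> \<gamma>b eb by (auto simp: O'_def)
  next
   fix u assume u: "u \<in> {u \<in> U. \<phi> u \<in> O'} Int mboundary F"
   then obtain t where t: "t \<in> V" "(\<phi> u - \<phi> y) \<bullet> e = q t" by (auto simp: O'_def)
   have "\<phi> u - \<phi> y = q t *\<^sub>R e"
   proof -
    have c: "(\<phi> u - \<phi> y) \<bullet> b = 0" using b(4) b(5)[of u] u by (simp add: inner_diff_left)
    show ?thesis using rep[of "\<phi> u - \<phi> y"] unfolding t(2) c scaleR_zero_left add_0_left .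
   qed
   then have "\<phi> u = \<phi> (\<gamma> t)" using \<gamma>(2)[of t] by (simp add: algebra_simps)
   then have "u = \<gamma> t" using chart_inj[OF F c(1)] u \<gamma>(1) by (auto dest: inj_onD)
   then show "u \<in> \<gamma> ` V" using t(1) by simp
  qed
  then show ?thesis using oG by (auto simp: openin_subtopology)
 qed
 have "\<gamma> 0 = y" using chart_inj[OF F c(1)] c(2) by (simp add: \<gamma>_def q_def)
 then have "y \<in> range \<gamma>" by (metis rangeI)
 moreover have "arc_in ?C \<gamma>" unfolding arc_in_def open_map_def using cont inj op by simp
 ultimately show ?thesis by blast
qed

section \<open>Characters of the torus\<close>

lemma torus_facts: "smooth_manifold torus" "mboundary torus = {}"
 "topo torus = prod_topology (top_of_set (sphere 0 1)) (top_of_set (sphere 0 1))"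
 "carr torus = sphere 0 1 \<times> sphere 0 1"
 by (simp_all add: torus_def smooth_manifold_prod mboundary_prod smooth_manifold_circle mboundary_circle)

text \<open>Negative powers on the unit circle are powers of the conjugate, so smoothness of
  integral powers reduces to products.\<close>

lemma powi_unit:
 assumes "cmod z = 1" shows "z powi n = (if n \<ge> 0 then z ^ nat n else cnj z ^ nat (- n))"
proof (cases "n \<ge> 0")
 case False
 have "inverse z = cnj z" using unit_mult_cnj[OF assms] by (simp add: inverse_unique)
 then show ?thesis using False by (simp add: power_int_def)
qed (simp add: power_int_def)

lemma sfun_power:
 fixes f :: "'a => complex"
 assumes "sfun M S f" shows "sfun M S (%x. f x ^ n)"
 by (induction n) (auto intro!: sfun_const sfun_mult assms)

lemma sfun_powi:
 assumes M: "smooth_manifold M" and f: "sfun M S f" "!!x. x \<in> S ==> cmod (f x) = 1"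
 shows "sfun M S (%x. f x powi n)"
proof (cases "n \<ge> 0")
 case True
 show ?thesis by (rule sfun_cong[OF M sfun_power[OF f(1), of "nat n"]]) (use True f(2) powi_unit in simp)
next
 case False
 show ?thesis by (rule sfun_cong[OF M sfun_power[OF sfun_linear[OF bounded_linear_cnj f(1)], of "nat (- n)"]])
  (use False f(2) powi_unit in simp)
qed

lemma continuous_on_powi: "continuous_on (sphere 0 1) (%z::complex. z powi n)"
 by (auto intro!: continuous_intros)

definition character :: "int => int => complex \<times> complex => complex" where
 "character m n z = fst z powi m * snd z powi n"

lemma cmod_character: "z \<in> carr torus ==> cmod (character m n z) = 1"
 by (auto simp: torus_facts character_def norm_mult norm_power_int)

lemma continuous_character: "continuous_map (topo torus) euclidean (character m n)"
proof -
 have "continuous_on (sphere 0 1 \<times> sphere 0 1) (character m n)"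
  unfolding character_def by (auto intro!: continuous_intros)
 then have "continuous_map (top_of_set (sphere 0 1 \<times> sphere 0 1)) euclidean (character m n)" by simp
 also have "top_of_set (sphere 0 1 \<times> sphere 0 1) = topo torus"
  by (simp add: torus_facts(3))
 finally show ?thesis .
qed

lemma sfun_character:
 assumes M: "smooth_manifold M" and S: "S <= carr M" and f: "smooth_map M S torus (carr torus) f"
 shows "sfun M S (%x. character m n (f x))"
proof -
 have 1: "smooth_map torus (carr torus) circle (sphere 0 1) fst" "smooth_map torus (carr torus) circle (sphere 0 1) snd"
  unfolding torus_facts(4) unfolding torus_def
  by (rule smooth_map_fst[OF smooth_manifold_circle smooth_manifold_circle mboundary_circle]
    smooth_map_snd[OF smooth_manifold_circle smooth_manifold_circle mboundary_circle])+
 have 2: "smooth_map M S circle (sphere 0 1) (%x. fst (f x))" "smooth_map M S circle (sphere 0 1) (%x. snd (f x))"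
  by (rule smooth_map_compose[OF M torus_facts(1) f 1(1)], rule smooth_map_compose[OF M torus_facts(1) f 1(2)])
 have "sfun M S (%x. fst (f x)) & (%x. fst (f x)) ` S <= sphere 0 1 Int sphere 0 1"
  using smooth_map_circle[OF M S, THEN iffD1, OF 2(1)] .
 moreover have "sfun M S (%x. snd (f x)) & (%x. snd (f x)) ` S <= sphere 0 1 Int sphere 0 1"
  using smooth_map_circle[OF M S, THEN iffD1, OF 2(2)] .
 ultimately show ?thesis unfolding character_def
  by (intro sfun_mult sfun_powi[OF M]) (auto simp: image_subset_iff)
qed

text \<open>The curve moves in the direction \<open>(m, n)\<close>, the gradient of the angle of the
  character, so the angle grows at the rate \<open>m^2 + n^2\<close>, which is nonzero for a
  nontrivial character.\<close>

lemma character_curve: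
 "character m n (fst z * cis (of_int m * t), snd z * cis (of_int n * t)) = character m n z * cis ((of_int m ^ 2 + of_int n ^ 2) * t)"
proof -
 have "cis ((of_int m ^ 2 + of_int n ^ 2) * t) = cis (of_int m * (of_int m * t)) * cis (of_int n * (of_int n * t))"
  unfolding cis_mult by (simp add: power2_eq_square algebra_simps)
 then show ?thesis by (simp add: character_def power_int_mult_distrib cis_power_int mult_ac)
qed

section \<open>Bundles over the torus with fiber a surface\<close>

locale sigma_bundle =
 fixes g :: nat and W :: "('w, real^4) manifold" and F :: "('f, real^2) manifold" and \<pi>
 assumes sigma: "Sigma_1_bundle_over_torus g W F \<pi>"
begin

abbreviation "C \<equiv> subtopology (topo F) (mboundary F)"
abbreviation "P \<equiv> prod_manifold torus F"

lemma basics: "smooth_manifold W" "smooth_manifold F" "compact_space (topo W)" "compact_space (topo F)"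
 "mboundary F ~= {}" "connectedin (topo F) (mboundary F)" "smooth_map W (carr W) torus (carr torus) \<pi>"
 using sigma by (auto simp: Sigma_1_bundle_over_torus_def is_Sigma_1_def fiber_bundle_def)

lemma P: "smooth_manifold P" "mboundary P = carr torus \<times> mboundary F" "carr P = carr torus \<times> carr F"
 "topo P = prod_topology (topo torus) (topo F)"
 using smooth_manifold_prod[OF torus_facts(1) basics(2) torus_facts(2)] mboundary_prod[OF torus_facts(1,2)] by auto

lemma C: "compact_space C" "Hausdorff_space C" "connected_space C" "topspace C = mboundary F"
proof -
 show "compact_space C"
  using closedin_compact_space[OF basics(4) closedin_mboundary[OF basics(2)]] by (metis compactin_subspace)
 show "Hausdorff_space C" using basics(2) by (simp add: smooth_manifold_def Hausdorff_space_subtopology)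
 show "connected_space C" using basics(6) by (simp add: connectedin_def)
 show "topspace C = mboundary F" using mboundary_subset[OF basics(2)] by auto
qed

lemma trivializations:
 obtains \<T> where "!!U \<Phi>. (U, \<Phi>) \<in> \<T> ==> local_trivialization W torus F \<pi> U \<Phi>"
  "!!z. z \<in> carr torus ==> EX U \<Phi>. (U, \<Phi>) \<in> \<T> & z \<in> U"
  "!!U \<Phi> V \<Psi> e. (U, \<Phi>) \<in> \<T> ==> (V, \<Psi>) \<in> \<T> ==> e \<in> carr W ==> \<pi> e \<in> U Int V ==> snd (\<Psi> e) \<in> mboundary F ==>
   snd (\<Phi> e) = snd (\<Psi> e)"
proof -
 have "EX \<T>. (ALL (U, \<Phi>):\<T>. local_trivialization W torus F \<pi> U \<Phi>) &
     (\<Union>(U, \<Phi>)\<in>\<T>. U) = carr torus &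
     (ALL (U, \<Phi>):\<T>. ALL (V, \<Psi>):\<T>. ALL x:U Int V. EX h:Diff_rel_boundary F.
      ALL e:carr W. \<pi> e = x --> snd (\<Phi> e) = h (snd (\<Psi> e)))"
  using sigma by (simp add: Sigma_1_bundle_over_torus_def fiber_bundle_def)
 then obtain \<T> where T: "ALL (U, \<Phi>):\<T>. local_trivialization W torus F \<pi> U \<Phi>" "(\<Union>(U, \<Phi>)\<in>\<T>. U) = carr torus"
  "ALL (U, \<Phi>):\<T>. ALL (V, \<Psi>):\<T>. ALL x:U Int V. EX h:Diff_rel_boundary F.
      ALL e:carr W. \<pi> e = x --> snd (\<Phi> e) = h (snd (\<Psi> e))"
  by (elim exE conjE) (rule that)
 show ?thesis
 proof (rule that[of \<T>])
  fix U \<Phi> assume "(U, \<Phi>) \<in> \<T>" then show "local_trivialization W torus F \<pi> U \<Phi>" using T(1) by auto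
 next
  fix z assume "z \<in> carr torus"
  then have "z \<in> (\<Union>(U, \<Phi>)\<in>\<T>. U)" unfolding T(2) .
  then show "EX U \<Phi>. (U, \<Phi>) \<in> \<T> & z \<in> U" by auto
 next
  fix U \<Phi> V \<Psi> e assume a: "(U, \<Phi>) \<in> \<T>" "(V, \<Psi>) \<in> \<T>" "e \<in> carr W" "\<pi> e \<in> U Int V" "snd (\<Psi> e) \<in> mboundary F"
  have "ALL (V, \<Psi>):\<T>. ALL x:U Int V. EX h:Diff_rel_boundary F. ALL e:carr W. \<pi> e = x --> snd (\<Phi> e) = h (snd (\<Psi> e))"
   using bspec[OF T(3) a(1)] by (simp only: prod.case)
  from bspec[OF this a(2)]
  have "ALL x:U Int V. EX h:Diff_rel_boundary F. ALL e:carr W. \<pi> e = x --> snd (\<Phi> e) = h (snd (\<Psi> e))"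
   by (simp only: prod.case)
  from bspec[OF this a(4)]
  have "EX h:Diff_rel_boundary F. ALL e':carr W. \<pi> e' = \<pi> e --> snd (\<Phi> e') = h (snd (\<Psi> e'))" .
  then obtain h where h: "h \<in> Diff_rel_boundary F" "ALL e':carr W. \<pi> e' = \<pi> e --> snd (\<Phi> e') = h (snd (\<Psi> e'))" by blast
  have "snd (\<Phi> e) = h (snd (\<Psi> e))" using h(2) a(3) by simp
  then show "snd (\<Phi> e) = snd (\<Psi> e)" using h(1) a(5) by (simp add: Diff_rel_boundary_def)
 qed
qed

section \<open>Trivializations and the boundary of the total space\<close>

abbreviation "over U \<equiv> {e \<in> carr W. \<pi> e \<in> U}"

lemma trivializationD:
 assumes "local_trivialization W torus F \<pi> U \<Phi>"
 shows "openin (topo torus) U" "diffeo W (over U) P (U \<times> carr F) \<Phi>" "e \<in> over U ==> fst (\<Phi> e) = \<pi> e"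
  "openin (topo W) (over U)" "openin (topo P) (U \<times> carr F)"
proof -
 show o: "openin (topo torus) U" and "diffeo W (over U) P (U \<times> carr F) \<Phi>" and "e \<in> over U ==> fst (\<Phi> e) = \<pi> e"
  using assms by (auto simp: local_trivialization_def)
 show "openin (topo W) (over U)" by (rule smooth_map_openin_preimage[OF basics(7) o openin_topspace])
 show "openin (topo P) (U \<times> carr F)" using o unfolding P(4) by (simp add: openin_prod_Times_iff)
qed

text \<open>A trivialization and its inverse are continuous and injective on open sets of manifolds
  of equal dimension, so neither moves an interior point to the boundary.\<close>

lemma trivialization_boundary:
 assumes t: "local_trivialization W torus F \<pi> U \<Phi>" and e: "e \<in> over U"
 shows "e \<in> mboundary W \<longleftrightarrow> snd (\<Phi> e) \<in> mboundary F"
proof -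
 note T = trivializationD[OF t] and d = diffeoD[OF trivializationD(2)[OF t]]
 have 1: "continuous_map (subtopology (topo W) (over U)) (topo P) \<Phi>"
  using smooth_map_continuous[OF d(2)] by (simp add: continuous_map_in_subtopology)
 have 2: "continuous_map (subtopology (topo P) (U \<times> carr F)) (topo W) (inv_into (over U) \<Phi>)"
  using smooth_map_continuous[OF d(3)] by (simp add: continuous_map_in_subtopology)
 have inj: "inj_on \<Phi> (over U)" "inj_on (inv_into (over U) \<Phi>) (U \<times> carr F)"
  using d(1) by (auto simp: bij_betw_def intro: inj_on_inv_into)
 have U: "U <= carr torus" using openin_subset[OF T(1)] .
 have dim: "DIM(real^4) = DIM((real \<times> real) \<times> (real^2))" by simp
 have Pe: "\<Phi> e \<in> U \<times> carr F" using d(4)[OF e] .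
 have iff: "e \<in> mboundary W \<longleftrightarrow> \<Phi> e \<in> mboundary P"
 proof
  assume "e \<in> mboundary W"
  then show "\<Phi> e \<in> mboundary P"
   using not_mboundary_image[OF P(1) basics(1) dim[symmetric] T(5) 2 inj(2) Pe] d(6)[OF e] by auto
 next
  assume "\<Phi> e \<in> mboundary P"
  then show "e \<in> mboundary W"
   using not_mboundary_image[OF basics(1) P(1) dim T(4) 1 inj(1) e] by auto
 qed
 show ?thesis unfolding iff P(2) using Pe U by (cases "\<Phi> e") auto
qed

text \<open>The trivializations agree over the boundary, since the structure group fixes \<open>mboundary F\<close>.\<close>

lemma boundary_parametrization:
 obtains K where "continuous_map (prod_topology (topo torus) C) (subtopology (topo W) (mboundary W)) K"
  "K ` (carr torus \<times> mboundary F) = mboundary W" "inj_on K (carr torus \<times> mboundary F)"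
  "!!z y. z \<in> carr torus ==> y \<in> mboundary F ==> \<pi> (K (z, y)) = z"
proof -
 obtain \<T> where T: "!!U \<Phi>. (U, \<Phi>) \<in> \<T> ==> local_trivialization W torus F \<pi> U \<Phi>"
  "!!z. z \<in> carr torus ==> EX U \<Phi>. (U, \<Phi>) \<in> \<T> & z \<in> U"
  "!!U \<Phi> V \<Psi> e. (U, \<Phi>) \<in> \<T> ==> (V, \<Psi>) \<in> \<T> ==> e \<in> carr W ==> \<pi> e \<in> U Int V ==> snd (\<Psi> e) \<in> mboundary F ==>
   snd (\<Phi> e) = snd (\<Psi> e)"
  by (rule trivializations) (rule that)
 have "ALL z:carr torus. EX t. t \<in> \<T> & z \<in> fst t" using T(2) by fastforce
 from bchoice[OF this] obtain t where t: "ALL z:carr torus. t z \<in> \<T> & z \<in> fst (t z)" ..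
 define K where "K p = inv_into (over (fst (t (fst p)))) (snd (t (fst p))) p" for p
 have bF: "mboundary F <= carr F" by (rule mboundary_subset[OF basics(2)])
 have inv: "inv_into (over U) \<Phi> (z, y) \<in> over U" "\<Phi> (inv_into (over U) \<Phi> (z, y)) = (z, y)"
  "\<pi> (inv_into (over U) \<Phi> (z, y)) = z" "inv_into (over U) \<Phi> (z, y) \<in> mboundary W"
  if "(U, \<Phi>) \<in> \<T>" "z \<in> U" "y \<in> mboundary F" for U \<Phi> z y
 proof -
  note Tr = trivializationD[OF T(1)[OF that(1)]]
  have zy: "(z, y) \<in> U \<times> carr F" using that bF by auto
  show 1: "inv_into (over U) \<Phi> (z, y) \<in> over U" "\<Phi> (inv_into (over U) \<Phi> (z, y)) = (z, y)"
   using diffeoD(5,7)[OF Tr(2)] zy by blast+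
  show "\<pi> (inv_into (over U) \<Phi> (z, y)) = z" using Tr(3)[OF 1(1)] 1(2) by simp
  show "inv_into (over U) \<Phi> (z, y) \<in> mboundary W"
   using trivialization_boundary[OF T(1)[OF that(1)] 1(1)] 1(2) that(3) by simp
 qed
 have K: "K (z, y) = inv_into (over U) \<Phi> (z, y)" if a: "(U, \<Phi>) \<in> \<T>" "z \<in> U" "z \<in> carr torus" "y \<in> mboundary F" for U \<Phi> z y
 proof -
  obtain V \<Psi> where tz: "t z = (V, \<Psi>)" by (cases "t z")
  then have V: "(V, \<Psi>) \<in> \<T>" "z \<in> V" using t a(3) by force+
  let ?e = "inv_into (over V) \<Psi> (z, y)"
  note e = inv[OF V a(4)]
  have eU: "?e \<in> over U" using e(1,3) a(2) by auto
  have "snd (\<Phi> ?e) = y" using T(3)[OF a(1) V(1), of ?e] e a(2,4) V(2) by auto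
  moreover have "fst (\<Phi> ?e) = z" using trivializationD(3)[OF T(1)[OF a(1)] eU] e(3) by simp
  ultimately have "\<Phi> ?e = (z, y)" by (metis prod.collapse)
  then have "inv_into (over U) \<Phi> (z, y) = ?e"
   using diffeoD(6)[OF trivializationD(2)[OF T(1)[OF a(1)]] eU] by simp
  then show ?thesis by (simp add: K_def tz)
 qed
 have K': "\<pi> (K (z, y)) = z" "K (z, y) \<in> mboundary W" if zy: "z \<in> carr torus" "y \<in> mboundary F" for z y
 proof -
  obtain U \<Phi> where U: "(U, \<Phi>) \<in> \<T>" "z \<in> U" using T(2)[OF zy(1)] by blast
  show "\<pi> (K (z, y)) = z" "K (z, y) \<in> mboundary W" using inv(3,4)[OF U zy(2)] K[OF U zy] by simp_all
 qed
 let ?Y = "prod_topology (topo torus) C"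
 have tY: "topspace ?Y = carr torus \<times> mboundary F" using C(4) by simp
 have "continuous_map (subtopology ?Y (carr torus \<times> mboundary F)) (topo W) K"
 proof (rule continuous_map_locally)
  fix p assume p: "p \<in> carr torus \<times> mboundary F"
  obtain U \<Phi> where U: "(U, \<Phi>) \<in> \<T>" "fst p \<in> U" using T(2) p by force
  note Tr = trivializationD[OF T(1)[OF U(1)]]
  have Us: "U <= carr torus" using openin_subset[OF Tr(1)] .
  have "openin ?Y (U \<times> mboundary F)" using Tr(1) openin_topspace[of C] C(4) by (simp add: openin_prod_Times_iff)
  moreover have "p \<in> U \<times> mboundary F" using p U(2) by (cases p) auto
  moreover have "continuous_map (subtopology ?Y ((U \<times> mboundary F) Int (carr torus \<times> mboundary F))) (topo W) K"
  proof -
   have Y: "?Y = subtopology (topo P) (carr torus \<times> mboundary F)"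
    unfolding P(4) by (simp add: subtopology_Times)
   have s: "subtopology ?Y ((U \<times> mboundary F) Int (carr torus \<times> mboundary F)) = subtopology (topo P) (U \<times> mboundary F)"
    unfolding Y subtopology_subtopology using Us by (intro arg_cong[of _ _ "subtopology (topo P)"]) auto
   have "continuous_map (subtopology (topo P) (U \<times> carr F)) (topo W) (inv_into (over U) \<Phi>)"
    using smooth_map_continuous[OF diffeoD(3)[OF Tr(2)]] by (simp add: continuous_map_in_subtopology)
   then have "continuous_map (subtopology (topo P) (U \<times> mboundary F)) (topo W) (inv_into (over U) \<Phi>)"
    by (rule continuous_map_from_subtopology_mono) (use bF in auto)
   then have "continuous_map (subtopology (topo P) (U \<times> mboundary F)) (topo W) K"
    by (rule continuous_map_eq) (use K[OF U(1)] Us in auto)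
   then show ?thesis unfolding s .
  qed
  ultimately show "EX G. openin ?Y G & p \<in> G & continuous_map (subtopology ?Y (G Int (carr torus \<times> mboundary F))) (topo W) K"
   by blast
 qed (use tY in blast)
 then have cK: "continuous_map ?Y (topo W) K" using tY by (metis subtopology_topspace)
 show ?thesis
 proof (rule that[of K])
  show "continuous_map ?Y (subtopology (topo W) (mboundary W)) K"
   using cK K'(2) tY by (auto simp: continuous_map_in_subtopology)
  show "K ` (carr torus \<times> mboundary F) = mboundary W"
  proof (intro equalityI subsetI)
   fix e assume e: "e \<in> mboundary W"
   then have eW: "e \<in> carr W" using mboundary_subset[OF basics(1)] by auto
   then have z: "\<pi> e \<in> carr torus" using smooth_map_in[OF basics(7)] by auto
   obtain U \<Phi> where U: "(U, \<Phi>) \<in> \<T>" "\<pi> e \<in> U" using T(2)[OF z] by blast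
   have eU: "e \<in> over U" using eW U(2) by simp
   have y: "snd (\<Phi> e) \<in> mboundary F" using trivialization_boundary[OF T(1)[OF U(1)] eU] e by simp
   have "\<Phi> e = (\<pi> e, snd (\<Phi> e))" using trivializationD(3)[OF T(1)[OF U(1)] eU] by (metis prod.collapse)
   then have "K (\<pi> e, snd (\<Phi> e)) = e"
    using K[OF U z y] diffeoD(6)[OF trivializationD(2)[OF T(1)[OF U(1)]] eU] by simp
   then show "e \<in> K ` (carr torus \<times> mboundary F)" using z y by force
  qed (use K'(2) in auto)
  show "inj_on K (carr torus \<times> mboundary F)"
  proof (rule inj_onI)
   fix p p' assume p: "p \<in> carr torus \<times> mboundary F" "p' \<in> carr torus \<times> mboundary F" "K p = K p'"
   obtain z y z' y' where zy: "p = (z, y)" "p' = (z', y')" by (cases p, cases p')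
   have in': "z \<in> carr torus" "y \<in> mboundary F" "z' \<in> carr torus" "y' \<in> mboundary F"
    using p(1,2) unfolding zy by blast+
   have KE: "K (z, y) = K (z', y')" using p(3) unfolding zy .
   then have "z' = z" using K'(1)[OF in'(1,2)] K'(1)[OF in'(3,4)] by simp
   obtain U \<Phi> where U: "(U, \<Phi>) \<in> \<T>" "z \<in> U" using T(2)[OF in'(1)] by blast
   have "inv_into (over U) \<Phi> (z, y) = inv_into (over U) \<Phi> (z, y')"
    using KE unfolding \<open>z' = z\<close> K[OF U in'(1,2)] K[OF U in'(1,4)] .
   then have "\<Phi> (inv_into (over U) \<Phi> (z, y)) = \<Phi> (inv_into (over U) \<Phi> (z, y'))" by (rule arg_cong)
   then have "(z, y) = (z, y')" unfolding inv(2)[OF U in'(2)] inv(2)[OF U in'(4)] .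
   then show "p = p'" unfolding zy \<open>z' = z\<close> .
  qed
 qed (use K' in auto)
qed

text \<open>The curve of \<open>character_curve\<close> is lifted in a local trivialization with the
  fiber coordinate kept constant. It therefore stays in the boundary if it starts there, and this is
  why a nontrivial character has no critical points on the boundary either.\<close>

lemma character_regular:
 assumes e: "e \<in> carr W" and mn: "m ~= 0 \<or> n ~= 0"
 shows "EX \<gamma> D. smooth_map eu {-1<..<1::real} W (if e \<in> mboundary W then mboundary W else carr W) \<gamma> & \<gamma> 0 = e &
  ((%t. character m n (\<pi> (\<gamma> t))) has_vector_derivative D) (at 0) & D ~= 0"
proof -
 have z: "\<pi> e \<in> carr torus" using smooth_map_in[OF basics(7)] e by auto
 obtain \<T> where "!!U \<Phi>. (U, \<Phi>) \<in> \<T> ==> local_trivialization W torus F \<pi> U \<Phi>"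
  "!!z. z \<in> carr torus ==> EX U \<Phi>. (U, \<Phi>) \<in> \<T> & z \<in> U"
  by (rule trivializations) (rule that)
 then obtain U \<Phi> where U: "local_trivialization W torus F \<pi> U \<Phi>" "\<pi> e \<in> U" using z by blast
 note Tr = trivializationD[OF U(1)] and d = diffeoD[OF trivializationD(2)[OF U(1)]]
 define z1 where "z1 = fst (\<pi> e)" define z2 where "z2 = snd (\<pi> e)"
 have z12: "cmod z1 = 1" "cmod z2 = 1" "\<pi> e = (z1, z2)" using z by (auto simp: torus_facts z1_def z2_def)
 define \<delta> where "\<delta> t = (z1 * cis (of_int m * t), z2 * cis (of_int n * t))" for t :: real
 have "smooth_map eu UNIV circle (sphere 0 1) (%t. z * cis (of_int k * t))" if "cmod z = 1" for z k
 proof (rule smooth_map_circle[OF smooth_manifold_eu, THEN iffD2])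
  show "sfun eu UNIV (%t. z * cis (of_int k * t)) & (%t. z * cis (of_int k * t)) ` UNIV <= sphere 0 1 Int sphere 0 1"
   unfolding sfun_eu using that
   by (auto simp: norm_mult intro!: smooth_on_mult smooth_on_const smooth_on_cis smooth_on_ident)
 qed simp
 from smooth_map_Pair[OF smooth_manifold_eu this[OF z12(1)] this[OF z12(2)]]
 have \<delta>: "smooth_map eu UNIV torus (carr torus) \<delta>" by (simp add: \<delta>_def[abs_def] torus_facts(4) flip: torus_def)
 obtain r where r: "r > 0" "ball 0 r <= UNIV" "!!t. t \<in> ball 0 r ==> \<delta> t \<in> U"
  by (rule smooth_map_eu_ball[OF \<delta> open_UNIV UNIV_I Tr(1), of 0]) (use U(2) z12(3) in \<open>auto simp: \<delta>_def\<close>)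
 have rU: "\<delta> (r * t) \<in> U" if "t \<in> {-1<..<1}" for t
 proof (rule r(3))
  have "r * \<bar>t\<bar> < r * 1" using that r(1) by (intro mult_strict_left_mono) (auto simp: abs_less_iff)
  then show "r * t \<in> ball 0 r" using r(1) by (simp add: abs_mult)
 qed
 define y where "y = snd (\<Phi> e)"
 have eU: "e \<in> over U" using e U(2) by simp
 have \<Phi>e: "\<Phi> e = (\<pi> e, y)" using Tr(3)[OF eU] by (metis y_def prod.collapse)
 have y: "y \<in> carr F" using d(4)[OF eU] \<Phi>e by auto
 define \<gamma> where "\<gamma> t = inv_into (over U) \<Phi> (\<delta> (r * t), y)" for t
 have \<gamma>: "\<gamma> t \<in> over U" "\<Phi> (\<gamma> t) = (\<delta> (r * t), y)" "\<pi> (\<gamma> t) = \<delta> (r * t)" if "t \<in> {-1<..<1}" for t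
 proof -
  have *: "(\<delta> (r * t), y) \<in> U \<times> carr F" using rU[OF that] y by simp
  show 1: "\<gamma> t \<in> over U" "\<Phi> (\<gamma> t) = (\<delta> (r * t), y)" using d(5,7)[OF *] by (auto simp: \<gamma>_def)
  show "\<pi> (\<gamma> t) = \<delta> (r * t)" using Tr(3)[OF 1(1)] 1(2) by simp
 qed
 have "smooth_map eu {-1<..<1} eu UNIV (%t::real. r * t)"
  unfolding smooth_map_eu by (auto intro!: smooth_on_mult smooth_on_const smooth_on_ident)
 from smooth_map_compose[OF smooth_manifold_eu smooth_manifold_eu this \<delta>]
 have "smooth_map eu {-1<..<1} torus U (%t. \<delta> (r * t))"
  by (rule smooth_map_subset[OF _ subset_refl]) (rule rU)
 moreover have "smooth_map eu {-1<..<1::real} F (carr F) (%t. y)"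
  using y by (intro smooth_mapI) (auto simp: continuous_map_in_subtopology o_def intro: smooth_on_const)
 ultimately have "smooth_map eu {-1<..<1} P (U \<times> carr F) (%t. (\<delta> (r * t), y))"
  by (rule smooth_map_Pair[OF smooth_manifold_eu])
 from smooth_map_compose[OF smooth_manifold_eu P(1) this d(3)]
 have s: "smooth_map eu {-1<..<1} W (over U) \<gamma>" by (simp add: \<gamma>_def[abs_def])
 have bd: "\<gamma> t \<in> mboundary W \<longleftrightarrow> e \<in> mboundary W" if "t \<in> {-1<..<1}" for t
  using trivialization_boundary[OF U(1) eU] trivialization_boundary[OF U(1) \<gamma>(1)[OF that]] \<gamma>(2)[OF that] \<Phi>e by simp
 have 1: "smooth_map eu {-1<..<1} W (if e \<in> mboundary W then mboundary W else carr W) \<gamma>"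
  by (rule smooth_map_subset[OF s subset_refl]) (use bd \<gamma>(1) in auto)
 have 2: "\<gamma> 0 = e" using d(6)[OF eU] \<Phi>e z12(3) by (simp add: \<gamma>_def \<delta>_def)
 define N where "N = (of_int m ^ 2 + of_int n ^ 2 :: real)"
 have N: "N ~= 0" using mn by (simp add: N_def sum_power2_eq_zero_iff)
 have ch: "character m n (\<delta> s) = character m n (z1, z2) * cis (N * s)" for s
  using character_curve[of m n "(z1, z2)" s] by (simp add: \<delta>_def N_def)
 have "((%t. cis (N * (r * t))) has_vector_derivative (N * r) *\<^sub>R (\<i> * cis (N * (r * 0)))) (at 0)"
 proof -
  have "((%t. N * (r * t)) has_vector_derivative N * r) (at 0)"
   unfolding has_real_derivative_iff_has_vector_derivative[symmetric] by (auto intro!: derivative_eq_intros)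
  from vector_diff_chain_at[OF this has_vector_derivative_cis] show ?thesis by (simp add: o_def)
 qed
 from has_vector_derivative_mult_right[OF this, of "character m n (z1, z2)"]
 have "((%t. character m n (\<delta> (r * t))) has_vector_derivative character m n (z1, z2) * ((N * r) *\<^sub>R \<i>)) (at 0)"
  by (simp add: ch)
 then have 3: "((%t. character m n (\<pi> (\<gamma> t))) has_vector_derivative character m n (z1, z2) * ((N * r) *\<^sub>R \<i>)) (at 0)"
  by (rule has_vector_derivative_transform_within_open[of _ _ _ "{-1<..<1}"]) (use \<gamma>(3) in auto)
 have "character m n (z1, z2) ~= 0" using cmod_character[OF z, of m n] z12(3) by auto
 then have "character m n (z1, z2) * ((N * r) *\<^sub>R \<i>) ~= 0" using N r(1) by simp
 with 1 2 3 show ?thesis by blast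
qed

end

section \<open>Matching the circle-valued maps on the boundary\<close>

lemma lifts_compose:
 assumes "lifts Y k" "continuous_map Y' Y q" "!!x. x \<in> topspace Y' ==> k' x = k (q x)"
 shows "lifts Y' k'"
proof -
 obtain u where u: "continuous_map Y euclideanreal u" "!!y. y \<in> topspace Y ==> k y = cis (u y)"
  using assms(1) by (auto simp: lifts_def)
 have "q x \<in> topspace Y" if "x \<in> topspace Y'" for x
  using continuous_map_image_subset_topspace[OF assms(2)] that by auto
 then show ?thesis unfolding lifts_def
  using continuous_map_compose[OF assms(2) u(1)] u(2) assms(3) by (intro exI[of _ "%x. u (q x)"]) (auto simp: o_def)
qed

text \<open>\<open>lifts_circle_times\<close> is applied to one circle factor after the other: first
  over \<open>C\<close>, which yields \<open>n\<close>, then over the product of a circle and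
  \<open>C\<close>, which is again compact, Hausdorff and connected, and this yields
  \<open>m\<close>.\<close>

lemma lifts_torus_times:
 fixes C :: "'c topology" and k :: "(complex \<times> complex) \<times> 'c => complex"
 defines "Y \<equiv> prod_topology (topo torus) C"
 assumes C: "compact_space C" "Hausdorff_space C" "connected_space C"
  and k: "continuous_map Y euclidean k" "!!p. p \<in> topspace Y ==> cmod (k p) = 1"
  and l: "lifts C (%y. k ((1, 1), y))"
 shows "EX m n. lifts Y (%p. k p * character m n (fst p))"
proof -
 let ?S = "top_of_set (sphere (0::complex) 1)"
 let ?Z = "prod_topology ?S C"
 have tY: "topspace Y = (sphere 0 1 \<times> sphere 0 1) \<times> topspace C" by (simp add: Y_def torus_facts)
 have Yd: "Y = prod_topology (prod_topology ?S ?S) C" by (simp only: Y_def torus_facts)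
 have cS: "compact_space ?S" "Hausdorff_space ?S" "connected_space ?S"
  using connected_sphere[of "0::complex" 1]
  by (simp_all add: compact_space_subtopology Hausdorff_space_subtopology connected_space_subtopology)
 have Z: "compact_space ?Z" "Hausdorff_space ?Z" "connected_space ?Z"
  using C cS by (simp_all add: compact_space_prod_topology Hausdorff_space_prod_topology connected_space_prod_topology)
 have kq: "continuous_map Y' euclidean (%x. k (q x))" if "continuous_map Y' Y q" for q and Y' :: "'y topology"
  using continuous_map_compose[OF that k(1)] by (simp add: o_def)
 have 1: "continuous_map ?Z Y (%q. ((1, fst q), snd q))"
  unfolding Yd by (intro continuous_map_pairedI continuous_map_fst continuous_map_snd) simp
 have unit1: "cmod (k ((1, fst q), snd q)) = 1" if "q \<in> topspace ?Z" for q
  using that by (intro k(2)) (auto simp: tY)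
 obtain n :: int where n: "lifts ?Z (%q. k ((1, fst q), snd q) * fst q powi n)"
  using lifts_circle_times[OF C, of "%q. k ((1, fst q), snd q)"] kq[OF 1] unit1 l by auto
 have pw: "continuous_map ?S euclidean (%z. z powi n)" using continuous_on_powi by simp
 have 2: "continuous_map (prod_topology ?S ?Z) Y (%q. ((fst q, fst (snd q)), snd (snd q)))"
  unfolding Yd
  by (intro continuous_map_pairedI continuous_map_fst continuous_map_snd
    continuous_map_compose[OF continuous_map_snd continuous_map_fst, unfolded o_def]
    continuous_map_compose[OF continuous_map_snd continuous_map_snd, unfolded o_def])
 have 3: "continuous_map (prod_topology ?S ?Z) ?S (%q. fst (snd q))"
  by (rule continuous_map_compose[OF continuous_map_snd continuous_map_fst, unfolded o_def])
 have k2: "continuous_map (prod_topology ?S ?Z) euclidean (%q. k ((fst q, fst (snd q)), snd (snd q)) * fst (snd q) powi n)"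
  by (rule continuous_map_op2[OF kq[OF 2] continuous_map_compose[OF 3 pw, unfolded o_def]]) (intro continuous_intros)
 have unit2: "cmod (k ((fst q, fst (snd q)), snd (snd q)) * fst (snd q) powi n) = 1"
  if "q \<in> topspace (prod_topology ?S ?Z)" for q
 proof -
  have "((fst q, fst (snd q)), snd (snd q)) \<in> topspace Y" "cmod (fst (snd q)) = 1" using that by (auto simp: tY)
  then show ?thesis using k(2) by (simp add: norm_mult norm_power_int)
 qed
 obtain m :: int where m: "lifts (prod_topology ?S ?Z) (%q. (k ((fst q, fst (snd q)), snd (snd q)) * fst (snd q) powi n) * fst q powi m)"
  using lifts_circle_times[OF Z, of "%q. k ((fst q, fst (snd q)), snd (snd q)) * fst (snd q) powi n"] k2 unit2 n by auto
 have 4: "continuous_map Y (prod_topology ?S ?Z) (%p. (fst (fst p), (snd (fst p), snd p)))"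
  unfolding Yd
  by (intro continuous_map_pairedI continuous_map_fst continuous_map_snd
    continuous_map_compose[OF continuous_map_fst continuous_map_fst, unfolded o_def]
    continuous_map_compose[OF continuous_map_fst continuous_map_snd, unfolded o_def])
 have "lifts Y (%p. k p * character m n (fst p))"
  by (rule lifts_compose[OF m 4]) (simp add: character_def mult_ac)
 then show ?thesis by blast
qed

text \<open>Restriction to the two coordinate circles leaves the powers \<open>m\<close> and
  \<open>n\<close>.\<close>

lemma character_not_lifts:
 assumes "lifts (topo torus) (character m n)" shows "m = 0 & n = 0"
proof -
 let ?S = "top_of_set (sphere (0::complex) 1)"
 have 1: "continuous_map ?S (topo torus) (%w. (w, 1))" and 2: "continuous_map ?S (topo torus) (%w. (1, w))"
  unfolding torus_facts(3) by (intro continuous_map_pairedI; simp)+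
 have "lifts ?S (%w. w powi m)" by (rule lifts_compose[OF assms 1]) (simp add: character_def)
 moreover have "lifts ?S (%w. w powi n)" by (rule lifts_compose[OF assms 2]) (simp add: character_def)
 ultimately show ?thesis using power_not_lifts by auto
qed

lemma character_minus:
 "z \<in> carr torus ==> character m n z * character (- m) (- n) z = 1"
proof -
 assume "z \<in> carr torus"
 then have "fst z ~= 0" "snd z ~= 0" by (auto simp: torus_facts)
 then show ?thesis by (simp add: character_def power_int_minus field_simps)
qed

text \<open>In the parametrization of \<open>mboundary W'\<close> by the torus times
  \<open>mboundary F'\<close>, a circle-valued map is determined up to homotopy by its restriction
  to one copy of \<open>mboundary F'\<close> and by two degrees along the torus. The first is made
  trivial by the choice of \<open>a\<close> and \<open>b\<close>; the degrees are then those of a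
  character of the second torus.\<close>

lemma matching_characters:
 assumes "Sigma_1_bundle_over_torus g W F \<pi>" "Sigma_1_bundle_over_torus g' W' F' \<pi>'"
  and f: "diffeo W' (mboundary W') W (mboundary W) f"
 obtains a b c d :: int and u where "a ~= 0 \<or> b ~= 0" "c ~= 0 \<or> d ~= 0"
  "continuous_map (subtopology (topo W') (mboundary W')) euclideanreal u"
  "!!p. p \<in> mboundary W' ==> character a b (\<pi> (f p)) = character c d (\<pi>' p) * cis (u p)"
proof -
 interpret B: sigma_bundle g W F \<pi> by (simp add: sigma_bundle_def assms)
 interpret B': sigma_bundle g' W' F' \<pi>' by (simp add: sigma_bundle_def assms)
 let ?bW = "subtopology (topo W) (mboundary W)" and ?bW' = "subtopology (topo W') (mboundary W')"
 obtain K where K: "continuous_map (prod_topology (topo torus) B.C) ?bW K"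
  "K ` (carr torus \<times> mboundary F) = mboundary W" "inj_on K (carr torus \<times> mboundary F)"
  "!!z y. z \<in> carr torus ==> y \<in> mboundary F ==> \<pi> (K (z, y)) = z"
  by (rule B.boundary_parametrization) (rule that)
 obtain K' where K': "continuous_map (prod_topology (topo torus) B'.C) ?bW' K'"
  "K' ` (carr torus \<times> mboundary F') = mboundary W'" "inj_on K' (carr torus \<times> mboundary F')"
  "!!z y. z \<in> carr torus ==> y \<in> mboundary F' ==> \<pi>' (K' (z, y)) = z"
  by (rule B'.boundary_parametrization) (rule that)
 let ?Y = "prod_topology (topo torus) B'.C"
 have tY: "topspace ?Y = carr torus \<times> mboundary F'" using B'.C(4) by simp
 have bW': "topspace ?bW' = mboundary W'" and bW: "topspace ?bW = mboundary W"
  using mboundary_subset[OF B'.basics(1)] mboundary_subset[OF B.basics(1)] by auto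
 have compY: "compact_space ?Y"
 proof -
  have "compact_space (topo torus)" by (simp add: torus_facts compact_space_subtopology compact_Times)
  then show ?thesis using B'.C(1) by (simp add: compact_space_prod_topology)
 qed
 have "homeomorphic_map ?Y ?bW' K'"
  by (rule continuous_imp_homeomorphic_map[OF K'(1) compY])
   (use K'(2,3) B'.basics(1) in \<open>auto simp: tY bW' smooth_manifold_def Hausdorff_space_subtopology simp del: topspace_prod_topology topspace_subtopology\<close>)
 then obtain L where "homeomorphic_maps ?Y ?bW' K' L" using homeomorphic_map_maps by blast
 then have L: "continuous_map ?bW' ?Y L" "!!p. p \<in> mboundary W' ==> K' (L p) = p"
  using bW' by (auto simp: homeomorphic_maps_def)
 have Lin: "L p \<in> carr torus \<times> mboundary F'" if "p \<in> mboundary W'" for p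
  using continuous_map_image_subset_topspace[OF L(1)] that unfolding tY bW' by blast
 have cf: "continuous_map ?bW' ?bW f" by (rule smooth_map_continuous[OF diffeo_smooth[OF f]])
 have cf': "continuous_map ?bW ?bW' (inv_into (mboundary W') f)" by (rule smooth_map_continuous[OF diffeo_inv_smooth[OF f]])
 have "continuous_map (topo W) (topo torus) \<pi>"
  using smooth_map_continuous[OF B.basics(7)] by simp
 then have c\<pi>: "continuous_map ?bW (topo torus) \<pi>" by (rule continuous_map_from_subtopology)
 \<comment> \<open>The boundary of the second piece in product form, mapped by \<open>f\<close> and
   then projected to the first torus. Restricted to the base point \<open>(1, 1)\<close> its two
   components are the circle-valued maps whose degrees are compared.\<close>
 define \<theta> where "\<theta> p = \<pi> (f (K' p))" for p
 have c\<theta>: "continuous_map ?Y (topo torus) \<theta>"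
  using continuous_map_compose[OF continuous_map_compose[OF K'(1) cf] c\<pi>] by (simp add: o_def \<theta>_def[abs_def])
 have \<theta>in: "\<theta> p \<in> carr torus" if "p \<in> topspace ?Y" for p
  using continuous_map_image_subset_topspace[OF c\<theta>] that by blast
 have c1: "continuous_map B'.C ?Y (%y. ((1, 1), y))"
  by (intro continuous_map_pairedI) (simp_all add: torus_facts)
 have ca: "continuous_map B'.C (topo torus) (%y. \<theta> ((1, 1), y))"
  using continuous_map_compose[OF c1 c\<theta>] by (simp add: o_def)
 have cfs: "continuous_map (topo torus) euclidean fst" "continuous_map (topo torus) euclidean snd"
  unfolding torus_facts(3)
  using continuous_map_fst[of "top_of_set (sphere (0::complex) 1)" "top_of_set (sphere (0::complex) 1)"]
   continuous_map_snd[of "top_of_set (sphere (0::complex) 1)" "top_of_set (sphere (0::complex) 1)"]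
  by (simp_all only: continuous_map_in_subtopology)
 have \<theta>1: "\<theta> ((1, 1), y) \<in> carr torus" if "y \<in> mboundary F'" for y
  by (rule \<theta>in, unfold tY) (use that in \<open>simp add: torus_facts\<close>)
 have "EX a b::int. (a ~= 0 \<or> b ~= 0) & lifts B'.C (%y. fst (\<theta> ((1, 1), y)) powi a * snd (\<theta> ((1, 1), y)) powi b)"
 proof (rule one_manifold_lifts[OF B'.C(1-3)])
  fix y assume "y \<in> topspace B'.C"
  then have y: "y \<in> mboundary F'" using B'.C(4) by simp
  show "EX \<gamma>. arc_in B'.C \<gamma> & y \<in> range \<gamma>" by (rule boundary_arc[OF B'.basics(2) y])
  show "cmod (fst (\<theta> ((1, 1), y))) = 1" "cmod (snd (\<theta> ((1, 1), y))) = 1"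
   using \<theta>1[OF y] by (auto simp: torus_facts)
 qed (use continuous_map_compose[OF ca cfs(1)] continuous_map_compose[OF ca cfs(2)] in \<open>simp_all add: o_def\<close>)
 then obtain a b :: int where ab: "a ~= 0 \<or> b ~= 0" "lifts B'.C (%y. character a b (\<theta> ((1, 1), y)))"
  unfolding character_def by blast
 have ck: "continuous_map ?Y euclidean (%p. character a b (\<theta> p))"
  using continuous_map_compose[OF c\<theta> continuous_character] by (simp add: o_def)
 have "EX m n. lifts ?Y (%p. character a b (\<theta> p) * character m n (fst p))"
  by (rule lifts_torus_times[OF B'.C(1-3) ck cmod_character[OF \<theta>in] ab(2)])
 then obtain m n where "lifts ?Y (%p. character a b (\<theta> p) * character m n (fst p))" by blast
 then obtain u where u: "continuous_map ?Y euclideanreal u"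
  "!!p. p \<in> topspace ?Y ==> character a b (\<theta> p) * character m n (fst p) = cis (u p)" by (auto simp: lifts_def)
 define v where "v p = u (L p)" for p
 have cv: "continuous_map ?bW' euclideanreal v"
  using continuous_map_compose[OF L(1) u(1)] by (simp add: o_def v_def[abs_def])
 have eq: "character a b (\<pi> (f p)) = character (- m) (- n) (\<pi>' p) * cis (v p)" if p: "p \<in> mboundary W'" for p
 proof -
  obtain z y where zy: "L p = (z, y)" "z \<in> carr torus" "y \<in> mboundary F'" using Lin[OF p] by auto
  have "\<pi>' p = z" using K'(4)[OF zy(2,3)] L(2)[OF p] zy(1) by simp
  moreover have "character a b (\<pi> (f p)) * character m n z = cis (v p)"
   using u(2)[of "L p"] Lin[OF p] L(2)[OF p] zy(1) by (simp add: tY v_def \<theta>_def del: topspace_prod_topology)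
  moreover have "character (- m) (- n) z * (character a b (\<pi> (f p)) * character m n z) = character a b (\<pi> (f p))"
   using character_minus[OF zy(2), of m n] by (simp add: mult_ac)
  ultimately show ?thesis by simp
 qed
 \<comment> \<open>Were the second character trivial, \<open>character a b\<close> would lift to the
   line on the boundary. Pulling the lift back along the section \<open>K (z, y0)\<close> of the
   first boundary, carried over by the inverse of \<open>f\<close>, would lift a nontrivial
   character on the torus itself.\<close>
 have cd: "- m ~= 0 \<or> - n ~= 0"
 proof (rule ccontr)
  assume "\<not> (- m ~= 0 \<or> - n ~= 0)"
  then have z: "character (- m) (- n) w = 1" for w by (simp add: character_def)
  obtain y0 where y0: "y0 \<in> mboundary F" using B.basics(5) by auto
  have 1: "continuous_map (topo torus) (prod_topology (topo torus) B.C) (%z. (z, y0))"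
   using y0 B.C(4) by (intro continuous_map_pairedI) simp_all
  have 2: "continuous_map (topo torus) ?bW' (%z. inv_into (mboundary W') f (K (z, y0)))"
   using continuous_map_compose[OF continuous_map_compose[OF 1 K(1)] cf'] by (simp add: o_def)
  have "lifts ?bW' (%p. character a b (\<pi> (f p)))"
   unfolding lifts_def using cv eq z bW' by (intro exI[of _ v]) simp
  then have "lifts (topo torus) (character a b)"
  proof (rule lifts_compose[OF _ 2])
   fix z assume z: "z \<in> carr torus"
   have "K (z, y0) \<in> mboundary W" using K(2) z y0 by blast
   then show "character a b z = character a b (\<pi> (f (inv_into (mboundary W') f (K (z, y0)))))"
    using diffeo_inv_right[OF f] K(4)[OF z y0] by simp
  qed
  then show False using character_not_lifts ab(1) by blast
 qed
 show ?thesis by (rule that[OF ab(1) cd cv eq])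
qed

section \<open>The theorem\<close>

text \<open>The curves of \<open>character_regular\<close> are transported by \<open>i\<close>.
  Those through boundary points remain in the boundary, so their images remain in \<open>N\<close>,
  as the conditions \<open>atan\<close> and \<open>btan\<close> of the collar require.\<close>

lemma glued_character:
 assumes W: "Sigma_1_bundle_over_torus g W F \<pi>" and X: "smooth_manifold X" and i: "diffeo W (carr W) X A i"
  and A: "A <= carr X" and mn: "m ~= 0 \<or> n ~= 0" and N: "N = i ` mboundary W"
 defines "a \<equiv> %x. character m n (\<pi> (inv_into (carr W) i x))"
 shows "sfun X A a" "x \<in> A ==> cmod (a x) = 1" "x \<in> A ==> regular_at X a x"
  "x \<in> N ==> EX \<gamma> D. smooth_map eu {-1<..<1::real} X N \<gamma> & \<gamma> 0 = x &
    ((%t. a (\<gamma> t)) has_vector_derivative D) (at 0) & D ~= 0"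
proof -
 interpret sigma_bundle g W F \<pi> by (simp add: sigma_bundle_def W)
 note d = diffeoD[OF i]
 have j: "inv_into (carr W) i x \<in> carr W" if "x \<in> A" for x using d(5)[OF that] .
 show "sfun X A a" unfolding a_def
  by (rule sfun_compose[OF X basics(1) A d(3) sfun_character[OF basics(1) subset_refl basics(7)]]) (use j in auto)
 show "cmod (a x) = 1" if "x \<in> A"
  unfolding a_def by (rule cmod_character) (use smooth_map_in[OF basics(7)] j[OF that] in auto)
 have curve: "EX \<gamma> D. smooth_map eu {-1<..<1::real} X (if q \<in> mboundary W then N else carr X) \<gamma> & \<gamma> 0 = i q &
    ((%t. a (\<gamma> t)) has_vector_derivative D) (at 0) & D ~= 0" if q: "q \<in> carr W" for q
 proof -
  let ?T = "if q \<in> mboundary W then mboundary W else carr W"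
  obtain \<gamma> D where \<gamma>: "smooth_map eu {-1<..<1::real} W ?T \<gamma>" "\<gamma> 0 = q"
   "((%t. character m n (\<pi> (\<gamma> t))) has_vector_derivative D) (at 0)" "D ~= 0"
   using character_regular[OF q mn] by blast
  have T: "?T <= carr W" using mboundary_subset[OF basics(1)] by auto
  have \<gamma>W: "\<gamma> t \<in> ?T" if "t \<in> {-1<..<1}" for t using smooth_map_in(1)[OF \<gamma>(1)] that by simp
  have "smooth_map eu {-1<..<1::real} W (carr W) \<gamma>"
   by (rule smooth_map_subset[OF \<gamma>(1) subset_refl]) (use \<gamma>W T in blast)
  from smooth_map_compose[OF smooth_manifold_eu basics(1) this d(2)]
  have s: "smooth_map eu {-1<..<1::real} X A (%t. i (\<gamma> t))" .
  have 1: "smooth_map eu {-1<..<1::real} X (if q \<in> mboundary W then N else carr X) (%t. i (\<gamma> t))"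
  proof (rule smooth_map_subset[OF s subset_refl])
   fix t :: real assume t: "t \<in> {-1<..<1}"
   have "i (\<gamma> t) \<in> A" using d(4) \<gamma>W[OF t] T by blast
   then show "i (\<gamma> t) \<in> (if q \<in> mboundary W then N else carr X)" using \<gamma>W[OF t] A N by auto
  qed
  have 2: "((%t. a (i (\<gamma> t))) has_vector_derivative D) (at 0)"
  proof (rule has_vector_derivative_transform_within_open[OF \<gamma>(3)])
   fix t :: real assume "t \<in> {-1<..<1}"
   from \<gamma>W[OF this] T have "\<gamma> t \<in> carr W" by blast
   then show "character m n (\<pi> (\<gamma> t)) = a (i (\<gamma> t))" by (simp add: a_def d(6))
  qed auto
  show ?thesis using 1 2 \<gamma>(2,4) by (intro exI[of _ "%t. i (\<gamma> t)"] exI[of _ D]) simp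
 qed
 show "regular_at X a x" if x: "x \<in> A"
 proof -
  obtain \<gamma> D where \<gamma>: "smooth_map eu {-1<..<1::real} X (if inv_into (carr W) i x \<in> mboundary W then N else carr X) \<gamma>"
   "\<gamma> 0 = i (inv_into (carr W) i x)" "((%t. a (\<gamma> t)) has_vector_derivative D) (at 0)" "D ~= 0"
   using curve[OF j[OF x]] by blast
  have "smooth_map eu {-1<..<1::real} X (carr X) \<gamma>"
   by (rule smooth_map_subset[OF \<gamma>(1) subset_refl]) (use smooth_map_in(2)[OF \<gamma>(1)] in auto)
  then show ?thesis unfolding regular_at_def using \<gamma>(2-4) d(7)[OF x] by (intro exI[of _ \<gamma>] exI[of _ D]) simp
 qed
 show "EX \<gamma> D. smooth_map eu {-1<..<1::real} X N \<gamma> & \<gamma> 0 = x &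
    ((%t. a (\<gamma> t)) has_vector_derivative D) (at 0) & D ~= 0" if xN: "x \<in> N"
 proof -
  obtain q where "q \<in> mboundary W" "x = i q" using xN N by blast
  then show ?thesis using curve[of q] mboundary_subset[OF basics(1)] by auto
 qed
qed

theorem theorem3p5:
 fixes W :: "('w, real^4) manifold" and F :: "('f, real^2) manifold"
  and W' :: "('v, real^4) manifold" and F' :: "('h, real^2) manifold"
  and X :: "('x, real^4) manifold"
  and g g' :: nat
 assumes "Sigma_1_bundle_over_torus g W F \<pi>"
  and "Sigma_1_bundle_over_torus g' W' F' \<pi>'"
  and "diffeo W' (mboundary W') W (mboundary W) f"
  and "is_gluing X W W' f i i'"
 shows "fibers_over_circle X"
proof -
 interpret B: sigma_bundle g W F \<pi> by (simp add: sigma_bundle_def assms(1))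
 interpret B': sigma_bundle g' W' F' \<pi>' by (simp add: sigma_bundle_def assms(2))
 interpret gluing X W W' f i i'
  by (intro gluing.intro B.basics(1,3) B'.basics(1,3) assms(3,4))
 obtain m n m' n' :: int and u where c: "m ~= 0 \<or> n ~= 0" "m' ~= 0 \<or> n' ~= 0"
  "continuous_map (subtopology (topo W') (mboundary W')) euclideanreal u"
  "!!p. p \<in> mboundary W' ==> character m n (\<pi> (f p)) = character m' n' (\<pi>' p) * cis (u p)"
  by (rule matching_characters[OF assms(1-3)]) (rule that)
 define a where "a x = character m n (\<pi> (inv_into (carr W) i x))" for x
 define b where "b x = character m' n' (\<pi>' (inv_into (carr W') i' x))" for x
 note a = glued_character[OF assms(1) X i sub(1) c(1) N_def, folded a_def]
 note b = glued_character[OF assms(2) X i' sub(2) c(2) N', folded b_def]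
 obtain s :: "'x => real" where s: "sfun X (carr X) s" "!!x. x \<in> A ==> s x \<le> 0" "!!x. x \<in> B ==> s x \<ge> 0"
  "!!x. x \<in> carr X ==> s x = 0 \<longleftrightarrow> x \<in> N" "!!x. x \<in> N ==> regular_at X s x"
  by (rule defining_function) (rule that)
 \<comment> \<open>The matching expresses the first character through the second, while in the
   collar \<open>b\<close> is expressed through \<open>a\<close>; hence the minus sign.\<close>
 define u0 where "u0 x = - u (inv_into (carr W') i' x)" for x
 have bd': "mboundary W' <= carr W'" "mboundary W <= carr W" by (rule mboundary_subset[OF W'(1)] mboundary_subset[OF W(1)])+
 have u0: "continuous_map (subtopology (topo X) N) euclideanreal u0"
 proof -
  have "smooth_map X N W' (mboundary W') (inv_into (carr W') i')"
  proof (rule smooth_map_subset[OF diffeo_inv_smooth[OF i'] sub(5)])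
   fix x assume "x \<in> N"
   then obtain p where "p \<in> mboundary W'" "x = i' p" unfolding N' by blast
   then show "inv_into (carr W') i' x \<in> mboundary W'" using diffeo_inv_left[OF i'] bd' by auto
  qed
  from continuous_map_compose[OF smooth_map_continuous[OF this] c(3)]
  have "continuous_map (subtopology (topo X) N) euclideanreal (%x. u (inv_into (carr W') i' x))" by (simp add: o_def)
  from continuous_map_minus[OF this] show ?thesis by (simp add: u0_def[abs_def])
 qed
 have ab: "b x = a x * cis (u0 x)" if xN: "x \<in> N" for x
 proof -
  obtain p where p: "p \<in> mboundary W'" "x = i' p" using xN unfolding N' by blast
  have fp: "f p \<in> mboundary W" using diffeo_in[OF f p(1)] .
  have 1: "inv_into (carr W') i' x = p" using diffeo_inv_left[OF i'] p bd' by auto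
  have "x = i (f p)" using glue_f[OF p(1)] p(2) by simp
  then have 2: "inv_into (carr W) i x = f p" using diffeo_inv_left[OF i] fp bd' by auto
  have "a x * cis (u0 x) = character m' n' (\<pi>' p) * (cis (u p) * cis (- u p))"
   using c(4)[OF p(1)] by (simp add: a_def u0_def 1 2)
  then show ?thesis by (simp add: cis_mult b_def 1)
 qed
 have "collar X A B s u0 a b"
  by (intro collar.intro X mboundaryX compactX closed_AB carrX s(1-3) a(1-3) b(1-3))
   (use s(4,5) a(3,4) b(3,4) u0 ab in \<open>auto simp: AB\<close>)
 then show ?thesis by (rule collar.fibers)
qed

end
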